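(* Let $k$ be a field, $\Gamma$ a finite group with $\mathrm{char}\,k\nmid|\Gamma|$, and $\mathcal C$ a Hom-finite, Krull--Schmidt, Frobenius, stably 2-Calabi--Yau exact $k$-category, with 2-Calabi--Yau isomorphism $c:\mathrm{Ext}^1_{\mathcal C}(-_1,-_2)\simeq\mathrm{Ext}^1_{\mathcal C}(-_2,-_1)^*$. Suppose $\Gamma$ acts on $\mathcal C$ and that the action is 2-Calabi--Yau for $c$. Then: 1. The functorial isomorphism of vector spaces $c$ is also a functorial isomorphism of $k[\Gamma]$-modules $$\mathbf{Ext}^1_{\mathcal C\Gamma}(-_1,-_2)\simeq\mathbf{Ext}^1_{\mathcal C\Gamma}(-_2,-_1)^*.$$ 2. The category $\mathcal C\Gamma$ is (stably) 2-Calabi--Yau.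
   Context: Frobenius: enough projectives and enough injectives, and projectives coincide with injectives. Stably 2-Calabi--Yau: there is a functorial isomorphism $\mathrm{Ext}^1_{\mathcal C}(X,Y)\simeq\mathrm{Ext}^1_{\mathcal C}(Y,X)^*$. An action of $\Gamma$ on $\mathcal C$ is a structure of module category over $\mathrm{mod}\,k(\Gamma)$, where $k(\Gamma)$ is the Hopf algebra of $k$-valued functions on $\Gamma$ with simple modules $\mathbf g$ ($g\in\Gamma$), $\mathbf g\otimes\mathbf h=\mathbf{gh}$: $k$-linear auto-equivalences $\mathbf g\otimes-$ with coherent structural isomorphisms $\alpha:\mathbf{gh}\otimes X\to\mathbf g\otimes(\mathbf h\otimes X)$ and $\mathbf 1\otimes X\to X$. The action is 2-Calabi--Yau for $c$ if it is exact (each $\mathbf g\otimes-$ is exact) and for every $g\in\Gamma$ and $X,Y\in\mathcal C$, $c_{X,Y}=(\mathbf g\otimes-)^*\circ c_{\mathbf g\otimes X,\mathbf g\otimes Y}\circ(\mathbf g\otimes-)$ as maps $\mathrm{Ext}^1_{\mathcal C}(X,Y)\to\mathrm{Ext}^1_{\mathcal C}(Y,X)^*$, where $\mathbf g\otimes-:\mathrm{Ext}^1_{\mathcal C}(X,Y)\to\mathrm{Ext}^1_{\mathcal C}(\mathbf g\otimes X,\mathbf g\otimes Y)$. The equivariant category $\mathcal C\Gamma$ has objects $(X,\psi)$, $\psi=(\psi_g:\mathbf g\otimes X\to X)_{g\in\Gamma}$ isomorphisms with $\psi_{gh}=\psi_g\circ(\mathrm{id}_{\mathbf g}\otimes\psi_h)\circ\alpha$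 and $\psi_e$ structural; morphisms are the morphisms of $\mathcal C$ commuting with the $\psi$'s. It is exact, the admissible exact sequences being those which are admissible in $\mathcal C$. $F:\mathcal C\Gamma\to\mathcal C$ is the forgetful functor. For $(X,\psi),(Y,\chi)\in\mathcal C\Gamma$, $\mathbf{Hom}_{\mathcal C\Gamma}((X,\psi),(Y,\chi))$ is the vector space $\mathrm{Hom}_{\mathcal C}(X,Y)$ with the $\Gamma$-action $g\cdot f=\chi_g\circ(\mathrm{id}_{\mathbf g}\otimes f)\circ\psi_g^{-1}$, and $\mathbf{Ext}^n_{\mathcal C\Gamma}$ denotes the derived functors of $\mathbf{Hom}_{\mathcal C\Gamma}$ (with values in $\mathrm{mod}\,k[\Gamma]$). The underlying space of $\mathbf{Ext}^1_{\mathcal C\Gamma}(X,Y)$ is $\mathrm{Ext}^1_{\mathcal C}(FX,FY)$, on which $g$ acts by $\xi\mapsto\mathrm{Ext}^1_{\mathcal C}(\psi_g^{-1},\chi_g)(\mathbf g\otimes\xi)$. The dual $V^*$ of a $k[\Gamma]$-module is the contragredient representation. *)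

theory Defs
  imports "HOL-Algebra.Module" "HOL-Algebra.Coset"
begin

section \<open>Vector spaces and representations\<close>

text \<open>A vector space over a field \<open>K\<close> is a \<^locale>\<open>module\<close> over \<open>K\<close>.\<close>

definition characteristic :: "('k, 'r) ring_scheme \<Rightarrow> nat" where
  "characteristic K =
     (if \<exists>n::nat>0. [n] \<cdot>\<^bsub>K\<^esub> \<one>\<^bsub>K\<^esub> = \<zero>\<^bsub>K\<^esub>
      then LEAST n::nat. n > 0 \<and> [n] \<cdot>\<^bsub>K\<^esub> \<one>\<^bsub>K\<^esub> = \<zero>\<^bsub>K\<^esub> else 0)"

definition finite_dimensional :: "('k, 'r) ring_scheme \<Rightarrow> ('k, 'v, 'x) module_scheme \<Rightarrow> bool" where
  "finite_dimensional K V \<longleftrightarrow>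
     (\<exists>S. finite S \<and> S \<subseteq> carrier V \<and>
        (\<forall>v\<in>carrier V. \<exists>a\<in>S \<rightarrow> carrier K. v = (\<Oplus>\<^bsub>V\<^esub>s\<in>S. a s \<odot>\<^bsub>V\<^esub> s)))"

definition linear_maps ::
  "('k, 'r) ring_scheme \<Rightarrow> ('k, 'v, 'x) module_scheme \<Rightarrow> ('k, 'w, 'y) module_scheme \<Rightarrow> ('v \<Rightarrow> 'w) set" where
  "linear_maps K V W =
     {f \<in> carrier V \<rightarrow> carrier W.
        (\<forall>u\<in>carrier V. \<forall>v\<in>carrier V. f (u \<oplus>\<^bsub>V\<^esub> v) = f u \<oplus>\<^bsub>W\<^esub> f v) \<and>
        (\<forall>a\<in>carrier K. \<forall>v\<in>carrier V. f (a \<odot>\<^bsub>V\<^esub> v) = a \<odot>\<^bsub>W\<^esub> f v)}"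

definition linear_isos ::
  "('k, 'r) ring_scheme \<Rightarrow> ('k, 'v, 'x) module_scheme \<Rightarrow> ('k, 'w, 'y) module_scheme \<Rightarrow> ('v \<Rightarrow> 'w) set" where
  "linear_isos K V W = {f \<in> linear_maps K V W. bij_betw f (carrier V) (carrier W)}"

text \<open>Functionals are made extensional, so that equality of functionals is equality of functions.\<close>

definition dual :: "('k, 'r) ring_scheme \<Rightarrow> ('k, 'v, 'x) module_scheme \<Rightarrow> ('k, 'v \<Rightarrow> 'k) module" where
  "dual K V =
     \<lparr>carrier = {\<phi> \<in> carrier V \<rightarrow>\<^sub>E carrier K.
         (\<forall>u\<in>carrier V. \<forall>v\<in>carrier V. \<phi> (u \<oplus>\<^bsub>V\<^esub> v) = \<phi> u \<oplus>\<^bsub>K\<^esub> \<phi> v) \<and>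
         (\<forall>a\<in>carrier K. \<forall>v\<in>carrier V. \<phi> (a \<odot>\<^bsub>V\<^esub> v) = a \<otimes>\<^bsub>K\<^esub> \<phi> v)},
      monoid.mult = undefined, monoid.one = undefined,
      ring.zero = (\<lambda>v\<in>carrier V. \<zero>\<^bsub>K\<^esub>),
      ring.add = (\<lambda>\<phi> \<phi>'. \<lambda>v\<in>carrier V. \<phi> v \<oplus>\<^bsub>K\<^esub> \<phi>' v),
      module.smult = (\<lambda>a \<phi>. \<lambda>v\<in>carrier V. a \<otimes>\<^bsub>K\<^esub> \<phi> v)\<rparr>"

text \<open>A module over the group algebra is a vector space with a linear group action.\<close>

record ('k, 'v, 'g) rep_module = "('k, 'v) module" +
  act :: "'g \<Rightarrow> 'v \<Rightarrow> 'v"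

definition representation ::
  "('k, 'r) ring_scheme \<Rightarrow> ('g, 's) monoid_scheme \<Rightarrow> ('k, 'v, 'g) rep_module \<Rightarrow> bool" where
  "representation K \<Gamma> V \<longleftrightarrow>
     module K V \<and>
     (\<forall>g\<in>carrier \<Gamma>. act V g \<in> linear_maps K V V) \<and>
     (\<forall>v\<in>carrier V. act V \<one>\<^bsub>\<Gamma>\<^esub> v = v) \<and>
     (\<forall>g\<in>carrier \<Gamma>. \<forall>h\<in>carrier \<Gamma>. \<forall>v\<in>carrier V. act V (g \<otimes>\<^bsub>\<Gamma>\<^esub> h) v = act V g (act V h v))"

definition rep_homs ::
  "('k, 'r) ring_scheme \<Rightarrow> ('g, 's) monoid_scheme \<Rightarrow> ('k, 'v, 'g) rep_module \<Rightarrow> ('k, 'w, 'g) rep_module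
     \<Rightarrow> ('v \<Rightarrow> 'w) set" where
  "rep_homs K \<Gamma> V W =
     {f \<in> linear_maps K V W. \<forall>g\<in>carrier \<Gamma>. \<forall>v\<in>carrier V. f (act V g v) = act W g (f v)}"

definition rep_isos ::
  "('k, 'r) ring_scheme \<Rightarrow> ('g, 's) monoid_scheme \<Rightarrow> ('k, 'v, 'g) rep_module \<Rightarrow> ('k, 'w, 'g) rep_module
     \<Rightarrow> ('v \<Rightarrow> 'w) set" where
  "rep_isos K \<Gamma> V W = {f \<in> rep_homs K \<Gamma> V W. bij_betw f (carrier V) (carrier W)}"

definition contragredient ::
  "('k, 'r) ring_scheme \<Rightarrow> ('g, 's) monoid_scheme \<Rightarrow> ('k, 'v, 'g) rep_module \<Rightarrow> ('k, 'v \<Rightarrow> 'k, 'g) rep_module" where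
  "contragredient K \<Gamma> V =
     module.extend (dual K V)
       (rep_module.fields (\<lambda>g \<phi>. \<lambda>v\<in>carrier V. \<phi> (act V (inv\<^bsub>\<Gamma>\<^esub> g) v)))"


section \<open>Exact categories\<close>

text \<open>
  Morphism sets of different pairs of objects are allowed to overlap (in the equivariant category
  the same morphism has many sources and targets), but composition of morphisms does not mention
  the objects. Every category can be presented in this way, by taking disjoint morphism sets.
  \<open>Confl A i B p D\<close> says that \<open>A \<rightarrow> B \<rightarrow> D\<close>, with maps \<open>i\<close> and \<open>p\<close>, is an admissible exact sequence.
\<close>

record ('k, 'o, 'm) ex_cat =
  Ob :: "'o set"
  Hom :: "'o \<Rightarrow> 'o \<Rightarrow> ('k, 'm) module"
  Comp :: "'m \<Rightarrow> 'm \<Rightarrow> 'm" (infixl \<open>\<bullet>\<index>\<close> 70)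
  Id :: "'o \<Rightarrow> 'm"
  Confl :: "'o \<Rightarrow> 'm \<Rightarrow> 'o \<Rightarrow> 'm \<Rightarrow> 'o \<Rightarrow> bool"

abbreviation mor :: "('k, 'o, 'm) ex_cat \<Rightarrow> 'o \<Rightarrow> 'o \<Rightarrow> 'm set" where
  "mor C X Y \<equiv> carrier (Hom C X Y)"

locale linear_category =
  fixes K :: "('k, 'r) ring_scheme" and C :: "('k, 'o, 'm) ex_cat" (structure)
  assumes field_K: "field K"
    and Hom_module: "\<lbrakk>X \<in> Ob C; Y \<in> Ob C\<rbrakk> \<Longrightarrow> module K (Hom C X Y)"
    and Id_mor: "X \<in> Ob C \<Longrightarrow> Id C X \<in> mor C X X"
    and Comp_mor: "\<lbrakk>X \<in> Ob C; Y \<in> Ob C; Z \<in> Ob C; f \<in> mor C X Y; g \<in> mor C Y Z\<rbrakk>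
          \<Longrightarrow> g \<bullet> f \<in> mor C X Z"
    and Comp_Id: "\<lbrakk>X \<in> Ob C; Y \<in> Ob C; f \<in> mor C X Y\<rbrakk> \<Longrightarrow> f \<bullet> Id C X = f"
    and Id_Comp: "\<lbrakk>X \<in> Ob C; Y \<in> Ob C; f \<in> mor C X Y\<rbrakk> \<Longrightarrow> Id C Y \<bullet> f = f"
    and Comp_assoc: "\<lbrakk>W \<in> Ob C; X \<in> Ob C; Y \<in> Ob C; Z \<in> Ob C;
            f \<in> mor C W X; g \<in> mor C X Y; h \<in> mor C Y Z\<rbrakk>
          \<Longrightarrow> h \<bullet> (g \<bullet> f) = (h \<bullet> g) \<bullet> f"
    and Comp_linear_right: "\<lbrakk>X \<in> Ob C; Y \<in> Ob C; Z \<in> Ob C; g \<in> mor C Y Z\<rbrakk>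
          \<Longrightarrow> (\<lambda>f. g \<bullet> f) \<in> linear_maps K (Hom C X Y) (Hom C X Z)"
    and Comp_linear_left: "\<lbrakk>X \<in> Ob C; Y \<in> Ob C; Z \<in> Ob C; f \<in> mor C X Y\<rbrakk>
          \<Longrightarrow> (\<lambda>g. g \<bullet> f) \<in> linear_maps K (Hom C Y Z) (Hom C X Z)"

definition isos :: "('k, 'o, 'm) ex_cat \<Rightarrow> 'o \<Rightarrow> 'o \<Rightarrow> 'm set" where
  "isos C X Y = {f \<in> mor C X Y. \<exists>g\<in>mor C Y X. g \<bullet>\<^bsub>C\<^esub> f = Id C X \<and> f \<bullet>\<^bsub>C\<^esub> g = Id C Y}"

definition mor_inv :: "('k, 'o, 'm) ex_cat \<Rightarrow> 'o \<Rightarrow> 'o \<Rightarrow> 'm \<Rightarrow> 'm" where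
  "mor_inv C X Y f = (THE g. g \<in> mor C Y X \<and> g \<bullet>\<^bsub>C\<^esub> f = Id C X \<and> f \<bullet>\<^bsub>C\<^esub> g = Id C Y)"

definition zero_object :: "('k, 'o, 'm) ex_cat \<Rightarrow> 'o \<Rightarrow> bool" where
  "zero_object C Z \<longleftrightarrow> Z \<in> Ob C \<and>
     (\<forall>X\<in>Ob C. mor C X Z = {\<zero>\<^bsub>Hom C X Z\<^esub>} \<and> mor C Z X = {\<zero>\<^bsub>Hom C Z X\<^esub>})"

definition biproduct ::
  "('k, 'o, 'm) ex_cat \<Rightarrow> 'o \<Rightarrow> 'o \<Rightarrow> 'o \<Rightarrow> 'm \<Rightarrow> 'm \<Rightarrow> 'm \<Rightarrow> 'm \<Rightarrow> bool" where
  "biproduct C X Y S i\<^sub>1 i\<^sub>2 p\<^sub>1 p\<^sub>2 \<longleftrightarrow>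
     S \<in> Ob C \<and> i\<^sub>1 \<in> mor C X S \<and> i\<^sub>2 \<in> mor C Y S \<and> p\<^sub>1 \<in> mor C S X \<and> p\<^sub>2 \<in> mor C S Y \<and>
     p\<^sub>1 \<bullet>\<^bsub>C\<^esub> i\<^sub>1 = Id C X \<and> p\<^sub>2 \<bullet>\<^bsub>C\<^esub> i\<^sub>2 = Id C Y \<and>
     p\<^sub>2 \<bullet>\<^bsub>C\<^esub> i\<^sub>1 = \<zero>\<^bsub>Hom C X Y\<^esub> \<and> p\<^sub>1 \<bullet>\<^bsub>C\<^esub> i\<^sub>2 = \<zero>\<^bsub>Hom C Y X\<^esub> \<and>
     (i\<^sub>1 \<bullet>\<^bsub>C\<^esub> p\<^sub>1) \<oplus>\<^bsub>Hom C S S\<^esub> (i\<^sub>2 \<bullet>\<^bsub>C\<^esub> p\<^sub>2) = Id C S"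

definition is_kernel :: "('k, 'o, 'm) ex_cat \<Rightarrow> 'o \<Rightarrow> 'm \<Rightarrow> 'o \<Rightarrow> 'm \<Rightarrow> 'o \<Rightarrow> bool" where
  "is_kernel C A i B p D \<longleftrightarrow>
     p \<bullet>\<^bsub>C\<^esub> i = \<zero>\<^bsub>Hom C A D\<^esub> \<and>
     (\<forall>T\<in>Ob C. \<forall>f\<in>mor C T B. p \<bullet>\<^bsub>C\<^esub> f = \<zero>\<^bsub>Hom C T D\<^esub> \<longrightarrow> (\<exists>!u. u \<in> mor C T A \<and> i \<bullet>\<^bsub>C\<^esub> u = f))"

definition is_cokernel :: "('k, 'o, 'm) ex_cat \<Rightarrow> 'o \<Rightarrow> 'm \<Rightarrow> 'o \<Rightarrow> 'm \<Rightarrow> 'o \<Rightarrow> bool" where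
  "is_cokernel C A i B p D \<longleftrightarrow>
     p \<bullet>\<^bsub>C\<^esub> i = \<zero>\<^bsub>Hom C A D\<^esub> \<and>
     (\<forall>T\<in>Ob C. \<forall>f\<in>mor C B T. f \<bullet>\<^bsub>C\<^esub> i = \<zero>\<^bsub>Hom C A T\<^esub> \<longrightarrow> (\<exists>!u. u \<in> mor C D T \<and> u \<bullet>\<^bsub>C\<^esub> p = f))"

definition inflation :: "('k, 'o, 'm) ex_cat \<Rightarrow> 'o \<Rightarrow> 'm \<Rightarrow> 'o \<Rightarrow> bool" where
  "inflation C A i B \<longleftrightarrow> (\<exists>p D. Confl C A i B p D)"

definition deflation :: "('k, 'o, 'm) ex_cat \<Rightarrow> 'o \<Rightarrow> 'm \<Rightarrow> 'o \<Rightarrow> bool" where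
  "deflation C B p D \<longleftrightarrow> (\<exists>A i. Confl C A i B p D)"

text \<open>
  \<open>is_pushout C A i B f A' j B' f'\<close>: \<open>j : A' \<rightarrow> B'\<close> and \<open>f' : B \<rightarrow> B'\<close> form a pushout of
  \<open>i : A \<rightarrow> B\<close> and \<open>f : A \<rightarrow> A'\<close>. Dually,
  \<open>is_pullback C B p D f D' q B' f'\<close>: \<open>q : B' \<rightarrow> D'\<close> and \<open>f' : B' \<rightarrow> B\<close> form a pullback of
  \<open>p : B \<rightarrow> D\<close> and \<open>f : D' \<rightarrow> D\<close>.
\<close>

definition is_pushout ::
  "('k, 'o, 'm) ex_cat \<Rightarrow> 'o \<Rightarrow> 'm \<Rightarrow> 'o \<Rightarrow> 'm \<Rightarrow> 'o \<Rightarrow> 'm \<Rightarrow> 'o \<Rightarrow> 'm \<Rightarrow> bool" where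
  "is_pushout C A i B f A' j B' f' \<longleftrightarrow>
     B' \<in> Ob C \<and> j \<in> mor C A' B' \<and> f' \<in> mor C B B' \<and> f' \<bullet>\<^bsub>C\<^esub> i = j \<bullet>\<^bsub>C\<^esub> f \<and>
     (\<forall>T\<in>Ob C. \<forall>s\<in>mor C B T. \<forall>t\<in>mor C A' T. s \<bullet>\<^bsub>C\<^esub> i = t \<bullet>\<^bsub>C\<^esub> f \<longrightarrow>
        (\<exists>!u. u \<in> mor C B' T \<and> u \<bullet>\<^bsub>C\<^esub> f' = s \<and> u \<bullet>\<^bsub>C\<^esub> j = t))"

definition is_pullback ::
  "('k, 'o, 'm) ex_cat \<Rightarrow> 'o \<Rightarrow> 'm \<Rightarrow> 'o \<Rightarrow> 'm \<Rightarrow> 'o \<Rightarrow> 'm \<Rightarrow> 'o \<Rightarrow> 'm \<Rightarrow> bool" where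
  "is_pullback C B p D f D' q B' f' \<longleftrightarrow>
     B' \<in> Ob C \<and> q \<in> mor C B' D' \<and> f' \<in> mor C B' B \<and> p \<bullet>\<^bsub>C\<^esub> f' = f \<bullet>\<^bsub>C\<^esub> q \<and>
     (\<forall>T\<in>Ob C. \<forall>s\<in>mor C T B. \<forall>t\<in>mor C T D'. p \<bullet>\<^bsub>C\<^esub> s = f \<bullet>\<^bsub>C\<^esub> t \<longrightarrow>
        (\<exists>!u. u \<in> mor C T B' \<and> f' \<bullet>\<^bsub>C\<^esub> u = s \<and> q \<bullet>\<^bsub>C\<^esub> u = t))"

text \<open>Exact categories in the sense of Quillen, with the axioms in the form given by Keller and Buehler.\<close>

locale exact_category = linear_category K C for K :: "('k, 'r) ring_scheme" and C :: "('k, 'o, 'm) ex_cat" (structure) +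
  assumes ex_zero_object: "\<exists>Z. zero_object C Z"
    and ex_biproduct: "\<lbrakk>X \<in> Ob C; Y \<in> Ob C\<rbrakk> \<Longrightarrow> \<exists>S i\<^sub>1 i\<^sub>2 p\<^sub>1 p\<^sub>2. biproduct C X Y S i\<^sub>1 i\<^sub>2 p\<^sub>1 p\<^sub>2"
    and Confl_mor: "Confl C A i B p D
          \<Longrightarrow> A \<in> Ob C \<and> B \<in> Ob C \<and> D \<in> Ob C \<and> i \<in> mor C A B \<and> p \<in> mor C B D"
    and Confl_kernel: "Confl C A i B p D \<Longrightarrow> is_kernel C A i B p D"
    and Confl_cokernel: "Confl C A i B p D \<Longrightarrow> is_cokernel C A i B p D"
    and Confl_iso: "\<lbrakk>Confl C A i B p D; A' \<in> Ob C; B' \<in> Ob C; D' \<in> Ob C;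
            i' \<in> mor C A' B'; p' \<in> mor C B' D'; a \<in> isos C A A'; b \<in> isos C B B'; d \<in> isos C D D';
            b \<bullet> i = i' \<bullet> a; d \<bullet> p = p' \<bullet> b\<rbrakk> \<Longrightarrow> Confl C A' i' B' p' D'"
    and Id_inflation: "X \<in> Ob C \<Longrightarrow> inflation C X (Id C X) X"
    and Id_deflation: "X \<in> Ob C \<Longrightarrow> deflation C X (Id C X) X"
    and Comp_inflation: "\<lbrakk>inflation C X i Y; inflation C Y j Z\<rbrakk> \<Longrightarrow> inflation C X (j \<bullet> i) Z"
    and Comp_deflation: "\<lbrakk>deflation C X p Y; deflation C Y q Z\<rbrakk> \<Longrightarrow> deflation C X (q \<bullet> p) Z"
    and pushout_inflation: "\<lbrakk>inflation C A i B; A' \<in> Ob C; f \<in> mor C A A'\<rbrakk>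
          \<Longrightarrow> \<exists>j B' f'. is_pushout C A i B f A' j B' f' \<and> inflation C A' j B'"
    and pullback_deflation: "\<lbrakk>deflation C B p D; D' \<in> Ob C; f \<in> mor C D' D\<rbrakk>
          \<Longrightarrow> \<exists>q B' f'. is_pullback C B p D f D' q B' f' \<and> deflation C B' q D'"

definition hom_finite :: "('k, 'r) ring_scheme \<Rightarrow> ('k, 'o, 'm) ex_cat \<Rightarrow> bool" where
  "hom_finite K C \<longleftrightarrow> (\<forall>X\<in>Ob C. \<forall>Y\<in>Ob C. finite_dimensional K (Hom C X Y))"

definition End_ring :: "('k, 'o, 'm) ex_cat \<Rightarrow> 'o \<Rightarrow> 'm ring" where
  "End_ring C X = \<lparr>carrier = mor C X X, monoid.mult = Comp C, monoid.one = Id C X,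
     ring.zero = \<zero>\<^bsub>Hom C X X\<^esub>, ring.add = ring.add (Hom C X X)\<rparr>"

definition local_ring :: "('a, 'r) ring_scheme \<Rightarrow> bool" where
  "local_ring R \<longleftrightarrow> ring R \<and> \<one>\<^bsub>R\<^esub> \<noteq> \<zero>\<^bsub>R\<^esub> \<and>
     (\<forall>a\<in>carrier R - Units R. \<forall>b\<in>carrier R - Units R. a \<oplus>\<^bsub>R\<^esub> b \<notin> Units R)"

definition finite_direct_sum ::
  "('k, 'o, 'm) ex_cat \<Rightarrow> nat \<Rightarrow> (nat \<Rightarrow> 'o) \<Rightarrow> 'o \<Rightarrow> (nat \<Rightarrow> 'm) \<Rightarrow> (nat \<Rightarrow> 'm) \<Rightarrow> bool" where
  "finite_direct_sum C n A S \<iota> \<pi> \<longleftrightarrow>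
     S \<in> Ob C \<and> (\<forall>j<n. A j \<in> Ob C \<and> \<iota> j \<in> mor C (A j) S \<and> \<pi> j \<in> mor C S (A j)) \<and>
     (\<forall>j<n. \<forall>l<n. \<pi> l \<bullet>\<^bsub>C\<^esub> \<iota> j = (if l = j then Id C (A j) else \<zero>\<^bsub>Hom C (A j) (A l)\<^esub>)) \<and>
     (\<Oplus>\<^bsub>Hom C S S\<^esub>j\<in>{..<n}. \<iota> j \<bullet>\<^bsub>C\<^esub> \<pi> j) = Id C S"

definition krull_schmidt :: "('k, 'o, 'm) ex_cat \<Rightarrow> bool" where
  "krull_schmidt C \<longleftrightarrow>
     (\<forall>X\<in>Ob C. \<exists>n A \<iota> \<pi>. finite_direct_sum C n A X \<iota> \<pi> \<and> (\<forall>j<n. local_ring (End_ring C (A j))))"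

definition projective :: "('k, 'o, 'm) ex_cat \<Rightarrow> 'o \<Rightarrow> bool" where
  "projective C P \<longleftrightarrow> P \<in> Ob C \<and>
     (\<forall>B p D f. deflation C B p D \<and> f \<in> mor C P D \<longrightarrow> (\<exists>u\<in>mor C P B. p \<bullet>\<^bsub>C\<^esub> u = f))"

definition injective :: "('k, 'o, 'm) ex_cat \<Rightarrow> 'o \<Rightarrow> bool" where
  "injective C I \<longleftrightarrow> I \<in> Ob C \<and>
     (\<forall>A i B f. inflation C A i B \<and> f \<in> mor C A I \<longrightarrow> (\<exists>u\<in>mor C B I. u \<bullet>\<^bsub>C\<^esub> i = f))"

definition frobenius :: "('k, 'o, 'm) ex_cat \<Rightarrow> bool" where
  "frobenius C \<longleftrightarrow>
     (\<forall>X\<in>Ob C. \<exists>P p. projective C P \<and> deflation C P p X) \<and>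
     (\<forall>X\<in>Ob C. \<exists>I i. injective C I \<and> inflation C X i I) \<and>
     (\<forall>X. projective C X \<longleftrightarrow> injective C X)"


section \<open>Extension spaces\<close>

text \<open>
  \<open>Ext C X Y\<close> is the Yoneda extension space of classes of conflations \<open>Y \<rightarrow> E \<rightarrow> X\<close>,
  where the triple \<open>(E, i, p)\<close> encodes the conflation.
\<close>

type_synonym ('o, 'm) ext_class = "('o \<times> 'm \<times> 'm) set"

definition exts :: "('k, 'o, 'm) ex_cat \<Rightarrow> 'o \<Rightarrow> 'o \<Rightarrow> ('o \<times> 'm \<times> 'm) set" where
  "exts C X Y = {(E, i, p). Confl C Y i E p X}"

definition ext_equiv :: "('k, 'o, 'm) ex_cat \<Rightarrow> 'o \<Rightarrow> 'o \<Rightarrow> (('o \<times> 'm \<times> 'm) \<times> ('o \<times> 'm \<times> 'm)) set" where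
  "ext_equiv C X Y = {((E, i, p), (E', i', p')).
     (E, i, p) \<in> exts C X Y \<and> (E', i', p') \<in> exts C X Y \<and>
     (\<exists>u\<in>mor C E E'. u \<bullet>\<^bsub>C\<^esub> i = i' \<and> p' \<bullet>\<^bsub>C\<^esub> u = p)}"

text \<open>
  Following Mac Lane, the class \<open>b\<^sub>*\<xi>\<close> (for \<open>b : Y \<rightarrow> Y'\<close>) is the class of the conflations
  \<open>Y' \<rightarrow> E' \<rightarrow> X\<close> receiving a morphism of conflations \<open>(b, u, id)\<close> from a member of \<open>\<xi>\<close>, that is,
  of the pushouts of members of \<open>\<xi>\<close> along \<open>b\<close>; dually for \<open>a\<^sup>*\<xi>\<close> with \<open>a : X' \<rightarrow> X\<close>.
\<close>

definition ext_push :: "('k, 'o, 'm) ex_cat \<Rightarrow> 'o \<Rightarrow> 'o \<Rightarrow> 'm \<Rightarrow> ('o, 'm) ext_class \<Rightarrow> ('o, 'm) ext_class" where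
  "ext_push C X Y' b \<xi> = {(E', i', p'). (E', i', p') \<in> exts C X Y' \<and>
     (\<exists>(E, i, p)\<in>\<xi>. \<exists>u\<in>mor C E E'. u \<bullet>\<^bsub>C\<^esub> i = i' \<bullet>\<^bsub>C\<^esub> b \<and> p' \<bullet>\<^bsub>C\<^esub> u = p)}"

definition ext_pull :: "('k, 'o, 'm) ex_cat \<Rightarrow> 'o \<Rightarrow> 'o \<Rightarrow> 'm \<Rightarrow> ('o, 'm) ext_class \<Rightarrow> ('o, 'm) ext_class" where
  "ext_pull C X' Y a \<xi> = {(E', i', p'). (E', i', p') \<in> exts C X' Y \<and>
     (\<exists>(E, i, p)\<in>\<xi>. \<exists>u\<in>mor C E' E. u \<bullet>\<^bsub>C\<^esub> i' = i \<and> p \<bullet>\<^bsub>C\<^esub> u = a \<bullet>\<^bsub>C\<^esub> p')}"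

text \<open>
  \<open>ext_map C X X' Y' a b\<close> is \<open>Ext(a, b) : Ext(X, Y) \<rightarrow> Ext(X', Y')\<close> for \<open>a : X' \<rightarrow> X\<close> and
  \<open>b : Y \<rightarrow> Y'\<close>.
\<close>

definition ext_map ::
  "('k, 'o, 'm) ex_cat \<Rightarrow> 'o \<Rightarrow> 'o \<Rightarrow> 'o \<Rightarrow> 'm \<Rightarrow> 'm \<Rightarrow> ('o, 'm) ext_class \<Rightarrow> ('o, 'm) ext_class" where
  "ext_map C X X' Y' a b \<xi> = ext_pull C X' Y' a (ext_push C X Y' b \<xi>)"

text \<open>
  The Baer sum: the direct sum \<open>Y \<oplus> Y \<rightarrow> E \<oplus> E' \<rightarrow> X \<oplus> X\<close> of the two conflations is pushed out
  along the codiagonal of \<open>Y\<close> and pulled back along the diagonal of \<open>X\<close>.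
\<close>

definition baer_sum ::
  "('k, 'o, 'm) ex_cat \<Rightarrow> 'o \<Rightarrow> 'o \<Rightarrow> ('o, 'm) ext_class \<Rightarrow> ('o, 'm) ext_class \<Rightarrow> ('o, 'm) ext_class" where
  "baer_sum C X Y \<xi> \<xi>' = {t. \<exists>(E, i, p)\<in>\<xi>. \<exists>(E', i', p')\<in>\<xi>'.
     \<exists>XX j\<^sub>1 j\<^sub>2 q\<^sub>1 q\<^sub>2 YY k\<^sub>1 k\<^sub>2 r\<^sub>1 r\<^sub>2 EE l\<^sub>1 l\<^sub>2 s\<^sub>1 s\<^sub>2.
       biproduct C X X XX j\<^sub>1 j\<^sub>2 q\<^sub>1 q\<^sub>2 \<and> biproduct C Y Y YY k\<^sub>1 k\<^sub>2 r\<^sub>1 r\<^sub>2 \<and> biproduct C E E' EE l\<^sub>1 l\<^sub>2 s\<^sub>1 s\<^sub>2 \<and>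
       t \<in> ext_map C XX X Y (j\<^sub>1 \<oplus>\<^bsub>Hom C X XX\<^esub> j\<^sub>2) (r\<^sub>1 \<oplus>\<^bsub>Hom C YY Y\<^esub> r\<^sub>2)
             (ext_equiv C XX YY ``
               {(EE,
                 (l\<^sub>1 \<bullet>\<^bsub>C\<^esub> i \<bullet>\<^bsub>C\<^esub> r\<^sub>1) \<oplus>\<^bsub>Hom C YY EE\<^esub> (l\<^sub>2 \<bullet>\<^bsub>C\<^esub> i' \<bullet>\<^bsub>C\<^esub> r\<^sub>2),
                 (j\<^sub>1 \<bullet>\<^bsub>C\<^esub> p \<bullet>\<^bsub>C\<^esub> s\<^sub>1) \<oplus>\<^bsub>Hom C EE XX\<^esub> (j\<^sub>2 \<bullet>\<^bsub>C\<^esub> p' \<bullet>\<^bsub>C\<^esub> s\<^sub>2))})}"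

text \<open>The zero is the class of the split conflations.\<close>

definition Ext :: "('k, 'o, 'm) ex_cat \<Rightarrow> 'o \<Rightarrow> 'o \<Rightarrow> ('k, ('o, 'm) ext_class) module" where
  "Ext C X Y =
     \<lparr>carrier = exts C X Y // ext_equiv C X Y,
      monoid.mult = undefined, monoid.one = undefined,
      ring.zero = {(E, i, p). (E, i, p) \<in> exts C X Y \<and> (\<exists>s\<in>mor C X E. p \<bullet>\<^bsub>C\<^esub> s = Id C X)},
      ring.add = baer_sum C X Y,
      module.smult = (\<lambda>a \<xi>. ext_push C X Y (a \<odot>\<^bsub>Hom C Y Y\<^esub> Id C Y) \<xi>)\<rparr>"


section \<open>The stable 2-Calabi--Yau property\<close>

text \<open>
  A functorial isomorphism \<open>Ext(X, Y) \<rightarrow> Ext(Y, X)\<^sup>*\<close>; the right hand side is a functor of \<open>(X, Y)\<close>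
  by transposing \<open>Ext(b, a) : Ext(Y', X') \<rightarrow> Ext(Y, X)\<close>.
\<close>

type_synonym ('k, 'o, 'm) cy_map = "'o \<Rightarrow> 'o \<Rightarrow> ('o, 'm) ext_class \<Rightarrow> ('o, 'm) ext_class \<Rightarrow> 'k"

definition cy_iso :: "('k, 'r) ring_scheme \<Rightarrow> ('k, 'o, 'm) ex_cat \<Rightarrow> ('k, 'o, 'm) cy_map \<Rightarrow> bool" where
  "cy_iso K C c \<longleftrightarrow>
     (\<forall>X\<in>Ob C. \<forall>Y\<in>Ob C. c X Y \<in> linear_isos K (Ext C X Y) (dual K (Ext C Y X))) \<and>
     (\<forall>X\<in>Ob C. \<forall>Y\<in>Ob C. \<forall>X'\<in>Ob C. \<forall>Y'\<in>Ob C. \<forall>a\<in>mor C X' X. \<forall>b\<in>mor C Y Y'.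
        \<forall>\<xi>\<in>carrier (Ext C X Y).
          c X' Y' (ext_map C X X' Y' a b \<xi>) =
            (\<lambda>\<eta>\<in>carrier (Ext C Y' X'). c X Y \<xi> (ext_map C Y' Y X b a \<eta>)))"

definition stably_2CY :: "('k, 'r) ring_scheme \<Rightarrow> ('k, 'o, 'm) ex_cat \<Rightarrow> bool" where
  "stably_2CY K C \<longleftrightarrow> exact_category K C \<and> (\<exists>c. cy_iso K C c)"


section \<open>Group actions and equivariant objects\<close>

text \<open>
  \<open>act_ob T g X\<close> and \<open>act_mor T g f\<close> are \<open>g \<otimes> X\<close> and \<open>g \<otimes> f\<close>; \<open>act_assoc T g h X\<close> is
  \<open>\<alpha> : gh \<otimes> X \<rightarrow> g \<otimes> (h \<otimes> X)\<close> and \<open>act_unit T X\<close> is the structural map \<open>1 \<otimes> X \<rightarrow> X\<close>.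
\<close>

record ('g, 'o, 'm) action_data =
  act_ob :: "'g \<Rightarrow> 'o \<Rightarrow> 'o"
  act_mor :: "'g \<Rightarrow> 'm \<Rightarrow> 'm"
  act_assoc :: "'g \<Rightarrow> 'g \<Rightarrow> 'o \<Rightarrow> 'm"
  act_unit :: "'o \<Rightarrow> 'm"

text \<open>
  The simple modules over the algebra of functions on \<open>\<Gamma>\<close> are indexed by \<open>\<Gamma>\<close> and multiply as in
  \<open>\<Gamma>\<close>, so a module category structure amounts to the following data on the simple modules.
  The last two axioms are the pentagon and the triangle.
\<close>

locale category_action =
  fixes K :: "('k, 'r) ring_scheme" and \<Gamma> :: "('g, 's) monoid_scheme"
    and C :: "('k, 'o, 'm) ex_cat" and T :: "('g, 'o, 'm) action_data"
  assumes act_ob_closed: "\<lbrakk>g \<in> carrier \<Gamma>; X \<in> Ob C\<rbrakk> \<Longrightarrow> act_ob T g X \<in> Ob C"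
    and act_mor_linear: "\<lbrakk>g \<in> carrier \<Gamma>; X \<in> Ob C; Y \<in> Ob C\<rbrakk>
          \<Longrightarrow> act_mor T g \<in> linear_maps K (Hom C X Y) (Hom C (act_ob T g X) (act_ob T g Y))"
    and act_mor_Id: "\<lbrakk>g \<in> carrier \<Gamma>; X \<in> Ob C\<rbrakk> \<Longrightarrow> act_mor T g (Id C X) = Id C (act_ob T g X)"
    and act_mor_Comp: "\<lbrakk>g \<in> carrier \<Gamma>; X \<in> Ob C; Y \<in> Ob C; Z \<in> Ob C; f \<in> mor C X Y; f' \<in> mor C Y Z\<rbrakk>
          \<Longrightarrow> act_mor T g (f' \<bullet>\<^bsub>C\<^esub> f) = act_mor T g f' \<bullet>\<^bsub>C\<^esub> act_mor T g f"
    and act_fully_faithful: "\<lbrakk>g \<in> carrier \<Gamma>; X \<in> Ob C; Y \<in> Ob C\<rbrakk>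
          \<Longrightarrow> bij_betw (act_mor T g) (mor C X Y) (mor C (act_ob T g X) (act_ob T g Y))"
    and act_ess_surj: "\<lbrakk>g \<in> carrier \<Gamma>; Y \<in> Ob C\<rbrakk> \<Longrightarrow> \<exists>X\<in>Ob C. isos C (act_ob T g X) Y \<noteq> {}"
    and act_assoc_iso: "\<lbrakk>g \<in> carrier \<Gamma>; h \<in> carrier \<Gamma>; X \<in> Ob C\<rbrakk>
          \<Longrightarrow> act_assoc T g h X \<in> isos C (act_ob T (g \<otimes>\<^bsub>\<Gamma>\<^esub> h) X) (act_ob T g (act_ob T h X))"
    and act_assoc_natural: "\<lbrakk>g \<in> carrier \<Gamma>; h \<in> carrier \<Gamma>; X \<in> Ob C; Y \<in> Ob C; f \<in> mor C X Y\<rbrakk>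
          \<Longrightarrow> act_assoc T g h Y \<bullet>\<^bsub>C\<^esub> act_mor T (g \<otimes>\<^bsub>\<Gamma>\<^esub> h) f
              = act_mor T g (act_mor T h f) \<bullet>\<^bsub>C\<^esub> act_assoc T g h X"
    and act_unit_iso: "X \<in> Ob C \<Longrightarrow> act_unit T X \<in> isos C (act_ob T \<one>\<^bsub>\<Gamma>\<^esub> X) X"
    and act_unit_natural: "\<lbrakk>X \<in> Ob C; Y \<in> Ob C; f \<in> mor C X Y\<rbrakk>
          \<Longrightarrow> act_unit T Y \<bullet>\<^bsub>C\<^esub> act_mor T \<one>\<^bsub>\<Gamma>\<^esub> f = f \<bullet>\<^bsub>C\<^esub> act_unit T X"
    and act_pentagon: "\<lbrakk>g \<in> carrier \<Gamma>; h \<in> carrier \<Gamma>; l \<in> carrier \<Gamma>; X \<in> Ob C\<rbrakk>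
          \<Longrightarrow> act_assoc T g h (act_ob T l X) \<bullet>\<^bsub>C\<^esub> act_assoc T (g \<otimes>\<^bsub>\<Gamma>\<^esub> h) l X
              = act_mor T g (act_assoc T h l X) \<bullet>\<^bsub>C\<^esub> act_assoc T g (h \<otimes>\<^bsub>\<Gamma>\<^esub> l) X"
    and act_triangle: "\<lbrakk>g \<in> carrier \<Gamma>; X \<in> Ob C\<rbrakk>
          \<Longrightarrow> act_mor T g (act_unit T X) \<bullet>\<^bsub>C\<^esub> act_assoc T g \<one>\<^bsub>\<Gamma>\<^esub> X = Id C (act_ob T g X)"

definition exact_action :: "('g, 's) monoid_scheme \<Rightarrow> ('k, 'o, 'm) ex_cat \<Rightarrow> ('g, 'o, 'm) action_data \<Rightarrow> bool" where
  "exact_action \<Gamma> C T \<longleftrightarrow>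
     (\<forall>g\<in>carrier \<Gamma>. \<forall>A i B p D. Confl C A i B p D \<longrightarrow>
        Confl C (act_ob T g A) (act_mor T g i) (act_ob T g B) (act_mor T g p) (act_ob T g D))"

text \<open>The map \<open>g \<otimes> - : Ext(X, Y) \<rightarrow> Ext(g \<otimes> X, g \<otimes> Y)\<close>.\<close>

definition act_ext ::
  "('k, 'o, 'm) ex_cat \<Rightarrow> ('g, 'o, 'm) action_data \<Rightarrow> 'g \<Rightarrow> 'o \<Rightarrow> 'o \<Rightarrow> ('o, 'm) ext_class \<Rightarrow> ('o, 'm) ext_class" where
  "act_ext C T g X Y \<xi> =
     ext_equiv C (act_ob T g X) (act_ob T g Y) ``
       {(act_ob T g E, act_mor T g i, act_mor T g p) | E i p. (E, i, p) \<in> \<xi>}"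

definition cy_action ::
  "('g, 's) monoid_scheme \<Rightarrow> ('k, 'o, 'm) ex_cat \<Rightarrow> ('g, 'o, 'm) action_data \<Rightarrow> ('k, 'o, 'm) cy_map \<Rightarrow> bool" where
  "cy_action \<Gamma> C T c \<longleftrightarrow>
     exact_action \<Gamma> C T \<and>
     (\<forall>g\<in>carrier \<Gamma>. \<forall>X\<in>Ob C. \<forall>Y\<in>Ob C. \<forall>\<xi>\<in>carrier (Ext C X Y).
        c X Y \<xi> = (\<lambda>\<eta>\<in>carrier (Ext C Y X).
          c (act_ob T g X) (act_ob T g Y) (act_ext C T g X Y \<xi>) (act_ext C T g Y X \<eta>)))"

text \<open>
  The families \<open>\<psi>\<close> are extensional, so that an object is determined by the \<open>\<psi>\<^sub>g\<close> with \<open>g \<in> \<Gamma>\<close>.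
\<close>

definition equiv_objects ::
  "('g, 's) monoid_scheme \<Rightarrow> ('k, 'o, 'm) ex_cat \<Rightarrow> ('g, 'o, 'm) action_data \<Rightarrow> ('o \<times> ('g \<Rightarrow> 'm)) set" where
  "equiv_objects \<Gamma> C T =
     {(X, \<psi>). X \<in> Ob C \<and> \<psi> \<in> extensional (carrier \<Gamma>) \<and>
        (\<forall>g\<in>carrier \<Gamma>. \<psi> g \<in> isos C (act_ob T g X) X) \<and>
        (\<forall>g\<in>carrier \<Gamma>. \<forall>h\<in>carrier \<Gamma>.
           \<psi> (g \<otimes>\<^bsub>\<Gamma>\<^esub> h) = \<psi> g \<bullet>\<^bsub>C\<^esub> act_mor T g (\<psi> h) \<bullet>\<^bsub>C\<^esub> act_assoc T g h X) \<and>
        \<psi> \<one>\<^bsub>\<Gamma>\<^esub> = act_unit T X}"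

definition equiv_mor ::
  "('g, 's) monoid_scheme \<Rightarrow> ('k, 'o, 'm) ex_cat \<Rightarrow> ('g, 'o, 'm) action_data
     \<Rightarrow> 'o \<times> ('g \<Rightarrow> 'm) \<Rightarrow> 'o \<times> ('g \<Rightarrow> 'm) \<Rightarrow> 'm set" where
  "equiv_mor \<Gamma> C T = (\<lambda>(X, \<psi>) (Y, \<chi>).
     {f \<in> mor C X Y. \<forall>g\<in>carrier \<Gamma>. f \<bullet>\<^bsub>C\<^esub> \<psi> g = \<chi> g \<bullet>\<^bsub>C\<^esub> act_mor T g f})"

definition equivariant_category ::
  "('g, 's) monoid_scheme \<Rightarrow> ('k, 'o, 'm) ex_cat \<Rightarrow> ('g, 'o, 'm) action_data
     \<Rightarrow> ('k, 'o \<times> ('g \<Rightarrow> 'm), 'm) ex_cat" where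
  "equivariant_category \<Gamma> C T =
     \<lparr>Ob = equiv_objects \<Gamma> C T,
      Hom = (\<lambda>X Y. (Hom C (fst X) (fst Y))\<lparr>carrier := equiv_mor \<Gamma> C T X Y\<rparr>),
      Comp = Comp C,
      Id = (\<lambda>X. Id C (fst X)),
      Confl = (\<lambda>A i B p D.
        A \<in> equiv_objects \<Gamma> C T \<and> B \<in> equiv_objects \<Gamma> C T \<and> D \<in> equiv_objects \<Gamma> C T \<and>
        i \<in> equiv_mor \<Gamma> C T A B \<and> p \<in> equiv_mor \<Gamma> C T B D \<and>
        Confl C (fst A) i (fst B) p (fst D))\<rparr>"

text \<open>
  The representation \<open>Ext(FX, FY)\<close>, for equivariant \<open>(X, \<psi>)\<close> and \<open>(Y, \<chi>)\<close>, on which \<open>g\<close> acts by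
  \<open>\<xi> \<mapsto> Ext(\<psi>\<^sub>g\<^sup>-\<^sup>1, \<chi>\<^sub>g)(g \<otimes> \<xi>)\<close>. It is the first derived functor of \<open>Hom(FX, FY)\<close> with the action
  \<open>g \<cdot> f = \<chi>\<^sub>g (g \<otimes> f) \<psi>\<^sub>g\<^sup>-\<^sup>1\<close>.
\<close>

definition rep_Ext ::
  "('k, 'o, 'm) ex_cat \<Rightarrow> ('g, 'o, 'm) action_data \<Rightarrow> 'o \<times> ('g \<Rightarrow> 'm) \<Rightarrow> 'o \<times> ('g \<Rightarrow> 'm)
     \<Rightarrow> ('k, ('o, 'm) ext_class, 'g) rep_module" where
  "rep_Ext C T = (\<lambda>(X, \<psi>) (Y, \<chi>).
     module.extend (Ext C X Y)
       (rep_module.fields (\<lambda>g \<xi>.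
          ext_map C (act_ob T g X) X Y (mor_inv C (act_ob T g X) X (\<psi> g)) (\<chi> g)
            (act_ext C T g X Y \<xi>))))"

text \<open>
  The maps \<open>c\<^bsub>FX,FY\<^esub>\<close> form an isomorphism between functors of \<open>(X, Y)\<close> with values in representations.
\<close>

definition rep_cy_iso ::
  "('k, 'r) ring_scheme \<Rightarrow> ('g, 's) monoid_scheme \<Rightarrow> ('k, 'o, 'm) ex_cat \<Rightarrow> ('g, 'o, 'm) action_data
     \<Rightarrow> ('k, 'o, 'm) cy_map \<Rightarrow> bool" where
  "rep_cy_iso K \<Gamma> C T c \<longleftrightarrow>
     (let D = equivariant_category \<Gamma> C T;
          V = rep_Ext C T;
          W = (\<lambda>X Y. contragredient K \<Gamma> (rep_Ext C T Y X));
          Vmap = (\<lambda>X X' Y' a b. ext_map C (fst X) (fst X') (fst Y') a b);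
          Wmap = (\<lambda>X Y X' Y' a b \<phi>. \<lambda>\<eta>\<in>carrier (V Y' X'). \<phi> (Vmap Y' Y X b a \<eta>))
      in (\<forall>X\<in>Ob D. \<forall>Y\<in>Ob D.
            representation K \<Gamma> (V X Y) \<and> representation K \<Gamma> (W X Y) \<and>
            c (fst X) (fst Y) \<in> rep_isos K \<Gamma> (V X Y) (W X Y)) \<and>
         (\<forall>X\<in>Ob D. \<forall>Y\<in>Ob D. \<forall>X'\<in>Ob D. \<forall>Y'\<in>Ob D. \<forall>a\<in>mor D X' X. \<forall>b\<in>mor D Y Y'.
            Vmap X X' Y' a b \<in> rep_homs K \<Gamma> (V X Y) (V X' Y') \<and>
            Wmap X Y X' Y' a b \<in> rep_homs K \<Gamma> (W X Y) (W X' Y') \<and>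
            (\<forall>\<xi>\<in>carrier (V X Y).
               c (fst X') (fst Y') (Vmap X X' Y' a b \<xi>) = Wmap X Y X' Y' a b (c (fst X) (fst Y) \<xi>))))"

end

theory Submission
  imports Defs
begin

text \<open>
  Classes in \<open>Ext(X, Y)\<close> coincide as soon as they meet, so all functoriality statements are obtained by
  composing and factoring morphisms of conflations. The vector space structure of \<open>Ext(X, Y)\<close>, the
  linearity of \<open>Ext(a, b)\<close> and that of the action of \<open>\<Gamma>\<close> are then read off from the natural bijection \<open>c\<close>
  onto a dual space. Writing \<open>g \<cdot> \<xi>\<close> for the action, the Calabi--Yau condition on the action says
  \<open>c(g \<cdot> \<xi>)(g \<cdot> \<eta>) = c(\<xi>)(\<eta>)\<close>, which is the equivariance of \<open>c\<close>.

  For the second part, the forgetful functor identifies the extensions in the equivariant category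
  with the invariants of \<open>\<Gamma>\<close> in \<open>Ext(FX, FY)\<close>: it is injective on classes because equivalences can be
  averaged, and it reaches every invariant class because the obstruction, a 2-cocycle of \<open>\<Gamma>\<close> with values in
  \<open>Hom(FX, FY)\<close>, is killed by averaging as well. As the order of \<open>\<Gamma>\<close> is invertible, \<open>c\<close> restricts
  to a perfect pairing between the spaces of invariants.
\<close>


section \<open>Linear categories\<close>

text \<open>Before \<open>c\<close> is used, Ext is only a set whose operations are unions over
  choices. Diagrams have to show that each such union is a single class and that Ext(a, b) is
  functorial. In the equivariant category no pairing is given, so its operations on Ext are compared
  with those of \<open>C\<close> through the forgetful map. The constant \<nu> is the inverse in
  \<open>K\<close> of the order of \<Gamma>, and the average built from it is a projection onto the
  invariants. It enters at four places: making an equivalence equivariant, writing the cocycle as a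
  coboundary, replacing a class that is tested against an invariant one by an invariant class, and
  extending a functional from the invariants to the whole Ext space so that \<open>c\<close> can
  represent it. Exactness of the action is what lets cokernels and pushouts inherit equivariant
  structures: a structure map starts at a translate of the object, so the translated sequence or
  square needs the universal property as well. Kernels and pullbacks receive structure maps and use
  only their own universal property.\<close>

text \<open>Morphism sets may overlap, and \<open>mor\<close> does not record whether its arguments
  are objects. \<open>arr\<close> carries membership and both object conditions in one fact, so that
  typing rules chain with \<open>OF\<close> without separate object premises.\<close>

definition arr :: "('k, 'o, 'm) ex_cat \<Rightarrow> 'o \<Rightarrow> 'o \<Rightarrow> 'm set" where
  "arr C X Y = {f \<in> mor C X Y. X \<in> Ob C \<and> Y \<in> Ob C}"

lemma arr_iff: "\<lbrakk>X \<in> Ob C; Y \<in> Ob C\<rbrakk> \<Longrightarrow> f \<in> arr C X Y \<longleftrightarrow> f \<in> mor C X Y"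
  by (simp add: arr_def)

lemma arr_mor: "f \<in> arr C X Y \<Longrightarrow> f \<in> mor C X Y"
  and arr_dom: "f \<in> arr C X Y \<Longrightarrow> X \<in> Ob C"
  and arr_cod: "f \<in> arr C X Y \<Longrightarrow> Y \<in> Ob C"
  by (simp_all add: arr_def)

context linear_category
begin

lemma Id_arr: "X \<in> Ob C \<Longrightarrow> Id C X \<in> arr C X X"
  by (simp add: arr_def Id_mor)

lemma comp: "\<lbrakk>f \<in> arr C X Y; g \<in> arr C Y Z\<rbrakk> \<Longrightarrow> g \<bullet> f \<in> arr C X Z"
  using Comp_mor by (auto simp: arr_def)

lemma assoc: "\<lbrakk>f \<in> arr C W X; g \<in> arr C X Y; h \<in> arr C Y Z\<rbrakk> \<Longrightarrow> h \<bullet> (g \<bullet> f) = (h \<bullet> g) \<bullet> f"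
  using Comp_assoc by (auto simp: arr_def)

lemma idr: "f \<in> arr C X Y \<Longrightarrow> f \<bullet> Id C X = f"
  using Comp_Id by (auto simp: arr_def)

lemma idl: "f \<in> arr C X Y \<Longrightarrow> Id C Y \<bullet> f = f"
  using Id_Comp by (auto simp: arr_def)

lemma Hom_abelian: "\<lbrakk>X \<in> Ob C; Y \<in> Ob C\<rbrakk> \<Longrightarrow> abelian_group (Hom C X Y)"
  using Hom_module module.axioms(2) by blast

lemma zero_arr: "\<lbrakk>X \<in> Ob C; Y \<in> Ob C\<rbrakk> \<Longrightarrow> \<zero>\<^bsub>Hom C X Y\<^esub> \<in> arr C X Y"
  using Hom_abelian[of X Y] abelian_groupE(2) by (auto simp: arr_def)

lemma add_arr: "\<lbrakk>f \<in> arr C X Y; g \<in> arr C X Y\<rbrakk> \<Longrightarrow> f \<oplus>\<^bsub>Hom C X Y\<^esub> g \<in> arr C X Y"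
  using Hom_abelian[of X Y] abelian_groupE(1) by (fastforce simp: arr_def)

lemma smult_arr: "\<lbrakk>a \<in> carrier K; f \<in> arr C X Y\<rbrakk> \<Longrightarrow> a \<odot>\<^bsub>Hom C X Y\<^esub> f \<in> arr C X Y"
  using Hom_module[of X Y] module.smult_closed by (fastforce simp: arr_def)

lemma neg_arr: "f \<in> arr C X Y \<Longrightarrow> \<ominus>\<^bsub>Hom C X Y\<^esub> f \<in> arr C X Y"
  using Hom_abelian[of X Y] abelian_group.a_inv_closed by (fastforce simp: arr_def)

lemma minus_arr: "\<lbrakk>f \<in> arr C X Y; g \<in> arr C X Y\<rbrakk> \<Longrightarrow> f \<ominus>\<^bsub>Hom C X Y\<^esub> g \<in> arr C X Y"
  using Hom_abelian[of X Y] abelian_group.minus_closed by (fastforce simp: arr_def)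

lemma comp_add: "\<lbrakk>f \<in> arr C X Y; f' \<in> arr C X Y; g \<in> arr C Y Z\<rbrakk>
    \<Longrightarrow> g \<bullet> (f \<oplus>\<^bsub>Hom C X Y\<^esub> f') = (g \<bullet> f) \<oplus>\<^bsub>Hom C X Z\<^esub> (g \<bullet> f')"
  using Comp_linear_right[of X Y Z g] by (auto simp: arr_def linear_maps_def)

lemma add_comp: "\<lbrakk>f \<in> arr C X Y; g \<in> arr C Y Z; g' \<in> arr C Y Z\<rbrakk>
    \<Longrightarrow> (g \<oplus>\<^bsub>Hom C Y Z\<^esub> g') \<bullet> f = (g \<bullet> f) \<oplus>\<^bsub>Hom C X Z\<^esub> (g' \<bullet> f)"
  using Comp_linear_left[of X Y Z f] by (auto simp: arr_def linear_maps_def)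

lemma comp_smult: "\<lbrakk>a \<in> carrier K; f \<in> arr C X Y; g \<in> arr C Y Z\<rbrakk>
    \<Longrightarrow> g \<bullet> (a \<odot>\<^bsub>Hom C X Y\<^esub> f) = a \<odot>\<^bsub>Hom C X Z\<^esub> (g \<bullet> f)"
  using Comp_linear_right[of X Y Z g] by (auto simp: arr_def linear_maps_def)

lemma smult_comp: "\<lbrakk>a \<in> carrier K; f \<in> arr C X Y; g \<in> arr C Y Z\<rbrakk>
    \<Longrightarrow> (a \<odot>\<^bsub>Hom C Y Z\<^esub> g) \<bullet> f = a \<odot>\<^bsub>Hom C X Z\<^esub> (g \<bullet> f)"
  using Comp_linear_left[of X Y Z f] by (auto simp: arr_def linear_maps_def)

lemma add_eq_self_iff:
  assumes "f \<in> arr C X Y" "g \<in> arr C X Y" shows "f \<oplus>\<^bsub>Hom C X Y\<^esub> g = f \<longleftrightarrow> g = \<zero>\<^bsub>Hom C X Y\<^esub>"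
proof -
  interpret H: abelian_group "Hom C X Y" using assms Hom_abelian by (auto simp: arr_def)
  show ?thesis using assms H.add.r_cancel_one by (auto simp: arr_def)
qed

lemma add_zero: "f \<in> arr C X Y \<Longrightarrow> f \<oplus>\<^bsub>Hom C X Y\<^esub> \<zero>\<^bsub>Hom C X Y\<^esub> = f"
  using add_eq_self_iff zero_arr by (auto simp: arr_def)

lemma add_commute:
  assumes "f \<in> arr C X Y" "g \<in> arr C X Y"
  shows "f \<oplus>\<^bsub>Hom C X Y\<^esub> g = g \<oplus>\<^bsub>Hom C X Y\<^esub> f"
proof -
  interpret H: abelian_group "Hom C X Y" using assms Hom_abelian by (auto simp: arr_def)
  show ?thesis using assms H.a_comm by (auto simp: arr_def)
qed

lemma zero_add: "f \<in> arr C X Y \<Longrightarrow> \<zero>\<^bsub>Hom C X Y\<^esub> \<oplus>\<^bsub>Hom C X Y\<^esub> f = f"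
  using add_zero add_commute zero_arr by (metis arr_cod arr_dom)

lemma comp_zero: "\<lbrakk>X \<in> Ob C; g \<in> arr C Y Z\<rbrakk> \<Longrightarrow> g \<bullet> \<zero>\<^bsub>Hom C X Y\<^esub> = \<zero>\<^bsub>Hom C X Z\<^esub>"
  using comp_add[of "\<zero>\<^bsub>Hom C X Y\<^esub>" X Y "\<zero>\<^bsub>Hom C X Y\<^esub>" g Z]
  by (metis add_eq_self_iff add_zero arr_dom comp zero_arr)

lemma zero_comp: "\<lbrakk>Z \<in> Ob C; f \<in> arr C X Y\<rbrakk> \<Longrightarrow> \<zero>\<^bsub>Hom C Y Z\<^esub> \<bullet> f = \<zero>\<^bsub>Hom C X Z\<^esub>"
  using add_comp[of f X Y "\<zero>\<^bsub>Hom C Y Z\<^esub>" Z "\<zero>\<^bsub>Hom C Y Z\<^esub>"]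
  by (metis add_eq_self_iff add_zero arr_cod comp zero_arr)

lemma minus_eq_zero_iff:
  assumes "f \<in> arr C X Y" "g \<in> arr C X Y"
  shows "f \<ominus>\<^bsub>Hom C X Y\<^esub> g = \<zero>\<^bsub>Hom C X Y\<^esub> \<longleftrightarrow> f = g"
proof -
  interpret H: abelian_group "Hom C X Y" using assms Hom_abelian by (auto simp: arr_def)
  have "f = g" if "f \<ominus>\<^bsub>Hom C X Y\<^esub> g = \<zero>\<^bsub>Hom C X Y\<^esub>"
  proof -
    have "(f \<ominus>\<^bsub>Hom C X Y\<^esub> g) \<oplus>\<^bsub>Hom C X Y\<^esub> g = f"
      using assms by (auto simp: arr_def a_minus_def H.a_assoc H.l_neg)
    then show ?thesis using that assms by (auto simp: arr_def)
  qed
  then show ?thesis using assms by (auto simp: arr_def a_minus_def H.r_neg)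
qed

lemma minus_zero: assumes "f \<in> arr C X Y" shows "f \<ominus>\<^bsub>Hom C X Y\<^esub> \<zero>\<^bsub>Hom C X Y\<^esub> = f"
proof -
  interpret H: abelian_group "Hom C X Y" using assms Hom_abelian by (auto simp: arr_def)
  show ?thesis using assms by (auto simp: arr_def a_minus_def)
qed

lemma minus_self: "f \<in> arr C X Y \<Longrightarrow> f \<ominus>\<^bsub>Hom C X Y\<^esub> f = \<zero>\<^bsub>Hom C X Y\<^esub>"
  by (simp add: minus_eq_zero_iff)

lemma minus_add_cancel:
  assumes "f \<in> arr C X Y" "g \<in> arr C X Y"
  shows "(f \<ominus>\<^bsub>Hom C X Y\<^esub> g) \<oplus>\<^bsub>Hom C X Y\<^esub> g = f"
proof -
  interpret H: abelian_group "Hom C X Y" using assms Hom_abelian by (auto simp: arr_def)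
  show ?thesis using assms by (auto simp: arr_def a_minus_def H.a_assoc H.l_neg)
qed

lemma add_right_cancel:
  assumes "f \<in> arr C X Y" "g \<in> arr C X Y" "h \<in> arr C X Y"
    "f \<oplus>\<^bsub>Hom C X Y\<^esub> h = g \<oplus>\<^bsub>Hom C X Y\<^esub> h"
  shows "f = g"
proof -
  interpret H: abelian_group "Hom C X Y" using assms Hom_abelian by (auto simp: arr_def)
  show ?thesis using assms H.add.right_cancel by (auto simp: arr_def)
qed

lemma add_assoc:
  assumes "f \<in> arr C X Y" "g \<in> arr C X Y" "h \<in> arr C X Y"
  shows "(f \<oplus>\<^bsub>Hom C X Y\<^esub> g) \<oplus>\<^bsub>Hom C X Y\<^esub> h = f \<oplus>\<^bsub>Hom C X Y\<^esub> (g \<oplus>\<^bsub>Hom C X Y\<^esub> h)"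
proof -
  interpret H: abelian_group "Hom C X Y" using assms Hom_abelian by (auto simp: arr_def)
  show ?thesis using assms H.a_assoc by (auto simp: arr_def)
qed

lemma comp_minus:
  assumes "f \<in> arr C X Y" "f' \<in> arr C X Y" "g \<in> arr C Y Z"
  shows "g \<bullet> (f \<ominus>\<^bsub>Hom C X Y\<^esub> f') = (g \<bullet> f) \<ominus>\<^bsub>Hom C X Z\<^esub> (g \<bullet> f')"
proof (rule add_right_cancel[where h = "g \<bullet> f'"])
  show "(g \<bullet> (f \<ominus>\<^bsub>Hom C X Y\<^esub> f')) \<oplus>\<^bsub>Hom C X Z\<^esub> (g \<bullet> f') =
    ((g \<bullet> f) \<ominus>\<^bsub>Hom C X Z\<^esub> (g \<bullet> f')) \<oplus>\<^bsub>Hom C X Z\<^esub> (g \<bullet> f')"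
    using assms by (metis comp_add minus_add_cancel comp minus_arr)
qed (use assms in \<open>auto intro: comp minus_arr\<close>)

lemma minus_comp:
  assumes "f \<in> arr C X Y" "g \<in> arr C Y Z" "g' \<in> arr C Y Z"
  shows "(g \<ominus>\<^bsub>Hom C Y Z\<^esub> g') \<bullet> f = (g \<bullet> f) \<ominus>\<^bsub>Hom C X Z\<^esub> (g' \<bullet> f)"
proof (rule add_right_cancel[where h = "g' \<bullet> f"])
  show "((g \<ominus>\<^bsub>Hom C Y Z\<^esub> g') \<bullet> f) \<oplus>\<^bsub>Hom C X Z\<^esub> (g' \<bullet> f) =
    ((g \<bullet> f) \<ominus>\<^bsub>Hom C X Z\<^esub> (g' \<bullet> f)) \<oplus>\<^bsub>Hom C X Z\<^esub> (g' \<bullet> f)"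
    using assms by (metis add_comp minus_add_cancel comp minus_arr)
qed (use assms in \<open>auto intro: comp minus_arr\<close>)

section \<open>Isomorphisms and their inverses\<close>

lemma isosI: "\<lbrakk>f \<in> arr C X Y; g \<in> arr C Y X; g \<bullet> f = Id C X; f \<bullet> g = Id C Y\<rbrakk> \<Longrightarrow> f \<in> isos C X Y"
  by (auto simp: isos_def arr_def)

lemma isosE:
  assumes "f \<in> isos C X Y" "X \<in> Ob C" "Y \<in> Ob C"
  obtains g where "f \<in> arr C X Y" "g \<in> arr C Y X" "g \<bullet> f = Id C X" "f \<bullet> g = Id C Y"
  using assms by (auto simp: isos_def arr_def)

text \<open>Two-sided inverses are unique, so the definite description behind \<open>mor_inv\<close>
  may be replaced by any inverse that has been exhibited.\<close>

lemma mor_inv_eq: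
  assumes f: "f \<in> arr C X Y" and g: "g \<in> arr C Y X" and gf: "g \<bullet> f = Id C X" and fg: "f \<bullet> g = Id C Y"
  shows "mor_inv C X Y f = g"
  unfolding mor_inv_def
proof (rule the_equality)
  show "g \<in> mor C Y X \<and> g \<bullet> f = Id C X \<and> f \<bullet> g = Id C Y" using assms by (auto simp: arr_def)
next
  fix h assume h: "h \<in> mor C Y X \<and> h \<bullet> f = Id C X \<and> f \<bullet> h = Id C Y"
  then have h': "h \<in> arr C Y X" using f by (auto simp: arr_def)
  show "h = g" using assoc[OF g f h'] idl[OF g] idr[OF h'] h fg by metis
qed

lemma mor_inv_iso:
  assumes "f \<in> isos C X Y" "X \<in> Ob C" "Y \<in> Ob C"
  shows "f \<in> arr C X Y" "mor_inv C X Y f \<in> arr C Y X"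
    "mor_inv C X Y f \<bullet> f = Id C X" "f \<bullet> mor_inv C X Y f = Id C Y"
    "mor_inv C X Y f \<in> isos C Y X"
proof -
  from isosE[OF assms] obtain g
    where g: "f \<in> arr C X Y" "g \<in> arr C Y X" "g \<bullet> f = Id C X" "f \<bullet> g = Id C Y" .
  have "mor_inv C X Y f = g" using g by (rule mor_inv_eq)
  then show "f \<in> arr C X Y" "mor_inv C X Y f \<in> arr C Y X"
    "mor_inv C X Y f \<bullet> f = Id C X" "f \<bullet> mor_inv C X Y f = Id C Y"
    "mor_inv C X Y f \<in> isos C Y X"
    using g isosI by auto
qed

lemma Id_isos: "X \<in> Ob C \<Longrightarrow> Id C X \<in> isos C X X"
  using isosI[OF Id_arr Id_arr] idl[OF Id_arr] by blast

lemma isos_comp: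
  assumes "f \<in> isos C X Y" "g \<in> isos C Y Z" "X \<in> Ob C" "Y \<in> Ob C" "Z \<in> Ob C"
  shows "g \<bullet> f \<in> isos C X Z"
proof -
  from isosE[OF assms(1,3,4)] obtain f' where f: "f \<in> arr C X Y" "f' \<in> arr C Y X" "f' \<bullet> f = Id C X" "f \<bullet> f' = Id C Y" .
  from isosE[OF assms(2,4,5)] obtain g' where g: "g \<in> arr C Y Z" "g' \<in> arr C Z Y" "g' \<bullet> g = Id C Y" "g \<bullet> g' = Id C Z" .
  show ?thesis
  proof (rule isosI)
    show "(f' \<bullet> g') \<bullet> (g \<bullet> f) = Id C X"
      using assoc[OF comp[OF f(1) g(1)] g(2) f(2)]  assoc[OF f(1) g(1) g(2)] idl[OF f(1)] f(3) g(3) by metis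
    show "(g \<bullet> f) \<bullet> (f' \<bullet> g') = Id C Z"
      using assoc[OF comp[OF g(2) f(2)] f(1) g(1)] assoc[OF g(2) f(2) f(1)] idl[OF g(2)] f(4) g(4) by metis
  qed (rule comp[OF f(1) g(1)], rule comp[OF g(2) f(2)])
qed

lemma iso_cancel_left:
  assumes "f \<in> isos C X Y" "Y \<in> Ob C" "a \<in> arr C W X" "b \<in> arr C W X" "f \<bullet> a = f \<bullet> b"
  shows "a = b"
proof -
  have "X \<in> Ob C" using assms by (auto simp: arr_def)
  from isosE[OF assms(1) this assms(2)] obtain g where
    g: "f \<in> arr C X Y" "g \<in> arr C Y X" "g \<bullet> f = Id C X" "f \<bullet> g = Id C Y" .
  show ?thesis using assoc[OF assms(3) g(1,2)] assoc[OF assms(4) g(1,2)] g(3) assms(5) idl[OF assms(3)] idl[OF assms(4)]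
    by metis
qed

lemma iso_cancel_right:
  assumes "f \<in> isos C X Y" "X \<in> Ob C" "a \<in> arr C Y Z" "b \<in> arr C Y Z" "a \<bullet> f = b \<bullet> f"
  shows "a = b"
proof -
  have "Y \<in> Ob C" using assms by (auto simp: arr_def)
  from isosE[OF assms(1,2) this] obtain g where
    g: "f \<in> arr C X Y" "g \<in> arr C Y X" "g \<bullet> f = Id C X" "f \<bullet> g = Id C Y" .
  show ?thesis using assoc[OF g(2,1) assms(3)] assoc[OF g(2,1) assms(4)] g(4) assms(5) idr[OF assms(3)] idr[OF assms(4)]
    by metis
qed

end


section \<open>The opposite category\<close>

text \<open>Duality is used as a proof method: statements on deflations, kernels and pullbacks are
  read off from those on inflations, cokernels and pushouts in \<open>op_cat C\<close>. The Hom
  modules are reused unchanged, so the dual notions agree after unfolding and the simplifier can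
  translate.\<close>

definition op_cat :: "('k, 'o, 'm) ex_cat \<Rightarrow> ('k, 'o, 'm) ex_cat" where
  "op_cat C = \<lparr>Ob = Ob C, Hom = (\<lambda>X Y. Hom C Y X), Comp = (\<lambda>g f. f \<bullet>\<^bsub>C\<^esub> g), Id = Id C,
     Confl = (\<lambda>A i B p D. Confl C D p B i A)\<rparr>"

lemma op_cat_simps [simp]:
  "Ob (op_cat C) = Ob C" "Hom (op_cat C) X Y = Hom C Y X"
  "g \<bullet>\<^bsub>op_cat C\<^esub> f = f \<bullet>\<^bsub>C\<^esub> g" "Id (op_cat C) = Id C"
  "Confl (op_cat C) A i B p D = Confl C D p B i A"
  by (simp_all add: op_cat_def)

lemma arr_op [simp]: "arr (op_cat C) X Y = arr C Y X"
  by (auto simp: arr_def)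

lemma isos_op [simp]: "isos (op_cat C) X Y = isos C Y X"
  by (auto simp: isos_def)

lemma inflation_op [simp]: "inflation (op_cat C) A i B = deflation C B i A"
  by (auto simp: inflation_def deflation_def)

lemma deflation_op [simp]: "deflation (op_cat C) A i B = inflation C B i A"
  by (auto simp: inflation_def deflation_def)

lemma is_pushout_op [simp]: "is_pushout (op_cat C) A i B f A' j B' f' = is_pullback C B i A f A' j B' f'"
  by (auto simp: is_pushout_def is_pullback_def)

lemma is_pullback_op [simp]: "is_pullback (op_cat C) B i A f A' j B' f' = is_pushout C A i B f A' j B' f'"
  by (auto simp: is_pushout_def is_pullback_def)

lemma (in linear_category) linear_category_op: "linear_category K (op_cat C)"
proof (rule linear_category.intro)
  show "\<And>W X Y Z f g h. \<lbrakk>W \<in> Ob (op_cat C); X \<in> Ob (op_cat C); Y \<in> Ob (op_cat C);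
       Z \<in> Ob (op_cat C); f \<in> mor (op_cat C) W X; g \<in> mor (op_cat C) X Y; h \<in> mor (op_cat C) Y Z\<rbrakk>
       \<Longrightarrow> h \<bullet>\<^bsub>op_cat C\<^esub> (g \<bullet>\<^bsub>op_cat C\<^esub> f) = h \<bullet>\<^bsub>op_cat C\<^esub> g \<bullet>\<^bsub>op_cat C\<^esub> f"
    using Comp_assoc by simp
qed (use field_K Hom_module Id_mor Comp_mor Comp_Id Id_Comp Comp_linear_right Comp_linear_left in simp_all)

text \<open>The axioms are self-dual or come in dual pairs. Only closure of conflations under
  isomorphism is oriented, and there the reversal of arrows requires passing to the inverse
  isomorphisms.\<close>

lemma (in exact_category) exact_category_op: "exact_category K (op_cat C)"
proof -
  show ?thesis
  proof (rule exact_category.intro[OF linear_category_op], rule exact_category_axioms.intro)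
    show "\<exists>Z. zero_object (op_cat C) Z"
      using ex_zero_object by (auto simp: zero_object_def)
    show "\<exists>S i\<^sub>1 i\<^sub>2 p\<^sub>1 p\<^sub>2. biproduct (op_cat C) X Y S i\<^sub>1 i\<^sub>2 p\<^sub>1 p\<^sub>2"
      if XY: "X \<in> Ob (op_cat C)" "Y \<in> Ob (op_cat C)" for X Y
    proof -
      obtain S i1 i2 p1 p2 where "biproduct C X Y S i1 i2 p1 p2"
        using ex_biproduct[of X Y] XY by auto
      then have "biproduct (op_cat C) X Y S p1 p2 i1 i2"
        by (simp add: biproduct_def)
      then show ?thesis by blast
    qed
    show "Confl (op_cat C) A' i' B' p' D'"
      if h: "Confl (op_cat C) A i B p D" "A' \<in> Ob (op_cat C)" "B' \<in> Ob (op_cat C)" "D' \<in> Ob (op_cat C)"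
        "i' \<in> mor (op_cat C) A' B'" "p' \<in> mor (op_cat C) B' D'"
        "a \<in> isos (op_cat C) A A'" "b \<in> isos (op_cat C) B B'" "d \<in> isos (op_cat C) D D'"
        "b \<bullet>\<^bsub>op_cat C\<^esub> i = i' \<bullet>\<^bsub>op_cat C\<^esub> a" "d \<bullet>\<^bsub>op_cat C\<^esub> p = p' \<bullet>\<^bsub>op_cat C\<^esub> b"
      for A i B p D A' B' D' i' p' a b d
    proof -
      have conf: "Confl C D p B i A" using h by simp
      note cm = Confl_mor[OF conf]
      have ob: "A \<in> Ob C" "B \<in> Ob C" "D \<in> Ob C" "A' \<in> Ob C" "B' \<in> Ob C" "D' \<in> Ob C"
        using h cm by auto
      have ip: "i \<in> arr C B A" "p \<in> arr C D B" "i' \<in> arr C B' A'" "p' \<in> arr C D' B'"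
        using h cm ob by (auto simp: arr_def)
      have "a \<in> isos C A' A" using h by simp
      from isosE[OF this ob(4,1)] obtain a' where a: "a \<in> arr C A' A" "a' \<in> arr C A A'"
        "a' \<bullet> a = Id C A'" "a \<bullet> a' = Id C A" .
      have "b \<in> isos C B' B" using h by simp
      from isosE[OF this ob(5,2)] obtain b' where b: "b \<in> arr C B' B" "b' \<in> arr C B B'"
        "b' \<bullet> b = Id C B'" "b \<bullet> b' = Id C B" .
      have "d \<in> isos C D' D" using h by simp
      from isosE[OF this ob(6,3)] obtain d' where d: "d \<in> arr C D' D" "d' \<in> arr C D D'"
        "d' \<bullet> d = Id C D'" "d \<bullet> d' = Id C D" .
      have eq1: "i \<bullet> b = a \<bullet> i'" and eq2: "p \<bullet> d = b \<bullet> p'" using h by simp_all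
      \<comment> \<open>Read in \<open>C\<close>, the given squares run from the primed to the
        unprimed conflation; conjugating with the inverses turns them around.\<close>
      have e1: "a' \<bullet> i = i' \<bullet> b'"
        using assoc[OF b(2,1) ip(1)] assoc[OF comp[OF b(2,1)] ip(1) a(2)]
          assoc[OF b(2) ip(3) a(1)] assoc[OF comp[OF b(2) ip(3)] a(1,2)]
          assoc[OF b(2) ip(3) a(1)] eq1 b a idr[OF ip(1)] idl[OF comp[OF b(2) ip(3)]]
        by simp
      have e2: "b' \<bullet> p = p' \<bullet> d'"
        using assoc[OF d(2,1) ip(2)] assoc[OF comp[OF d(2,1)] ip(2) b(2)]
          assoc[OF d(2) ip(4) b(1)] assoc[OF comp[OF d(2) ip(4)] b(1,2)]
          assoc[OF d(2) ip(4) b(1)] eq2 b d idr[OF ip(2)] idl[OF comp[OF d(2) ip(4)]]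
        by simp
      have "Confl C D' p' B' i' A'"
        by (rule Confl_iso[OF conf ob(6,5,4) arr_mor[OF ip(4)] arr_mor[OF ip(3)] isosI[OF d(2,1,4,3)] isosI[OF b(2,1,4,3)]
              isosI[OF a(2,1,4,3)] e2 e1])
      then show ?thesis by simp
    qed
    show "A \<in> Ob (op_cat C) \<and> B \<in> Ob (op_cat C) \<and> D \<in> Ob (op_cat C) \<and>
        i \<in> mor (op_cat C) A B \<and> p \<in> mor (op_cat C) B D"
      and "is_kernel (op_cat C) A i B p D" and "is_cokernel (op_cat C) A i B p D"
      if "Confl (op_cat C) A i B p D" for A i B p D
      using that Confl_mor[of D p B i A] Confl_kernel[of D p B i A] Confl_cokernel[of D p B i A]
      by (simp_all add: is_kernel_def is_cokernel_def)
    show "inflation (op_cat C) X (Id (op_cat C) X) X" if "X \<in> Ob (op_cat C)" for X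
      using that Id_deflation by simp
    show "deflation (op_cat C) X (Id (op_cat C) X) X" if "X \<in> Ob (op_cat C)" for X
      using that Id_inflation by simp
    show "inflation (op_cat C) X (j \<bullet>\<^bsub>op_cat C\<^esub> i) Z"
      if "inflation (op_cat C) X i Y" "inflation (op_cat C) Y j Z" for X i Y j Z
      using that Comp_deflation by simp
    show "deflation (op_cat C) X (j \<bullet>\<^bsub>op_cat C\<^esub> i) Z"
      if "deflation (op_cat C) X i Y" "deflation (op_cat C) Y j Z" for X i Y j Z
      using that Comp_inflation by simp
    show "\<exists>j B' f'. is_pushout (op_cat C) A i B f A' j B' f' \<and> inflation (op_cat C) A' j B'"
      if "inflation (op_cat C) A i B" "A' \<in> Ob (op_cat C)" "f \<in> mor (op_cat C) A A'" for A i B A' f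
      using that pullback_deflation[of B i A A' f] by simp
    show "\<exists>q B' f'. is_pullback (op_cat C) B p D f D' q B' f' \<and> deflation (op_cat C) B' q D'"
      if "deflation (op_cat C) B p D" "D' \<in> Ob (op_cat C)" "f \<in> mor (op_cat C) D' D" for B p D D' f
      using that pushout_inflation[of D p B D' f] by simp
  qed
qed


section \<open>Morphisms of extensions\<close>

text \<open>A morphism of conflations with prescribed ends. The middle component stays existential
  because classes only see the ends. With identities at both ends this is the equivalence of
  extensions; with one identity it describes a pushout or a pullback.\<close>

definition ext_mor ::
  "('k, 'o, 'm) ex_cat \<Rightarrow> 'o \<Rightarrow> 'o \<Rightarrow> 'o \<Rightarrow> 'o \<Rightarrow> 'm \<Rightarrow> 'm \<Rightarrow> 'o \<times> 'm \<times> 'm \<Rightarrow> 'o \<times> 'm \<times> 'm \<Rightarrow> bool" where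
  "ext_mor C X Y X' Y' a b = (\<lambda>(E, i, p) (E', i', p').
     (E, i, p) \<in> exts C X Y \<and> (E', i', p') \<in> exts C X' Y' \<and>
     (\<exists>u\<in>arr C E E'. u \<bullet>\<^bsub>C\<^esub> i = i' \<bullet>\<^bsub>C\<^esub> b \<and> p' \<bullet>\<^bsub>C\<^esub> u = a \<bullet>\<^bsub>C\<^esub> p))"

lemma ext_mor_exts:
  assumes "ext_mor C X Y X' Y' a b e e'"
  shows "e \<in> exts C X Y" "e' \<in> exts C X' Y'"
  using assms by (auto simp: ext_mor_def split: prod.splits)

abbreviation ext_cls :: "('k, 'o, 'm) ex_cat \<Rightarrow> 'o \<Rightarrow> 'o \<Rightarrow> 'o \<times> 'm \<times> 'm \<Rightarrow> ('o, 'm) ext_class" where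
  "ext_cls C X Y e \<equiv> ext_equiv C X Y `` {e}"

section \<open>Pushouts and pullbacks\<close>

context linear_category
begin

lemma pushout_arr:
  assumes "is_pushout C A i B f A' j B' f'" "A' \<in> Ob C" "B \<in> Ob C"
  shows "j \<in> arr C A' B'" "f' \<in> arr C B B'" "f' \<bullet> i = j \<bullet> f"
  using assms by (auto simp: is_pushout_def arr_def)

lemma pushout_factor:
  assumes "is_pushout C A i B f A' j B' f'" "s \<in> arr C B T" "t \<in> arr C A' T" "s \<bullet> i = t \<bullet> f"
  obtains v where "v \<in> arr C B' T" "v \<bullet> f' = s" "v \<bullet> j = t"
proof -
  have *: "T \<in> Ob C" "s \<in> mor C B T" "t \<in> mor C A' T" "B' \<in> Ob C"
    using assms by (auto simp: arr_def is_pushout_def)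
  then have "\<exists>!u. u \<in> mor C B' T \<and> u \<bullet> f' = s \<and> u \<bullet> j = t"
    using assms(1,4) unfolding is_pushout_def by blast
  then show ?thesis using that * by (auto simp: arr_def)
qed

text \<open>The two legs of a pushout are jointly epic. Morphisms out of a pushout are compared in
  this way throughout.\<close>

lemma pushout_unique:
  assumes po: "is_pushout C A i B f A' j B' f'" and i: "i \<in> arr C A B" and f: "f \<in> arr C A A'"
    and v: "v \<in> arr C B' T" and w: "w \<in> arr C B' T" and "v \<bullet> f' = w \<bullet> f'" "v \<bullet> j = w \<bullet> j"
  shows "v = w"
proof -
  have arrs: "j \<in> arr C A' B'" "f' \<in> arr C B B'" "f' \<bullet> i = j \<bullet> f"
    using pushout_arr[OF po arr_cod[OF f] arr_cod[OF i]] .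
  have sq: "(v \<bullet> f') \<bullet> i = (v \<bullet> j) \<bullet> f"
    using assoc[OF i arrs(2) v] assoc[OF f arrs(1) v] arrs(3) by metis
  have "\<exists>!u. u \<in> mor C B' T \<and> u \<bullet> f' = v \<bullet> f' \<and> u \<bullet> j = v \<bullet> j"
    using po sq arr_mor[OF comp[OF arrs(2) v]] arr_mor[OF comp[OF arrs(1) v]] arr_cod[OF v]
    unfolding is_pushout_def by blast
  then show ?thesis using assms arr_mor[OF v] arr_mor[OF w] by metis
qed

end

lemma (in linear_category) pullback_arr:
  assumes "is_pullback C B p D f D' q B' f'" "D' \<in> Ob C" "B \<in> Ob C"
  shows "q \<in> arr C B' D'" "f' \<in> arr C B' B" "p \<bullet> f' = f \<bullet> q"
  using assms by (auto simp: is_pullback_def arr_def)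

lemma (in linear_category) pullback_factor:
  assumes "is_pullback C B p D f D' q B' f'" "s \<in> arr C T B" "t \<in> arr C T D'" "p \<bullet> s = f \<bullet> t"
  obtains v where "v \<in> arr C T B'" "f' \<bullet> v = s" "q \<bullet> v = t"
  using linear_category.pushout_factor[OF linear_category_op, of D p B f D' q B' f' s T t] assms by auto

lemma (in linear_category) pullback_unique:
  assumes "is_pullback C B p D f D' q B' f'" and "p \<in> arr C B D" and "f \<in> arr C D' D"
    and "v \<in> arr C T B'" and "w \<in> arr C T B'" and "f' \<bullet> v = f' \<bullet> w" "q \<bullet> v = q \<bullet> w"
  shows "v = w"
  using linear_category.pushout_unique[OF linear_category_op, of D p B f D' q B' f' v T w] assms by auto

section \<open>Conflations as kernel-cokernel pairs\<close>

context exact_category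
begin

lemma Confl_arr:
  assumes "Confl C A i B p D"
  shows "i \<in> arr C A B" "p \<in> arr C B D" "p \<bullet> i = \<zero>\<^bsub>Hom C A D\<^esub>"
  using Confl_mor[OF assms] Confl_kernel[OF assms] by (auto simp: arr_def is_kernel_def)

lemma kernel_lift:
  assumes "Confl C A i B p D" "f \<in> arr C T B" "p \<bullet> f = \<zero>\<^bsub>Hom C T D\<^esub>"
  obtains u where "u \<in> arr C T A" "i \<bullet> u = f"
proof -
  have *: "T \<in> Ob C" "f \<in> mor C T B" "A \<in> Ob C"
    using Confl_mor[OF assms(1)] assms(2) by (auto simp: arr_def)
  then have "\<exists>!u. u \<in> mor C T A \<and> i \<bullet> u = f"
    using Confl_kernel[OF assms(1)] assms(3) unfolding is_kernel_def by blast
  then show ?thesis using that * by (auto simp: arr_def)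
qed

lemma Confl_mono:
  assumes c: "Confl C A i B p D" and f: "f \<in> arr C T A" and g: "g \<in> arr C T A" and "i \<bullet> f = i \<bullet> g"
  shows "f = g"
proof -
  note a = Confl_arr[OF c]
  have "p \<bullet> (i \<bullet> f) = \<zero>\<^bsub>Hom C T D\<^esub>"
    using assoc[OF f a(1,2)] a(3) zero_comp[OF arr_cod[OF a(2)] f] by metis
  then have "\<exists>!u. u \<in> mor C T A \<and> i \<bullet> u = i \<bullet> f"
    using Confl_kernel[OF c] comp[OF f a(1)] by (auto simp: is_kernel_def arr_def)
  then show ?thesis using arr_mor[OF f] arr_mor[OF g] assms(4) by metis
qed

lemma cokernel_lift:
  assumes "Confl C A i B p D" "f \<in> arr C B T" "f \<bullet> i = \<zero>\<^bsub>Hom C A T\<^esub>"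
  obtains u where "u \<in> arr C D T" "u \<bullet> p = f"
  using exact_category.kernel_lift[OF exact_category_op, of D p B i A f T] assms by auto

lemma Confl_epi:
  assumes "Confl C A i B p D" "f \<in> arr C D T" "g \<in> arr C D T" "f \<bullet> p = g \<bullet> p"
  shows "f = g"
  using exact_category.Confl_mono[OF exact_category_op, of D p B i A f T g] assms by auto

text \<open>An inflation belongs to some conflation, whose deflation is another cokernel of
  \<open>i\<close>. The two cokernels are canonically isomorphic, and conflations are closed under
  isomorphism. This is how a sequence built by hand is recognised as admissible.\<close>

lemma Confl_of_cokernel:
  assumes inf: "inflation C A i B" and ck: "is_cokernel C A i B p D" and p: "p \<in> arr C B D"
  shows "Confl C A i B p D"
proof -
  from inf obtain p0 D0 where c: "Confl C A i B p0 D0" by (auto simp: inflation_def)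
  note a = Confl_arr[OF c]
  have pi: "p \<bullet> i = \<zero>\<^bsub>Hom C A D\<^esub>" using ck by (simp add: is_cokernel_def)
  from cokernel_lift[OF c p pi] obtain v where v: "v \<in> arr C D0 D" "v \<bullet> p0 = p" .
  have uni: "\<exists>!u. u \<in> mor C D T \<and> u \<bullet> p = f" if "f \<in> arr C B T" "f \<bullet> i = \<zero>\<^bsub>Hom C A T\<^esub>" for f T
    using ck that by (auto simp: is_cokernel_def arr_def)
  from uni[OF a(2,3)] obtain w where w: "w \<in> arr C D D0" "w \<bullet> p = p0"
    using p a by (auto simp: arr_def)
  have "w \<bullet> v = Id C D0"
    by (rule Confl_epi[OF c comp[OF v(1) w(1)] Id_arr[OF arr_cod[OF a(2)]]])
       (use assoc[OF a(2) v(1) w(1)] v w idl[OF a(2)] in metis)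
  moreover have "v \<bullet> w = Id C D"
  proof -
    have "(v \<bullet> w) \<bullet> p = p" "Id C D \<bullet> p = p"
      using assoc[OF p w(1) v(1)] v w idl[OF p] by metis+
    then show ?thesis using uni[OF p pi] comp[OF w(1) v(1)] Id_arr[OF arr_cod[OF p]] arr_mor by metis
  qed
  ultimately have "v \<in> isos C D0 D" using isosI[OF v(1) w(1)] by blast
  then show ?thesis
    using Confl_iso[OF c arr_dom[OF a(1)] arr_cod[OF a(1)] arr_cod[OF p] arr_mor[OF a(1)] arr_mor[OF p]
        Id_isos[OF arr_dom[OF a(1)]] Id_isos[OF arr_cod[OF a(1)]]] v(2) idl[OF a(1)] idr[OF a(1)] idr[OF p]
    by simp
qed

section \<open>Pushing out and pulling back extensions\<close>

lemma exts_arr: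
  assumes "(E, i, p) \<in> exts C X Y"
  shows "Confl C Y i E p X" "i \<in> arr C Y E" "p \<in> arr C E X" "p \<bullet> i = \<zero>\<^bsub>Hom C Y X\<^esub>"
    "X \<in> Ob C" "Y \<in> Ob C" "E \<in> Ob C"
  using assms Confl_arr[of Y i E p X] Confl_mor[of Y i E p X] by (auto simp: exts_def)

lemma exts_Ob: assumes "e \<in> exts C X Y" shows "X \<in> Ob C" "Y \<in> Ob C"
proof -
  obtain E i p where "e = (E, i, p)" by (metis prod_cases3)
  then show "X \<in> Ob C" "Y \<in> Ob C" using assms exts_arr(5,6) by blast+
qed

text \<open>The axiom only provides the pushout and the inflation \<open>i'\<close>. The deflation
  is the map that is \<open>p\<close> on \<open>E\<close> and zero on \<open>Y'\<close>; it is a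
  cokernel because a map out of \<open>E'\<close> that kills \<open>i'\<close> restricts to a map
  out of \<open>E\<close> that kills \<open>i\<close>, hence factors over \<open>X\<close>.\<close>

lemma push_exists:
  assumes e: "(E, i, p) \<in> exts C X Y" and b: "b \<in> arr C Y Y'"
  obtains E' i' p' u where "(E', i', p') \<in> exts C X Y'" "is_pushout C Y i E b Y' i' E' u"
    "u \<in> arr C E E'" "u \<bullet> i = i' \<bullet> b" "p' \<bullet> u = p"
proof -
  note a = exts_arr[OF e]
  have "inflation C Y i E" using a(1) by (auto simp: inflation_def)
  from pushout_inflation[OF this arr_cod[OF b] arr_mor[OF b]] obtain j E' u
    where po: "is_pushout C Y i E b Y' j E' u" and j: "inflation C Y' j E'" by blast
  note u = pushout_arr[OF po arr_cod[OF b] a(7)]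
  have "p \<bullet> i = \<zero>\<^bsub>Hom C Y' X\<^esub> \<bullet> b" using a(4) zero_comp[OF a(5) b] by simp
  from pushout_factor[OF po a(3) zero_arr[OF arr_cod[OF b] a(5)] this] obtain p'
    where p': "p' \<in> arr C E' X" "p' \<bullet> u = p" "p' \<bullet> j = \<zero>\<^bsub>Hom C Y' X\<^esub>" .
  have "is_cokernel C Y' j E' p' X"
    unfolding is_cokernel_def
  proof (intro conjI ballI impI)
    show "p' \<bullet> j = \<zero>\<^bsub>Hom C Y' X\<^esub>" by fact
    fix T f assume T: "T \<in> Ob C" and "f \<in> mor C E' T" and fj: "f \<bullet> j = \<zero>\<^bsub>Hom C Y' T\<^esub>"
    then have f: "f \<in> arr C E' T" using u by (auto simp: arr_def)
    have "(f \<bullet> u) \<bullet> i = \<zero>\<^bsub>Hom C Y T\<^esub>"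
      using assoc[OF a(2) u(2) f] assoc[OF b u(1) f] u(3) fj zero_comp[OF T b] by metis
    from cokernel_lift[OF a(1) comp[OF u(2) f] this] obtain v
      where v: "v \<in> arr C X T" "v \<bullet> p = f \<bullet> u" .
    have "v \<bullet> p' = f"
    proof (rule pushout_unique[OF po a(2) b comp[OF p'(1) v(1)] f])
      show "(v \<bullet> p') \<bullet> u = f \<bullet> u" using assoc[OF u(2) p'(1) v(1)] v p' by metis
      show "(v \<bullet> p') \<bullet> j = f \<bullet> j"
        using assoc[OF u(1) p'(1) v(1)] p'(3) fj comp_zero[OF arr_dom[OF u(1)] v(1)] by metis
    qed
    moreover have "w = v" if w: "w \<in> mor C X T" "w \<bullet> p' = f" for w
    proof (rule Confl_epi[OF a(1) _ v(1)])
      show w': "w \<in> arr C X T" using w T a by (auto simp: arr_def)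
      show "w \<bullet> p = v \<bullet> p" using assoc[OF u(2) p'(1) w'] w v p' by metis
    qed
    ultimately show "\<exists>!w. w \<in> mor C X T \<and> w \<bullet> p' = f" using arr_mor[OF v(1)] by metis
  qed
  from Confl_of_cokernel[OF j this p'(1)] have "(E', j, p') \<in> exts C X Y'" by (simp add: exts_def)
  then show ?thesis using that po u p' by blast
qed

lemma exts_op: "(E, i, p) \<in> exts (op_cat C) X Y \<longleftrightarrow> (E, p, i) \<in> exts C Y X"
  by (simp add: exts_def)

text \<open>The dual of \<open>push_exists\<close>; in the opposite category the two ends of an
  extension trade places.\<close>

lemma pull_exists:
  assumes "(E, i, p) \<in> exts C X Y" and "a \<in> arr C X' X"
  obtains E' i' p' u where "(E', i', p') \<in> exts C X' Y" "u \<in> arr C E' E" "u \<bullet> i' = i" "p \<bullet> u = a \<bullet> p'"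
proof -
  have "(E, p, i) \<in> exts (op_cat C) Y X" "a \<in> arr (op_cat C) X X'"
    using assms by (simp_all add: exts_op)
  from exact_category.push_exists[OF exact_category_op this] obtain E' i' p' u
    where "(E', p', i') \<in> exts (op_cat C) Y X'" "u \<in> arr (op_cat C) E E'" "u \<bullet>\<^bsub>op_cat C\<^esub> p = p' \<bullet>\<^bsub>op_cat C\<^esub> a"
      "i' \<bullet>\<^bsub>op_cat C\<^esub> u = i" .
  then show ?thesis using that[of E' i' p' u] by (simp add: exts_op)
qed

text \<open>
  Pulling \<open>p\<close> back along \<open>p'\<close> makes the difference of \<open>q'\<close> and \<open>u q\<close> factor through \<open>i'\<close>, and the
  factorisation splits the pulled back conflation.
\<close>

lemma ext_mor_right_inverse:
  assumes e: "(E, i, p) \<in> exts C X Y" and e': "(E', i', p') \<in> exts C X Y"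
    and u: "u \<in> arr C E E'" "u \<bullet> i = i'" "p' \<bullet> u = p"
  obtains v where "v \<in> arr C E' E" "u \<bullet> v = Id C E'" "v \<bullet> i' = i" "p \<bullet> v = p'"
proof -
  note a = exts_arr[OF e] and a' = exts_arr[OF e']
  from pull_exists[OF e a'(3)] obtain Q l q' q where Q: "(Q, l, q') \<in> exts C E' Y"
    and q: "q \<in> arr C Q E" "q \<bullet> l = i" "p \<bullet> q = p' \<bullet> q'" .
  note aQ = exts_arr[OF Q]
  let ?d = "(u \<bullet> q) \<ominus>\<^bsub>Hom C Q E'\<^esub> q'"
  have uq: "u \<bullet> q \<in> arr C Q E'" using comp[OF q(1) u(1)] .
  have d: "?d \<in> arr C Q E'" using minus_arr[OF uq aQ(3)] .
  have "p' \<bullet> (u \<bullet> q) = p' \<bullet> q'" using assoc[OF q(1) u(1) a'(3)] q u by metis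
  then have "p' \<bullet> ?d = \<zero>\<^bsub>Hom C Q X\<^esub>"
    using comp_minus[OF uq aQ(3) a'(3)] minus_self[OF comp[OF aQ(3) a'(3)]] by simp
  from kernel_lift[OF a'(1) d this] obtain \<rho> where \<rho>: "\<rho> \<in> arr C Q Y" "i' \<bullet> \<rho> = ?d" .
  have dl: "?d \<bullet> l = i'"
  proof -
    have "(u \<bullet> q) \<bullet> l = i'" using assoc[OF aQ(2) q(1) u(1)] q u by metis
    then show ?thesis using minus_comp[OF aQ(2) uq aQ(3)] aQ(4) minus_zero[OF a'(2)] by simp
  qed
  have \<rho>l: "\<rho> \<bullet> l = Id C Y"
    by (rule Confl_mono[OF a'(1) comp[OF aQ(2) \<rho>(1)] Id_arr[OF a(6)]])
       (use assoc[OF aQ(2) \<rho>(1) a'(2)] \<rho>(2) dl idr[OF a'(2)] in metis)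
  \<comment> \<open>\<open>l \<bullet> \<rho>\<close> is idempotent because
    \<open>\<rho> \<bullet> l\<close> is the identity. Its complement kills \<open>l\<close>, so it
    descends along \<open>q'\<close> to a section \<sigma> of \<open>q'\<close> for which
    \<open>\<rho> \<bullet> \<sigma>\<close> is zero.\<close>
  let ?\<pi> = "Id C Q \<ominus>\<^bsub>Hom C Q Q\<^esub> (l \<bullet> \<rho>)"
  have l\<rho>: "l \<bullet> \<rho> \<in> arr C Q Q" using comp[OF \<rho>(1) aQ(2)] .
  have idQ: "Id C Q \<in> arr C Q Q" using Id_arr[OF aQ(7)] .
  have \<pi>: "?\<pi> \<in> arr C Q Q" using minus_arr[OF idQ l\<rho>] .
  have "(l \<bullet> \<rho>) \<bullet> l = l" using assoc[OF aQ(2) \<rho>(1) aQ(2)] \<rho>l idr[OF aQ(2)] by metis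
  then have "?\<pi> \<bullet> l = \<zero>\<^bsub>Hom C Y Q\<^esub>"
    using minus_comp[OF aQ(2) idQ l\<rho>] idl[OF aQ(2)] minus_self[OF aQ(2)] by simp
  from cokernel_lift[OF aQ(1) \<pi> this] obtain \<sigma> where \<sigma>: "\<sigma> \<in> arr C E' Q" "\<sigma> \<bullet> q' = ?\<pi>" .
  have "q' \<bullet> (l \<bullet> \<rho>) = \<zero>\<^bsub>Hom C Q E'\<^esub>"
    using assoc[OF \<rho>(1) aQ(2) aQ(3)] aQ(4) zero_comp[OF aQ(5) \<rho>(1)] by metis
  then have "q' \<bullet> ?\<pi> = q'"
    using comp_minus[OF idQ l\<rho> aQ(3)] idr[OF aQ(3)] minus_zero[OF aQ(3)] by simp
  then have q\<sigma>: "q' \<bullet> \<sigma> = Id C E'"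
    using Confl_epi[OF aQ(1) comp[OF \<sigma>(1) aQ(3)] Id_arr[OF aQ(5)]]
      assoc[OF aQ(3) \<sigma>(1) aQ(3)] \<sigma>(2) idl[OF aQ(3)] by metis
  have "\<rho> \<bullet> (l \<bullet> \<rho>) = \<rho>" using assoc[OF \<rho>(1) aQ(2) \<rho>(1)] \<rho>l idl[OF \<rho>(1)] by metis
  then have "\<rho> \<bullet> ?\<pi> = \<zero>\<^bsub>Hom C Q Y\<^esub>"
    using comp_minus[OF idQ l\<rho> \<rho>(1)] idr[OF \<rho>(1)] minus_self[OF \<rho>(1)] by simp
  then have \<rho>\<sigma>: "\<rho> \<bullet> \<sigma> = \<zero>\<^bsub>Hom C E' Y\<^esub>"
    using Confl_epi[OF aQ(1) comp[OF \<sigma>(1) \<rho>(1)] zero_arr[OF aQ(5) a(6)]]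
      assoc[OF aQ(3) \<sigma>(1) \<rho>(1)] \<sigma>(2) zero_comp[OF a(6) aQ(3)] by metis
  \<comment> \<open>After \<sigma> the difference vanishes, so \<open>u \<bullet> q\<close> agrees
    there with \<open>q'\<close>, which \<sigma> splits. Therefore
    \<open>q \<bullet> \<sigma>\<close> is a right inverse of \<open>u\<close>.\<close>
  have "?d \<bullet> \<sigma> = \<zero>\<^bsub>Hom C E' E'\<^esub>"
    using assoc[OF \<sigma>(1) \<rho>(1) a'(2)] \<rho>(2) \<rho>\<sigma> comp_zero[OF aQ(5) a'(2)] by metis
  moreover have "?d \<bullet> \<sigma> = ((u \<bullet> q) \<bullet> \<sigma>) \<ominus>\<^bsub>Hom C E' E'\<^esub> (q' \<bullet> \<sigma>)"
    using minus_comp[OF \<sigma>(1) uq aQ(3)] .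
  ultimately have "(u \<bullet> q) \<bullet> \<sigma> = q' \<bullet> \<sigma>"
    using minus_eq_zero_iff[OF comp[OF \<sigma>(1) uq] comp[OF \<sigma>(1) aQ(3)]] by simp
  then have uv: "u \<bullet> (q \<bullet> \<sigma>) = Id C E'"
    using assoc[OF \<sigma>(1) q(1) u(1)] q\<sigma> by metis
  define v where "v = q \<bullet> \<sigma>"
  have v: "v \<in> arr C E' E" using comp[OF \<sigma>(1) q(1)] by (simp add: v_def)
  have pv: "p \<bullet> v = p'"
    using assoc[OF \<sigma>(1) q(1) a(3)] assoc[OF \<sigma>(1) aQ(3) a'(3)] q(3) q\<sigma> idr[OF a'(3)] v_def by metis
  \<comment> \<open>It remains to see that \<open>v\<close> respects the inflations:
    \<open>v \<bullet> i'\<close> factors as \<open>i \<bullet> s\<close>, and applying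
    \<open>u\<close> gives \<open>i' \<bullet> s = i'\<close>, so \<open>s\<close> is the
    identity.\<close>
  have "p \<bullet> (v \<bullet> i') = \<zero>\<^bsub>Hom C Y X\<^esub>" using assoc[OF a'(2) v a(3)] pv a'(4) by metis
  from kernel_lift[OF a(1) comp[OF a'(2) v] this] obtain s where s: "s \<in> arr C Y Y" "i \<bullet> s = v \<bullet> i'" .
  have "i' \<bullet> s = i' \<bullet> Id C Y"
    using assoc[OF s(1) a(2) u(1)] assoc[OF a'(2) v u(1)] s(2) u(2) uv v_def idl[OF a'(2)] idr[OF a'(2)]
    by metis
  then have "s = Id C Y" using Confl_mono[OF a'(1) s(1) Id_arr[OF a(6)]] by blast
  then have "v \<bullet> i' = i" using s(2) idr[OF a(2)] by metis
  then show ?thesis using that v uv pv v_def by blast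
qed

text \<open>The short five lemma. The right inverse is again a morphism of extensions with
  identities at the ends, so it has a right inverse in turn, and this one has to be
  \<open>u\<close>.\<close>

lemma ext_mor_iso:
  assumes e: "(E, i, p) \<in> exts C X Y" and e': "(E', i', p') \<in> exts C X Y"
    and u: "u \<in> arr C E E'" "u \<bullet> i = i'" "p' \<bullet> u = p"
  obtains v where "v \<in> arr C E' E" "u \<bullet> v = Id C E'" "v \<bullet> u = Id C E" "v \<bullet> i' = i" "p \<bullet> v = p'"
proof -
  from ext_mor_right_inverse[OF assms] obtain v
    where v: "v \<in> arr C E' E" "u \<bullet> v = Id C E'" "v \<bullet> i' = i" "p \<bullet> v = p'" .
  from ext_mor_right_inverse[OF e' e v(1,3,4)] obtain w where w: "w \<in> arr C E E'" "v \<bullet> w = Id C E" .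
  have "u = w" using assoc[OF w(1) v(1) u(1)] v w idl[OF w(1)] idr[OF u(1)] by metis
  then show ?thesis using that v w by blast
qed

section \<open>Equivalence of extensions\<close>

lemma ext_mor_comp:
  assumes "ext_mor C X Y X' Y' a b e e'" "ext_mor C X' Y' X'' Y'' a' b' e' e''"
    and a: "a \<in> arr C X X'" and b: "b \<in> arr C Y Y'" and a': "a' \<in> arr C X' X''" and b': "b' \<in> arr C Y' Y''"
  shows "ext_mor C X Y X'' Y'' (a' \<bullet> a) (b' \<bullet> b) e e''"
proof -
  obtain E i p E' i' p' E'' i'' p'' where es: "e = (E, i, p)" "e' = (E', i', p')" "e'' = (E'', i'', p'')"
    by (metis prod_cases3)
  from assms obtain u u' where u: "u \<in> arr C E E'" "u \<bullet> i = i' \<bullet> b" "p' \<bullet> u = a \<bullet> p"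
    and u': "u' \<in> arr C E' E''" "u' \<bullet> i' = i'' \<bullet> b'" "p'' \<bullet> u' = a' \<bullet> p'"
    and ex: "(E, i, p) \<in> exts C X Y" "(E', i', p') \<in> exts C X' Y'" "(E'', i'', p'') \<in> exts C X'' Y''"
    by (auto simp: ext_mor_def es)
  note a1 = exts_arr[OF ex(1)] and a2 = exts_arr[OF ex(2)] and a3 = exts_arr[OF ex(3)]
  have "(u' \<bullet> u) \<bullet> i = i'' \<bullet> (b' \<bullet> b)"
    using assoc[OF a1(2) u(1) u'(1)] assoc[OF b a2(2) u'(1)] assoc[OF b b' a3(2)] u u' by metis
  moreover have "p'' \<bullet> (u' \<bullet> u) = (a' \<bullet> a) \<bullet> p"
    using assoc[OF u(1) u'(1) a3(3)] assoc[OF u(1) a2(3) a'] assoc[OF a1(3) a a'] u u' by metis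
  ultimately show ?thesis using comp[OF u(1) u'(1)] ex by (auto simp: ext_mor_def es)
qed

lemma ext_mor_refl: assumes "e \<in> exts C X Y" shows "ext_mor C X Y X Y (Id C X) (Id C Y) e e"
proof -
  obtain E i p where e: "e = (E, i, p)" by (metis prod_cases3)
  note a = exts_arr[OF assms[unfolded e]]
  show ?thesis using assms Id_arr[OF a(7)] idl[OF a(2)] idr[OF a(2)] idl[OF a(3)] idr[OF a(3)]
    by (auto simp: ext_mor_def e)
qed

lemma ext_mor_Id_iff:
  "ext_mor C X Y X Y (Id C X) (Id C Y) (E, i, p) (E', i', p') \<longleftrightarrow>
    (E, i, p) \<in> exts C X Y \<and> (E', i', p') \<in> exts C X Y \<and>
     (\<exists>u\<in>arr C E E'. u \<bullet> i = i' \<and> p' \<bullet> u = p)"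
  using exts_arr(2)[THEN idr, of E' i' p' X Y] exts_arr(3)[THEN idl, of E i p X Y]
  by (auto simp: ext_mor_def)

lemma ext_mor_sym:
  assumes "ext_mor C X Y X Y (Id C X) (Id C Y) e e'" shows "ext_mor C X Y X Y (Id C X) (Id C Y) e' e"
proof -
  obtain E i p E' i' p' where es: "e = (E, i, p)" "e' = (E', i', p')" by (metis prod_cases3)
  from assms obtain u where ex: "(E, i, p) \<in> exts C X Y" "(E', i', p') \<in> exts C X Y"
    and u: "u \<in> arr C E E'" "u \<bullet> i = i'" "p' \<bullet> u = p" by (auto simp: es ext_mor_Id_iff)
  from ext_mor_right_inverse[OF ex u] show ?thesis using ex by (auto simp: es ext_mor_Id_iff)
qed

lemma ext_equiv_iff: "(e, e') \<in> ext_equiv C X Y \<longleftrightarrow> ext_mor C X Y X Y (Id C X) (Id C Y) e e'"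
proof -
  obtain E i p E' i' p' where es: "e = (E, i, p)" "e' = (E', i', p')" by (metis prod_cases3)
  show ?thesis unfolding es ext_mor_Id_iff ext_equiv_def
    using exts_arr(7)[of E i p X Y] exts_arr(7)[of E' i' p' X Y] by (auto simp: arr_def)
qed

lemma mem_ext_cls: "e' \<in> ext_cls C X Y e \<longleftrightarrow> ext_mor C X Y X Y (Id C X) (Id C Y) e e'"
  by (simp add: ext_equiv_iff)

text \<open>Reflexivity and transitivity come from identities and composition of morphisms; symmetry
  is the short five lemma.\<close>

lemma equiv_ext_equiv: "equiv (exts C X Y) (ext_equiv C X Y)"
proof (rule equivI)
  show "ext_equiv C X Y \<subseteq> exts C X Y \<times> exts C X Y" by (auto simp: ext_equiv_def)
  show "refl_on (exts C X Y) (ext_equiv C X Y)"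
    by (auto simp: refl_on_def ext_equiv_iff ext_mor_refl)
  show "sym (ext_equiv C X Y)" by (auto intro!: symI simp: ext_equiv_iff ext_mor_sym)
  show "trans (ext_equiv C X Y)"
  proof (rule transI, unfold ext_equiv_iff)
    fix e e' e''
    assume 1: "ext_mor C X Y X Y (Id C X) (Id C Y) e e'" and 2: "ext_mor C X Y X Y (Id C X) (Id C Y) e' e''"
    have "X \<in> Ob C" "Y \<in> Ob C" using exts_Ob ext_mor_exts(1)[OF 1] by blast+
    then show "ext_mor C X Y X Y (Id C X) (Id C Y) e e''"
      using ext_mor_comp[OF 1 2] Id_arr idl[OF Id_arr] by metis
  qed
qed

lemma ext_cls_eq: "ext_mor C X Y X Y (Id C X) (Id C Y) e e' \<Longrightarrow> ext_cls C X Y e = ext_cls C X Y e'"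
  using equiv_class_eq[OF equiv_ext_equiv] by (simp add: ext_equiv_iff)

lemma ext_cls_self: "e \<in> exts C X Y \<Longrightarrow> e \<in> ext_cls C X Y e"
  by (simp add: ext_equiv_iff ext_mor_refl)

lemma ext_cls_carrier: "e \<in> exts C X Y \<Longrightarrow> ext_cls C X Y e \<in> carrier (Ext C X Y)"
  by (simp add: Ext_def quotientI)

lemma ExtE:
  assumes "\<xi> \<in> carrier (Ext C X Y)" obtains e where "e \<in> exts C X Y" "\<xi> = ext_cls C X Y e"
  using assms by (auto simp: Ext_def elim: quotientE)

lemma Ext_mem_cls:
  assumes "\<xi> \<in> carrier (Ext C X Y)" "e \<in> \<xi>" shows "\<xi> = ext_cls C X Y e" "e \<in> exts C X Y"
proof -
  obtain e0 where "e0 \<in> exts C X Y" "\<xi> = ext_cls C X Y e0" using ExtE[OF assms(1)] .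
  then have *: "ext_mor C X Y X Y (Id C X) (Id C Y) e0 e" and **: "\<xi> = ext_cls C X Y e0"
    using assms by (simp_all add: ext_equiv_iff)
  show "\<xi> = ext_cls C X Y e" using ext_cls_eq[OF *] ** by simp
  show "e \<in> exts C X Y" using ext_mor_exts(2)[OF *] .
qed

section \<open>Universality of pushouts and pullbacks of extensions\<close>

lemma push_mor_exists:
  assumes "e \<in> exts C X Y" "b \<in> arr C Y Y'"
  obtains e' where "ext_mor C X Y X Y' (Id C X) b e e'"
proof -
  obtain E i p where e: "e = (E, i, p)" by (metis prod_cases3)
  from push_exists[OF assms[unfolded e]] obtain E' i' p' u where
    "(E', i', p') \<in> exts C X Y'" "u \<in> arr C E E'" "u \<bullet> i = i' \<bullet> b" "p' \<bullet> u = p" by metis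
  then have "ext_mor C X Y X Y' (Id C X) b e (E', i', p')"
    using assms exts_arr(3)[OF assms(1)[unfolded e], THEN idl] by (auto simp: ext_mor_def e)
  then show ?thesis using that by blast
qed

text \<open>Among the morphisms that leave \<open>e\<close> with \<open>b\<close> on the subobject,
  the one to a pushout is universal: the pushout property supplies the middle component, and
  compatibility with the deflations is tested on its legs. The extension \<open>e0\<close> is first
  identified with a constructed pushout.\<close>

lemma ext_mor_factor_push:
  assumes m: "ext_mor C X Y X' Y' a b e e'" and m0: "ext_mor C X Y X Y' (Id C X) b e e0"
    and a: "a \<in> arr C X X'" and b: "b \<in> arr C Y Y'"
  shows "ext_mor C X Y' X' Y' a (Id C Y') e0 e'"
proof -
  obtain E i p where e: "e = (E, i, p)" by (metis prod_cases3)
  have ex: "(E, i, p) \<in> exts C X Y" using ext_mor_exts(1)[OF m] by (simp add: e)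
  note x = exts_arr[OF ex]
  from push_exists[OF ex b] obtain E1 i1 p1 u1 where e1: "(E1, i1, p1) \<in> exts C X Y'"
    and po: "is_pushout C Y i E b Y' i1 E1 u1"
    and u1: "u1 \<in> arr C E E1" "u1 \<bullet> i = i1 \<bullet> b" "p1 \<bullet> u1 = p" .
  note x1 = exts_arr[OF e1]
  \<comment> \<open>Stated for an arbitrary target because it serves twice: for \<open>e'\<close>,
    and for \<open>e0\<close>, where inverting the result identifies \<open>e0\<close> with the
    constructed pushout.\<close>
  have factor: "ext_mor C X Y' X'' Y' a (Id C Y') (E1, i1, p1) e'"
    if m: "ext_mor C X Y X'' Y' a b e e'" and a: "a \<in> arr C X X''" for e' a X''
  proof -
    obtain E' i' p' where e': "e' = (E', i', p')" by (metis prod_cases3)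
    from m obtain u where ex': "(E', i', p') \<in> exts C X'' Y'"
      and u: "u \<in> arr C E E'" "u \<bullet> i = i' \<bullet> b" "p' \<bullet> u = a \<bullet> p" by (auto simp: ext_mor_def e e')
    note x' = exts_arr[OF ex']
    from pushout_factor[OF po u(1) x'(2) u(2)] obtain v
      where v: "v \<in> arr C E1 E'" "v \<bullet> u1 = u" "v \<bullet> i1 = i'" .
    have "p' \<bullet> v = a \<bullet> p1"
    proof (rule pushout_unique[OF po x(2) b comp[OF v(1) x'(3)] comp[OF x1(3) a]])
      show "(p' \<bullet> v) \<bullet> u1 = (a \<bullet> p1) \<bullet> u1"
        using assoc[OF u1(1) v(1) x'(3)] assoc[OF u1(1) x1(3) a] v u u1 by metis
      show "(p' \<bullet> v) \<bullet> i1 = (a \<bullet> p1) \<bullet> i1"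
        using assoc[OF x1(2) v(1) x'(3)] assoc[OF x1(2) x1(3) a] v x'(4) x1(4)
          comp_zero[OF x1(6) a] by metis
    qed
    then show ?thesis using v ex' e1 idr[OF x'(2)] by (auto simp: ext_mor_def e')
  qed
  have "ext_mor C X Y' X Y' (Id C X) (Id C Y') e0 (E1, i1, p1)"
    using ext_mor_sym[OF factor[OF m0 Id_arr[OF x(5)]]] .
  from ext_mor_comp[OF this factor[OF m a] Id_arr[OF x(5)] Id_arr[OF x1(6)] a Id_arr[OF x1(6)]]
  show ?thesis using idr[OF a] idl[OF Id_arr[OF x1(6)]] by simp
qed

text \<open>The comparison map from a constructed pushout to \<open>E'\<close> is an isomorphism by
  the short five lemma and carries the universal property over. The hypotheses survive an exact
  functor, so such pushouts are preserved by translation with a group element.\<close>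

lemma ext_mor_pushout:
  assumes ex: "(E, i, p) \<in> exts C X Y" and ex': "(E', i', p') \<in> exts C X Y'" and b: "b \<in> arr C Y Y'"
    and u: "u \<in> arr C E E'" "u \<bullet> i = i' \<bullet> b" "p' \<bullet> u = p"
  shows "is_pushout C Y i E b Y' i' E' u"
proof -
  note x = exts_arr[OF ex] and x' = exts_arr[OF ex']
  from push_exists[OF ex b] obtain E1 i1 p1 u1 where e1: "(E1, i1, p1) \<in> exts C X Y'"
    and po: "is_pushout C Y i E b Y' i1 E1 u1"
    and u1: "u1 \<in> arr C E E1" "u1 \<bullet> i = i1 \<bullet> b" "p1 \<bullet> u1 = p" .
  note x1 = exts_arr[OF e1]
  from pushout_factor[OF po u(1) x'(2) u(2)] obtain v
    where v: "v \<in> arr C E1 E'" "v \<bullet> u1 = u" "v \<bullet> i1 = i'" .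
  have pv: "p' \<bullet> v = p1"
  proof (rule pushout_unique[OF po x(2) b comp[OF v(1) x'(3)] x1(3)])
    show "(p' \<bullet> v) \<bullet> u1 = p1 \<bullet> u1" using assoc[OF u1(1) v(1) x'(3)] v u u1 by metis
    show "(p' \<bullet> v) \<bullet> i1 = p1 \<bullet> i1" using assoc[OF x1(2) v(1) x'(3)] v x'(4) x1(4) by metis
  qed
  from ext_mor_iso[OF e1 ex' v(1,3) pv] obtain w where w: "w \<in> arr C E' E1" "v \<bullet> w = Id C E'"
    "w \<bullet> v = Id C E1" "w \<bullet> i' = i1" .
  have wu: "w \<bullet> u = u1" using assoc[OF u1(1) v(1) w(1)] v w idl[OF u1(1)] by metis
  show ?thesis unfolding is_pushout_def
  proof (intro conjI ballI impI)
    show "E' \<in> Ob C" "i' \<in> mor C Y' E'" "u \<in> mor C E E'" "u \<bullet> i = i' \<bullet> b"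
      using u x' by (auto simp: arr_def)
    fix T s t assume T: "T \<in> Ob C" and "s \<in> mor C E T" "t \<in> mor C Y' T" and st: "s \<bullet> i = t \<bullet> b"
    then have s: "s \<in> arr C E T" and t: "t \<in> arr C Y' T" using x x' by (auto simp: arr_def)
    from pushout_factor[OF po s t st] obtain r where r: "r \<in> arr C E1 T" "r \<bullet> u1 = s" "r \<bullet> i1 = t" .
    have "(r \<bullet> w) \<bullet> u = s" "(r \<bullet> w) \<bullet> i' = t"
      using assoc[OF u(1) w(1) r(1)] assoc[OF x'(2) w(1) r(1)] wu w(4) r by metis+
    moreover have "z = r \<bullet> w" if z: "z \<in> mor C E' T" "z \<bullet> u = s" "z \<bullet> i' = t" for z
    proof -
      have z': "z \<in> arr C E' T" using z T x' by (auto simp: arr_def)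
      have "z \<bullet> v = r"
      proof (rule pushout_unique[OF po x(2) b comp[OF v(1) z'] r(1)])
        show "(z \<bullet> v) \<bullet> u1 = r \<bullet> u1" using assoc[OF u1(1) v(1) z'] v z r by metis
        show "(z \<bullet> v) \<bullet> i1 = r \<bullet> i1" using assoc[OF x1(2) v(1) z'] v z r by metis
      qed
      then show ?thesis using assoc[OF w(1) v(1) z'] w(2) idr[OF z'] by metis
    qed
    ultimately show "\<exists>!z. z \<in> mor C E' T \<and> z \<bullet> u = s \<and> z \<bullet> i' = t"
      using arr_mor[OF comp[OF w(1) r(1)]] by metis
  qed
qed

end

lemma ext_mor_op:
  "ext_mor (op_cat C) X Y X' Y' a b (E, i, p) (E', i', p') \<longleftrightarrow> ext_mor C Y' X' Y X b a (E', p', i') (E, p, i)"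
  by (auto simp: ext_mor_def exts_def)

context exact_category
begin

lemma pull_mor_exists:
  assumes "e \<in> exts C X Y" "a \<in> arr C X' X"
  obtains e' where "ext_mor C X' Y X Y a (Id C Y) e' e"
proof -
  obtain E i p where e: "e = (E, i, p)" by (metis prod_cases3)
  have "(E, p, i) \<in> exts (op_cat C) Y X" "a \<in> arr (op_cat C) X X'"
    using assms by (simp_all add: exts_op e)
  from exact_category.push_mor_exists[OF exact_category_op this] obtain e'
    where "ext_mor (op_cat C) Y X Y X' (Id (op_cat C) Y) a (E, p, i) e'" .
  then show ?thesis using that by (cases e') (auto simp: ext_mor_op e)
qed

lemma ext_mor_factor_pull:
  assumes "ext_mor C X Y X' Y' a b e e'" and "ext_mor C X Y' X' Y' a (Id C Y') e0 e'"
    and "a \<in> arr C X X'" and "b \<in> arr C Y Y'"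
  shows "ext_mor C X Y X Y' (Id C X) b e e0"
proof -
  obtain E i p E' i' p' E0 i0 p0 where es: "e = (E, i, p)" "e' = (E', i', p')" "e0 = (E0, i0, p0)"
    by (metis prod_cases3)
  show ?thesis
    using exact_category.ext_mor_factor_push[OF exact_category_op, of Y' X' Y X b a "(E', p', i')" "(E, p, i)" "(E0, p0, i0)"]
      assms by (simp add: es ext_mor_op)
qed

section \<open>Ext as a bifunctor\<close>

text \<open>\<open>ext_push\<close> collects everything that receives a suitable morphism from any
  member of the class. Composing with equivalences shows that this set contains the class of
  \<open>e0\<close>; universality of the pushout shows that it contains nothing else.\<close>

lemma ext_push_cls:
  assumes m: "ext_mor C X Y X Y' (Id C X) b e e0" and b: "b \<in> arr C Y Y'"
  shows "ext_push C X Y' b (ext_cls C X Y e) = ext_cls C X Y' e0"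
proof -
  note X = exts_Ob[OF ext_mor_exts(1)[OF m]]
  note I = Id_arr[OF X(1)] Id_arr[OF X(2)] Id_arr[OF arr_cod[OF b]]
  have "e' \<in> ext_push C X Y' b (ext_cls C X Y e) \<longleftrightarrow>
     (\<exists>e1. ext_mor C X Y X Y (Id C X) (Id C Y) e e1 \<and> ext_mor C X Y X Y' (Id C X) b e1 e')" for e'
  proof -
    have "(\<exists>u\<in>mor C E E'. u \<bullet> i = i' \<bullet> b \<and> p' \<bullet> u = p) \<longleftrightarrow> (\<exists>u\<in>arr C E E'. u \<bullet> i = i' \<bullet> b \<and> p' \<bullet> u = Id C X \<bullet> p)"
      if "(E, i, p) \<in> exts C X Y" "(E', i', p') \<in> exts C X Y'" for E i p E' i' p'
      using exts_arr(3,7)[OF that(1)] exts_arr(7)[OF that(2)] idl[of p E X] by (auto simp: arr_def)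
    then show ?thesis
      using ext_mor_exts(2)[of C X Y X Y "Id C X" "Id C Y" e]
      unfolding ext_push_def ext_mor_def[of C X Y X Y' "Id C X" b] Image_singleton ext_equiv_iff mem_Collect_eq
      by (cases e') (simp, blast)
  qed
  also have "\<dots> e' \<longleftrightarrow> e' \<in> ext_cls C X Y' e0" for e'
  proof
    assume "\<exists>e1. ext_mor C X Y X Y (Id C X) (Id C Y) e e1 \<and> ext_mor C X Y X Y' (Id C X) b e1 e'"
    then obtain e1 where 1: "ext_mor C X Y X Y (Id C X) (Id C Y) e e1" and 2: "ext_mor C X Y X Y' (Id C X) b e1 e'"
      by blast
    have "ext_mor C X Y X Y' (Id C X) b e e'"
      using ext_mor_comp[OF 1 2 I(1,2) I(1) b] idr[OF b] idl[OF I(1)] by simp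
    from ext_mor_factor_push[OF this m I(1) b] show "e' \<in> ext_cls C X Y' e0" by (simp add: ext_equiv_iff)
  next
    assume "e' \<in> ext_cls C X Y' e0"
    then have "ext_mor C X Y' X Y' (Id C X) (Id C Y') e0 e'" by (simp add: ext_equiv_iff)
    from ext_mor_comp[OF m this I(1) b I(1) I(3)] have "ext_mor C X Y X Y' (Id C X) b e e'"
      using idl[OF b] idl[OF I(1)] by simp
    then show "\<exists>e1. ext_mor C X Y X Y (Id C X) (Id C Y) e e1 \<and> ext_mor C X Y X Y' (Id C X) b e1 e'"
      using ext_mor_refl[OF ext_mor_exts(1)[OF m]] by blast
  qed
  finally show ?thesis by blast
qed

text \<open>Dual in content to \<open>ext_push_cls\<close>. A pullback maps to the members of the
  class, so equivalences are traversed backwards here, which their symmetry allows.\<close>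

lemma ext_pull_cls:
  assumes m: "ext_mor C X' Y X Y a (Id C Y) e0 e" and a: "a \<in> arr C X' X"
  shows "ext_pull C X' Y a (ext_cls C X Y e) = ext_cls C X' Y e0"
proof -
  note X = exts_Ob[OF ext_mor_exts(2)[OF m]]
  note I = Id_arr[OF X(1)] Id_arr[OF X(2)] Id_arr[OF arr_dom[OF a]]
  have "e' \<in> ext_pull C X' Y a (ext_cls C X Y e) \<longleftrightarrow>
     (\<exists>e1. ext_mor C X Y X Y (Id C X) (Id C Y) e e1 \<and> ext_mor C X' Y X Y a (Id C Y) e' e1)" for e'
  proof -
    have "(\<exists>u\<in>mor C E' E. u \<bullet> i' = i \<and> p \<bullet> u = a \<bullet> p') \<longleftrightarrow> (\<exists>u\<in>arr C E' E. u \<bullet> i' = i \<bullet> Id C Y \<and> p \<bullet> u = a \<bullet> p')"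
      if "(E, i, p) \<in> exts C X Y" "(E', i', p') \<in> exts C X' Y" for E i p E' i' p'
      using exts_arr(2,7)[OF that(1)] exts_arr(7)[OF that(2)] idr[of i Y E] by (auto simp: arr_def)
    then show ?thesis
      using ext_mor_exts(2)[of C X Y X Y "Id C X" "Id C Y" e]
      unfolding ext_pull_def ext_mor_def[of C X' Y X Y a "Id C Y"] Image_singleton ext_equiv_iff mem_Collect_eq
      by (cases e') (simp, blast)
  qed
  also have "\<dots> e' \<longleftrightarrow> e' \<in> ext_cls C X' Y e0" for e'
  proof
    assume "\<exists>e1. ext_mor C X Y X Y (Id C X) (Id C Y) e e1 \<and> ext_mor C X' Y X Y a (Id C Y) e' e1"
    then obtain e1 where 1: "ext_mor C X Y X Y (Id C X) (Id C Y) e e1" and 2: "ext_mor C X' Y X Y a (Id C Y) e' e1"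
      by blast
    have "ext_mor C X' Y X Y a (Id C Y) e' e"
      using ext_mor_comp[OF 2 ext_mor_sym[OF 1] a I(2) I(1,2)] idl[OF a] idl[OF I(2)] by simp
    from ext_mor_factor_pull[OF this m a I(2)] have "ext_mor C X' Y X' Y (Id C X') (Id C Y) e' e0" .
    from ext_mor_sym[OF this] show "e' \<in> ext_cls C X' Y e0" by (simp add: ext_equiv_iff)
  next
    assume "e' \<in> ext_cls C X' Y e0"
    then have "ext_mor C X' Y X' Y (Id C X') (Id C Y) e0 e'" by (simp add: ext_equiv_iff)
    from ext_mor_comp[OF ext_mor_sym[OF this] m I(3,2) a I(2)] have "ext_mor C X' Y X Y a (Id C Y) e' e"
      using idr[OF a] idl[OF I(2)] by simp
    then show "\<exists>e1. ext_mor C X Y X Y (Id C X) (Id C Y) e e1 \<and> ext_mor C X' Y X Y a (Id C Y) e' e1"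
      using ext_mor_refl[OF ext_mor_exts(2)[OF m]] by blast
  qed
  finally show ?thesis by blast
qed

lemma ext_map_cls:
  assumes "ext_mor C X Y X Y' (Id C X) b e e1" "ext_mor C X' Y' X Y' a (Id C Y') e2 e1"
    and "a \<in> arr C X' X" "b \<in> arr C Y Y'"
  shows "ext_map C X X' Y' a b (ext_cls C X Y e) = ext_cls C X' Y' e2"
  using ext_push_cls[OF assms(1,4)] ext_pull_cls[OF assms(2,3)] by (simp add: ext_map_def)

lemma ext_map_rep:
  assumes "e \<in> exts C X Y" "a \<in> arr C X' X" "b \<in> arr C Y Y'"
  obtains e1 e2 where "ext_mor C X Y X Y' (Id C X) b e e1" "ext_mor C X' Y' X Y' a (Id C Y') e2 e1"
    "ext_map C X X' Y' a b (ext_cls C X Y e) = ext_cls C X' Y' e2"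
proof -
  from push_mor_exists[OF assms(1,3)] obtain e1 where e1: "ext_mor C X Y X Y' (Id C X) b e e1" .
  from pull_mor_exists[OF ext_mor_exts(2)[OF e1] assms(2)] obtain e2
    where e2: "ext_mor C X' Y' X Y' a (Id C Y') e2 e1" .
  show ?thesis using that[OF e1 e2 ext_map_cls[OF e1 e2 assms(2,3)]] .
qed

lemma ext_map_closed:
  assumes "\<xi> \<in> carrier (Ext C X Y)" "a \<in> arr C X' X" "b \<in> arr C Y Y'"
  shows "ext_map C X X' Y' a b \<xi> \<in> carrier (Ext C X' Y')"
proof -
  from ExtE[OF assms(1)] obtain e where e: "e \<in> exts C X Y" "\<xi> = ext_cls C X Y e" .
  from ext_map_rep[OF e(1) assms(2,3)] show ?thesis using e ext_mor_exts ext_cls_carrier by metis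
qed

text \<open>A morphism of extensions identifies the pushout of its source along \<open>t\<close>
  with the pullback of its target along \<open>s\<close>. After both are pushed out to
  \<open>Y'\<close> the morphism factors through the two pushouts, so a pullback of the first along
  \<open>a1\<close> is a pullback of the second along \<open>s \<bullet> a1\<close>. Functoriality
  in both variables and the interchange of pushing and pulling are instances.\<close>

lemma ext_map_square:
  assumes m: "ext_mor C X1 Y1 X2 Y2 s t e1 e2" and s: "s \<in> arr C X1 X2" and t: "t \<in> arr C Y1 Y2"
    and a1: "a1 \<in> arr C X' X1" and b2: "b2 \<in> arr C Y2 Y'"
  shows "ext_map C X1 X' Y' a1 (b2 \<bullet> t) (ext_cls C X1 Y1 e1) = ext_map C X2 X' Y' (s \<bullet> a1) b2 (ext_cls C X2 Y2 e2)"
proof -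
  note I = Id_arr[OF arr_dom[OF s]] Id_arr[OF arr_cod[OF s]] Id_arr[OF arr_cod[OF b2]]
  have b1: "b2 \<bullet> t \<in> arr C Y1 Y'" using comp[OF t b2] .
  from ext_map_rep[OF ext_mor_exts(1)[OF m] a1 b1] obtain m1 t1 where
    1: "ext_mor C X1 Y1 X1 Y' (Id C X1) (b2 \<bullet> t) e1 m1" "ext_mor C X' Y' X1 Y' a1 (Id C Y') t1 m1"
    "ext_map C X1 X' Y' a1 (b2 \<bullet> t) (ext_cls C X1 Y1 e1) = ext_cls C X' Y' t1" .
  from push_mor_exists[OF ext_mor_exts(2)[OF m] b2] obtain m2 where
    m2: "ext_mor C X2 Y2 X2 Y' (Id C X2) b2 e2 m2" .
  have "ext_mor C X1 Y1 X2 Y' s (b2 \<bullet> t) e1 m2"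
    using ext_mor_comp[OF m m2 s t I(2) b2] idl[OF s] by simp
  from ext_mor_factor_push[OF this 1(1) s b1] have "ext_mor C X1 Y' X2 Y' s (Id C Y') m1 m2" .
  from ext_mor_comp[OF 1(2) this a1 I(3) s I(3)] have "ext_mor C X' Y' X2 Y' (s \<bullet> a1) (Id C Y') t1 m2"
    using idl[OF I(3)] by simp
  from ext_map_cls[OF m2 this comp[OF a1 s] b2] show ?thesis using 1(3) by simp
qed

text \<open>Two squares suffice: the inner class is reached by a pushout from \<open>e\<close> to
  \<open>m1\<close> and a pullback from \<open>t1\<close> to \<open>m1\<close>, and each of these
  morphisms absorbs one of \<open>a\<close> and \<open>b\<close> into the outer map.\<close>

lemma ext_map_comp:
  assumes \<xi>: "\<xi> \<in> carrier (Ext C X Y)" and a: "a \<in> arr C X' X" and b: "b \<in> arr C Y Y'"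
    and a': "a' \<in> arr C X'' X'" and b': "b' \<in> arr C Y' Y''"
  shows "ext_map C X' X'' Y'' a' b' (ext_map C X X' Y' a b \<xi>) = ext_map C X X'' Y'' (a \<bullet> a') (b' \<bullet> b) \<xi>"
proof -
  from ExtE[OF \<xi>] obtain e where e: "e \<in> exts C X Y" "\<xi> = ext_cls C X Y e" .
  note I = Id_arr[OF arr_cod[OF a]] Id_arr[OF arr_cod[OF b]]
  from ext_map_rep[OF e(1) a b] obtain m1 t1 where
    1: "ext_mor C X Y X Y' (Id C X) b e m1" "ext_mor C X' Y' X Y' a (Id C Y') t1 m1"
    "ext_map C X X' Y' a b \<xi> = ext_cls C X' Y' t1" unfolding e(2) by metis
  have "ext_map C X' X'' Y'' a' b' (ext_cls C X' Y' t1) = ext_map C X X'' Y'' (a \<bullet> a') b' (ext_cls C X Y' m1)"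
    using ext_map_square[OF 1(2) a I(2) a' b'] idr[OF b'] by simp
  also have "\<dots> = ext_map C X X'' Y'' (a \<bullet> a') (b' \<bullet> b) (ext_cls C X Y e)"
    using ext_map_square[OF 1(1) I(1) b comp[OF a' a] b'] idl[OF comp[OF a' a]] by simp
  finally show ?thesis using 1(3) e by simp
qed

lemma ext_map_Id:
  assumes "\<xi> \<in> carrier (Ext C X Y)" shows "ext_map C X X Y (Id C X) (Id C Y) \<xi> = \<xi>"
proof -
  from ExtE[OF assms] obtain e where e: "e \<in> exts C X Y" "\<xi> = ext_cls C X Y e" .
  note X = exts_Ob[OF e(1)]
  show ?thesis using ext_map_cls[OF ext_mor_refl[OF e(1)] ext_mor_refl[OF e(1)] Id_arr[OF X(1)] Id_arr[OF X(2)]] e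
    by simp
qed

lemma ext_push_eq_map:
  assumes "\<xi> \<in> carrier (Ext C X Y)" and b: "b \<in> arr C Y Y'"
  shows "ext_push C X Y' b \<xi> = ext_map C X X Y' (Id C X) b \<xi>"
proof -
  from ExtE[OF assms(1)] obtain e where e: "e \<in> exts C X Y" "\<xi> = ext_cls C X Y e" .
  from push_mor_exists[OF e(1) b] obtain e1 where e1: "ext_mor C X Y X Y' (Id C X) b e e1" .
  note I = Id_arr[OF exts_Ob(1)[OF e(1)]]
  show ?thesis using ext_map_cls[OF e1 ext_mor_refl[OF ext_mor_exts(2)[OF e1]] I b] ext_push_cls[OF e1 b] e by simp
qed

text \<open>With \<open>a \<bullet> a'\<close> the identity, one side of
  \<open>ext_map_square\<close> collapses to the class of the target, so no pullback has to be
  formed. In this form the group action, which contains inverses of structure maps, is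
  computed.\<close>

lemma ext_map_iso:
  assumes m: "ext_mor C X Y X' Y' a b e e'" and a: "a \<in> arr C X X'" and a': "a' \<in> arr C X' X"
    and inv: "a \<bullet> a' = Id C X'" and b: "b \<in> arr C Y Y'"
  shows "ext_map C X X' Y' a' b (ext_cls C X Y e) = ext_cls C X' Y' e'"
proof -
  have e': "e' \<in> exts C X' Y'" using ext_mor_exts(2)[OF m] .
  note X = exts_Ob[OF e']
  show ?thesis using ext_map_square[OF m a b a' Id_arr[OF X(2)]] idl[OF b] inv
     ext_map_Id[OF ext_cls_carrier[OF e']] by simp
qed

end


section \<open>Direct sums and the Baer sum\<close>

lemma biproduct_swap:
  assumes L: "linear_category K C" and b: "biproduct C X Y S i1 i2 p1 p2" and X: "X \<in> Ob C" "Y \<in> Ob C"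
  shows "biproduct C Y X S i2 i1 p2 p1"
proof -
  interpret linear_category K C by fact
  have "i1 \<bullet>\<^bsub>C\<^esub> p1 \<in> arr C S S" "i2 \<bullet>\<^bsub>C\<^esub> p2 \<in> arr C S S"
    using b X comp[of p1 S X i1 S] comp[of p2 S Y i2 S] by (auto simp: biproduct_def arr_def)
  from add_commute[OF this] show ?thesis using b by (simp add: biproduct_def)
qed

section \<open>Calculus of biproducts\<close>

context linear_category
begin

lemma biproduct_arr:
  assumes "biproduct C X Y S i1 i2 p1 p2" "X \<in> Ob C" "Y \<in> Ob C"
  shows "i1 \<in> arr C X S" "i2 \<in> arr C Y S" "p1 \<in> arr C S X" "p2 \<in> arr C S Y"
    "p1 \<bullet> i1 = Id C X" "p2 \<bullet> i2 = Id C Y" "p2 \<bullet> i1 = \<zero>\<^bsub>Hom C X Y\<^esub>" "p1 \<bullet> i2 = \<zero>\<^bsub>Hom C Y X\<^esub>"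
    "(i1 \<bullet> p1) \<oplus>\<^bsub>Hom C S S\<^esub> (i2 \<bullet> p2) = Id C S"
  using assms by (auto simp: biproduct_def arr_def)

lemma biproduct_epi:
  assumes b: "biproduct C X Y S i1 i2 p1 p2" and X: "X \<in> Ob C" "Y \<in> Ob C"
    and v: "v \<in> arr C S T" and w: "w \<in> arr C S T" and eq: "v \<bullet> i1 = w \<bullet> i1" "v \<bullet> i2 = w \<bullet> i2"
  shows "v = w"
proof -
  note a = biproduct_arr[OF b X]
  have "z = ((z \<bullet> i1) \<bullet> p1) \<oplus>\<^bsub>Hom C S T\<^esub> ((z \<bullet> i2) \<bullet> p2)" if z: "z \<in> arr C S T" for z
    using comp_add[OF comp[OF a(3,1)] comp[OF a(4,2)] z] a(9) idr[OF z]
      assoc[OF a(3,1) z] assoc[OF a(4,2) z] by metis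
  from this[OF v] this[OF w] eq show ?thesis by metis
qed

lemma biproduct_mono:
  assumes b: "biproduct C X Y S i1 i2 p1 p2" and X: "X \<in> Ob C" "Y \<in> Ob C"
    and v: "v \<in> arr C T S" and w: "w \<in> arr C T S" and eq: "p1 \<bullet> v = p1 \<bullet> w" "p2 \<bullet> v = p2 \<bullet> w"
  shows "v = w"
proof -
  note a = biproduct_arr[OF b X]
  have "z = (i1 \<bullet> (p1 \<bullet> z)) \<oplus>\<^bsub>Hom C T S\<^esub> (i2 \<bullet> (p2 \<bullet> z))" if z: "z \<in> arr C T S" for z
    using add_comp[OF z comp[OF a(3,1)] comp[OF a(4,2)]] a(9) idl[OF z]
      assoc[OF z a(3,1)] assoc[OF z a(4,2)] by metis
  from this[OF v] this[OF w] eq show ?thesis by metis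
qed

lemma biproduct_copair:
  assumes b: "biproduct C X Y S i1 i2 p1 p2" and f: "f \<in> arr C X T" and g: "g \<in> arr C Y T"
  shows "(f \<bullet> p1) \<oplus>\<^bsub>Hom C S T\<^esub> (g \<bullet> p2) \<in> arr C S T"
    "((f \<bullet> p1) \<oplus>\<^bsub>Hom C S T\<^esub> (g \<bullet> p2)) \<bullet> i1 = f"
    "((f \<bullet> p1) \<oplus>\<^bsub>Hom C S T\<^esub> (g \<bullet> p2)) \<bullet> i2 = g"
proof -
  note X = arr_dom[OF f] arr_dom[OF g]
  note a = biproduct_arr[OF b X]
  note fp = comp[OF a(3) f] and gp = comp[OF a(4) g]
  show "(f \<bullet> p1) \<oplus>\<^bsub>Hom C S T\<^esub> (g \<bullet> p2) \<in> arr C S T" using add_arr[OF fp gp] .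
  have 1: "(f \<bullet> p1) \<bullet> i1 = f" "(g \<bullet> p2) \<bullet> i1 = \<zero>\<^bsub>Hom C X T\<^esub>"
    using assoc[OF a(1,3) f] assoc[OF a(1,4) g] a idr[OF f] comp_zero[OF X(1) g] by metis+
  show "((f \<bullet> p1) \<oplus>\<^bsub>Hom C S T\<^esub> (g \<bullet> p2)) \<bullet> i1 = f"
    using add_comp[OF a(1) fp gp] 1 add_zero[OF f] by simp
  have 2: "(f \<bullet> p1) \<bullet> i2 = \<zero>\<^bsub>Hom C Y T\<^esub>" "(g \<bullet> p2) \<bullet> i2 = g"
    using assoc[OF a(2,3) f] assoc[OF a(2,4) g] a idr[OF g] comp_zero[OF X(2) f] by metis+
  show "((f \<bullet> p1) \<oplus>\<^bsub>Hom C S T\<^esub> (g \<bullet> p2)) \<bullet> i2 = g"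
    using add_comp[OF a(2) fp gp] 2 zero_add[OF g] by simp
qed

lemma biproduct_pair:
  assumes b: "biproduct C X Y S i1 i2 p1 p2" and f: "f \<in> arr C T X" and g: "g \<in> arr C T Y"
  shows "(i1 \<bullet> f) \<oplus>\<^bsub>Hom C T S\<^esub> (i2 \<bullet> g) \<in> arr C T S"
    "p1 \<bullet> ((i1 \<bullet> f) \<oplus>\<^bsub>Hom C T S\<^esub> (i2 \<bullet> g)) = f"
    "p2 \<bullet> ((i1 \<bullet> f) \<oplus>\<^bsub>Hom C T S\<^esub> (i2 \<bullet> g)) = g"
proof -
  have b': "biproduct (op_cat C) X Y S p1 p2 i1 i2" using b by (simp add: biproduct_def)
  from linear_category.biproduct_copair[OF linear_category_op b', of f T g] f g
  show "(i1 \<bullet> f) \<oplus>\<^bsub>Hom C T S\<^esub> (i2 \<bullet> g) \<in> arr C T S"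
    "p1 \<bullet> ((i1 \<bullet> f) \<oplus>\<^bsub>Hom C T S\<^esub> (i2 \<bullet> g)) = f"
    "p2 \<bullet> ((i1 \<bullet> f) \<oplus>\<^bsub>Hom C T S\<^esub> (i2 \<bullet> g)) = g" by simp_all
qed

lemma biproduct_diagonal:
  assumes b: "biproduct C X X S i1 i2 p1 p2" and X: "X \<in> Ob C"
  shows "i1 \<oplus>\<^bsub>Hom C X S\<^esub> i2 \<in> arr C X S" "p1 \<oplus>\<^bsub>Hom C S X\<^esub> p2 \<in> arr C S X"
    "(p1 \<oplus>\<^bsub>Hom C S X\<^esub> p2) \<bullet> i1 = Id C X" "(p1 \<oplus>\<^bsub>Hom C S X\<^esub> p2) \<bullet> i2 = Id C X"
proof -
  note a = biproduct_arr(1-4)[OF b X X]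
  show "i1 \<oplus>\<^bsub>Hom C X S\<^esub> i2 \<in> arr C X S" "p1 \<oplus>\<^bsub>Hom C S X\<^esub> p2 \<in> arr C S X"
    "(p1 \<oplus>\<^bsub>Hom C S X\<^esub> p2) \<bullet> i1 = Id C X" "(p1 \<oplus>\<^bsub>Hom C S X\<^esub> p2) \<bullet> i2 = Id C X"
    using biproduct_copair[OF b Id_arr[OF X] Id_arr[OF X]] add_arr[OF a(1,2)] idl[OF a(3)] idl[OF a(4)]
    by simp_all
qed

end

text \<open>The direct sum of two morphisms. Only the projections of the source and the injections
  of the target enter, and the bracketing is that of \<open>baer_sum\<close>, so the two expressions
  coincide on unfolding.\<close>

definition biprod_map ::
  "('k, 'o, 'm) ex_cat \<Rightarrow> 'o \<Rightarrow> 'm \<Rightarrow> 'm \<Rightarrow> 'o \<Rightarrow> 'm \<Rightarrow> 'm \<Rightarrow> 'm \<Rightarrow> 'm \<Rightarrow> 'm" where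
  "biprod_map C S p1 p2 S' i1' i2' f g =
     (i1' \<bullet>\<^bsub>C\<^esub> f \<bullet>\<^bsub>C\<^esub> p1) \<oplus>\<^bsub>Hom C S S'\<^esub> (i2' \<bullet>\<^bsub>C\<^esub> g \<bullet>\<^bsub>C\<^esub> p2)"

lemma mem_baer_sum:
  "t \<in> baer_sum C X Y \<xi> \<xi>' \<longleftrightarrow> (\<exists>E i p E' i' p' XX j\<^sub>1 j\<^sub>2 q\<^sub>1 q\<^sub>2 YY k\<^sub>1 k\<^sub>2 r\<^sub>1 r\<^sub>2 EE l\<^sub>1 l\<^sub>2 s\<^sub>1 s\<^sub>2.
      (E, i, p) \<in> \<xi> \<and> (E', i', p') \<in> \<xi>' \<and>
      biproduct C X X XX j\<^sub>1 j\<^sub>2 q\<^sub>1 q\<^sub>2 \<and> biproduct C Y Y YY k\<^sub>1 k\<^sub>2 r\<^sub>1 r\<^sub>2 \<and> biproduct C E E' EE l\<^sub>1 l\<^sub>2 s\<^sub>1 s\<^sub>2 \<and>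
      t \<in> ext_map C XX X Y (j\<^sub>1 \<oplus>\<^bsub>Hom C X XX\<^esub> j\<^sub>2) (r\<^sub>1 \<oplus>\<^bsub>Hom C YY Y\<^esub> r\<^sub>2)
        (ext_cls C XX YY (EE, biprod_map C YY r\<^sub>1 r\<^sub>2 EE l\<^sub>1 l\<^sub>2 i i', biprod_map C EE s\<^sub>1 s\<^sub>2 XX j\<^sub>1 j\<^sub>2 p p')))"
  unfolding baer_sum_def biprod_map_def by (simp add: Bex_def split_paired_Ex)

lemma (in linear_category) biprod_map:
  assumes b: "biproduct C X Y S i1 i2 p1 p2" and b': "biproduct C X' Y' S' i1' i2' p1' p2'"
    and f: "f \<in> arr C X X'" and g: "g \<in> arr C Y Y'"
  shows "biprod_map C S p1 p2 S' i1' i2' f g \<in> arr C S S'"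
    "biprod_map C S p1 p2 S' i1' i2' f g \<bullet> i1 = i1' \<bullet> f"
    "biprod_map C S p1 p2 S' i1' i2' f g \<bullet> i2 = i2' \<bullet> g"
proof -
  note a' = biproduct_arr[OF b' arr_cod[OF f] arr_cod[OF g]]
  show "biprod_map C S p1 p2 S' i1' i2' f g \<in> arr C S S'"
    "biprod_map C S p1 p2 S' i1' i2' f g \<bullet> i1 = i1' \<bullet> f"
    "biprod_map C S p1 p2 S' i1' i2' f g \<bullet> i2 = i2' \<bullet> g"
    using biproduct_copair[OF b comp[OF f a'(1)] comp[OF g a'(2)]] by (simp_all add: biprod_map_def)
qed

section \<open>Direct sums of conflations\<close>

context exact_category
begin

text \<open>The axiom makes one pushout of an inflation an inflation; any other pushout is
  isomorphic to it under \<open>A'\<close>, and conflations are closed under isomorphism.\<close>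

lemma pushout_inflation':
  assumes inf: "inflation C A i B" and po: "is_pushout C A i B f A' j B' u" and f: "f \<in> arr C A A'"
  shows "inflation C A' j B'"
proof -
  have i: "i \<in> arr C A B" using inf Confl_arr by (auto simp: inflation_def)
  note a = pushout_arr[OF po arr_cod[OF f] arr_cod[OF i]]
  from pushout_inflation[OF inf arr_cod[OF f] arr_mor[OF f]] obtain j0 B0 u0
    where po0: "is_pushout C A i B f A' j0 B0 u0" and inf0: "inflation C A' j0 B0" by blast
  note a0 = pushout_arr[OF po0 arr_cod[OF f] arr_cod[OF i]]
  from inf0 obtain p D where c: "Confl C A' j0 B0 p D" by (auto simp: inflation_def)
  note ac = Confl_arr[OF c]
  from pushout_factor[OF po0 a(2,1,3)] obtain v where v: "v \<in> arr C B0 B'" "v \<bullet> u0 = u" "v \<bullet> j0 = j" .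
  from pushout_factor[OF po a0(2,1,3)] obtain w where w: "w \<in> arr C B' B0" "w \<bullet> u = u0" "w \<bullet> j = j0" .
  have "v \<bullet> w = Id C B'"
    by (rule pushout_unique[OF po i f comp[OF w(1) v(1)] Id_arr[OF arr_cod[OF a(1)]]])
       (use assoc[OF a(1) w(1) v(1)] assoc[OF a(2) w(1) v(1)] v w idl[OF a(1)] idl[OF a(2)] in metis)+
  moreover have "w \<bullet> v = Id C B0"
    by (rule pushout_unique[OF po0 i f comp[OF v(1) w(1)] Id_arr[OF arr_cod[OF a0(1)]]])
       (use assoc[OF a0(1) v(1) w(1)] assoc[OF a0(2) v(1) w(1)] v w idl[OF a0(1)] idl[OF a0(2)] in metis)+
  ultimately have wv: "w \<bullet> v = Id C B0" and iso: "v \<in> isos C B0 B'" using isosI[OF v(1) w(1)] by blast+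
  have "Confl C A' j B' (p \<bullet> w) D"
  proof (rule Confl_iso[OF c arr_dom[OF a(1)] arr_cod[OF a(1)] arr_cod[OF ac(2)] arr_mor[OF a(1)] arr_mor[OF comp[OF w(1) ac(2)]]
        Id_isos[OF arr_dom[OF a(1)]] iso Id_isos[OF arr_cod[OF ac(2)]]])
    show "v \<bullet> j0 = j \<bullet> Id C A'" using v idr[OF a(1)] by simp
    show "Id C D \<bullet> p = (p \<bullet> w) \<bullet> v"
      using assoc[OF v(1) w(1) ac(2)] wv idl[OF ac(2)] idr[OF ac(2)] by metis
  qed
  then show ?thesis by (auto simp: inflation_def)
qed

text \<open>Adding an identity summand to \<open>i\<close> amounts to pushing \<open>i\<close> out
  along the injection \<open>k1\<close>, so inflations are stable under it.\<close>

lemma biproduct_inflation: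
  assumes inf: "inflation C Y i E" and b: "biproduct C Y Z S k1 k2 r1 r2" and b': "biproduct C E Z M m1 m2 n1 n2"
    and Z: "Z \<in> Ob C" and h: "h \<in> arr C S M" "h \<bullet> k1 = m1 \<bullet> i" "h \<bullet> k2 = m2"
  shows "inflation C S h M"
proof -
  have i: "i \<in> arr C Y E" using inf Confl_arr by (auto simp: inflation_def)
  note a = biproduct_arr[OF b arr_dom[OF i] Z] and a' = biproduct_arr[OF b' arr_cod[OF i] Z]
  have "is_pushout C Y i E k1 S h M m1"
    unfolding is_pushout_def
  proof (intro conjI ballI impI)
    show "M \<in> Ob C" "h \<in> mor C S M" "m1 \<in> mor C E M" "m1 \<bullet> i = h \<bullet> k1"
      using h a' by (auto simp: arr_def)
    fix T s t assume T: "T \<in> Ob C" and "s \<in> mor C E T" "t \<in> mor C S T" and st: "s \<bullet> i = t \<bullet> k1"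
    then have s: "s \<in> arr C E T" and t: "t \<in> arr C S T" using i h by (auto simp: arr_def)
    let ?u = "(s \<bullet> n1) \<oplus>\<^bsub>Hom C M T\<^esub> ((t \<bullet> k2) \<bullet> n2)"
    note u = biproduct_copair[OF b' s comp[OF a(2) t]]
    have "?u \<bullet> h = t"
      by (rule biproduct_epi[OF b arr_dom[OF i] Z comp[OF h(1) u(1)] t])
         (use assoc[OF a(1) h(1) u(1)] assoc[OF i a'(1) u(1)] assoc[OF a(2) h(1) u(1)] h u(2,3) st in metis)+
    moreover have "w = ?u" if w: "w \<in> mor C M T" "w \<bullet> m1 = s" "w \<bullet> h = t" for w
    proof -
      have w': "w \<in> arr C M T" using w T h by (auto simp: arr_def)
      show ?thesis
        by (rule biproduct_epi[OF b' arr_cod[OF i] Z w' u(1)])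
           (use w u(2,3) h assoc[OF a(2) h(1) w'] in metis)+
    qed
    ultimately show "\<exists>!w. w \<in> mor C M T \<and> w \<bullet> m1 = s \<and> w \<bullet> h = t" using arr_mor[OF u(1)] u(2) by metis
  qed
  then show ?thesis using pushout_inflation'[OF inf _ a(1)] by blast
qed

text \<open>The sum of two inflations is \<open>i\<close> plus an identity followed by an identity
  plus \<open>i'\<close>; both factors are inflations, and inflations compose. That the sum of the
  deflations is a cokernel is checked on the summands.\<close>

lemma direct_sum_exts:
  assumes e: "(E, i, p) \<in> exts C X Y" and e': "(E', i', p') \<in> exts C X' Y'"
    and bX: "biproduct C X X' XX j1 j2 q1 q2" and bY: "biproduct C Y Y' YY k1 k2 r1 r2"
    and bE: "biproduct C E E' EE l1 l2 s1 s2"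
  shows "(EE, biprod_map C YY r1 r2 EE l1 l2 i i', biprod_map C EE s1 s2 XX j1 j2 p p') \<in> exts C XX YY"
proof -
  note x = exts_arr[OF e] and x' = exts_arr[OF e']
  let ?I = "biprod_map C YY r1 r2 EE l1 l2 i i'" and ?P = "biprod_map C EE s1 s2 XX j1 j2 p p'"
  note aX = biproduct_arr[OF bX x(5) x'(5)] and aY = biproduct_arr[OF bY x(6) x'(6)]
    and aE = biproduct_arr[OF bE x(7) x'(7)]
  note I = biprod_map[OF bY bE x(2) x'(2)] and P = biprod_map[OF bE bX x(3) x'(3)]
  obtain M m1 m2 n1 n2 where bM: "biproduct C E Y' M m1 m2 n1 n2" using ex_biproduct[OF x(7) x'(6)] by blast
  note aM = biproduct_arr[OF bM x(7) x'(6)]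
  let ?I1 = "biprod_map C YY r1 r2 M m1 m2 i (Id C Y')"
  let ?I2 = "biprod_map C M n1 n2 EE l1 l2 (Id C E) i'"
  note I1 = biprod_map[OF bY bM x(2) Id_arr[OF x'(6)]] and I2 = biprod_map[OF bM bE Id_arr[OF x(7)] x'(2)]
  have inf: "inflation C Y i E" "inflation C Y' i' E'" using x(1) x'(1) by (auto simp: inflation_def)
  have "inflation C YY ?I1 M"
    using biproduct_inflation[OF inf(1) bY bM x'(6) I1(1,2)] I1(3) idr[OF aM(2)] by simp
  moreover have "inflation C M ?I2 EE"
  proof (rule biproduct_inflation[OF inf(2) biproduct_swap[OF linear_category_axioms bM x(7) x'(6)]
        biproduct_swap[OF linear_category_axioms bE x(7) x'(7)] x(7) I2(1,3)])
    show "?I2 \<bullet> m1 = l1" using I2(2) idr[OF aE(1)] by simp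
  qed
  ultimately have "inflation C YY (?I2 \<bullet> ?I1) EE" by (rule Comp_inflation)
  moreover have "?I2 \<bullet> ?I1 = ?I"
  proof (rule biproduct_epi[OF bY x(6) x'(6) comp[OF I1(1) I2(1)] I(1)])
    show "(?I2 \<bullet> ?I1) \<bullet> k1 = ?I \<bullet> k1"
      using assoc[OF aY(1) I1(1) I2(1)] assoc[OF x(2) aM(1) I2(1)] I1(2) I2(2) I(2) idr[OF aE(1)] by metis
    show "(?I2 \<bullet> ?I1) \<bullet> k2 = ?I \<bullet> k2"
      using assoc[OF aY(2) I1(1) I2(1)] I1(3) I2(3) I(3) idr[OF aM(2)] by metis
  qed
  ultimately have infI: "inflation C YY ?I EE" by simp
  have PI: "?P \<bullet> ?I = \<zero>\<^bsub>Hom C YY XX\<^esub>"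
  proof (rule biproduct_epi[OF bY x(6) x'(6) comp[OF I(1) P(1)] zero_arr[OF arr_cod[OF aY(1)] arr_cod[OF aX(1)]]])
    show "(?P \<bullet> ?I) \<bullet> k1 = \<zero>\<^bsub>Hom C YY XX\<^esub> \<bullet> k1"
      using assoc[OF aY(1) I(1) P(1)] assoc[OF x(2) aE(1) P(1)] assoc[OF x(2,3) aX(1)] I(2) P(2) x(4)
        comp_zero[OF x(6) aX(1)] zero_comp[OF arr_cod[OF aX(1)] aY(1)] by metis
    show "(?P \<bullet> ?I) \<bullet> k2 = \<zero>\<^bsub>Hom C YY XX\<^esub> \<bullet> k2"
      using assoc[OF aY(2) I(1) P(1)] assoc[OF x'(2) aE(2) P(1)] assoc[OF x'(2,3) aX(2)] I(3) P(3) x'(4)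
        comp_zero[OF x'(6) aX(2)] zero_comp[OF arr_cod[OF aX(1)] aY(2)] by metis
  qed
  have "is_cokernel C YY ?I EE ?P XX"
    unfolding is_cokernel_def
  proof (intro conjI ballI impI PI)
    fix T f assume T: "T \<in> Ob C" and "f \<in> mor C EE T" and fI: "f \<bullet> ?I = \<zero>\<^bsub>Hom C YY T\<^esub>"
    then have f: "f \<in> arr C EE T" using aE by (auto simp: arr_def)
    have "(f \<bullet> l1) \<bullet> i = \<zero>\<^bsub>Hom C Y T\<^esub>"
      using assoc[OF x(2) aE(1) f] assoc[OF aY(1) I(1) f] I(2) fI zero_comp[OF T aY(1)] by metis
    from cokernel_lift[OF x(1) comp[OF aE(1) f] this] obtain a where a: "a \<in> arr C X T" "a \<bullet> p = f \<bullet> l1" .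
    have "(f \<bullet> l2) \<bullet> i' = \<zero>\<^bsub>Hom C Y' T\<^esub>"
      using assoc[OF x'(2) aE(2) f] assoc[OF aY(2) I(1) f] I(3) fI zero_comp[OF T aY(2)] by metis
    from cokernel_lift[OF x'(1) comp[OF aE(2) f] this] obtain b where b: "b \<in> arr C X' T" "b \<bullet> p' = f \<bullet> l2" .
    let ?u = "(a \<bullet> q1) \<oplus>\<^bsub>Hom C XX T\<^esub> (b \<bullet> q2)"
    note u = biproduct_copair[OF bX a(1) b(1)]
    have "?u \<bullet> ?P = f"
      by (rule biproduct_epi[OF bE x(7) x'(7) comp[OF P(1) u(1)] f])
         (use assoc[OF aE(1) P(1) u(1)] assoc[OF x(3) aX(1) u(1)] assoc[OF aE(2) P(1) u(1)]
            assoc[OF x'(3) aX(2) u(1)] P u(2,3) a b in metis)+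
    moreover have "w = ?u" if w: "w \<in> mor C XX T" "w \<bullet> ?P = f" for w
    proof -
      have w': "w \<in> arr C XX T" using w T aX by (auto simp: arr_def)
      have "w \<bullet> j1 = a"
        by (rule Confl_epi[OF x(1) comp[OF aX(1) w'] a(1)])
           (use assoc[OF x(3) aX(1) w'] assoc[OF aE(1) P(1) w'] P w a in metis)
      moreover have "w \<bullet> j2 = b"
        by (rule Confl_epi[OF x'(1) comp[OF aX(2) w'] b(1)])
           (use assoc[OF x'(3) aX(2) w'] assoc[OF aE(2) P(1) w'] P w b in metis)
      ultimately show ?thesis using biproduct_epi[OF bX x(5) x'(5) w' u(1)] u(2,3) by simp
    qed
    ultimately show "\<exists>!w. w \<in> mor C XX T \<and> w \<bullet> ?P = f" using arr_mor[OF u(1)] by metis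
  qed
  from Confl_of_cokernel[OF infI this P(1)] show ?thesis by (simp add: exts_def)
qed

text \<open>Varies all the choices in a direct sum at once, the representatives as well as the three
  biproducts; \<sigma> and \<tau> compare the biproducts of the ends. Independence of the Baer sum
  from its choices rests on it.\<close>

lemma direct_sum_ext_mor:
  assumes m: "ext_mor C X Y X Y (Id C X) (Id C Y) (E, i, p) (F, h, o')"
    and m': "ext_mor C X' Y' X' Y' (Id C X') (Id C Y') (E', i', p') (F', h', o'')"
    and bX: "biproduct C X X' XX j1 j2 q1 q2" and bY: "biproduct C Y Y' YY k1 k2 r1 r2"
    and bE: "biproduct C E E' EE l1 l2 s1 s2"
    and dX: "biproduct C X X' XX2 j1' j2' q1' q2'" and dY: "biproduct C Y Y' YY2 k1' k2' r1' r2'"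
    and dE: "biproduct C F F' FF l1' l2' s1' s2'"
    and \<sigma>: "\<sigma> \<in> arr C XX XX2" "\<sigma> \<bullet> j1 = j1'" "\<sigma> \<bullet> j2 = j2'"
    and \<tau>: "\<tau> \<in> arr C YY YY2" "\<tau> \<bullet> k1 = k1'" "\<tau> \<bullet> k2 = k2'"
  shows "ext_mor C XX YY XX2 YY2 \<sigma> \<tau>
    (EE, biprod_map C YY r1 r2 EE l1 l2 i i', biprod_map C EE s1 s2 XX j1 j2 p p')
    (FF, biprod_map C YY2 r1' r2' FF l1' l2' h h', biprod_map C FF s1' s2' XX2 j1' j2' o' o'')"
proof -
  from m obtain u where e: "(E, i, p) \<in> exts C X Y" "(F, h, o') \<in> exts C X Y"
    and u: "u \<in> arr C E F" "u \<bullet> i = h" "o' \<bullet> u = p" by (auto simp: ext_mor_Id_iff)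
  from m' obtain u' where e': "(E', i', p') \<in> exts C X' Y'" "(F', h', o'') \<in> exts C X' Y'"
    and u': "u' \<in> arr C E' F'" "u' \<bullet> i' = h'" "o'' \<bullet> u' = p'" by (auto simp: ext_mor_Id_iff)
  note x = exts_arr[OF e(1)] and x' = exts_arr[OF e'(1)] and y = exts_arr[OF e(2)] and y' = exts_arr[OF e'(2)]
  let ?I = "biprod_map C YY r1 r2 EE l1 l2 i i'" and ?P = "biprod_map C EE s1 s2 XX j1 j2 p p'"
  let ?J = "biprod_map C YY2 r1' r2' FF l1' l2' h h'" and ?Q = "biprod_map C FF s1' s2' XX2 j1' j2' o' o''"
  let ?\<omega> = "biprod_map C EE s1 s2 FF l1' l2' u u'"
  note aX = biproduct_arr[OF bX x(5) x'(5)] and aY = biproduct_arr[OF bY x(6) x'(6)]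
    and aE = biproduct_arr[OF bE x(7) x'(7)]
  note cX = biproduct_arr[OF dX x(5) x'(5)] and cY = biproduct_arr[OF dY x(6) x'(6)]
    and cE = biproduct_arr[OF dE y(7) y'(7)]
  note I = biprod_map[OF bY bE x(2) x'(2)] and P = biprod_map[OF bE bX x(3) x'(3)]
  note J = biprod_map[OF dY dE y(2) y'(2)] and Q = biprod_map[OF dE dX y(3) y'(3)]
  note \<omega> = biprod_map[OF bE dE u(1) u'(1)]
  have "?\<omega> \<bullet> ?I = ?J \<bullet> \<tau>"
  proof (rule biproduct_epi[OF bY x(6) x'(6) comp[OF I(1) \<omega>(1)] comp[OF \<tau>(1) J(1)]])
    show "(?\<omega> \<bullet> ?I) \<bullet> k1 = (?J \<bullet> \<tau>) \<bullet> k1"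
      using assoc[OF aY(1) I(1) \<omega>(1)] assoc[OF aY(1) \<tau>(1) J(1)] assoc[OF x(2) aE(1) \<omega>(1)] assoc[OF x(2) u(1) cE(1)]
        I(2) J(2) \<omega>(2) u \<tau> by metis
    show "(?\<omega> \<bullet> ?I) \<bullet> k2 = (?J \<bullet> \<tau>) \<bullet> k2"
      using assoc[OF aY(2) I(1) \<omega>(1)] assoc[OF aY(2) \<tau>(1) J(1)] assoc[OF x'(2) aE(2) \<omega>(1)] assoc[OF x'(2) u'(1) cE(2)]
        I(3) J(3) \<omega>(3) u' \<tau> by metis
  qed
  moreover have "?Q \<bullet> ?\<omega> = \<sigma> \<bullet> ?P"
  proof (rule biproduct_epi[OF bE x(7) x'(7) comp[OF \<omega>(1) Q(1)] comp[OF P(1) \<sigma>(1)]])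
    show "(?Q \<bullet> ?\<omega>) \<bullet> l1 = (\<sigma> \<bullet> ?P) \<bullet> l1"
      using assoc[OF aE(1) \<omega>(1) Q(1)] assoc[OF aE(1) P(1) \<sigma>(1)] assoc[OF u(1) cE(1) Q(1)] assoc[OF u(1) y(3) cX(1)]
        assoc[OF x(3) aX(1) \<sigma>(1)] \<omega>(2) P(2) Q(2) u \<sigma> by metis
    show "(?Q \<bullet> ?\<omega>) \<bullet> l2 = (\<sigma> \<bullet> ?P) \<bullet> l2"
      using assoc[OF aE(2) \<omega>(1) Q(1)] assoc[OF aE(2) P(1) \<sigma>(1)] assoc[OF u'(1) cE(2) Q(1)] assoc[OF u'(1) y'(3) cX(2)]
        assoc[OF x'(3) aX(2) \<sigma>(1)] \<omega>(3) P(3) Q(3) u' \<sigma> by metis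
  qed
  ultimately show ?thesis
    using direct_sum_exts[OF e(1) e'(1) bX bY bE] direct_sum_exts[OF e(2) e'(2) dX dY dE] \<omega>(1)
    by (auto simp: ext_mor_def)
qed

section \<open>Closure of Ext under its operations\<close>

lemma Ext_add: "\<xi> \<oplus>\<^bsub>Ext C X Y\<^esub> \<xi>' = baer_sum C X Y \<xi> \<xi>'"
  by (simp add: Ext_def)

lemma Ext_zero: "\<zero>\<^bsub>Ext C X Y\<^esub> = {(E, i, p). (E, i, p) \<in> exts C X Y \<and> (\<exists>s\<in>mor C X E. p \<bullet> s = Id C X)}"
  by (simp add: Ext_def)

lemma Ext_smult: "a \<odot>\<^bsub>Ext C X Y\<^esub> \<xi> = ext_push C X Y (a \<odot>\<^bsub>Hom C Y Y\<^esub> Id C Y) \<xi>"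
  by (simp add: Ext_def)

text \<open>\<open>baer_sum\<close> is a union over all choices of representatives and biproducts,
  so the issue is that every choice yields the same class. Two choices are linked by a morphism of
  direct sums whose end components are compatible with the diagonals and the codiagonals, and
  \<open>ext_map_square\<close> then equates the results.\<close>

lemma baer_sum_closed:
  assumes \<xi>: "\<xi> \<in> carrier (Ext C X Y)" and \<xi>': "\<xi>' \<in> carrier (Ext C X Y)"
  shows "baer_sum C X Y \<xi> \<xi>' \<in> carrier (Ext C X Y)"
proof -
  \<comment> \<open>\<open>datum \<zeta>\<close> says that \<zeta> is the class obtained from one
    complete set of choices.\<close>
  define datum where "datum = (\<lambda>\<zeta>. \<exists>E i p E' i' p' XX j\<^sub>1 j\<^sub>2 q\<^sub>1 q\<^sub>2 YY k\<^sub>1 k\<^sub>2 r\<^sub>1 r\<^sub>2 EE l\<^sub>1 l\<^sub>2 s\<^sub>1 s\<^sub>2.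
      (E, i, p) \<in> \<xi> \<and> (E', i', p') \<in> \<xi>' \<and>
      biproduct C X X XX j\<^sub>1 j\<^sub>2 q\<^sub>1 q\<^sub>2 \<and> biproduct C Y Y YY k\<^sub>1 k\<^sub>2 r\<^sub>1 r\<^sub>2 \<and> biproduct C E E' EE l\<^sub>1 l\<^sub>2 s\<^sub>1 s\<^sub>2 \<and>
      \<zeta> = ext_map C XX X Y (j\<^sub>1 \<oplus>\<^bsub>Hom C X XX\<^esub> j\<^sub>2) (r\<^sub>1 \<oplus>\<^bsub>Hom C YY Y\<^esub> r\<^sub>2)
        (ext_cls C XX YY (EE, biprod_map C YY r\<^sub>1 r\<^sub>2 EE l\<^sub>1 l\<^sub>2 i i', biprod_map C EE s\<^sub>1 s\<^sub>2 XX j\<^sub>1 j\<^sub>2 p p')))"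
  have baer: "baer_sum C X Y \<xi> \<xi>' = \<Union>{\<zeta>. datum \<zeta>}"
    unfolding baer_sum_def datum_def biprod_map_def by (rule Set.set_eqI) (simp, blast)
  have closed: "\<zeta> \<in> carrier (Ext C X Y)" if "datum \<zeta>" for \<zeta>
  proof -
    from that obtain E i p E' i' p' XX j1 j2 q1 q2 YY k1 k2 r1 r2 EE l1 l2 s1 s2
      where e: "(E, i, p) \<in> \<xi>" "(E', i', p') \<in> \<xi>'"
       and b: "biproduct C X X XX j1 j2 q1 q2" "biproduct C Y Y YY k1 k2 r1 r2" "biproduct C E E' EE l1 l2 s1 s2"
       and \<zeta>: "\<zeta> = ext_map C XX X Y (j1 \<oplus>\<^bsub>Hom C X XX\<^esub> j2) (r1 \<oplus>\<^bsub>Hom C YY Y\<^esub> r2)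
        (ext_cls C XX YY (EE, biprod_map C YY r1 r2 EE l1 l2 i i', biprod_map C EE s1 s2 XX j1 j2 p p'))"
      unfolding datum_def by - (elim exE conjE, rule that)
    note x = Ext_mem_cls(2)[OF \<xi> e(1)] and x' = Ext_mem_cls(2)[OF \<xi>' e(2)]
    note X = exts_Ob[OF x]
    show ?thesis unfolding \<zeta>
      by (rule ext_map_closed[OF ext_cls_carrier[OF direct_sum_exts[OF x x' b]]
            biproduct_diagonal(1)[OF b(1) X(1)] biproduct_diagonal(2)[OF b(2) X(2)]])
  qed
  have unique: "\<zeta> = \<zeta>'" if "datum \<zeta>" "datum \<zeta>'" for \<zeta> \<zeta>'
  proof -
    from that(1) obtain E i p E' i' p' XX j1 j2 q1 q2 YY k1 k2 r1 r2 EE l1 l2 s1 s2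
      where e: "(E, i, p) \<in> \<xi>" "(E', i', p') \<in> \<xi>'"
       and b: "biproduct C X X XX j1 j2 q1 q2" "biproduct C Y Y YY k1 k2 r1 r2" "biproduct C E E' EE l1 l2 s1 s2"
       and \<zeta>: "\<zeta> = ext_map C XX X Y (j1 \<oplus>\<^bsub>Hom C X XX\<^esub> j2) (r1 \<oplus>\<^bsub>Hom C YY Y\<^esub> r2)
        (ext_cls C XX YY (EE, biprod_map C YY r1 r2 EE l1 l2 i i', biprod_map C EE s1 s2 XX j1 j2 p p'))"
      unfolding datum_def by - (elim exE conjE, rule that)
    from that(2) obtain F h o' F' h' o'' XX' j1' j2' q1' q2' YY' k1' k2' r1' r2' FF l1' l2' s1' s2'
      where f: "(F, h, o') \<in> \<xi>" "(F', h', o'') \<in> \<xi>'"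
       and d: "biproduct C X X XX' j1' j2' q1' q2'" "biproduct C Y Y YY' k1' k2' r1' r2'" "biproduct C F F' FF l1' l2' s1' s2'"
       and \<zeta>': "\<zeta>' = ext_map C XX' X Y (j1' \<oplus>\<^bsub>Hom C X XX'\<^esub> j2') (r1' \<oplus>\<^bsub>Hom C YY' Y\<^esub> r2')
        (ext_cls C XX' YY' (FF, biprod_map C YY' r1' r2' FF l1' l2' h h', biprod_map C FF s1' s2' XX' j1' j2' o' o''))"
      unfolding datum_def by - (elim exE conjE, rule that)
    have m: "ext_mor C X Y X Y (Id C X) (Id C Y) (E, i, p) (F, h, o')"
      using Ext_mem_cls(1)[OF \<xi> e(1)] f(1) mem_ext_cls by metis
    have m': "ext_mor C X Y X Y (Id C X) (Id C Y) (E', i', p') (F', h', o'')"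
      using Ext_mem_cls(1)[OF \<xi>' e(2)] f(2) mem_ext_cls by metis
    note X = exts_Ob[OF Ext_mem_cls(2)[OF \<xi> e(1)]]
    note aX = biproduct_arr[OF b(1) X(1) X(1)] and aY = biproduct_arr[OF b(2) X(2) X(2)]
    note cX = biproduct_arr[OF d(1) X(1) X(1)] and cY = biproduct_arr[OF d(2) X(2) X(2)]
    \<comment> \<open>The comparison of the two biproducts of \<open>X\<close> that matches the
      injections; it sends diagonal to diagonal. The comparison for \<open>Y\<close> is built in the
      same way and is used through the codiagonals.\<close>
    let ?\<sigma> = "(j1' \<bullet> q1) \<oplus>\<^bsub>Hom C XX XX'\<^esub> (j2' \<bullet> q2)"
    let ?\<tau> = "(k1' \<bullet> r1) \<oplus>\<^bsub>Hom C YY YY'\<^esub> (k2' \<bullet> r2)"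
    note \<sigma> = biproduct_copair[OF b(1) cX(1,2)] and \<tau> = biproduct_copair[OF b(2) cY(1,2)]
    note D = biproduct_diagonal[OF b(1) X(1)] biproduct_diagonal[OF b(2) X(2)]
    note D' = biproduct_diagonal[OF d(1) X(1)] biproduct_diagonal[OF d(2) X(2)]
    have "?\<sigma> \<bullet> (j1 \<oplus>\<^bsub>Hom C X XX\<^esub> j2) = j1' \<oplus>\<^bsub>Hom C X XX'\<^esub> j2'"
      using comp_add[OF aX(1,2) \<sigma>(1)] \<sigma>(2,3) by simp
    moreover have "(r1' \<oplus>\<^bsub>Hom C YY' Y\<^esub> r2') \<bullet> ?\<tau> = r1 \<oplus>\<^bsub>Hom C YY Y\<^esub> r2"
      by (rule biproduct_epi[OF b(2) X(2) X(2) comp[OF \<tau>(1) D'(6)] D(6)])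
         (use assoc[OF aY(1) \<tau>(1) D'(6)] assoc[OF aY(2) \<tau>(1) D'(6)] \<tau>(2,3) D D' in metis)+
    ultimately show ?thesis unfolding \<zeta> \<zeta>'
      using ext_map_square[OF direct_sum_ext_mor[OF m m' b d \<sigma> \<tau>] \<sigma>(1) \<tau>(1) D(1) D'(6)] by simp
  qed
  obtain e e' where "e \<in> exts C X Y" "\<xi> = ext_cls C X Y e" "e' \<in> exts C X Y" "\<xi>' = ext_cls C X Y e'"
    using ExtE[OF \<xi>] ExtE[OF \<xi>'] by metis
  then obtain E i p E' i' p' where e: "(E, i, p) \<in> \<xi>" "(E', i', p') \<in> \<xi>'"
    and x: "(E, i, p) \<in> exts C X Y" "(E', i', p') \<in> exts C X Y"
    using ext_cls_self by (metis prod_cases3)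
  note a = exts_arr[OF x(1)] and a' = exts_arr[OF x(2)]
  obtain XX j1 j2 q1 q2 YY k1 k2 r1 r2 EE l1 l2 s1 s2
    where "biproduct C X X XX j1 j2 q1 q2" "biproduct C Y Y YY k1 k2 r1 r2" "biproduct C E E' EE l1 l2 s1 s2"
    using ex_biproduct[OF a(5,5)] ex_biproduct[OF a(6,6)] ex_biproduct[OF a(7) a'(7)] by metis
  then have "\<exists>\<zeta>. datum \<zeta>"
    unfolding datum_def using e by - ((rule exI)+, (rule conjI refl | assumption)+)
  then obtain \<zeta> where "datum \<zeta>" by blast
  then have "{\<zeta>. datum \<zeta>} = {\<zeta>}" using unique by blast
  then show ?thesis using closed[OF \<open>datum \<zeta>\<close>] baer by simp
qed

lemma Ext_smult_map:
  assumes "a \<in> carrier K" "\<xi> \<in> carrier (Ext C X Y)"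
  shows "a \<odot>\<^bsub>Ext C X Y\<^esub> \<xi> = ext_map C X X Y (Id C X) (a \<odot>\<^bsub>Hom C Y Y\<^esub> Id C Y) \<xi>"
proof -
  obtain e where e: "e \<in> exts C X Y" using ExtE[OF assms(2)] .
  show ?thesis using ext_push_eq_map[OF assms(2)] smult_arr[OF assms(1) Id_arr[OF exts_Ob(2)[OF e]]]
    by (simp add: Ext_smult)
qed

lemma Ext_smult_closed:
  assumes "a \<in> carrier K" "\<xi> \<in> carrier (Ext C X Y)"
  shows "a \<odot>\<^bsub>Ext C X Y\<^esub> \<xi> \<in> carrier (Ext C X Y)"
proof -
  obtain e where e: "e \<in> exts C X Y" using ExtE[OF assms(2)] .
  note I = Id_arr[OF exts_Ob(1)[OF e]] Id_arr[OF exts_Ob(2)[OF e]]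
  show ?thesis unfolding Ext_smult_map[OF assms]
    by (rule ext_map_closed[OF assms(2) I(1) smult_arr[OF assms(1) I(2)]])
qed

text \<open>A middle component that is zero on the subobject descends along \<open>p\<close> to a
  section of \<open>p'\<close>, and conversely a section \<open>s\<close> gives the middle component
  \<open>s \<bullet> p\<close>. Hence the split conflations are exactly what a pushout along a zero
  map produces.\<close>

lemma ext_push_zero:
  assumes e: "e \<in> exts C X A" and Y: "Y \<in> Ob C"
  shows "ext_push C X Y \<zero>\<^bsub>Hom C A Y\<^esub> (ext_cls C X A e) = \<zero>\<^bsub>Ext C X Y\<^esub>"
proof -
  obtain E i p where ep: "e = (E, i, p)" by (metis prod_cases3)
  note x = exts_arr[OF e[unfolded ep]]
  have z: "\<zero>\<^bsub>Hom C A Y\<^esub> \<in> arr C A Y" using zero_arr[OF x(6) Y] .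
  from push_mor_exists[OF e z] obtain e0 where e0: "ext_mor C X A X Y (Id C X) \<zero>\<^bsub>Hom C A Y\<^esub> e e0" .
  have "e' \<in> ext_cls C X Y e0 \<longleftrightarrow> ext_mor C X A X Y (Id C X) \<zero>\<^bsub>Hom C A Y\<^esub> e e'" for e'
  proof
    assume "e' \<in> ext_cls C X Y e0"
    then have "ext_mor C X Y X Y (Id C X) (Id C Y) e0 e'" by (simp add: ext_equiv_iff)
    from ext_mor_comp[OF e0 this Id_arr[OF x(5)] z Id_arr[OF x(5)] Id_arr[OF Y]]
    show "ext_mor C X A X Y (Id C X) \<zero>\<^bsub>Hom C A Y\<^esub> e e'"
      using idl[OF z] idl[OF Id_arr[OF x(5)]] by simp
  next
    assume "ext_mor C X A X Y (Id C X) \<zero>\<^bsub>Hom C A Y\<^esub> e e'"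
    from ext_mor_factor_push[OF this e0 Id_arr[OF x(5)] z] show "e' \<in> ext_cls C X Y e0"
      by (simp add: ext_equiv_iff)
  qed
  moreover have "ext_mor C X A X Y (Id C X) \<zero>\<^bsub>Hom C A Y\<^esub> e (E', i', p') \<longleftrightarrow>
      (E', i', p') \<in> exts C X Y \<and> (\<exists>s\<in>mor C X E'. p' \<bullet> s = Id C X)" for E' i' p'
  proof
    assume "ext_mor C X A X Y (Id C X) \<zero>\<^bsub>Hom C A Y\<^esub> e (E', i', p')"
    then obtain u where e': "(E', i', p') \<in> exts C X Y"
      and u: "u \<in> arr C E E'" "u \<bullet> i = i' \<bullet> \<zero>\<^bsub>Hom C A Y\<^esub>" "p' \<bullet> u = Id C X \<bullet> p" by (auto simp: ext_mor_def ep)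
    note x' = exts_arr[OF e']
    from cokernel_lift[OF x(1) u(1)] u(2) comp_zero[OF x(6) x'(2)] obtain s
      where s: "s \<in> arr C X E'" "s \<bullet> p = u" by metis
    have "p' \<bullet> s = Id C X"
      by (rule Confl_epi[OF x(1) comp[OF s(1) x'(3)] Id_arr[OF x(5)]])
         (use assoc[OF x(3) s(1) x'(3)] s(2) u(3) in metis)
    then show "(E', i', p') \<in> exts C X Y \<and> (\<exists>s\<in>mor C X E'. p' \<bullet> s = Id C X)"
      using e' s arr_mor by metis
  next
    assume "(E', i', p') \<in> exts C X Y \<and> (\<exists>s\<in>mor C X E'. p' \<bullet> s = Id C X)"
    then obtain s where e': "(E', i', p') \<in> exts C X Y" and s: "s \<in> mor C X E'" "p' \<bullet> s = Id C X" by blast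
    note x' = exts_arr[OF e']
    have s': "s \<in> arr C X E'" using s x' by (auto simp: arr_def)
    have "(s \<bullet> p) \<bullet> i = i' \<bullet> \<zero>\<^bsub>Hom C A Y\<^esub>"
      using assoc[OF x(2,3) s'] x(4) comp_zero[OF x(6) s'] comp_zero[OF x(6) x'(2)] by metis
    moreover have "p' \<bullet> (s \<bullet> p) = Id C X \<bullet> p" using assoc[OF x(3) s' x'(3)] s by metis
    ultimately show "ext_mor C X A X Y (Id C X) \<zero>\<^bsub>Hom C A Y\<^esub> e (E', i', p')"
      using e e' comp[OF x(3) s'] by (auto simp: ext_mor_def ep)
  qed
  ultimately show ?thesis
    unfolding ext_push_cls[OF e0 z] Ext_zero by (intro Set.set_eqI) (auto simp del: Image_singleton_iff)
qed

text \<open>To recognise the split conflations as a class, one extension of \<open>X\<close> is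
  needed that can be pushed out along a zero map. The identity of \<open>X\<close> is a deflation
  and belongs to such an extension.\<close>

lemma Ext_zero_closed:
  assumes X: "X \<in> Ob C" and Y: "Y \<in> Ob C" shows "\<zero>\<^bsub>Ext C X Y\<^esub> \<in> carrier (Ext C X Y)"
proof -
  from Id_deflation[OF X] obtain A i where "Confl C A i X (Id C X) X" by (auto simp: deflation_def)
  then have e: "(X, i, Id C X) \<in> exts C X A" by (simp add: exts_def)
  note z = zero_arr[OF exts_arr(6)[OF e] Y]
  from push_mor_exists[OF e z] obtain e0 where
    e0: "ext_mor C X A X Y (Id C X) \<zero>\<^bsub>Hom C A Y\<^esub> (X, i, Id C X) e0" .
  show ?thesis using ext_push_zero[OF e Y] ext_push_cls[OF e0 z] ext_cls_carrier[OF ext_mor_exts(2)[OF e0]] by simp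
qed

text \<open>Multiplying by zero pushes out along the zero endomorphism. Through this, compatibility
  of \<open>c\<close> with scalars shows that \<open>c\<close> preserves zero.\<close>

lemma Ext_zero_smult:
  assumes "\<xi> \<in> carrier (Ext C X Y)" shows "\<zero>\<^bsub>K\<^esub> \<odot>\<^bsub>Ext C X Y\<^esub> \<xi> = \<zero>\<^bsub>Ext C X Y\<^esub>"
proof -
  from ExtE[OF assms] obtain e where e: "e \<in> exts C X Y" "\<xi> = ext_cls C X Y e" .
  note X = exts_Ob[OF e(1)]
  have "\<zero>\<^bsub>K\<^esub> \<odot>\<^bsub>Hom C Y Y\<^esub> Id C Y = \<zero>\<^bsub>Hom C Y Y\<^esub>"
    using module.smult_l_null[OF Hom_module[OF X(2,2)] Id_mor[OF X(2)]] .
  then show ?thesis using ext_push_zero[OF e(1) X(2)] by (simp add: Ext_smult e(2))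
qed

end


section \<open>Representations and Calabi--Yau pairings\<close>

text \<open>The operations of the dual are pointwise in \<open>K\<close>, so closure of the
  operations of \<open>V\<close> suffices. This form makes the lemma applicable to an extension
  space before its module axioms are known.\<close>

lemma module_dual:
  assumes K: "cring K"
    and add: "\<And>u v. \<lbrakk>u \<in> carrier V; v \<in> carrier V\<rbrakk> \<Longrightarrow> u \<oplus>\<^bsub>V\<^esub> v \<in> carrier V"
    and smult: "\<And>a v. \<lbrakk>a \<in> carrier K; v \<in> carrier V\<rbrakk> \<Longrightarrow> a \<odot>\<^bsub>V\<^esub> v \<in> carrier V"
  shows "module K (dual K V)"
proof -
  interpret K: cring K by fact
  have val: "\<phi> v \<in> carrier K" if "\<phi> \<in> carrier (dual K V)" "v \<in> carrier V" for \<phi> v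
    using that by (auto simp: dual_def)
  have "abelian_group (dual K V)"
  proof (rule abelian_groupI)
    fix \<phi> assume \<phi>: "\<phi> \<in> carrier (dual K V)"
    have "(\<lambda>v\<in>carrier V. \<ominus>\<^bsub>K\<^esub> \<phi> v) \<in> carrier (dual K V)"
      using \<phi> by (auto simp: dual_def add smult K.minus_add K.r_minus val[OF \<phi>])
    moreover have "(\<lambda>v\<in>carrier V. \<ominus>\<^bsub>K\<^esub> \<phi> v) \<oplus>\<^bsub>dual K V\<^esub> \<phi> = \<zero>\<^bsub>dual K V\<^esub>"
      using val[OF \<phi>] by (auto simp: dual_def K.l_neg)
    ultimately show "\<exists>\<psi>\<in>carrier (dual K V). \<psi> \<oplus>\<^bsub>dual K V\<^esub> \<phi> = \<zero>\<^bsub>dual K V\<^esub>" by blast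
  next
    fix \<phi> \<psi> assume \<phi>: "\<phi> \<in> carrier (dual K V)" and \<psi>: "\<psi> \<in> carrier (dual K V)"
    then show "\<phi> \<oplus>\<^bsub>dual K V\<^esub> \<psi> \<in> carrier (dual K V)"
      by (auto simp: dual_def add smult K.r_distr K.a_ac val[OF \<phi>] val[OF \<psi>])
  next
    show "\<zero>\<^bsub>dual K V\<^esub> \<in> carrier (dual K V)" by (auto simp: dual_def add smult)
  next
    fix \<phi> \<psi> \<chi> assume a: "\<phi> \<in> carrier (dual K V)" "\<psi> \<in> carrier (dual K V)" "\<chi> \<in> carrier (dual K V)"
    then show "\<phi> \<oplus>\<^bsub>dual K V\<^esub> \<psi> \<oplus>\<^bsub>dual K V\<^esub> \<chi> = \<phi> \<oplus>\<^bsub>dual K V\<^esub> (\<psi> \<oplus>\<^bsub>dual K V\<^esub> \<chi>)"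
      by (auto simp: dual_def K.a_assoc val[OF a(1)] val[OF a(2)] val[OF a(3)] intro!: restrict_ext)
  next
    fix \<phi> \<psi> assume a: "\<phi> \<in> carrier (dual K V)" "\<psi> \<in> carrier (dual K V)"
    then show "\<phi> \<oplus>\<^bsub>dual K V\<^esub> \<psi> = \<psi> \<oplus>\<^bsub>dual K V\<^esub> \<phi>"
      by (auto simp: dual_def K.a_comm val[OF a(1)] val[OF a(2)] intro!: restrict_ext)
  next
    fix \<phi> assume \<phi>: "\<phi> \<in> carrier (dual K V)"
    then have "(\<lambda>v\<in>carrier V. \<phi> v) = \<phi>" by (auto simp: dual_def)
    then show "\<zero>\<^bsub>dual K V\<^esub> \<oplus>\<^bsub>dual K V\<^esub> \<phi> = \<phi>"
      using val[OF \<phi>] by (auto simp: dual_def cong: restrict_cong)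
  qed
  moreover have "a \<odot>\<^bsub>dual K V\<^esub> \<phi> \<in> carrier (dual K V)" if "a \<in> carrier K" "\<phi> \<in> carrier (dual K V)" for a \<phi>
    using that by (auto simp: dual_def add smult K.r_distr K.m_ac val[OF that(2)])
  moreover have "\<one>\<^bsub>K\<^esub> \<odot>\<^bsub>dual K V\<^esub> \<phi> = \<phi>" if \<phi>: "\<phi> \<in> carrier (dual K V)" for \<phi>
  proof -
    have "(\<lambda>v\<in>carrier V. \<phi> v) = \<phi>" using \<phi> by (auto simp: dual_def)
    then show ?thesis using val[OF \<phi>] by (auto simp: dual_def cong: restrict_cong)
  qed
  moreover have "(a \<oplus>\<^bsub>K\<^esub> b) \<odot>\<^bsub>dual K V\<^esub> \<phi> = a \<odot>\<^bsub>dual K V\<^esub> \<phi> \<oplus>\<^bsub>dual K V\<^esub> b \<odot>\<^bsub>dual K V\<^esub> \<phi>"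
    "(a \<otimes>\<^bsub>K\<^esub> b) \<odot>\<^bsub>dual K V\<^esub> \<phi> = a \<odot>\<^bsub>dual K V\<^esub> (b \<odot>\<^bsub>dual K V\<^esub> \<phi>)"
    if "a \<in> carrier K" "b \<in> carrier K" "\<phi> \<in> carrier (dual K V)" for a b \<phi>
    using that by (auto simp: dual_def K.l_distr K.m_assoc val[OF that(3)] intro!: restrict_ext)
  moreover have "a \<odot>\<^bsub>dual K V\<^esub> (\<phi> \<oplus>\<^bsub>dual K V\<^esub> \<psi>) = a \<odot>\<^bsub>dual K V\<^esub> \<phi> \<oplus>\<^bsub>dual K V\<^esub> a \<odot>\<^bsub>dual K V\<^esub> \<psi>"
    if "a \<in> carrier K" "\<phi> \<in> carrier (dual K V)" "\<psi> \<in> carrier (dual K V)" for a \<phi> \<psi>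
    using that by (auto simp: dual_def K.r_distr val[OF that(2)] val[OF that(3)] intro!: restrict_ext)
  ultimately show ?thesis using K by (intro moduleI)
qed

text \<open>Equational axioms pull back along an injection compatible with the operations; the
  existence of negatives uses surjectivity.\<close>

lemma module_transport:
  assumes W: "module K W" and bij: "bij_betw f (carrier V) (carrier W)"
    and add: "\<And>u v. \<lbrakk>u \<in> carrier V; v \<in> carrier V\<rbrakk> \<Longrightarrow> u \<oplus>\<^bsub>V\<^esub> v \<in> carrier V \<and> f (u \<oplus>\<^bsub>V\<^esub> v) = f u \<oplus>\<^bsub>W\<^esub> f v"
    and smult: "\<And>a v. \<lbrakk>a \<in> carrier K; v \<in> carrier V\<rbrakk>
      \<Longrightarrow> a \<odot>\<^bsub>V\<^esub> v \<in> carrier V \<and> f (a \<odot>\<^bsub>V\<^esub> v) = a \<odot>\<^bsub>W\<^esub> f v"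
    and zero: "\<zero>\<^bsub>V\<^esub> \<in> carrier V" "f \<zero>\<^bsub>V\<^esub> = \<zero>\<^bsub>W\<^esub>"
  shows "module K V"
proof -
  interpret W: module K W by fact
  have inj: "u = v" if "u \<in> carrier V" "v \<in> carrier V" "f u = f v" for u v
    using bij that by (auto simp: bij_betw_def inj_on_def)
  have fc: "f v \<in> carrier W" if "v \<in> carrier V" for v
    using bij that by (auto simp: bij_betw_def)
  have "abelian_group V"
  proof (rule abelian_groupI)
    fix v assume v: "v \<in> carrier V"
    then obtain w where w: "w \<in> carrier V" "f w = \<ominus>\<^bsub>W\<^esub> f v"
      using bij fc[OF v] W.a_inv_closed[of "f v"] by (metis bij_betw_def imageE)
    then have "w \<oplus>\<^bsub>V\<^esub> v = \<zero>\<^bsub>V\<^esub>"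
      using v by (intro inj) (simp_all add: add zero fc W.l_neg)
    then show "\<exists>w\<in>carrier V. w \<oplus>\<^bsub>V\<^esub> v = \<zero>\<^bsub>V\<^esub>" using w by blast
  qed (auto intro!: inj simp: add zero fc W.a_ac)
  then show ?thesis
    using W.R.cring_axioms
    by (intro moduleI) (auto intro!: inj simp: add smult fc W.smult_l_distr W.smult_r_distr W.smult_assoc1)
qed


lemma linear_mapsD:
  assumes "f \<in> linear_maps K V W"
  shows "v \<in> carrier V \<Longrightarrow> f v \<in> carrier W"
    and "\<lbrakk>u \<in> carrier V; v \<in> carrier V\<rbrakk> \<Longrightarrow> f (u \<oplus>\<^bsub>V\<^esub> v) = f u \<oplus>\<^bsub>W\<^esub> f v"
    and "\<lbrakk>a \<in> carrier K; v \<in> carrier V\<rbrakk> \<Longrightarrow> f (a \<odot>\<^bsub>V\<^esub> v) = a \<odot>\<^bsub>W\<^esub> f v"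
  using assms by (auto simp: linear_maps_def)

lemma contragredient_simps [simp]:
  "carrier (contragredient K \<Gamma> V) = carrier (dual K V)"
  "\<zero>\<^bsub>contragredient K \<Gamma> V\<^esub> = \<zero>\<^bsub>dual K V\<^esub>"
  "\<phi> \<oplus>\<^bsub>contragredient K \<Gamma> V\<^esub> \<psi> = \<phi> \<oplus>\<^bsub>dual K V\<^esub> \<psi>"
  "a \<odot>\<^bsub>contragredient K \<Gamma> V\<^esub> \<phi> = a \<odot>\<^bsub>dual K V\<^esub> \<phi>"
  "act (contragredient K \<Gamma> V) = (\<lambda>g \<phi>. \<lambda>v\<in>carrier V. \<phi> (act V (inv\<^bsub>\<Gamma>\<^esub> g) v))"
  by (simp_all add: contragredient_def module.defs rep_module.defs)

text \<open>A representation is a record that extends a module, so it cannot be equated with the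
  underlying module; agreement of the components is what can be used.\<close>

lemma module_cong:
  assumes "module K W" "carrier V = carrier W" "\<zero>\<^bsub>V\<^esub> = \<zero>\<^bsub>W\<^esub>"
    "\<And>u v. u \<oplus>\<^bsub>V\<^esub> v = u \<oplus>\<^bsub>W\<^esub> v" "\<And>a v. a \<odot>\<^bsub>V\<^esub> v = a \<odot>\<^bsub>W\<^esub> v"
  shows "module K V"
proof -
  interpret W: module K W by fact
  show ?thesis by (rule module_transport[OF assms(1), of id]) (use assms in auto)
qed

lemma dual_apply: "\<lbrakk>\<phi> \<in> carrier (dual K V); v \<in> carrier V\<rbrakk> \<Longrightarrow> \<phi> v \<in> carrier K"
  by (auto simp: dual_def)

lemma dual_ext:
  "\<lbrakk>\<phi> \<in> carrier (dual K V); \<psi> \<in> carrier (dual K V); \<And>v. v \<in> carrier V \<Longrightarrow> \<phi> v = \<psi> v\<rbrakk> \<Longrightarrow> \<phi> = \<psi>"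
  by (auto simp: dual_def intro: PiE_ext)

lemma dual_add_apply: "v \<in> carrier V \<Longrightarrow> (\<phi> \<oplus>\<^bsub>dual K V\<^esub> \<psi>) v = \<phi> v \<oplus>\<^bsub>K\<^esub> \<psi> v"
  by (simp add: dual_def)

lemma dual_smult_apply: "v \<in> carrier V \<Longrightarrow> (a \<odot>\<^bsub>dual K V\<^esub> \<phi>) v = a \<otimes>\<^bsub>K\<^esub> \<phi> v"
  by (simp add: dual_def)

lemma dual_linear:
  assumes "\<phi> \<in> carrier (dual K V)"
  shows "\<lbrakk>u \<in> carrier V; v \<in> carrier V\<rbrakk> \<Longrightarrow> \<phi> (u \<oplus>\<^bsub>V\<^esub> v) = \<phi> u \<oplus>\<^bsub>K\<^esub> \<phi> v"
    "\<lbrakk>a \<in> carrier K; v \<in> carrier V\<rbrakk> \<Longrightarrow> \<phi> (a \<odot>\<^bsub>V\<^esub> v) = a \<otimes>\<^bsub>K\<^esub> \<phi> v"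
  using assms by (auto simp: dual_def)

lemma dual_compose:
  assumes f: "f \<in> linear_maps K V W" and W: "\<phi> \<in> carrier (dual K W)"
    and add: "\<And>u v. \<lbrakk>u \<in> carrier V; v \<in> carrier V\<rbrakk> \<Longrightarrow> u \<oplus>\<^bsub>V\<^esub> v \<in> carrier V"
    and smult: "\<And>a v. \<lbrakk>a \<in> carrier K; v \<in> carrier V\<rbrakk> \<Longrightarrow> a \<odot>\<^bsub>V\<^esub> v \<in> carrier V"
  shows "(\<lambda>v\<in>carrier V. \<phi> (f v)) \<in> carrier (dual K V)"
  using assms by (auto simp: dual_def linear_maps_def Pi_iff)

lemma transpose_linear:
  assumes f: "f \<in> linear_maps K V W" and V: "module K V"
  shows "(\<lambda>\<phi>. \<lambda>v\<in>carrier V. \<phi> (f v)) \<in> linear_maps K (dual K W) (dual K V)"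
proof -
  interpret V: module K V by fact
  show ?thesis
    unfolding linear_maps_def
  proof (intro CollectI conjI funcsetI ballI)
    fix \<phi> assume "\<phi> \<in> carrier (dual K W)"
    then show "(\<lambda>v\<in>carrier V. \<phi> (f v)) \<in> carrier (dual K V)" using dual_compose[OF f] by simp
  qed (use linear_mapsD(1)[OF f] in \<open>auto simp: dual_def\<close>)
qed

section \<open>Representations and contragredients\<close>

locale group_representation = group \<Gamma> for \<Gamma> :: "('g, 's) monoid_scheme" +
  fixes K :: "('k, 'r) ring_scheme" and V :: "('k, 'v, 'g) rep_module"
  assumes rep: "representation K \<Gamma> V"
begin

lemma rep_module: "module K V"
  using rep by (simp add: representation_def)

lemma act_linear: "g \<in> carrier \<Gamma> \<Longrightarrow> act V g \<in> linear_maps K V V"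
  using rep by (simp add: representation_def)

lemma act_closed: "\<lbrakk>g \<in> carrier \<Gamma>; v \<in> carrier V\<rbrakk> \<Longrightarrow> act V g v \<in> carrier V"
  by (rule linear_mapsD(1)[OF act_linear])

lemma act_one: "v \<in> carrier V \<Longrightarrow> act V \<one>\<^bsub>\<Gamma>\<^esub> v = v"
  using rep by (simp add: representation_def)

lemma act_mult: "\<lbrakk>g \<in> carrier \<Gamma>; h \<in> carrier \<Gamma>; v \<in> carrier V\<rbrakk>
    \<Longrightarrow> act V (g \<otimes>\<^bsub>\<Gamma>\<^esub> h) v = act V g (act V h v)"
  using rep by (simp add: representation_def)

text \<open>Transposition reverses the order of multiplication, and inverting the group element
  restores it.\<close>

lemma representation_contragredient: "representation K \<Gamma> (contragredient K \<Gamma> V)"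
proof -
  interpret V: module K V by (rule rep_module)
  have D: "module K (dual K V)" using module_dual V.R.cring_axioms V.a_closed V.smult_closed by blast
  show ?thesis
    unfolding representation_def
  proof (intro conjI ballI)
    show "module K (contragredient K \<Gamma> V)" by (rule module_cong[OF D]) simp_all
    fix g assume g: "g \<in> carrier \<Gamma>"
    have "(\<lambda>\<phi>. \<lambda>v\<in>carrier V. \<phi> (act V (inv\<^bsub>\<Gamma>\<^esub> g) v)) \<in> linear_maps K (dual K V) (dual K V)"
      using transpose_linear[OF act_linear rep_module] g by simp
    then show "act (contragredient K \<Gamma> V) g
        \<in> linear_maps K (contragredient K \<Gamma> V) (contragredient K \<Gamma> V)"
      by (simp add: linear_maps_def)
    fix h \<phi> assume h: "h \<in> carrier \<Gamma>" and \<phi>: "\<phi> \<in> carrier (contragredient K \<Gamma> V)"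
    show "act (contragredient K \<Gamma> V) (g \<otimes>\<^bsub>\<Gamma>\<^esub> h) \<phi>
        = act (contragredient K \<Gamma> V) g (act (contragredient K \<Gamma> V) h \<phi>)"
      using g h by (auto simp: inv_mult_group act_mult act_closed intro!: restrict_ext)
  next
    fix \<phi> assume "\<phi> \<in> carrier (contragredient K \<Gamma> V)"
    then show "act (contragredient K \<Gamma> V) \<one>\<^bsub>\<Gamma>\<^esub> \<phi> = \<phi>"
      by (auto simp: act_one dual_def cong: restrict_cong)
  qed
qed

end

text \<open>Equivariance of \<open>f\<close> at the inverse of a group element is what the transpose
  needs at that element.\<close>

lemma transpose_rep_hom:
  assumes \<Gamma>: "group \<Gamma>" and V: "representation K \<Gamma> V" and W: "representation K \<Gamma> W"
    and f: "f \<in> rep_homs K \<Gamma> V W"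
  shows "(\<lambda>\<phi>. \<lambda>v\<in>carrier V. \<phi> (f v)) \<in> rep_homs K \<Gamma> (contragredient K \<Gamma> W) (contragredient K \<Gamma> V)"
proof -
  interpret \<Gamma>: group \<Gamma> by fact
  interpret V: group_representation \<Gamma> K V using V by unfold_locales
  have fl: "f \<in> linear_maps K V W" using f by (simp add: rep_homs_def)
  have "(\<lambda>\<phi>. \<lambda>v\<in>carrier V. \<phi> (f v)) \<in> linear_maps K (contragredient K \<Gamma> W) (contragredient K \<Gamma> V)"
    using transpose_linear[OF fl V.rep_module] by (simp add: linear_maps_def)
  then show ?thesis
    using f linear_mapsD(1)[OF fl] by (auto simp: rep_homs_def V.act_closed intro!: restrict_ext)
qed

section \<open>The Calabi--Yau pairing and the linear structure of Ext\<close>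

locale cy_category = exact_category K C
  for K :: "('k, 'r) ring_scheme" and C :: "('k, 'o, 'm) ex_cat" (structure) +
  fixes c :: "('k, 'o, 'm) cy_map"
  assumes cy: "cy_iso K C c"
begin

lemma cy_linear_iso: "\<lbrakk>X \<in> Ob C; Y \<in> Ob C\<rbrakk> \<Longrightarrow> c X Y \<in> linear_isos K (Ext C X Y) (dual K (Ext C Y X))"
  using cy by (simp add: cy_iso_def)

lemma cy_linear: "\<lbrakk>X \<in> Ob C; Y \<in> Ob C\<rbrakk> \<Longrightarrow> c X Y \<in> linear_maps K (Ext C X Y) (dual K (Ext C Y X))"
  using cy_linear_iso by (simp add: linear_isos_def)

lemma cy_bij: "\<lbrakk>X \<in> Ob C; Y \<in> Ob C\<rbrakk> \<Longrightarrow> bij_betw (c X Y) (carrier (Ext C X Y)) (carrier (dual K (Ext C Y X)))"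
  using cy_linear_iso by (simp add: linear_isos_def)

text \<open>Nondegeneracy of the pairing: functionals are extensional and \<open>c X Y\<close> is
  injective, so a class is determined by its values. Identities between classes can thus be tested
  in \<open>K\<close>.\<close>

lemma cy_eqI:
  assumes X: "X \<in> Ob C" "Y \<in> Ob C" and \<xi>: "\<xi> \<in> carrier (Ext C X Y)" "\<xi>' \<in> carrier (Ext C X Y)"
    and eq: "\<And>\<eta>. \<eta> \<in> carrier (Ext C Y X) \<Longrightarrow> c X Y \<xi> \<eta> = c X Y \<xi>' \<eta>"
  shows "\<xi> = \<xi>'"
proof -
  have "c X Y \<xi> = c X Y \<xi>'"
    using dual_ext[OF linear_mapsD(1)[OF cy_linear[OF X] \<xi>(1)] linear_mapsD(1)[OF cy_linear[OF X] \<xi>(2)]] eq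
    by blast
  then show ?thesis using cy_bij[OF X] \<xi> by (auto simp: bij_betw_def inj_on_def)
qed

lemma cy_add: "\<lbrakk>X \<in> Ob C; Y \<in> Ob C; \<xi> \<in> carrier (Ext C X Y); \<xi>' \<in> carrier (Ext C X Y); \<eta> \<in> carrier (Ext C Y X)\<rbrakk>
    \<Longrightarrow> c X Y (\<xi> \<oplus>\<^bsub>Ext C X Y\<^esub> \<xi>') \<eta> = c X Y \<xi> \<eta> \<oplus>\<^bsub>K\<^esub> c X Y \<xi>' \<eta>"
  using linear_mapsD(2)[OF cy_linear] by (simp add: dual_add_apply)

lemma cy_smult: "\<lbrakk>X \<in> Ob C; Y \<in> Ob C; a \<in> carrier K; \<xi> \<in> carrier (Ext C X Y); \<eta> \<in> carrier (Ext C Y X)\<rbrakk>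
    \<Longrightarrow> c X Y (a \<odot>\<^bsub>Ext C X Y\<^esub> \<xi>) \<eta> = a \<otimes>\<^bsub>K\<^esub> c X Y \<xi> \<eta>"
  using linear_mapsD(3)[OF cy_linear] by (simp add: dual_smult_apply)

text \<open>Read through the pairing, naturality makes Ext(a, b) and Ext(b, a) adjoint to each
  other.\<close>

lemma cy_natural:
  assumes \<xi>: "\<xi> \<in> carrier (Ext C X Y)" and a: "a \<in> arr C X' X" and b: "b \<in> arr C Y Y'"
    and \<eta>: "\<eta> \<in> carrier (Ext C Y' X')"
  shows "c X' Y' (ext_map C X X' Y' a b \<xi>) \<eta> = c X Y \<xi> (ext_map C Y' Y X b a \<eta>)"
proof -
  have "c X' Y' (ext_map C X X' Y' a b \<xi>) = (\<lambda>\<eta>\<in>carrier (Ext C Y' X'). c X Y \<xi> (ext_map C Y' Y X b a \<eta>))"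
    using cy \<xi> a b by (auto simp: cy_iso_def arr_def)
  then show ?thesis using \<eta> by simp
qed

lemma Ext_add_closed: "\<lbrakk>\<xi> \<in> carrier (Ext C X Y); \<xi>' \<in> carrier (Ext C X Y)\<rbrakk> \<Longrightarrow> \<xi> \<oplus>\<^bsub>Ext C X Y\<^esub> \<xi>' \<in> carrier (Ext C X Y)"
  by (simp add: Ext_add baer_sum_closed)

text \<open>
  The vector space axioms of \<open>Ext\<close> need no diagram chase: they are transported from the dual of
  \<open>Ext C Y X\<close>, whose operations are pointwise.
\<close>

lemma Ext_module: assumes X: "X \<in> Ob C" "Y \<in> Ob C" shows "module K (Ext C X Y)"
proof -
  interpret K: field K by (rule field_K)
  have D: "module K (dual K (Ext C Y X))"
    by (rule module_dual[OF K.cring_axioms Ext_add_closed Ext_smult_closed])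
  interpret D: module K "dual K (Ext C Y X)" by (rule D)
  have z: "\<zero>\<^bsub>Ext C X Y\<^esub> \<in> carrier (Ext C X Y)" using Ext_zero_closed[OF X] .
  note l = linear_mapsD[OF cy_linear[OF X]]
  show ?thesis
  proof (rule module_transport[OF D cy_bij[OF X]])
    show "c X Y \<zero>\<^bsub>Ext C X Y\<^esub> = \<zero>\<^bsub>dual K (Ext C Y X)\<^esub>"
      using l(3)[OF K.zero_closed z] Ext_zero_smult[OF z] D.smult_l_null[OF l(1)[OF z]] by simp
  qed (simp_all add: z l Ext_add_closed Ext_smult_closed)
qed

text \<open>A map with an adjoint for a nondegenerate pairing is linear: adjunction moves the map to
  the second argument, and the pairing is linear in the first. This replaces a comparison of Baer
  sums along pushouts and pullbacks.\<close>

lemma ext_map_linear: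
  assumes a: "a \<in> arr C X' X" and b: "b \<in> arr C Y Y'"
  shows "ext_map C X X' Y' a b \<in> linear_maps K (Ext C X Y) (Ext C X' Y')"
proof -
  note X = arr_cod[OF a] arr_dom[OF b] and X' = arr_dom[OF a] arr_cod[OF b]
  note cl = ext_map_closed[OF _ a b] and cl' = ext_map_closed[OF _ b a]
  note nat = cy_natural[OF _ a b]
  show ?thesis unfolding linear_maps_def
  proof (intro CollectI conjI ballI funcsetI)
    show "\<And>\<xi>. \<xi> \<in> carrier (Ext C X Y) \<Longrightarrow> ext_map C X X' Y' a b \<xi> \<in> carrier (Ext C X' Y')" by (rule cl)
    fix \<xi> \<xi>' assume \<xi>: "\<xi> \<in> carrier (Ext C X Y)" "\<xi>' \<in> carrier (Ext C X Y)"
    show "ext_map C X X' Y' a b (\<xi> \<oplus>\<^bsub>Ext C X Y\<^esub> \<xi>')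
        = ext_map C X X' Y' a b \<xi> \<oplus>\<^bsub>Ext C X' Y'\<^esub> ext_map C X X' Y' a b \<xi>'"
      by (rule cy_eqI[OF X'])
         (simp_all add: cl cl' \<xi> Ext_add_closed nat cy_add X X')
  next
    fix r \<xi> assume r: "r \<in> carrier K" and \<xi>: "\<xi> \<in> carrier (Ext C X Y)"
    show "ext_map C X X' Y' a b (r \<odot>\<^bsub>Ext C X Y\<^esub> \<xi>) = r \<odot>\<^bsub>Ext C X' Y'\<^esub> ext_map C X X' Y' a b \<xi>"
      by (rule cy_eqI[OF X'])
         (simp_all add: cl cl' r \<xi> Ext_smult_closed nat cy_smult X X')
  qed
qed

end


section \<open>Equivariant objects\<close>

text \<open>A two-out-of-six argument: the first isomorphism gives \<open>m\<close> a left inverse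
  and the second a right inverse, so \<open>m\<close> is invertible and with it
  \<open>p\<close>.\<close>

lemma (in linear_category) iso_of_split:
  assumes pm: "p \<bullet> m \<in> isos C A D" and mq: "m \<bullet> q \<in> isos C Z B"
    and m: "m \<in> arr C A B" and p: "p \<in> arr C B D" and q: "q \<in> arr C Z A"
  shows "p \<in> isos C B D"
proof -
  from isosE[OF pm arr_dom[OF m] arr_cod[OF p]] obtain s where
    s: "s \<in> arr C D A" "s \<bullet> (p \<bullet> m) = Id C A" "(p \<bullet> m) \<bullet> s = Id C D" .
  from isosE[OF mq arr_dom[OF q] arr_cod[OF m]] obtain t where
    t: "t \<in> arr C B Z" "t \<bullet> (m \<bullet> q) = Id C Z" "(m \<bullet> q) \<bullet> t = Id C B" .
  have r: "q \<bullet> t \<in> arr C B A" "m \<bullet> (q \<bullet> t) = Id C B" using comp[OF t(1) q] assoc[OF t(1) q m] t by simp_all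
  have sp: "s \<bullet> p \<in> arr C B A" "(s \<bullet> p) \<bullet> m = Id C A" using comp[OF p s(1)] assoc[OF m p s(1)] s by simp_all
  have "s \<bullet> p = q \<bullet> t"
    using assoc[OF r(1) m sp(1)] r sp idl[OF r(1)] idr[OF sp(1)] by metis
  then have "m \<bullet> (s \<bullet> p) = Id C B" using r by simp
  then show ?thesis
    using isosI[OF p comp[OF s(1) m]] assoc[OF p s(1) m] assoc[OF s(1) m p] s(3) by simp
qed

locale equivariant = exact_category K C + category_action K \<Gamma> C T + G: group \<Gamma>
  for K :: "('k, 'r) ring_scheme" and \<Gamma> :: "('g, 's) monoid_scheme"
    and C :: "('k, 'o, 'm) ex_cat" (structure) and T :: "('g, 'o, 'm) action_data" +
  assumes action_exact: "exact_action \<Gamma> C T"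
begin

abbreviation "ob \<equiv> act_ob T"
abbreviation "mo \<equiv> act_mor T"
abbreviation "asc \<equiv> act_assoc T"
abbreviation "unt \<equiv> act_unit T"
abbreviation "D \<equiv> equivariant_category \<Gamma> C T"

lemma mo_arr: "\<lbrakk>g \<in> carrier \<Gamma>; f \<in> arr C X Y\<rbrakk> \<Longrightarrow> mo g f \<in> arr C (ob g X) (ob g Y)"
  using act_ob_closed linear_mapsD(1)[OF act_mor_linear] by (auto simp: arr_def)

lemma mo_comp: "\<lbrakk>g \<in> carrier \<Gamma>; f \<in> arr C X Y; f' \<in> arr C Y Z\<rbrakk> \<Longrightarrow> mo g (f' \<bullet> f) = mo g f' \<bullet> mo g f"
  using act_mor_Comp by (auto simp: arr_def)

lemma mo_add: "\<lbrakk>g \<in> carrier \<Gamma>; f \<in> arr C X Y; f' \<in> arr C X Y\<rbrakk>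
    \<Longrightarrow> mo g (f \<oplus>\<^bsub>Hom C X Y\<^esub> f') = mo g f \<oplus>\<^bsub>Hom C (ob g X) (ob g Y)\<^esub> mo g f'"
  using linear_mapsD(2)[OF act_mor_linear] by (auto simp: arr_def)

lemma mo_smult: "\<lbrakk>g \<in> carrier \<Gamma>; a \<in> carrier K; f \<in> arr C X Y\<rbrakk>
    \<Longrightarrow> mo g (a \<odot>\<^bsub>Hom C X Y\<^esub> f) = a \<odot>\<^bsub>Hom C (ob g X) (ob g Y)\<^esub> mo g f"
  using linear_mapsD(3)[OF act_mor_linear] by (auto simp: arr_def)

lemma mo_zero:
  assumes g: "g \<in> carrier \<Gamma>" and X: "X \<in> Ob C" "Y \<in> Ob C"
  shows "mo g \<zero>\<^bsub>Hom C X Y\<^esub> = \<zero>\<^bsub>Hom C (ob g X) (ob g Y)\<^esub>"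
  using mo_add[OF g zero_arr[OF X] zero_arr[OF X]] add_zero[OF zero_arr[OF X]]
    add_eq_self_iff[OF mo_arr[OF g zero_arr[OF X]] mo_arr[OF g zero_arr[OF X]]] by simp

lemma mo_inj: "\<lbrakk>g \<in> carrier \<Gamma>; f \<in> arr C X Y; f' \<in> arr C X Y; mo g f = mo g f'\<rbrakk> \<Longrightarrow> f = f'"
  using act_fully_faithful[of g X Y] by (auto simp: arr_def bij_betw_def inj_on_def)

lemma mo_full:
  assumes g: "g \<in> carrier \<Gamma>" and X: "X \<in> Ob C" "Y \<in> Ob C" and f: "f \<in> arr C (ob g X) (ob g Y)"
  obtains f' where "f' \<in> arr C X Y" "mo g f' = f"
  using act_fully_faithful[OF g X] f X by (auto simp: arr_def bij_betw_def image_iff elim!: equalityE)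

lemma asc_arr: "\<lbrakk>g \<in> carrier \<Gamma>; h \<in> carrier \<Gamma>; X \<in> Ob C\<rbrakk> \<Longrightarrow> asc g h X \<in> arr C (ob (g \<otimes>\<^bsub>\<Gamma>\<^esub> h) X) (ob g (ob h X))"
  using act_assoc_iso[of g h X] act_ob_closed by (auto simp: arr_def isos_def)

lemma asc_natural: "\<lbrakk>g \<in> carrier \<Gamma>; h \<in> carrier \<Gamma>; f \<in> arr C X Y\<rbrakk>
    \<Longrightarrow> asc g h Y \<bullet> mo (g \<otimes>\<^bsub>\<Gamma>\<^esub> h) f = mo g (mo h f) \<bullet> asc g h X"
  using act_assoc_natural by (auto simp: arr_def)

lemma unt_arr: "X \<in> Ob C \<Longrightarrow> unt X \<in> arr C (ob \<one>\<^bsub>\<Gamma>\<^esub> X) X"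
  using act_unit_iso[of X] act_ob_closed by (auto simp: arr_def isos_def)

lemma unt_natural: "f \<in> arr C X Y \<Longrightarrow> unt Y \<bullet> mo \<one>\<^bsub>\<Gamma>\<^esub> f = f \<bullet> unt X"
  using act_unit_natural by (auto simp: arr_def)

lemma mo_isos:
  assumes g: "g \<in> carrier \<Gamma>" and X: "X \<in> Ob C" "Y \<in> Ob C" and f: "f \<in> isos C X Y"
  shows "mo g f \<in> isos C (ob g X) (ob g Y)"
proof -
  from isosE[OF f X] obtain f' where f': "f \<in> arr C X Y" "f' \<in> arr C Y X" "f' \<bullet> f = Id C X" "f \<bullet> f' = Id C Y" .
  show ?thesis
    using isosI[OF mo_arr[OF g f'(1)] mo_arr[OF g f'(2)]] mo_comp[OF g f'(1,2)] mo_comp[OF g f'(2,1)] f'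
      act_mor_Id[OF g X(1)] act_mor_Id[OF g X(2)] by simp
qed

text \<open>
  A morphism \<open>ob g X \<rightarrow> Y\<close> is viewed as a morphism of degree \<open>g\<close> from \<open>X\<close> to \<open>Y\<close>; \<open>gc\<close> composes
  such morphisms. An equivariant structure is then a family of endomorphisms of all degrees which is
  multiplicative for this composition.
\<close>

definition gc :: "'g \<Rightarrow> 'g \<Rightarrow> 'o \<Rightarrow> 'm \<Rightarrow> 'm \<Rightarrow> 'm" where
  "gc g h X f e = f \<bullet> mo g e \<bullet> asc g h X"

context
  fixes g h assumes g: "g \<in> carrier \<Gamma>" and h: "h \<in> carrier \<Gamma>"
begin

lemma gc_arr:
  assumes e: "e \<in> arr C (ob h X) Y" and f: "f \<in> arr C (ob g Y) Z" and X: "X \<in> Ob C"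
  shows "gc g h X f e \<in> arr C (ob (g \<otimes>\<^bsub>\<Gamma>\<^esub> h) X) Z"
  unfolding gc_def by (rule comp[OF asc_arr[OF g h X] comp[OF mo_arr[OF g e] f]])

text \<open>Together with \<open>gc_mid\<close> and \<open>gc_pre\<close> this lets ordinary
  morphisms move through graded composition at its end, in its middle and at its start.
  Verifications for products of group elements become chains of such moves.\<close>

lemma gc_post:
  assumes e: "e \<in> arr C (ob h X) Y" and f: "f \<in> arr C (ob g Y) Z" and X: "X \<in> Ob C" and t: "t \<in> arr C Z W"
  shows "gc g h X (t \<bullet> f) e = t \<bullet> gc g h X f e"
  unfolding gc_def
  using assoc[OF asc_arr[OF g h X] comp[OF mo_arr[OF g e] f] t] assoc[OF mo_arr[OF g e] f t] by metis

lemma gc_mid: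
  assumes e: "e \<in> arr C (ob h X) Y" and f: "f \<in> arr C (ob g Y') Z" and t: "t \<in> arr C Y Y'"
  shows "gc g h X (f \<bullet> mo g t) e = gc g h X f (t \<bullet> e)"
  unfolding gc_def using assoc[OF mo_arr[OF g e] mo_arr[OF g t] f] mo_comp[OF g e t] by metis

text \<open>The place where naturality of the associativity isomorphism enters.\<close>

lemma gc_pre:
  assumes e: "e \<in> arr C (ob h X) Y" and f: "f \<in> arr C (ob g Y) Z" and t: "t \<in> arr C X' X"
  shows "gc g h X' f (e \<bullet> mo h t) = gc g h X f e \<bullet> mo (g \<otimes>\<^bsub>\<Gamma>\<^esub> h) t"
proof -
  have gh: "g \<otimes>\<^bsub>\<Gamma>\<^esub> h \<in> carrier \<Gamma>" using g h by simp
  note a = asc_arr[OF g h arr_dom[OF t]] asc_arr[OF g h arr_cod[OF t]]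
  note me = mo_arr[OF g e] and mt = mo_arr[OF g mo_arr[OF h t]]
  have "gc g h X f e \<bullet> mo (g \<otimes>\<^bsub>\<Gamma>\<^esub> h) t = (f \<bullet> mo g e) \<bullet> (mo g (mo h t) \<bullet> asc g h X')"
    unfolding gc_def
    using assoc[OF mo_arr[OF gh t] a(2) comp[OF me f]] asc_natural[OF g h t] by metis
  also have "\<dots> = (f \<bullet> (mo g e \<bullet> mo g (mo h t))) \<bullet> asc g h X'"
    using assoc[OF a(1) mt comp[OF me f]] assoc[OF mt me f] by metis
  finally show ?thesis unfolding gc_def using mo_comp[OF g mo_arr[OF h t] e] by simp
qed

end

text \<open>Associativity of graded composition is the pentagon, once functoriality has collected
  the morphisms in front of the associativity isomorphisms.\<close>

lemma gc_assoc:
  assumes g: "g \<in> carrier \<Gamma>" and h: "h \<in> carrier \<Gamma>" and k: "k \<in> carrier \<Gamma>" and X: "X \<in> Ob C"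
    and d: "d \<in> arr C (ob k X) Y" and e: "e \<in> arr C (ob h Y) Z" and f: "f \<in> arr C (ob g Z) W"
  shows "gc (g \<otimes>\<^bsub>\<Gamma>\<^esub> h) k X (gc g h Y f e) d = gc g (h \<otimes>\<^bsub>\<Gamma>\<^esub> k) X f (gc h k X e d)"
proof -
  have gh: "g \<otimes>\<^bsub>\<Gamma>\<^esub> h \<in> carrier \<Gamma>" and hk: "h \<otimes>\<^bsub>\<Gamma>\<^esub> k \<in> carrier \<Gamma>" using g h k by simp_all
  have eq: "(g \<otimes>\<^bsub>\<Gamma>\<^esub> h) \<otimes>\<^bsub>\<Gamma>\<^esub> k = g \<otimes>\<^bsub>\<Gamma>\<^esub> (h \<otimes>\<^bsub>\<Gamma>\<^esub> k)" using g h k by (rule G.m_assoc)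
  note oX = act_ob_closed[OF k X]
  note a1 = asc_arr[OF gh k X, unfolded eq] and a2 = asc_arr[OF g h oX]
    and a3 = asc_arr[OF g hk X] and a4 = mo_arr[OF g asc_arr[OF h k X]]
  note md = mo_arr[OF g mo_arr[OF h d]]
  note fe = comp[OF mo_arr[OF g e] f]
  have "gc (g \<otimes>\<^bsub>\<Gamma>\<^esub> h) k X (gc g h Y f e) d = gc g h (ob k X) f (e \<bullet> mo h d) \<bullet> asc (g \<otimes>\<^bsub>\<Gamma>\<^esub> h) k X"
    unfolding gc_def[of "g \<otimes>\<^bsub>\<Gamma>\<^esub> h"] using gc_pre[OF g h e f d] by simp
  also have "\<dots> = (f \<bullet> mo g (e \<bullet> mo h d)) \<bullet> (asc g h (ob k X) \<bullet> asc (g \<otimes>\<^bsub>\<Gamma>\<^esub> h) k X)"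
    unfolding gc_def
    using assoc[OF a1 a2 comp[OF mo_arr[OF g comp[OF mo_arr[OF h d] e]] f]] by simp
  also have "\<dots> = (f \<bullet> mo g (e \<bullet> mo h d)) \<bullet> (mo g (asc h k X) \<bullet> asc g (h \<otimes>\<^bsub>\<Gamma>\<^esub> k) X)"
    using act_pentagon[OF g h k X] by simp
  also have "\<dots> = (f \<bullet> (mo g (e \<bullet> mo h d) \<bullet> mo g (asc h k X))) \<bullet> asc g (h \<otimes>\<^bsub>\<Gamma>\<^esub> k) X"
    using assoc[OF a3 a4 comp[OF mo_arr[OF g comp[OF mo_arr[OF h d] e]] f]]
      assoc[OF a4 mo_arr[OF g comp[OF mo_arr[OF h d] e]] f] by simp
  finally show ?thesis
    unfolding gc_def using mo_comp[OF g asc_arr[OF h k X] comp[OF mo_arr[OF h d] e]] by simp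
qed

section \<open>Recognising equivariant structures\<close>

text \<open>Invertibility of the structure maps follows from the equations. By multiplicativity,
  \<open>\<psi> g\<close> after the translate of \<psi> at the inverse of \<open>g\<close> is the
  unit map up to an associativity isomorphism, hence invertible. The same fact for the inverse of
  \<open>g\<close>, translated by \<open>g\<close>, gives the second hypothesis of
  \<open>iso_of_split\<close>.\<close>

lemma equiv_objectsI:
  assumes X: "X \<in> Ob C" and ext: "\<psi> \<in> extensional (carrier \<Gamma>)"
    and \<psi>: "\<And>g. g \<in> carrier \<Gamma> \<Longrightarrow> \<psi> g \<in> arr C (ob g X) X"
    and mult: "\<And>g h. \<lbrakk>g \<in> carrier \<Gamma>; h \<in> carrier \<Gamma>\<rbrakk> \<Longrightarrow> \<psi> (g \<otimes>\<^bsub>\<Gamma>\<^esub> h) = gc g h X (\<psi> g) (\<psi> h)"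
    and one: "\<psi> \<one>\<^bsub>\<Gamma>\<^esub> = unt X"
  shows "(X, \<psi>) \<in> equiv_objects \<Gamma> C T"
proof -
  have split: "\<psi> g \<bullet> mo g (\<psi> (inv\<^bsub>\<Gamma>\<^esub> g)) \<in> isos C (ob g (ob (inv\<^bsub>\<Gamma>\<^esub> g) X)) X" if g: "g \<in> carrier \<Gamma>" for g
  proof -
    have g': "inv\<^bsub>\<Gamma>\<^esub> g \<in> carrier \<Gamma>" using g by simp
    note m = comp[OF mo_arr[OF g \<psi>[OF g']] \<psi>[OF g]]
    note oX = act_ob_closed[OF g act_ob_closed[OF g' X]] act_ob_closed[OF G.one_closed X]
    have as: "asc g (inv\<^bsub>\<Gamma>\<^esub> g) X \<in> isos C (ob \<one>\<^bsub>\<Gamma>\<^esub> X) (ob g (ob (inv\<^bsub>\<Gamma>\<^esub> g) X))"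
      using act_assoc_iso[OF g g' X] g by simp
    note as' = mor_inv_iso[OF as oX(2,1)]
    have eq: "(\<psi> g \<bullet> mo g (\<psi> (inv\<^bsub>\<Gamma>\<^esub> g))) \<bullet> asc g (inv\<^bsub>\<Gamma>\<^esub> g) X = unt X"
      using mult[OF g g'] g one by (simp add: gc_def)
    have "\<psi> g \<bullet> mo g (\<psi> (inv\<^bsub>\<Gamma>\<^esub> g)) = unt X \<bullet> mor_inv C (ob \<one>\<^bsub>\<Gamma>\<^esub> X) (ob g (ob (inv\<^bsub>\<Gamma>\<^esub> g) X)) (asc g (inv\<^bsub>\<Gamma>\<^esub> g) X)"
      using assoc[OF as'(2,1) m] as'(4) eq idr[OF m] by metis
    then show ?thesis using isos_comp[OF as'(5) act_unit_iso[OF X] oX(1,2) X] by simp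
  qed
  have "\<psi> g \<in> isos C (ob g X) X" if g: "g \<in> carrier \<Gamma>" for g
  proof (rule iso_of_split[OF split[OF g] _ _ \<psi>[OF g]])
    have g': "inv\<^bsub>\<Gamma>\<^esub> g \<in> carrier \<Gamma>" using g by simp
    have oX: "ob (inv\<^bsub>\<Gamma>\<^esub> g) (ob g X) \<in> Ob C" using g g' X act_ob_closed by simp
    have "\<psi> (inv\<^bsub>\<Gamma>\<^esub> g) \<bullet> mo (inv\<^bsub>\<Gamma>\<^esub> g) (\<psi> g) \<in> isos C (ob (inv\<^bsub>\<Gamma>\<^esub> g) (ob g X)) X"
      using split[OF g'] g by simp
    from mo_isos[OF g oX X this]
    show "mo g (\<psi> (inv\<^bsub>\<Gamma>\<^esub> g)) \<bullet> mo g (mo (inv\<^bsub>\<Gamma>\<^esub> g) (\<psi> g)) \<in> isos C (ob g (ob (inv\<^bsub>\<Gamma>\<^esub> g) (ob g X))) (ob g X)"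
      using mo_comp[OF g mo_arr[OF g' \<psi>[OF g]] \<psi>[OF g']] by simp
    show "mo g (\<psi> (inv\<^bsub>\<Gamma>\<^esub> g)) \<in> arr C (ob g (ob (inv\<^bsub>\<Gamma>\<^esub> g) X)) (ob g X)" using mo_arr[OF g \<psi>[OF g']] .
    show "mo g (mo (inv\<^bsub>\<Gamma>\<^esub> g) (\<psi> g)) \<in> arr C (ob g (ob (inv\<^bsub>\<Gamma>\<^esub> g) (ob g X))) (ob g (ob (inv\<^bsub>\<Gamma>\<^esub> g) X))"
      using mo_arr[OF g mo_arr[OF g' \<psi>[OF g]]] .
  qed
  then show ?thesis using X ext mult one by (auto simp: equiv_objects_def gc_def)
qed

lemma equiv_objectsD:
  assumes "(X, \<psi>) \<in> equiv_objects \<Gamma> C T"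
  shows "X \<in> Ob C" "\<psi> \<in> extensional (carrier \<Gamma>)"
    "g \<in> carrier \<Gamma> \<Longrightarrow> \<psi> g \<in> isos C (ob g X) X"
    "g \<in> carrier \<Gamma> \<Longrightarrow> \<psi> g \<in> arr C (ob g X) X"
    "\<lbrakk>g \<in> carrier \<Gamma>; h \<in> carrier \<Gamma>\<rbrakk> \<Longrightarrow> \<psi> (g \<otimes>\<^bsub>\<Gamma>\<^esub> h) = gc g h X (\<psi> g) (\<psi> h)"
    "\<psi> \<one>\<^bsub>\<Gamma>\<^esub> = unt X"
  using assms act_ob_closed[of g X] by (auto simp: equiv_objects_def gc_def isos_def arr_def)

text \<open>Translation by \<open>g\<close> is an equivalence and so preserves jointly epic
  families: up to isomorphism the target is itself a translate, by fullness both morphisms are then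
  translates of morphisms out of \<open>B\<close>, and faithfulness brings the equations down to
  these.\<close>

lemma joint_epi_act:
  assumes g: "g \<in> carrier \<Gamma>" and M: "\<And>X m. (X, m) \<in> M \<Longrightarrow> m \<in> arr C X B" and B: "B \<in> Ob C"
    and epi: "\<And>Z v w. \<lbrakk>v \<in> arr C B Z; w \<in> arr C B Z; \<And>X m. (X, m) \<in> M \<Longrightarrow> v \<bullet> m = w \<bullet> m\<rbrakk> \<Longrightarrow> v = w"
    and v: "v \<in> arr C (ob g B) Z" and w: "w \<in> arr C (ob g B) Z"
    and eq: "\<And>X m. (X, m) \<in> M \<Longrightarrow> v \<bullet> mo g m = w \<bullet> mo g m"
  shows "v = w"
proof -
  from act_ess_surj[OF g arr_cod[OF v]] obtain Z0 s where Z0: "Z0 \<in> Ob C" and s: "s \<in> isos C (ob g Z0) Z" by blast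
  from isosE[OF s act_ob_closed[OF g Z0] arr_cod[OF v]] obtain t
    where st: "s \<in> arr C (ob g Z0) Z" "t \<in> arr C Z (ob g Z0)" "t \<bullet> s = Id C (ob g Z0)" "s \<bullet> t = Id C Z" .
  from mo_full[OF g B Z0 comp[OF v st(2)]] obtain v0 where v0: "v0 \<in> arr C B Z0" "mo g v0 = t \<bullet> v" .
  from mo_full[OF g B Z0 comp[OF w st(2)]] obtain w0 where w0: "w0 \<in> arr C B Z0" "mo g w0 = t \<bullet> w" .
  have "v0 = w0"
  proof (rule epi[OF v0(1) w0(1)])
    fix X m assume m: "(X, m) \<in> M"
    note m' = M[OF m] and mm = mo_arr[OF g M[OF m]]
    show "v0 \<bullet> m = w0 \<bullet> m"
      by (rule mo_inj[OF g comp[OF m' v0(1)] comp[OF m' w0(1)]])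
         (use mo_comp[OF g m' v0(1)] mo_comp[OF g m' w0(1)] v0(2) w0(2) assoc[OF mm v st(2)] assoc[OF mm w st(2)] eq[OF m]
          in metis)
  qed
  then show ?thesis using v0(2) w0(2) assoc[OF v st(2,1)] assoc[OF w st(2,1)] st(4) idl[OF v] idl[OF w] by metis
qed

text \<open>The axioms for \<theta> are equations between morphisms out of translates of
  \<open>B\<close>. They may be tested on the translates of a jointly epic family from equivariant
  objects, where they follow from the axioms there. This puts structures on cokernels and
  pushouts.\<close>

lemma equiv_object_of_epi:
  assumes M: "\<And>X \<psi> m. (X, \<psi>, m) \<in> M \<Longrightarrow> (X, \<psi>) \<in> equiv_objects \<Gamma> C T \<and> m \<in> arr C X B \<and>
      (\<forall>g\<in>carrier \<Gamma>. m \<bullet> \<psi> g = \<theta> g \<bullet> mo g m)"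
    and epi: "\<And>Z v w. \<lbrakk>v \<in> arr C B Z; w \<in> arr C B Z; \<And>X \<psi> m. (X, \<psi>, m) \<in> M \<Longrightarrow> v \<bullet> m = w \<bullet> m\<rbrakk> \<Longrightarrow> v = w"
    and B: "B \<in> Ob C" and \<theta>: "\<And>g. g \<in> carrier \<Gamma> \<Longrightarrow> \<theta> g \<in> arr C (ob g B) B"
    and ext: "\<theta> \<in> extensional (carrier \<Gamma>)"
  shows "(B, \<theta>) \<in> equiv_objects \<Gamma> C T"
proof -
  have epi': "v = w" if g: "g \<in> carrier \<Gamma>" and v: "v \<in> arr C (ob g B) B" and w: "w \<in> arr C (ob g B) B"
    and eq: "\<And>X \<psi> m. (X, \<psi>, m) \<in> M \<Longrightarrow> v \<bullet> mo g m = w \<bullet> mo g m" for g v w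
  proof (rule joint_epi_act[OF g _ B _ v w, of "{(X, m). \<exists>\<psi>. (X, \<psi>, m) \<in> M}"])
    show "\<And>X m. (X, m) \<in> {(X, m). \<exists>\<psi>. (X, \<psi>, m) \<in> M} \<Longrightarrow> m \<in> arr C X B" using M by blast
    show "\<And>X m. (X, m) \<in> {(X, m). \<exists>\<psi>. (X, \<psi>, m) \<in> M} \<Longrightarrow> v \<bullet> mo g m = w \<bullet> mo g m" using eq by blast
    fix Z v w assume "v \<in> arr C B Z" "w \<in> arr C B Z"
      "\<And>X m. (X, m) \<in> {(X, m). \<exists>\<psi>. (X, \<psi>, m) \<in> M} \<Longrightarrow> v \<bullet> m = w \<bullet> m"
    then show "v = w" using epi by blast
  qed
  show ?thesis
  proof (rule equiv_objectsI[OF B ext \<theta>])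
    fix g h assume g: "g \<in> carrier \<Gamma>" and h: "h \<in> carrier \<Gamma>"
    have gh: "g \<otimes>\<^bsub>\<Gamma>\<^esub> h \<in> carrier \<Gamma>" using g h by simp
    show "\<theta> (g \<otimes>\<^bsub>\<Gamma>\<^esub> h) = gc g h B (\<theta> g) (\<theta> h)"
    proof (rule epi'[OF gh \<theta>[OF gh] gc_arr[OF g h \<theta>[OF h] \<theta>[OF g] B]])
      fix X \<psi> m assume "(X, \<psi>, m) \<in> M"
      from M[OF this] have X: "(X, \<psi>) \<in> equiv_objects \<Gamma> C T" and m: "m \<in> arr C X B"
        and eq: "\<And>g. g \<in> carrier \<Gamma> \<Longrightarrow> m \<bullet> \<psi> g = \<theta> g \<bullet> mo g m" by auto
      note d = equiv_objectsD[OF X]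
      show "\<theta> (g \<otimes>\<^bsub>\<Gamma>\<^esub> h) \<bullet> mo (g \<otimes>\<^bsub>\<Gamma>\<^esub> h) m = gc g h B (\<theta> g) (\<theta> h) \<bullet> mo (g \<otimes>\<^bsub>\<Gamma>\<^esub> h) m"
        using eq[OF gh] d(5)[OF g h] gc_post[OF g h d(4)[OF h] d(4)[OF g] d(1) m] eq[OF g]
          gc_mid[OF g h d(4)[OF h] \<theta>[OF g] m] eq[OF h] gc_pre[OF g h \<theta>[OF h] \<theta>[OF g] m] by metis
    qed
  next
    show "\<theta> \<one>\<^bsub>\<Gamma>\<^esub> = unt B"
    proof (rule epi'[OF G.one_closed \<theta>[OF G.one_closed] unt_arr[OF B]])
      fix X \<psi> m assume "(X, \<psi>, m) \<in> M"
      from M[OF this] have X: "(X, \<psi>) \<in> equiv_objects \<Gamma> C T" and m: "m \<in> arr C X B"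
        and eq: "\<And>g. g \<in> carrier \<Gamma> \<Longrightarrow> m \<bullet> \<psi> g = \<theta> g \<bullet> mo g m" by auto
      show "\<theta> \<one>\<^bsub>\<Gamma>\<^esub> \<bullet> mo \<one>\<^bsub>\<Gamma>\<^esub> m = unt B \<bullet> mo \<one>\<^bsub>\<Gamma>\<^esub> m"
        using eq[OF G.one_closed] equiv_objectsD(6)[OF X] unt_natural[OF m] by simp
    qed
  qed
qed

text \<open>Structure maps end in \<open>B\<close> itself, so a jointly monic family out of
  \<open>B\<close> tests the equations directly, without passing to translates of the family. This
  serves kernels, biproducts, pullbacks and the zero object.\<close>

lemma equiv_object_of_mono:
  assumes M: "\<And>X \<psi> m. (X, \<psi>, m) \<in> M \<Longrightarrow> (X, \<psi>) \<in> equiv_objects \<Gamma> C T \<and> m \<in> arr C B X \<and>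
      (\<forall>g\<in>carrier \<Gamma>. m \<bullet> \<theta> g = \<psi> g \<bullet> mo g m)"
    and mono: "\<And>Z v w. \<lbrakk>v \<in> arr C Z B; w \<in> arr C Z B; \<And>X \<psi> m. (X, \<psi>, m) \<in> M \<Longrightarrow> m \<bullet> v = m \<bullet> w\<rbrakk> \<Longrightarrow> v = w"
    and B: "B \<in> Ob C" and \<theta>: "\<And>g. g \<in> carrier \<Gamma> \<Longrightarrow> \<theta> g \<in> arr C (ob g B) B"
    and ext: "\<theta> \<in> extensional (carrier \<Gamma>)"
  shows "(B, \<theta>) \<in> equiv_objects \<Gamma> C T"
proof (rule equiv_objectsI[OF B ext \<theta>])
  fix g h assume g: "g \<in> carrier \<Gamma>" and h: "h \<in> carrier \<Gamma>"
  have gh: "g \<otimes>\<^bsub>\<Gamma>\<^esub> h \<in> carrier \<Gamma>" using g h by simp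
  show "\<theta> (g \<otimes>\<^bsub>\<Gamma>\<^esub> h) = gc g h B (\<theta> g) (\<theta> h)"
  proof (rule mono[OF \<theta>[OF gh] gc_arr[OF g h \<theta>[OF h] \<theta>[OF g] B]])
    fix X \<psi> m assume "(X, \<psi>, m) \<in> M"
    from M[OF this] have X: "(X, \<psi>) \<in> equiv_objects \<Gamma> C T" and m: "m \<in> arr C B X"
      and eq: "\<And>g. g \<in> carrier \<Gamma> \<Longrightarrow> m \<bullet> \<theta> g = \<psi> g \<bullet> mo g m" by auto
    note d = equiv_objectsD[OF X]
    show "m \<bullet> \<theta> (g \<otimes>\<^bsub>\<Gamma>\<^esub> h) = m \<bullet> gc g h B (\<theta> g) (\<theta> h)"
      using eq[OF gh] d(5)[OF g h] gc_post[OF g h \<theta>[OF h] \<theta>[OF g] B m] eq[OF g]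
        gc_mid[OF g h \<theta>[OF h] d(4)[OF g] m] eq[OF h] gc_pre[OF g h d(4)[OF h] d(4)[OF g] m] by metis
  qed
next
  show "\<theta> \<one>\<^bsub>\<Gamma>\<^esub> = unt B"
  proof (rule mono[OF \<theta>[OF G.one_closed] unt_arr[OF B]])
    fix X \<psi> m assume "(X, \<psi>, m) \<in> M"
    from M[OF this] have X: "(X, \<psi>) \<in> equiv_objects \<Gamma> C T" and m: "m \<in> arr C B X"
      and eq: "\<And>g. g \<in> carrier \<Gamma> \<Longrightarrow> m \<bullet> \<theta> g = \<psi> g \<bullet> mo g m" by auto
    show "m \<bullet> \<theta> \<one>\<^bsub>\<Gamma>\<^esub> = m \<bullet> unt B"
      using eq[OF G.one_closed] equiv_objectsD(6)[OF X] unt_natural[OF m] by simp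
  qed
qed

end


section \<open>The exact structure of the equivariant category\<close>

context equivariant
begin

lemma equivariant_category_simps [simp]:
  "Ob D = equiv_objects \<Gamma> C T" "mor D X Y = equiv_mor \<Gamma> C T X Y" "f' \<bullet>\<^bsub>D\<^esub> f = f' \<bullet> f" "Id D X = Id C (fst X)"
  "\<zero>\<^bsub>Hom D X Y\<^esub> = \<zero>\<^bsub>Hom C (fst X) (fst Y)\<^esub>"
  "f \<oplus>\<^bsub>Hom D X Y\<^esub> f' = f \<oplus>\<^bsub>Hom C (fst X) (fst Y)\<^esub> f'"
  "a \<odot>\<^bsub>Hom D X Y\<^esub> f = a \<odot>\<^bsub>Hom C (fst X) (fst Y)\<^esub> f"
  by (simp_all add: equivariant_category_def)

lemma arr_D: "f \<in> arr D (X, \<psi>) (Y, \<chi>) \<longleftrightarrow>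
    (X, \<psi>) \<in> equiv_objects \<Gamma> C T \<and> (Y, \<chi>) \<in> equiv_objects \<Gamma> C T \<and> f \<in> arr C X Y \<and>
    (\<forall>g\<in>carrier \<Gamma>. f \<bullet> \<psi> g = \<chi> g \<bullet> mo g f)"
  using equiv_objectsD(1)[of X \<psi>] equiv_objectsD(1)[of Y \<chi>] by (auto simp: arr_def equiv_mor_def)

lemma arr_D_forget: "f \<in> arr D X Y \<Longrightarrow> f \<in> arr C (fst X) (fst Y)"
  by (cases X; cases Y) (simp add: arr_D)

lemma Confl_D: "Confl D (A, \<alpha>) i (B, \<beta>) p (E, \<delta>) \<longleftrightarrow>
    i \<in> arr D (A, \<alpha>) (B, \<beta>) \<and> p \<in> arr D (B, \<beta>) (E, \<delta>) \<and> Confl C A i B p E"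
  by (auto simp: equivariant_category_def arr_def)

lemma action_Confl: "\<lbrakk>g \<in> carrier \<Gamma>; Confl C A i B p E\<rbrakk> \<Longrightarrow> Confl C (ob g A) (mo g i) (ob g B) (mo g p) (ob g E)"
  using action_exact by (simp add: exact_action_def)

section \<open>Equivariant morphisms as a linear category\<close>

lemma arr_D_comp:
  assumes f: "f \<in> arr D X Y" and f': "f' \<in> arr D Y Z" shows "f' \<bullet> f \<in> arr D X Z"
proof -
  obtain x \<psi> y \<chi> z \<omega> where XYZ: "X = (x, \<psi>)" "Y = (y, \<chi>)" "Z = (z, \<omega>)" by (metis surj_pair)
  have a: "f \<in> arr C x y" "f' \<in> arr C y z" and o: "(x, \<psi>) \<in> equiv_objects \<Gamma> C T" "(y, \<chi>) \<in> equiv_objects \<Gamma> C T"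
    "(z, \<omega>) \<in> equiv_objects \<Gamma> C T"
    using f f' by (simp_all add: XYZ arr_D)
  have "(f' \<bullet> f) \<bullet> \<psi> g = \<omega> g \<bullet> mo g (f' \<bullet> f)" if g: "g \<in> carrier \<Gamma>" for g
  proof -
    have e: "f \<bullet> \<psi> g = \<chi> g \<bullet> mo g f" "f' \<bullet> \<chi> g = \<omega> g \<bullet> mo g f'" using f f' g by (auto simp: XYZ arr_D)
    note d = equiv_objectsD(4)[OF o(1) g] equiv_objectsD(4)[OF o(2) g] equiv_objectsD(4)[OF o(3) g]
    show ?thesis
      using e mo_comp[OF g a] assoc[OF d(1) a] assoc[OF mo_arr[OF g a(1)] d(2) a(2)]
        assoc[OF mo_arr[OF g a(1)] mo_arr[OF g a(2)] d(3)] by metis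
  qed
  then show ?thesis using o comp[OF a] by (simp add: XYZ arr_D)
qed

lemma arr_D_Id: assumes "X \<in> equiv_objects \<Gamma> C T" shows "Id C (fst X) \<in> arr D X X"
proof -
  obtain x \<psi> where X: "X = (x, \<psi>)" by (metis surj_pair)
  note o = assms[unfolded X]
  note x = equiv_objectsD(1)[OF o]
  show ?thesis
    using o Id_arr[OF x] act_mor_Id[OF _ x] idl[OF equiv_objectsD(4)[OF o]] idr[OF equiv_objectsD(4)[OF o]]
    by (simp add: X arr_D)
qed

lemma arr_D_add:
  assumes f: "f \<in> arr D X Y" and f': "f' \<in> arr D X Y"
  shows "f \<oplus>\<^bsub>Hom C (fst X) (fst Y)\<^esub> f' \<in> arr D X Y"
proof -
  obtain x \<psi> y \<chi> where XY: "X = (x, \<psi>)" "Y = (y, \<chi>)" by (metis surj_pair)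
  have a: "f \<in> arr C x y" "f' \<in> arr C x y" and o: "(x, \<psi>) \<in> equiv_objects \<Gamma> C T" "(y, \<chi>) \<in> equiv_objects \<Gamma> C T"
    using f f' by (simp_all add: XY arr_D)
  have "(f \<oplus>\<^bsub>Hom C x y\<^esub> f') \<bullet> \<psi> g = \<chi> g \<bullet> mo g (f \<oplus>\<^bsub>Hom C x y\<^esub> f')" if g: "g \<in> carrier \<Gamma>" for g
    using add_comp[OF equiv_objectsD(4)[OF o(1) g] a] comp_add[OF mo_arr[OF g a(1)] mo_arr[OF g a(2)] equiv_objectsD(4)[OF o(2) g]]
      mo_add[OF g a] f f' g by (simp add: XY arr_D)
  then show ?thesis using o add_arr[OF a] by (simp add: XY arr_D)
qed

lemma arr_D_smult:
  assumes r: "r \<in> carrier K" and f: "f \<in> arr D X Y"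
  shows "r \<odot>\<^bsub>Hom C (fst X) (fst Y)\<^esub> f \<in> arr D X Y"
proof -
  obtain x \<psi> y \<chi> where XY: "X = (x, \<psi>)" "Y = (y, \<chi>)" by (metis surj_pair)
  have a: "f \<in> arr C x y" and o: "(x, \<psi>) \<in> equiv_objects \<Gamma> C T" "(y, \<chi>) \<in> equiv_objects \<Gamma> C T"
    using f by (simp_all add: XY arr_D)
  have "(r \<odot>\<^bsub>Hom C x y\<^esub> f) \<bullet> \<psi> g = \<chi> g \<bullet> mo g (r \<odot>\<^bsub>Hom C x y\<^esub> f)" if g: "g \<in> carrier \<Gamma>" for g
    using smult_comp[OF r equiv_objectsD(4)[OF o(1) g] a] comp_smult[OF r mo_arr[OF g a] equiv_objectsD(4)[OF o(2) g]]
      mo_smult[OF g r a] f g by (simp add: XY arr_D)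
  then show ?thesis using o smult_arr[OF r a] by (simp add: XY arr_D)
qed

lemma arr_D_zero:
  assumes "X \<in> equiv_objects \<Gamma> C T" "Y \<in> equiv_objects \<Gamma> C T" shows "\<zero>\<^bsub>Hom C (fst X) (fst Y)\<^esub> \<in> arr D X Y"
proof -
  obtain x \<psi> y \<chi> where XY: "X = (x, \<psi>)" "Y = (y, \<chi>)" by (metis surj_pair)
  note o = assms[unfolded XY]
  note x = equiv_objectsD(1)[OF o(1)] equiv_objectsD(1)[OF o(2)]
  have "\<zero>\<^bsub>Hom C x y\<^esub> \<bullet> \<psi> g = \<chi> g \<bullet> mo g \<zero>\<^bsub>Hom C x y\<^esub>" if g: "g \<in> carrier \<Gamma>" for g
    using zero_comp[OF x(2) equiv_objectsD(4)[OF o(1) g]] mo_zero[OF g x]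
      comp_zero[OF act_ob_closed[OF g x(1)] equiv_objectsD(4)[OF o(2) g]] by simp
  then show ?thesis using o zero_arr[OF x] by (simp add: XY arr_D)
qed

lemma mor_D: "\<lbrakk>X \<in> equiv_objects \<Gamma> C T; Y \<in> equiv_objects \<Gamma> C T\<rbrakk> \<Longrightarrow> f \<in> equiv_mor \<Gamma> C T X Y \<longleftrightarrow> f \<in> arr D X Y"
  by (simp add: arr_def)

lemma fst_equiv_object: "X \<in> equiv_objects \<Gamma> C T \<Longrightarrow> fst X \<in> Ob C"
  by (cases X) (simp add: equiv_objectsD)

text \<open>Equivariance is a linear condition, so equivariant morphisms form a submodule of the Hom
  space; the equational axioms are inherited from \<open>C\<close>.\<close>

lemma linear_category_D: "linear_category K D"
proof (rule linear_category.intro)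
  note mor_C = arr_mor[OF arr_D_forget]
  show "field K" by (rule field_K)
  show "module K (Hom D X Y)" if XY: "X \<in> Ob D" "Y \<in> Ob D" for X Y
  proof -
    have o: "X \<in> equiv_objects \<Gamma> C T" "Y \<in> equiv_objects \<Gamma> C T" using XY by simp_all
    interpret H: module K "Hom C (fst X) (fst Y)" using Hom_module fst_equiv_object o by blast
    have "submodule (equiv_mor \<Gamma> C T X Y) K (Hom C (fst X) (fst Y))"
    proof (rule H.submoduleI)
      show sub: "equiv_mor \<Gamma> C T X Y \<subseteq> mor C (fst X) (fst Y)"
      proof
        fix f assume "f \<in> equiv_mor \<Gamma> C T X Y"
        then have "f \<in> arr D X Y" by (simp add: mor_D[OF o])
        then show "f \<in> mor C (fst X) (fst Y)" by (rule mor_C)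
      qed
      show "\<zero>\<^bsub>Hom C (fst X) (fst Y)\<^esub> \<in> equiv_mor \<Gamma> C T X Y" using arr_D_zero[OF o] by (simp add: mor_D[OF o])
      show "\<And>f. f \<in> equiv_mor \<Gamma> C T X Y \<Longrightarrow> \<ominus>\<^bsub>Hom C (fst X) (fst Y)\<^esub> f \<in> equiv_mor \<Gamma> C T X Y"
      proof -
        fix f assume f: "f \<in> equiv_mor \<Gamma> C T X Y"
        then have fC: "f \<in> mor C (fst X) (fst Y)" using sub by blast
        have "\<ominus>\<^bsub>Hom C (fst X) (fst Y)\<^esub> f = (\<ominus>\<^bsub>K\<^esub> \<one>\<^bsub>K\<^esub>) \<odot>\<^bsub>Hom C (fst X) (fst Y)\<^esub> f"
          using H.smult_l_minus[OF H.R.one_closed fC] fC by simp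
        then show "\<ominus>\<^bsub>Hom C (fst X) (fst Y)\<^esub> f \<in> equiv_mor \<Gamma> C T X Y"
          using arr_D_smult f by (simp add: mor_D[OF o])
      qed
    qed (simp_all add: mor_D[OF o] arr_D_add arr_D_smult)
    from submodule.submodule_is_module[OF this H.module_axioms]
    show ?thesis by (simp add: equivariant_category_def)
  qed
  show "\<And>X. X \<in> Ob D \<Longrightarrow> Id D X \<in> mor D X X" using arr_D_Id by (simp add: mor_D)
  show "f' \<bullet>\<^bsub>D\<^esub> f \<in> mor D X Z" if "X \<in> Ob D" "Y \<in> Ob D" "Z \<in> Ob D" "f \<in> mor D X Y" "f' \<in> mor D Y Z" for X Y Z f f'
    using that arr_D_comp[of f X Y f' Z] by (simp add: mor_D)
  show "f \<bullet>\<^bsub>D\<^esub> Id D X = f" if "X \<in> Ob D" "Y \<in> Ob D" "f \<in> mor D X Y" for X Y f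
    using that idr[OF arr_D_forget[of f X Y]] by (simp add: mor_D)
  show "Id D Y \<bullet>\<^bsub>D\<^esub> f = f" if "X \<in> Ob D" "Y \<in> Ob D" "f \<in> mor D X Y" for X Y f
    using that idl[OF arr_D_forget[of f X Y]] by (simp add: mor_D)
  show "h \<bullet>\<^bsub>D\<^esub> (g \<bullet>\<^bsub>D\<^esub> f) = h \<bullet>\<^bsub>D\<^esub> g \<bullet>\<^bsub>D\<^esub> f"
    if "W \<in> Ob D" "X \<in> Ob D" "Y \<in> Ob D" "Z \<in> Ob D" "f \<in> mor D W X" "g \<in> mor D X Y" "h \<in> mor D Y Z" for W X Y Z f g h
    using that assoc[OF arr_D_forget[of f W X] arr_D_forget[of g X Y] arr_D_forget[of h Y Z]] by (simp add: mor_D)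
  show "(\<lambda>f. g \<bullet>\<^bsub>D\<^esub> f) \<in> linear_maps K (Hom D X Y) (Hom D X Z)"
    if h: "X \<in> Ob D" "Y \<in> Ob D" "Z \<in> Ob D" "g \<in> mor D Y Z" for X Y Z g
  proof -
    have o: "X \<in> equiv_objects \<Gamma> C T" "Y \<in> equiv_objects \<Gamma> C T" "Z \<in> equiv_objects \<Gamma> C T" using h by simp_all
    have g: "g \<in> arr D Y Z" using h by (simp add: mor_D)
    show ?thesis
      unfolding linear_maps_def
      using arr_D_comp[OF _ g] comp_add[OF arr_D_forget arr_D_forget arr_D_forget[OF g]]
        comp_smult[OF _ arr_D_forget arr_D_forget[OF g]] o by (auto simp: mor_D)
  qed
  show "(\<lambda>g. g \<bullet>\<^bsub>D\<^esub> f) \<in> linear_maps K (Hom D Y Z) (Hom D X Z)"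
    if h: "X \<in> Ob D" "Y \<in> Ob D" "Z \<in> Ob D" "f \<in> mor D X Y" for X Y Z f
  proof -
    have o: "X \<in> equiv_objects \<Gamma> C T" "Y \<in> equiv_objects \<Gamma> C T" "Z \<in> equiv_objects \<Gamma> C T" using h by simp_all
    have f: "f \<in> arr D X Y" using h by (simp add: mor_D)
    show ?thesis
      unfolding linear_maps_def
      using arr_D_comp[OF f] add_comp[OF arr_D_forget[OF f] arr_D_forget arr_D_forget]
        smult_comp[OF _ arr_D_forget[OF f] arr_D_forget] o by (auto simp: mor_D)
  qed
qed

section \<open>Lifting kernels, cokernels, sums, pushouts and pullbacks\<close>

text \<open>Structure maps are found one group element at a time; the chosen family is cut down to
  the carrier because equivariant objects require extensional families.\<close>

lemma equivariant_structure_choice: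
  assumes "\<And>g. g \<in> carrier \<Gamma> \<Longrightarrow> \<exists>t. t \<in> arr C (ob g B) B \<and> P g t"
  shows "\<exists>\<theta>. \<theta> \<in> extensional (carrier \<Gamma>) \<and> (\<forall>g\<in>carrier \<Gamma>. \<theta> g \<in> arr C (ob g B) B) \<and> (\<forall>g\<in>carrier \<Gamma>. P g (\<theta> g))"
proof -
  obtain \<theta> where "\<forall>g\<in>carrier \<Gamma>. \<theta> g \<in> arr C (ob g B) B \<and> P g (\<theta> g)"
    using bchoice[of "carrier \<Gamma>" "\<lambda>g t. t \<in> arr C (ob g B) B \<and> P g t"] assms by blast
  then show ?thesis by (intro exI[of _ "restrict \<theta> (carrier \<Gamma>)"]) auto
qed

text \<open>By exactness of the action the translate of \<open>p\<close> is again a cokernel, so the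
  structure of \<open>B\<close> descends to \<open>E\<close> and the conflation of \<open>C\<close>
  becomes equivariant.\<close>

lemma inflation_D:
  assumes i: "i \<in> arr D (A, \<alpha>) (B, \<beta>)" and inf: "inflation C A i B"
  shows "inflation D (A, \<alpha>) i (B, \<beta>)"
proof -
  from inf obtain p E where c: "Confl C A i B p E" by (auto simp: inflation_def)
  note a = Confl_arr[OF c]
  have A: "(A, \<alpha>) \<in> equiv_objects \<Gamma> C T" and B: "(B, \<beta>) \<in> equiv_objects \<Gamma> C T"
    and eq: "\<And>g. g \<in> carrier \<Gamma> \<Longrightarrow> i \<bullet> \<alpha> g = \<beta> g \<bullet> mo g i" using i by (auto simp: arr_D)
  have "\<exists>t. t \<in> arr C (ob g E) E \<and> p \<bullet> \<beta> g = t \<bullet> mo g p" if g: "g \<in> carrier \<Gamma>" for g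
  proof -
    note \<alpha> = equiv_objectsD(4)[OF A g] and \<beta> = equiv_objectsD(4)[OF B g]
    have "(p \<bullet> \<beta> g) \<bullet> mo g i = \<zero>\<^bsub>Hom C (ob g A) E\<^esub>"
      using assoc[OF mo_arr[OF g a(1)] \<beta> a(2)] eq[OF g] assoc[OF \<alpha> a(1,2)] a(3)
        zero_comp[OF arr_cod[OF a(2)] \<alpha>] by metis
    from cokernel_lift[OF action_Confl[OF g c] comp[OF \<beta> a(2)] this] show ?thesis by metis
  qed
  from equivariant_structure_choice[OF this] obtain \<delta> where ext: "\<delta> \<in> extensional (carrier \<Gamma>)"
    and \<delta>: "\<And>g. g \<in> carrier \<Gamma> \<Longrightarrow> \<delta> g \<in> arr C (ob g E) E" "\<And>g. g \<in> carrier \<Gamma> \<Longrightarrow> p \<bullet> \<beta> g = \<delta> g \<bullet> mo g p" by blast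
  have "(E, \<delta>) \<in> equiv_objects \<Gamma> C T"
  proof (rule equiv_object_of_epi[of "{(B, \<beta>, p)}", OF _ _ arr_cod[OF a(2)] \<delta>(1) ext])
    fix Z v w assume "v \<in> arr C E Z" "w \<in> arr C E Z" "\<And>X \<psi> m. (X, \<psi>, m) \<in> {(B, \<beta>, p)} \<Longrightarrow> v \<bullet> m = w \<bullet> m"
    then show "v = w" using Confl_epi[OF c] by blast
  qed (use B a(2) \<delta>(2) in auto)
  then have "p \<in> arr D (B, \<beta>) (E, \<delta>)" using B a(2) \<delta>(2) by (simp add: arr_D)
  then show ?thesis using i c by (auto simp: inflation_def Confl_D)
qed

text \<open>Dually, the structure map of \<open>B\<close> restricted to the translated kernel is
  killed by \<open>p\<close>, so it lifts to a structure map of the kernel.\<close>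

lemma deflation_D:
  assumes p: "p \<in> arr D (B, \<beta>) (E, \<delta>)" and def: "deflation C B p E"
  shows "deflation D (B, \<beta>) p (E, \<delta>)"
proof -
  from def obtain i A where c: "Confl C A i B p E" by (auto simp: deflation_def)
  note a = Confl_arr[OF c]
  have E: "(E, \<delta>) \<in> equiv_objects \<Gamma> C T" and B: "(B, \<beta>) \<in> equiv_objects \<Gamma> C T"
    and eq: "\<And>g. g \<in> carrier \<Gamma> \<Longrightarrow> p \<bullet> \<beta> g = \<delta> g \<bullet> mo g p" using p by (auto simp: arr_D)
  have "\<exists>t. t \<in> arr C (ob g A) A \<and> i \<bullet> t = \<beta> g \<bullet> mo g i" if g: "g \<in> carrier \<Gamma>" for g
  proof -
    note \<delta> = equiv_objectsD(4)[OF E g] and \<beta> = equiv_objectsD(4)[OF B g]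
    note ag = Confl_arr[OF action_Confl[OF g c]]
    have "p \<bullet> (\<beta> g \<bullet> mo g i) = \<zero>\<^bsub>Hom C (ob g A) E\<^esub>"
      using assoc[OF ag(1) \<beta> a(2)] eq[OF g] assoc[OF ag(1,2) \<delta>] ag(3) comp_zero[OF arr_dom[OF ag(1)] \<delta>] by metis
    from kernel_lift[OF c comp[OF ag(1) \<beta>] this] show ?thesis by metis
  qed
  from equivariant_structure_choice[OF this] obtain \<alpha> where ext: "\<alpha> \<in> extensional (carrier \<Gamma>)"
    and \<alpha>: "\<And>g. g \<in> carrier \<Gamma> \<Longrightarrow> \<alpha> g \<in> arr C (ob g A) A" "\<And>g. g \<in> carrier \<Gamma> \<Longrightarrow> i \<bullet> \<alpha> g = \<beta> g \<bullet> mo g i" by blast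
  have "(A, \<alpha>) \<in> equiv_objects \<Gamma> C T"
  proof (rule equiv_object_of_mono[of "{(B, \<beta>, i)}", OF _ _ arr_dom[OF a(1)] \<alpha>(1) ext])
    fix Z v w assume "v \<in> arr C Z A" "w \<in> arr C Z A" "\<And>X \<psi> m. (X, \<psi>, m) \<in> {(B, \<beta>, i)} \<Longrightarrow> m \<bullet> v = m \<bullet> w"
    then show "v = w" using Confl_mono[OF c] by blast
  qed (use B a(1) \<alpha>(2) in auto)
  then have "i \<in> arr D (A, \<alpha>) (B, \<beta>)" using B a(1) \<alpha>(2) by (simp add: arr_D)
  then show ?thesis using p c by (auto simp: deflation_def Confl_D)
qed

lemma inflation_D_iff: "inflation D X i Y \<longleftrightarrow> i \<in> arr D X Y \<and> inflation C (fst X) i (fst Y)"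
proof -
  obtain x \<psi> y \<chi> where XY: "X = (x, \<psi>)" "Y = (y, \<chi>)" by (metis surj_pair)
  show ?thesis using inflation_D[of i x \<psi> y \<chi>] by (auto simp: XY inflation_def Confl_D)
qed

lemma deflation_D_iff: "deflation D X p Y \<longleftrightarrow> p \<in> arr D X Y \<and> deflation C (fst X) p (fst Y)"
proof -
  obtain x \<psi> y \<chi> where XY: "X = (x, \<psi>)" "Y = (y, \<chi>)" by (metis surj_pair)
  show ?thesis using deflation_D[of p x \<psi> y \<chi>] by (auto simp: XY deflation_def Confl_D)
qed

lemma zero_object_D: "\<exists>Z. zero_object D Z"
proof -
  obtain Z where Z: "zero_object C Z" using ex_zero_object by blast
  have ZO: "Z \<in> Ob C" using Z by (simp add: zero_object_def)
  have into: "f = \<zero>\<^bsub>Hom C X Z\<^esub>" if "f \<in> arr C X Z" for f X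
    using Z that arr_dom[OF that] by (auto simp: zero_object_def arr_def)
  have out: "f = \<zero>\<^bsub>Hom C Z X\<^esub>" if "f \<in> arr C Z X" for f X
    using Z that arr_cod[OF that] by (auto simp: zero_object_def arr_def)
  define \<theta> where "\<theta> = (\<lambda>g\<in>carrier \<Gamma>. \<zero>\<^bsub>Hom C (ob g Z) Z\<^esub>)"
  have \<theta>: "\<And>g. g \<in> carrier \<Gamma> \<Longrightarrow> \<theta> g \<in> arr C (ob g Z) Z"
    using zero_arr[OF act_ob_closed ZO] ZO by (simp add: \<theta>_def)
  have O: "(Z, \<theta>) \<in> equiv_objects \<Gamma> C T"
  \<comment> \<open>Morphisms into a zero object with a common source are equal, so the empty family
    is jointly monic and no equation remains to be checked.\<close>
  proof (rule equiv_object_of_mono[of "{}", OF _ _ ZO \<theta>])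
    show "\<theta> \<in> extensional (carrier \<Gamma>)" unfolding \<theta>_def by (rule restrict_extensional)
    show "\<And>X v w. \<lbrakk>v \<in> arr C X Z; w \<in> arr C X Z\<rbrakk> \<Longrightarrow> v = w" using into by metis
  qed auto
  have "equiv_mor \<Gamma> C T X (Z, \<theta>) = {\<zero>\<^bsub>Hom C (fst X) Z\<^esub>} \<and> equiv_mor \<Gamma> C T (Z, \<theta>) X = {\<zero>\<^bsub>Hom C Z (fst X)\<^esub>}"
    if X: "X \<in> equiv_objects \<Gamma> C T" for X
    using arr_D_zero[OF X O] arr_D_zero[OF O X] into arr_D_forget[of _ X "(Z, \<theta>)"] out arr_D_forget[of _ "(Z, \<theta>)" X]
    by (auto simp: mor_D[OF X O] mor_D[OF O X])
  then have "zero_object D (Z, \<theta>)" using O by (simp add: zero_object_def)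
  then show ?thesis ..
qed

text \<open>The structure on the sum is determined by making the projections equivariant. The
  injections are then equivariant as well, since this can be tested after the projections.\<close>

lemma biproduct_D:
  assumes X: "(X, \<psi>) \<in> equiv_objects \<Gamma> C T" and Y: "(Y, \<chi>) \<in> equiv_objects \<Gamma> C T"
  shows "\<exists>S i1 i2 p1 p2. biproduct D (X, \<psi>) (Y, \<chi>) S i1 i2 p1 p2"
proof -
  note XO = equiv_objectsD(1)[OF X] and YO = equiv_objectsD(1)[OF Y]
  obtain S i1 i2 p1 p2 where b: "biproduct C X Y S i1 i2 p1 p2" using ex_biproduct[OF XO YO] by blast
  note a = biproduct_arr[OF b XO YO]
  have "\<exists>t. t \<in> arr C (ob g S) S \<and> p1 \<bullet> t = \<psi> g \<bullet> mo g p1 \<and> p2 \<bullet> t = \<chi> g \<bullet> mo g p2" if g: "g \<in> carrier \<Gamma>" for g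
    using biproduct_pair[OF b comp[OF mo_arr[OF g a(3)] equiv_objectsD(4)[OF X g]]
       comp[OF mo_arr[OF g a(4)] equiv_objectsD(4)[OF Y g]]] by blast
  from equivariant_structure_choice[OF this] obtain \<theta> where ext: "\<theta> \<in> extensional (carrier \<Gamma>)"
    and \<theta>: "\<And>g. g \<in> carrier \<Gamma> \<Longrightarrow> \<theta> g \<in> arr C (ob g S) S"
      "\<And>g. g \<in> carrier \<Gamma> \<Longrightarrow> p1 \<bullet> \<theta> g = \<psi> g \<bullet> mo g p1 \<and> p2 \<bullet> \<theta> g = \<chi> g \<bullet> mo g p2" by blast
  have S: "(S, \<theta>) \<in> equiv_objects \<Gamma> C T"
  proof (rule equiv_object_of_mono[of "{(X, \<psi>, p1), (Y, \<chi>, p2)}", OF _ _ arr_cod[OF a(1)] \<theta>(1) ext])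
    fix Z v w assume "v \<in> arr C Z S" "w \<in> arr C Z S"
      "\<And>U \<upsilon> m. (U, \<upsilon>, m) \<in> {(X, \<psi>, p1), (Y, \<chi>, p2)} \<Longrightarrow> m \<bullet> v = m \<bullet> w"
    then show "v = w" using biproduct_mono[OF b XO YO, of v Z w] by blast
  qed (use X Y a(3,4) \<theta>(2) in auto)
  have p: "p1 \<in> arr D (S, \<theta>) (X, \<psi>)" "p2 \<in> arr D (S, \<theta>) (Y, \<chi>)"
    using X Y S a(3,4) \<theta>(2) by (simp_all add: arr_D)
  have "i1 \<bullet> \<psi> g = \<theta> g \<bullet> mo g i1" "i2 \<bullet> \<chi> g = \<theta> g \<bullet> mo g i2" if g: "g \<in> carrier \<Gamma>" for g
  proof -
    note d = equiv_objectsD(4)[OF X g] equiv_objectsD(4)[OF Y g] and t = \<theta>[OF g]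
    note m = mo_arr[OF g a(1)] mo_arr[OF g a(2)] mo_arr[OF g a(3)] mo_arr[OF g a(4)]
    note z = zero_comp[OF YO d(1)] zero_comp[OF XO d(2)] comp_zero[OF act_ob_closed[OF g XO] d(2)]
      comp_zero[OF act_ob_closed[OF g YO] d(1)]
    have k1: "p1 \<bullet> (i1 \<bullet> \<psi> g) = \<psi> g" "p2 \<bullet> (i1 \<bullet> \<psi> g) = \<zero>\<^bsub>Hom C (ob g X) Y\<^esub>"
      using assoc[OF d(1) a(1,3)] assoc[OF d(1) a(1,4)] a(5,7) idl[OF d(1)] z(1) by simp_all
    have k2: "p1 \<bullet> (\<theta> g \<bullet> mo g i1) = \<psi> g" "p2 \<bullet> (\<theta> g \<bullet> mo g i1) = \<zero>\<^bsub>Hom C (ob g X) Y\<^esub>"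
      using assoc[OF m(1) t(1) a(3)] assoc[OF m(1) t(1) a(4)] t(2) assoc[OF m(1,3) d(1)] assoc[OF m(1,4) d(2)]
        mo_comp[OF g a(1,3)] mo_comp[OF g a(1,4)] a(5,7) act_mor_Id[OF g XO] mo_zero[OF g XO YO] idr[OF d(1)] z(3)
      by metis+
    show "i1 \<bullet> \<psi> g = \<theta> g \<bullet> mo g i1"
      by (rule biproduct_mono[OF b XO YO comp[OF d(1) a(1)] comp[OF m(1) t(1)]]) (simp_all add: k1 k2)
    have l1: "p1 \<bullet> (i2 \<bullet> \<chi> g) = \<zero>\<^bsub>Hom C (ob g Y) X\<^esub>" "p2 \<bullet> (i2 \<bullet> \<chi> g) = \<chi> g"
      using assoc[OF d(2) a(2,3)] assoc[OF d(2) a(2,4)] a(6,8) idl[OF d(2)] z(2) by simp_all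
    have l2: "p1 \<bullet> (\<theta> g \<bullet> mo g i2) = \<zero>\<^bsub>Hom C (ob g Y) X\<^esub>" "p2 \<bullet> (\<theta> g \<bullet> mo g i2) = \<chi> g"
      using assoc[OF m(2) t(1) a(3)] assoc[OF m(2) t(1) a(4)] t(2) assoc[OF m(2,3) d(1)] assoc[OF m(2,4) d(2)]
        mo_comp[OF g a(2,3)] mo_comp[OF g a(2,4)] a(6,8) act_mor_Id[OF g YO] mo_zero[OF g YO XO] idr[OF d(2)] z(4)
      by metis+
    show "i2 \<bullet> \<chi> g = \<theta> g \<bullet> mo g i2"
      by (rule biproduct_mono[OF b XO YO comp[OF d(2) a(2)] comp[OF m(2) t(1)]]) (simp_all add: l1 l2)
  qed
  then have i: "i1 \<in> arr D (X, \<psi>) (S, \<theta>)" "i2 \<in> arr D (Y, \<chi>) (S, \<theta>)"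
    using X Y S a(1,2) by (simp_all add: arr_D)
  have "biproduct D (X, \<psi>) (Y, \<chi>) (S, \<theta>) i1 i2 p1 p2"
    using b S i p X Y by (simp add: biproduct_def mor_D)
  then show ?thesis by blast
qed

text \<open>A structure map of the pushout starts at its translate, so the translated square has to
  be a pushout too; exactness of the action and \<open>ext_mor_pushout\<close> provide this.\<close>

lemma pushout_D:
  assumes inf: "inflation D (A, \<alpha>) i (B, \<beta>)" and f: "f \<in> arr D (A, \<alpha>) (A', \<alpha>')"
  shows "\<exists>j B' f'. is_pushout D (A, \<alpha>) i (B, \<beta>) f (A', \<alpha>') j B' f' \<and> inflation D (A', \<alpha>') j B'"
proof -
  have i: "i \<in> arr D (A, \<alpha>) (B, \<beta>)" and infC: "inflation C A i B" using inf by (simp_all add: inflation_D_iff)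
  have A: "(A, \<alpha>) \<in> equiv_objects \<Gamma> C T" and B: "(B, \<beta>) \<in> equiv_objects \<Gamma> C T" and A': "(A', \<alpha>') \<in> equiv_objects \<Gamma> C T"
    and eqi: "\<And>g. g \<in> carrier \<Gamma> \<Longrightarrow> i \<bullet> \<alpha> g = \<beta> g \<bullet> mo g i" and eqf: "\<And>g. g \<in> carrier \<Gamma> \<Longrightarrow> f \<bullet> \<alpha> g = \<alpha>' g \<bullet> mo g f"
    and iC: "i \<in> arr C A B" and fC: "f \<in> arr C A A'" using i f by (auto simp: arr_D)
  from infC obtain p E where "Confl C A i B p E" by (auto simp: inflation_def)
  then have e: "(B, i, p) \<in> exts C E A" by (simp add: exts_def)
  from push_exists[OF e fC] obtain B' j p' u where e': "(B', j, p') \<in> exts C E A'"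
    and po: "is_pushout C A i B f A' j B' u" and u: "u \<in> arr C B B'" "u \<bullet> i = j \<bullet> f" "p' \<bullet> u = p" .
  note x = exts_arr[OF e] and x' = exts_arr[OF e']
  \<comment> \<open>The pushout square belongs to a morphism of conflations that is the identity on
    the common cokernel, and translating the two conflations gives a morphism of the same
    kind.\<close>
  have gpo: "is_pushout C (ob g A) (mo g i) (ob g B) (mo g f) (ob g A') (mo g j) (ob g B') (mo g u)" if g: "g \<in> carrier \<Gamma>" for g
  proof (rule ext_mor_pushout[OF _ _ mo_arr[OF g fC] mo_arr[OF g u(1)]])
    show "(ob g B, mo g i, mo g p) \<in> exts C (ob g E) (ob g A)" "(ob g B', mo g j, mo g p') \<in> exts C (ob g E) (ob g A')"
      using action_Confl[OF g x(1)] action_Confl[OF g x'(1)] by (simp_all add: exts_def)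
    show "mo g u \<bullet> mo g i = mo g j \<bullet> mo g f" using mo_comp[OF g iC u(1)] mo_comp[OF g fC x'(2)] u(2) by simp
    show "mo g p' \<bullet> mo g u = mo g p" using mo_comp[OF g u(1) x'(3)] u(3) by simp
  qed
  have "\<exists>t. t \<in> arr C (ob g B') B' \<and> u \<bullet> \<beta> g = t \<bullet> mo g u \<and> j \<bullet> \<alpha>' g = t \<bullet> mo g j" if g: "g \<in> carrier \<Gamma>" for g
  proof -
    note d = equiv_objectsD(4)[OF A g] equiv_objectsD(4)[OF B g] equiv_objectsD(4)[OF A' g]
    have "(u \<bullet> \<beta> g) \<bullet> mo g i = (j \<bullet> \<alpha>' g) \<bullet> mo g f"
      using assoc[OF mo_arr[OF g iC] d(2) u(1)] assoc[OF mo_arr[OF g fC] d(3) x'(2)] eqi[OF g] eqf[OF g]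
        assoc[OF d(1) iC u(1)] assoc[OF d(1) fC x'(2)] u(2) by metis
    from pushout_factor[OF gpo[OF g] comp[OF d(2) u(1)] comp[OF d(3) x'(2)] this] show ?thesis by metis
  qed
  from equivariant_structure_choice[OF this] obtain \<theta> where ext: "\<theta> \<in> extensional (carrier \<Gamma>)"
    and \<theta>: "\<And>g. g \<in> carrier \<Gamma> \<Longrightarrow> \<theta> g \<in> arr C (ob g B') B'"
      "\<And>g. g \<in> carrier \<Gamma> \<Longrightarrow> u \<bullet> \<beta> g = \<theta> g \<bullet> mo g u \<and> j \<bullet> \<alpha>' g = \<theta> g \<bullet> mo g j" by blast
  have B': "(B', \<theta>) \<in> equiv_objects \<Gamma> C T"
  proof (rule equiv_object_of_epi[of "{(B, \<beta>, u), (A', \<alpha>', j)}", OF _ _ x'(7) \<theta>(1) ext])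
    fix Z v w assume "v \<in> arr C B' Z" "w \<in> arr C B' Z"
      "\<And>U \<upsilon> m. (U, \<upsilon>, m) \<in> {(B, \<beta>, u), (A', \<alpha>', j)} \<Longrightarrow> v \<bullet> m = w \<bullet> m"
    then show "v = w" using pushout_unique[OF po iC fC, of v Z w] by blast
  qed (use B A' u x' \<theta>(2) in auto)
  have ju: "j \<in> arr D (A', \<alpha>') (B', \<theta>)" "u \<in> arr D (B, \<beta>) (B', \<theta>)"
    using B A' B' x'(2) u(1) \<theta>(2) by (simp_all add: arr_D)
  have "inflation C A' j B'" using x'(1) by (auto simp: inflation_def)
  then have "inflation D (A', \<alpha>') j (B', \<theta>)" using ju by (simp add: inflation_D_iff)
  moreover have "is_pushout D (A, \<alpha>) i (B, \<beta>) f (A', \<alpha>') j (B', \<theta>) u"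
    unfolding is_pushout_def
  proof (intro conjI ballI impI)
    fix Z s t assume Z: "Z \<in> Ob D" and s: "s \<in> mor D (B, \<beta>) Z" and t: "t \<in> mor D (A', \<alpha>') Z"
      and st: "s \<bullet>\<^bsub>D\<^esub> i = t \<bullet>\<^bsub>D\<^esub> f"
    obtain z \<zeta> where zz: "Z = (z, \<zeta>)" by (metis surj_pair)
    have ZO: "(z, \<zeta>) \<in> equiv_objects \<Gamma> C T" using Z zz by simp
    have s': "s \<in> arr D (B, \<beta>) (z, \<zeta>)" and t': "t \<in> arr D (A', \<alpha>') (z, \<zeta>)"
      using s t B A' ZO by (simp_all add: mor_D zz)
    then have sC: "s \<in> arr C B z" "\<And>g. g \<in> carrier \<Gamma> \<Longrightarrow> s \<bullet> \<beta> g = \<zeta> g \<bullet> mo g s"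
      and tC: "t \<in> arr C A' z" "\<And>g. g \<in> carrier \<Gamma> \<Longrightarrow> t \<bullet> \<alpha>' g = \<zeta> g \<bullet> mo g t" by (auto simp: arr_D)
    have "s \<bullet> i = t \<bullet> f" using st by simp
    from pushout_factor[OF po sC(1) tC(1) this] obtain v where v: "v \<in> arr C B' z" "v \<bullet> u = s" "v \<bullet> j = t" .
    have "v \<bullet> \<theta> g = \<zeta> g \<bullet> mo g v" if g: "g \<in> carrier \<Gamma>" for g
    proof -
      note d = equiv_objectsD(4)[OF ZO g] equiv_objectsD(4)[OF B g] equiv_objectsD(4)[OF A' g]
      note mv = mo_arr[OF g v(1)] and mu = mo_arr[OF g u(1)] and mj = mo_arr[OF g x'(2)]
      show ?thesis
      proof (rule pushout_unique[OF gpo[OF g] mo_arr[OF g iC] mo_arr[OF g fC] comp[OF \<theta>(1)[OF g] v(1)] comp[OF mv d(1)]])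
        show "(v \<bullet> \<theta> g) \<bullet> mo g u = (\<zeta> g \<bullet> mo g v) \<bullet> mo g u"
          using assoc[OF mu \<theta>(1)[OF g] v(1)] \<theta>(2)[OF g] assoc[OF d(2) u(1) v(1)] v(2) sC(2)[OF g]
            assoc[OF mu mv d(1)] mo_comp[OF g u(1) v(1)] by metis
        show "(v \<bullet> \<theta> g) \<bullet> mo g j = (\<zeta> g \<bullet> mo g v) \<bullet> mo g j"
          using assoc[OF mj \<theta>(1)[OF g] v(1)] \<theta>(2)[OF g] assoc[OF d(3) x'(2) v(1)] v(3) tC(2)[OF g]
            assoc[OF mj mv d(1)] mo_comp[OF g x'(2) v(1)] by metis
      qed
    qed
    then have "v \<in> arr D (B', \<theta>) (z, \<zeta>)" using B' ZO v(1) by (simp add: arr_D)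
    then have v': "v \<in> mor D (B', \<theta>) Z" using B' ZO by (simp add: mor_D zz)
    show "\<exists>!v. v \<in> mor D (B', \<theta>) Z \<and> v \<bullet>\<^bsub>D\<^esub> u = s \<and> v \<bullet>\<^bsub>D\<^esub> j = t"
    proof (rule ex1I[of _ v])
      show "v \<in> mor D (B', \<theta>) Z \<and> v \<bullet>\<^bsub>D\<^esub> u = s \<and> v \<bullet>\<^bsub>D\<^esub> j = t" using v' v by simp
      fix w assume w: "w \<in> mor D (B', \<theta>) Z \<and> w \<bullet>\<^bsub>D\<^esub> u = s \<and> w \<bullet>\<^bsub>D\<^esub> j = t"
      then have "w \<in> arr D (B', \<theta>) (z, \<zeta>)" using B' ZO by (simp add: mor_D zz)
      then have w': "w \<in> arr C B' z" by (simp add: arr_D)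
      show "w = v" by (rule pushout_unique[OF po iC fC w' v(1)]) (use v w in simp_all)
    qed
  qed (use B' B A' ju u(2) in \<open>simp_all add: mor_D\<close>)
  ultimately show ?thesis by blast
qed

text \<open>Structure maps end in the pullback, so its own universal property in \<open>C\<close>
  produces them.\<close>

lemma pullback_D:
  assumes def: "deflation D (B, \<beta>) p (E, \<delta>)" and f: "f \<in> arr D (E', \<delta>') (E, \<delta>)"
  shows "\<exists>q B' f'. is_pullback D (B, \<beta>) p (E, \<delta>) f (E', \<delta>') q B' f' \<and> deflation D B' q (E', \<delta>')"
proof -
  have p: "p \<in> arr D (B, \<beta>) (E, \<delta>)" and defC: "deflation C B p E" using def by (simp_all add: deflation_D_iff)
  have E: "(E, \<delta>) \<in> equiv_objects \<Gamma> C T" and B: "(B, \<beta>) \<in> equiv_objects \<Gamma> C T" and E': "(E', \<delta>') \<in> equiv_objects \<Gamma> C T"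
    and eqp: "\<And>g. g \<in> carrier \<Gamma> \<Longrightarrow> p \<bullet> \<beta> g = \<delta> g \<bullet> mo g p" and eqf: "\<And>g. g \<in> carrier \<Gamma> \<Longrightarrow> f \<bullet> \<delta>' g = \<delta> g \<bullet> mo g f"
    and pC: "p \<in> arr C B E" and fC: "f \<in> arr C E' E" using p f by (auto simp: arr_D)
  from pullback_deflation[OF defC arr_dom[OF fC] arr_mor[OF fC]] obtain q B' u
    where pb: "is_pullback C B p E f E' q B' u" and dq: "deflation C B' q E'" by blast
  note u = pullback_arr[OF pb arr_dom[OF fC] arr_dom[OF pC]]
  have "\<exists>t. t \<in> arr C (ob g B') B' \<and> u \<bullet> t = \<beta> g \<bullet> mo g u \<and> q \<bullet> t = \<delta>' g \<bullet> mo g q" if g: "g \<in> carrier \<Gamma>" for g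
  proof -
    note d = equiv_objectsD(4)[OF E g] equiv_objectsD(4)[OF B g] equiv_objectsD(4)[OF E' g]
    note m = mo_arr[OF g u(1)] mo_arr[OF g u(2)]
    have "p \<bullet> (\<beta> g \<bullet> mo g u) = f \<bullet> (\<delta>' g \<bullet> mo g q)"
      using assoc[OF m(2) d(2) pC] assoc[OF m(1) d(3) fC] eqp[OF g] eqf[OF g]
        assoc[OF m(2) mo_arr[OF g pC] d(1)] assoc[OF m(1) mo_arr[OF g fC] d(1)]
        mo_comp[OF g u(2) pC] mo_comp[OF g u(1) fC] u(3) by metis
    from pullback_factor[OF pb comp[OF m(2) d(2)] comp[OF m(1) d(3)] this] show ?thesis by metis
  qed
  from equivariant_structure_choice[OF this] obtain \<theta> where ext: "\<theta> \<in> extensional (carrier \<Gamma>)"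
    and \<theta>: "\<And>g. g \<in> carrier \<Gamma> \<Longrightarrow> \<theta> g \<in> arr C (ob g B') B'"
      "\<And>g. g \<in> carrier \<Gamma> \<Longrightarrow> u \<bullet> \<theta> g = \<beta> g \<bullet> mo g u \<and> q \<bullet> \<theta> g = \<delta>' g \<bullet> mo g q" by blast
  have B': "(B', \<theta>) \<in> equiv_objects \<Gamma> C T"
  proof (rule equiv_object_of_mono[of "{(B, \<beta>, u), (E', \<delta>', q)}", OF _ _ arr_dom[OF u(1)] \<theta>(1) ext])
    fix Z v w assume "v \<in> arr C Z B'" "w \<in> arr C Z B'"
      "\<And>U \<upsilon> m. (U, \<upsilon>, m) \<in> {(B, \<beta>, u), (E', \<delta>', q)} \<Longrightarrow> m \<bullet> v = m \<bullet> w"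
    then show "v = w" using pullback_unique[OF pb pC fC, of v Z w] by blast
  qed (use B E' u \<theta>(2) in auto)
  have qu: "q \<in> arr D (B', \<theta>) (E', \<delta>')" "u \<in> arr D (B', \<theta>) (B, \<beta>)"
    using B E' B' u \<theta>(2) by (simp_all add: arr_D)
  have "deflation D (B', \<theta>) q (E', \<delta>')" using qu dq by (simp add: deflation_D_iff)
  moreover have "is_pullback D (B, \<beta>) p (E, \<delta>) f (E', \<delta>') q (B', \<theta>) u"
    unfolding is_pullback_def
  proof (intro conjI ballI impI)
    fix Z s t assume Z: "Z \<in> Ob D" and s: "s \<in> mor D Z (B, \<beta>)" and t: "t \<in> mor D Z (E', \<delta>')"
      and st: "p \<bullet>\<^bsub>D\<^esub> s = f \<bullet>\<^bsub>D\<^esub> t"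
    obtain z \<zeta> where zz: "Z = (z, \<zeta>)" by (metis surj_pair)
    have ZO: "(z, \<zeta>) \<in> equiv_objects \<Gamma> C T" using Z zz by simp
    have s': "s \<in> arr D (z, \<zeta>) (B, \<beta>)" and t': "t \<in> arr D (z, \<zeta>) (E', \<delta>')"
      using s t B E' ZO by (simp_all add: mor_D zz)
    then have sC: "s \<in> arr C z B" "\<And>g. g \<in> carrier \<Gamma> \<Longrightarrow> s \<bullet> \<zeta> g = \<beta> g \<bullet> mo g s"
      and tC: "t \<in> arr C z E'" "\<And>g. g \<in> carrier \<Gamma> \<Longrightarrow> t \<bullet> \<zeta> g = \<delta>' g \<bullet> mo g t" by (auto simp: arr_D)
    have "p \<bullet> s = f \<bullet> t" using st by simp
    from pullback_factor[OF pb sC(1) tC(1) this] obtain v where v: "v \<in> arr C z B'" "u \<bullet> v = s" "q \<bullet> v = t" .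
    have "v \<bullet> \<zeta> g = \<theta> g \<bullet> mo g v" if g: "g \<in> carrier \<Gamma>" for g
    proof -
      note d = equiv_objectsD(4)[OF ZO g] equiv_objectsD(4)[OF B g] equiv_objectsD(4)[OF E' g]
      note mv = mo_arr[OF g v(1)] and mu = mo_arr[OF g u(2)] and mq = mo_arr[OF g u(1)]
      show ?thesis
      proof (rule pullback_unique[OF pb pC fC comp[OF d(1) v(1)] comp[OF mv \<theta>(1)[OF g]]])
        show "u \<bullet> (v \<bullet> \<zeta> g) = u \<bullet> (\<theta> g \<bullet> mo g v)"
          using assoc[OF mv \<theta>(1)[OF g] u(2)] \<theta>(2)[OF g] assoc[OF d(1) v(1) u(2)] v(2) sC(2)[OF g]
            assoc[OF mv mu d(2)] mo_comp[OF g v(1) u(2)] by metis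
        show "q \<bullet> (v \<bullet> \<zeta> g) = q \<bullet> (\<theta> g \<bullet> mo g v)"
          using assoc[OF mv \<theta>(1)[OF g] u(1)] \<theta>(2)[OF g] assoc[OF d(1) v(1) u(1)] v(3) tC(2)[OF g]
            assoc[OF mv mq d(3)] mo_comp[OF g v(1) u(1)] by metis
      qed
    qed
    then have "v \<in> arr D (z, \<zeta>) (B', \<theta>)" using B' ZO v(1) by (simp add: arr_D)
    then have v': "v \<in> mor D Z (B', \<theta>)" using B' ZO by (simp add: mor_D zz)
    show "\<exists>!v. v \<in> mor D Z (B', \<theta>) \<and> u \<bullet>\<^bsub>D\<^esub> v = s \<and> q \<bullet>\<^bsub>D\<^esub> v = t"
    proof (rule ex1I[of _ v])
      show "v \<in> mor D Z (B', \<theta>) \<and> u \<bullet>\<^bsub>D\<^esub> v = s \<and> q \<bullet>\<^bsub>D\<^esub> v = t" using v' v by simp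
      fix w assume w: "w \<in> mor D Z (B', \<theta>) \<and> u \<bullet>\<^bsub>D\<^esub> w = s \<and> q \<bullet>\<^bsub>D\<^esub> w = t"
      then have "w \<in> arr D (z, \<zeta>) (B', \<theta>)" using B' ZO by (simp add: mor_D zz)
      then have w': "w \<in> arr C z B'" by (simp add: arr_D)
      show "w = v" by (rule pullback_unique[OF pb pC fC w' v(1)]) (use v w in simp_all)
    qed
  qed (use B' B E' qu u(3) in \<open>simp_all add: mor_D\<close>)
  ultimately show ?thesis by blast
qed

text \<open>The factorisation found in \<open>C\<close> is equivariant by cancellation:
  \<open>i\<close> is monic for the kernel, and the translate of \<open>p\<close> is epic for the
  cokernel.\<close>

lemma kernel_cokernel_D:
  assumes c: "Confl D A i B p E" shows "is_kernel D A i B p E" "is_cokernel D A i B p E"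
proof -
  obtain a \<alpha> b \<beta> e \<delta> where AB: "A = (a, \<alpha>)" "B = (b, \<beta>)" "E = (e, \<delta>)" by (metis surj_pair)
  have i: "i \<in> arr D (a, \<alpha>) (b, \<beta>)" and p: "p \<in> arr D (b, \<beta>) (e, \<delta>)" and conf: "Confl C a i b p e"
    using c by (simp_all add: AB Confl_D)
  note x = Confl_arr[OF conf]
  have O: "(a, \<alpha>) \<in> equiv_objects \<Gamma> C T" "(b, \<beta>) \<in> equiv_objects \<Gamma> C T" "(e, \<delta>) \<in> equiv_objects \<Gamma> C T"
    and eq: "\<And>g. g \<in> carrier \<Gamma> \<Longrightarrow> i \<bullet> \<alpha> g = \<beta> g \<bullet> mo g i" "\<And>g. g \<in> carrier \<Gamma> \<Longrightarrow> p \<bullet> \<beta> g = \<delta> g \<bullet> mo g p"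
    using i p by (auto simp: arr_D)
  show "is_kernel D A i B p E"
    unfolding is_kernel_def AB
  proof (intro conjI ballI impI)
    show "p \<bullet>\<^bsub>D\<^esub> i = \<zero>\<^bsub>Hom D (a, \<alpha>) (e, \<delta>)\<^esub>" using x(3) by simp
    fix Z f assume Z: "Z \<in> Ob D" and "f \<in> mor D Z (b, \<beta>)" and "p \<bullet>\<^bsub>D\<^esub> f = \<zero>\<^bsub>Hom D Z (e, \<delta>)\<^esub>"
    moreover obtain z \<zeta> where zz: "Z = (z, \<zeta>)" by (metis surj_pair)
    ultimately have ZO: "(z, \<zeta>) \<in> equiv_objects \<Gamma> C T" and "f \<in> arr D (z, \<zeta>) (b, \<beta>)" and pf: "p \<bullet> f = \<zero>\<^bsub>Hom C z e\<^esub>"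
      using O by (simp_all add: mor_D)
    then have f: "f \<in> arr C z b" "\<And>g. g \<in> carrier \<Gamma> \<Longrightarrow> f \<bullet> \<zeta> g = \<beta> g \<bullet> mo g f" by (auto simp: arr_D)
    from kernel_lift[OF conf f(1) pf] obtain u where u: "u \<in> arr C z a" "i \<bullet> u = f" .
    have "u \<bullet> \<zeta> g = \<alpha> g \<bullet> mo g u" if g: "g \<in> carrier \<Gamma>" for g
    proof -
      note d = equiv_objectsD(4)[OF ZO g] equiv_objectsD(4)[OF O(1) g] equiv_objectsD(4)[OF O(2) g]
      show ?thesis
        by (rule Confl_mono[OF conf comp[OF d(1) u(1)] comp[OF mo_arr[OF g u(1)] d(2)]])
           (use assoc[OF d(1) u(1) x(1)] u(2) f(2)[OF g] assoc[OF mo_arr[OF g u(1)] d(2) x(1)] eq(1)[OF g]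
             assoc[OF mo_arr[OF g u(1)] mo_arr[OF g x(1)] d(3)] mo_comp[OF g u(1) x(1)] in metis)
    qed
    then have "u \<in> arr D (z, \<zeta>) (a, \<alpha>)" using ZO O u(1) by (simp add: arr_D)
    then have u': "u \<in> mor D Z (a, \<alpha>)" using ZO O by (simp add: mor_D zz)
    show "\<exists>!u. u \<in> mor D Z (a, \<alpha>) \<and> i \<bullet>\<^bsub>D\<^esub> u = f"
    proof (rule ex1I[of _ u])
      show "u \<in> mor D Z (a, \<alpha>) \<and> i \<bullet>\<^bsub>D\<^esub> u = f" using u u' by simp
      fix w assume w: "w \<in> mor D Z (a, \<alpha>) \<and> i \<bullet>\<^bsub>D\<^esub> w = f"
      then have "w \<in> arr D (z, \<zeta>) (a, \<alpha>)" using O ZO by (simp add: mor_D zz)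
      then have w': "w \<in> arr C z a" by (simp add: arr_D)
      show "w = u" by (rule Confl_mono[OF conf w' u(1)]) (use u w in simp)
    qed
  qed
  show "is_cokernel D A i B p E"
    unfolding is_cokernel_def AB
  proof (intro conjI ballI impI)
    show "p \<bullet>\<^bsub>D\<^esub> i = \<zero>\<^bsub>Hom D (a, \<alpha>) (e, \<delta>)\<^esub>" using x(3) by simp
    fix Z f assume Z: "Z \<in> Ob D" and "f \<in> mor D (b, \<beta>) Z" and "f \<bullet>\<^bsub>D\<^esub> i = \<zero>\<^bsub>Hom D (a, \<alpha>) Z\<^esub>"
    moreover obtain z \<zeta> where zz: "Z = (z, \<zeta>)" by (metis surj_pair)
    ultimately have ZO: "(z, \<zeta>) \<in> equiv_objects \<Gamma> C T" and "f \<in> arr D (b, \<beta>) (z, \<zeta>)" and pf: "f \<bullet> i = \<zero>\<^bsub>Hom C a z\<^esub>"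
      using O by (simp_all add: mor_D)
    then have f: "f \<in> arr C b z" "\<And>g. g \<in> carrier \<Gamma> \<Longrightarrow> f \<bullet> \<beta> g = \<zeta> g \<bullet> mo g f" by (auto simp: arr_D)
    from cokernel_lift[OF conf f(1) pf] obtain u where u: "u \<in> arr C e z" "u \<bullet> p = f" .
    have "u \<bullet> \<delta> g = \<zeta> g \<bullet> mo g u" if g: "g \<in> carrier \<Gamma>" for g
    proof -
      note d = equiv_objectsD(4)[OF ZO g] equiv_objectsD(4)[OF O(3) g] equiv_objectsD(4)[OF O(2) g]
      note mp = mo_arr[OF g x(2)] and mu = mo_arr[OF g u(1)]
      show ?thesis
        by (rule Confl_epi[OF action_Confl[OF g conf] comp[OF d(2) u(1)] comp[OF mu d(1)]])
           (use assoc[OF mp d(2) u(1)] eq(2)[OF g] assoc[OF d(3) x(2) u(1)] u(2) f(2)[OF g]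
             assoc[OF mp mu d(1)] mo_comp[OF g x(2) u(1)] in metis)
    qed
    then have "u \<in> arr D (e, \<delta>) (z, \<zeta>)" using ZO O u(1) by (simp add: arr_D)
    then have u': "u \<in> mor D (e, \<delta>) Z" using ZO O by (simp add: mor_D zz)
    show "\<exists>!u. u \<in> mor D (e, \<delta>) Z \<and> u \<bullet>\<^bsub>D\<^esub> p = f"
    proof (rule ex1I[of _ u])
      show "u \<in> mor D (e, \<delta>) Z \<and> u \<bullet>\<^bsub>D\<^esub> p = f" using u u' by simp
      fix w assume w: "w \<in> mor D (e, \<delta>) Z \<and> w \<bullet>\<^bsub>D\<^esub> p = f"
      then have "w \<in> arr D (e, \<delta>) (z, \<zeta>)" using O ZO by (simp add: mor_D zz)
      then have w': "w \<in> arr C e z" by (simp add: arr_D)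
      show "w = u" by (rule Confl_epi[OF conf w' u(1)]) (use u w in simp)
    qed
  qed
qed

lemma isos_D_forget:
  assumes "a \<in> isos D X Y" "X \<in> equiv_objects \<Gamma> C T" "Y \<in> equiv_objects \<Gamma> C T"
  shows "a \<in> isos C (fst X) (fst Y)"
proof -
  from assms obtain b where "a \<in> arr D X Y" "b \<in> arr D Y X" "b \<bullet> a = Id C (fst X)" "a \<bullet> b = Id C (fst Y)"
    by (auto simp: isos_def mor_D)
  then show ?thesis using isosI arr_D_forget by blast
qed

text \<open>Admissibility is detected in \<open>C\<close>, so closure under composition and
  isomorphism is inherited. The axioms that assert existence are covered by the structures placed on
  the objects constructed in \<open>C\<close>.\<close>

theorem exact_category_D: "exact_category K D"
proof (rule exact_category.intro[OF linear_category_D], rule exact_category_axioms.intro)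
  show "\<exists>Z. zero_object D Z" by (rule zero_object_D)
  show "\<exists>S i\<^sub>1 i\<^sub>2 p\<^sub>1 p\<^sub>2. biproduct D X Y S i\<^sub>1 i\<^sub>2 p\<^sub>1 p\<^sub>2" if "X \<in> Ob D" "Y \<in> Ob D" for X Y
    using that biproduct_D[of "fst X" "snd X" "fst Y" "snd Y"] by simp
  show "A \<in> Ob D \<and> B \<in> Ob D \<and> E \<in> Ob D \<and> i \<in> mor D A B \<and> p \<in> mor D B E" if "Confl D A i B p E" for A i B p E
    using that by (simp add: equivariant_category_def)
  show "\<And>A i B p E. Confl D A i B p E \<Longrightarrow> is_kernel D A i B p E"
    "\<And>A i B p E. Confl D A i B p E \<Longrightarrow> is_cokernel D A i B p E" by (rule kernel_cokernel_D; assumption)+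
  show "Confl D A' i' B' p' E'"
    if h: "Confl D A i B p E" "A' \<in> Ob D" "B' \<in> Ob D" "E' \<in> Ob D" "i' \<in> mor D A' B'" "p' \<in> mor D B' E'"
      "a \<in> isos D A A'" "b \<in> isos D B B'" "d \<in> isos D E E'" "b \<bullet>\<^bsub>D\<^esub> i = i' \<bullet>\<^bsub>D\<^esub> a" "d \<bullet>\<^bsub>D\<^esub> p = p' \<bullet>\<^bsub>D\<^esub> b"
    for A i B p E A' i' B' p' E' a b d
  proof -
    have conf: "Confl C (fst A) i (fst B) p (fst E)"
      and O: "A \<in> equiv_objects \<Gamma> C T" "B \<in> equiv_objects \<Gamma> C T" "E \<in> equiv_objects \<Gamma> C T"
      using h(1) by (simp_all add: equivariant_category_def)
    have O': "A' \<in> equiv_objects \<Gamma> C T" "B' \<in> equiv_objects \<Gamma> C T" "E' \<in> equiv_objects \<Gamma> C T"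
      and m: "i' \<in> equiv_mor \<Gamma> C T A' B'" "p' \<in> equiv_mor \<Gamma> C T B' E'"
      using h(2-6) by simp_all
    have mC: "i' \<in> mor C (fst A') (fst B')" "p' \<in> mor C (fst B') (fst E')"
      using m arr_mor[OF arr_D_forget] by (simp_all add: mor_D O')
    have "Confl C (fst A') i' (fst B') p' (fst E')"
      using Confl_iso[OF conf fst_equiv_object[OF O'(1)] fst_equiv_object[OF O'(2)] fst_equiv_object[OF O'(3)] mC
          isos_D_forget[OF h(7) O(1) O'(1)] isos_D_forget[OF h(8) O(2) O'(2)] isos_D_forget[OF h(9) O(3) O'(3)]] h(10,11)
      by simp
    then show ?thesis using O' m by (simp add: equivariant_category_def)
  qed
  show "inflation D X (Id D X) X" "deflation D X (Id D X) X" if "X \<in> Ob D" for X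
    using that arr_D_Id[of X] Id_inflation[of "fst X"] Id_deflation[of "fst X"] fst_equiv_object[of X]
    by (simp_all add: inflation_D_iff deflation_D_iff)
  show "inflation D X (j \<bullet>\<^bsub>D\<^esub> i) Z" if "inflation D X i Y" "inflation D Y j Z" for X i Y j Z
    using that arr_D_comp[of i X Y j Z] Comp_inflation by (auto simp: inflation_D_iff)
  show "deflation D X (j \<bullet>\<^bsub>D\<^esub> i) Z" if "deflation D X i Y" "deflation D Y j Z" for X i Y j Z
    using that arr_D_comp[of i X Y j Z] Comp_deflation by (auto simp: deflation_D_iff)
  show "\<exists>j B' f'. is_pushout D A i B f A' j B' f' \<and> inflation D A' j B'"
    if h: "inflation D A i B" "A' \<in> Ob D" "f \<in> mor D A A'" for A i B A' f
  proof -
    obtain a \<alpha> b \<beta> a' \<alpha>' where AB: "A = (a, \<alpha>)" "B = (b, \<beta>)" "A' = (a', \<alpha>')" by (metis surj_pair)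
    have "A \<in> equiv_objects \<Gamma> C T" using h(1) by (auto simp: inflation_D_iff arr_def)
    then have "f \<in> arr D A A'" using h by (simp add: mor_D)
    then show ?thesis using pushout_D h(1) unfolding AB by blast
  qed
  show "\<exists>q B' f'. is_pullback D B p E f E' q B' f' \<and> deflation D B' q E'"
    if h: "deflation D B p E" "E' \<in> Ob D" "f \<in> mor D E' E" for B p E E' f
  proof -
    obtain b \<beta> e \<delta> e' \<delta>' where AB: "B = (b, \<beta>)" "E = (e, \<delta>)" "E' = (e', \<delta>')" by (metis surj_pair)
    have "E \<in> equiv_objects \<Gamma> C T" using h(1) by (auto simp: deflation_D_iff arr_def)
    then have "f \<in> arr D E' E" using h by (simp add: mor_D)
    then show ?thesis using pullback_D h(1) unfolding AB by blast
  qed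
qed

end


section \<open>Averages\<close>

text \<open>\<nu> inverts the order of the group, written as a sum of ones over \<Gamma> because
  averages produce it in that shape. Were the sum zero, the characteristic would be the least
  positive number that annihilates one, and division with remainder would make it divide the
  order.\<close>

lemma order_invertible:
  assumes K: "field K" and \<Gamma>: "group \<Gamma>" and fin: "finite (carrier \<Gamma>)"
    and char: "\<not> characteristic K dvd order \<Gamma>"
  shows "\<exists>\<nu>\<in>carrier K. \<nu> \<otimes>\<^bsub>K\<^esub> (\<Oplus>\<^bsub>K\<^esub>g\<in>carrier \<Gamma>. \<one>\<^bsub>K\<^esub>) = \<one>\<^bsub>K\<^esub>"
proof -
  interpret K: field K by fact
  interpret \<Gamma>: group \<Gamma> by fact
  let ?n = "order \<Gamma>"
  have npos: "?n > 0" using \<Gamma>.order_gt_0_iff_finite fin by simp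
  have sum: "(\<Oplus>\<^bsub>K\<^esub>g\<in>carrier \<Gamma>. \<one>\<^bsub>K\<^esub>) = [?n] \<cdot>\<^bsub>K\<^esub> \<one>\<^bsub>K\<^esub>"
    using K.add.finprod_const[OF K.one_closed, of "carrier \<Gamma>"] by (simp add: order_def)
  have "[?n] \<cdot>\<^bsub>K\<^esub> \<one>\<^bsub>K\<^esub> \<noteq> \<zero>\<^bsub>K\<^esub>"
  proof
    assume z: "[?n] \<cdot>\<^bsub>K\<^esub> \<one>\<^bsub>K\<^esub> = \<zero>\<^bsub>K\<^esub>"
    let ?P = "\<lambda>m::nat. m > 0 \<and> [m] \<cdot>\<^bsub>K\<^esub> \<one>\<^bsub>K\<^esub> = \<zero>\<^bsub>K\<^esub>"
    have ex: "?P ?n" using z npos by simp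
    then have "\<exists>m. ?P m" by blast
    then have c: "characteristic K = (LEAST m. ?P m)" unfolding characteristic_def by simp
    have p: "?P (characteristic K)" unfolding c by (rule LeastI[of ?P, OF ex])
    have "[(characteristic K * (?n div characteristic K))] \<cdot>\<^bsub>K\<^esub> \<one>\<^bsub>K\<^esub> = \<zero>\<^bsub>K\<^esub>"
      using K.add.nat_pow_pow[OF K.one_closed, of "?n div characteristic K" "characteristic K"] p by simp
    then have "[(?n mod characteristic K)] \<cdot>\<^bsub>K\<^esub> \<one>\<^bsub>K\<^esub> = \<zero>\<^bsub>K\<^esub>"
      using K.add.nat_pow_mult[OF K.one_closed, of "characteristic K * (?n div characteristic K)" "?n mod characteristic K"] z
      by simp
    moreover have "?n mod characteristic K < characteristic K" using p by simp
    ultimately have "?n mod characteristic K = 0"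
      using not_less_Least[of "?n mod characteristic K" ?P] c by auto
    then show False using char by (simp add: dvd_eq_mod_eq_0)
  qed
  then have "[?n] \<cdot>\<^bsub>K\<^esub> \<one>\<^bsub>K\<^esub> \<in> Units K" by (simp add: K.field_Units)
  then show ?thesis using K.Units_l_inv K.Units_inv_closed unfolding sum by blast
qed

lemma linear_maps_finsum:
  assumes f: "f \<in> linear_maps K V W" and V: "abelian_group V" and W: "abelian_group W"
    and A: "finite A" and x: "\<And>a. a \<in> A \<Longrightarrow> x a \<in> carrier V"
  shows "f (\<Oplus>\<^bsub>V\<^esub>a\<in>A. x a) = (\<Oplus>\<^bsub>W\<^esub>a\<in>A. f (x a))"
proof -
  interpret V: abelian_group V by fact
  interpret W: abelian_group W by fact
  note l = linear_mapsD[OF f]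
  have "f \<zero>\<^bsub>V\<^esub> \<oplus>\<^bsub>W\<^esub> f \<zero>\<^bsub>V\<^esub> = f \<zero>\<^bsub>V\<^esub>" using l(2)[OF V.zero_closed V.zero_closed] by simp
  then have z: "f \<zero>\<^bsub>V\<^esub> = \<zero>\<^bsub>W\<^esub>" using l(1)[OF V.zero_closed] by simp
  show ?thesis using A x
  proof (induction A rule: finite_induct)
    case empty then show ?case by (simp add: z)
  next
    case (insert a A)
    have 1: "x \<in> A \<rightarrow> carrier V" "x a \<in> carrier V" using insert.prems by auto
    have 2: "(\<lambda>a. f (x a)) \<in> A \<rightarrow> carrier W" "f (x a) \<in> carrier W" using insert.prems l(1) by auto
    have "f (\<Oplus>\<^bsub>V\<^esub>a\<in>insert a A. x a) = f (x a) \<oplus>\<^bsub>W\<^esub> f (\<Oplus>\<^bsub>V\<^esub>a\<in>A. x a)"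
      using V.finsum_insert[OF insert.hyps 1] l(2)[OF 1(2) V.finsum_closed[OF 1(1)]] by simp
    also have "\<dots> = (\<Oplus>\<^bsub>W\<^esub>a\<in>insert a A. f (x a))"
      using W.finsum_insert[OF insert.hyps 2] insert.IH insert.prems by simp
    finally show ?case .
  qed
qed

lemma (in module) finsum_constant:
  assumes A: "finite A" and v: "v \<in> carrier M"
  shows "(\<Oplus>\<^bsub>M\<^esub>a\<in>A. v) = (\<Oplus>\<^bsub>R\<^esub>a\<in>A. \<one>\<^bsub>R\<^esub>) \<odot>\<^bsub>M\<^esub> v"
  using A
proof (induction A rule: finite_induct)
  case empty then show ?case using v by simp
next
  case (insert a A)
  have 1: "(\<lambda>_. v) \<in> A \<rightarrow> carrier M" "(\<lambda>_. \<one>\<^bsub>R\<^esub>) \<in> A \<rightarrow> carrier R" using v by auto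
  show ?case
    using M.finsum_insert[OF insert.hyps 1(1) v] R.finsum_insert[OF insert.hyps 1(2) R.one_closed]
      insert.IH smult_l_distr[OF R.one_closed R.finsum_closed[OF 1(2)] v] v by simp
qed

section \<open>The averaging projection\<close>

context group_representation
begin

text \<open>The Reynolds operator. Invariance of its values comes from the sum over the group, and
  being the identity on invariants from the choice of \<nu>.\<close>

definition average :: "'k \<Rightarrow> 'v \<Rightarrow> 'v" where
  "average \<nu> v = \<nu> \<odot>\<^bsub>V\<^esub> (\<Oplus>\<^bsub>V\<^esub>g\<in>carrier \<Gamma>. act V g v)"

lemma sum_closed: "v \<in> carrier V \<Longrightarrow> (\<Oplus>\<^bsub>V\<^esub>g\<in>carrier \<Gamma>. act V g v) \<in> carrier V"
  using abelian_monoid.finsum_closed[of V "\<lambda>g. act V g v" "carrier \<Gamma>"] act_closed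
    module.axioms(2)[OF rep_module] by (auto simp: abelian_group_def)

lemma average_closed: "\<lbrakk>\<nu> \<in> carrier K; v \<in> carrier V\<rbrakk> \<Longrightarrow> average \<nu> v \<in> carrier V"
  unfolding average_def using module.smult_closed[OF rep_module] sum_closed by blast

text \<open>Left translation by \<open>h\<close> permutes the summands.\<close>

lemma average_invariant:
  assumes fin: "finite (carrier \<Gamma>)" and \<nu>: "\<nu> \<in> carrier K" and v: "v \<in> carrier V" and h: "h \<in> carrier \<Gamma>"
  shows "act V h (average \<nu> v) = average \<nu> v"
proof -
  interpret V: module K V by (rule rep_module)
  have "act V h (\<Oplus>\<^bsub>V\<^esub>g\<in>carrier \<Gamma>. act V g v) = (\<Oplus>\<^bsub>V\<^esub>g\<in>carrier \<Gamma>. act V h (act V g v))"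
    by (rule linear_maps_finsum[OF act_linear[OF h] V.abelian_group_axioms V.abelian_group_axioms fin act_closed[OF _ v]])
  also have "\<dots> = (\<Oplus>\<^bsub>V\<^esub>g\<in>carrier \<Gamma>. act V (h \<otimes>\<^bsub>\<Gamma>\<^esub> g) v)"
    by (rule V.M.finsum_cong') (use h v act_closed act_mult in auto)
  also have "\<dots> = (\<Oplus>\<^bsub>V\<^esub>g\<in>(\<lambda>g. h \<otimes>\<^bsub>\<Gamma>\<^esub> g) ` carrier \<Gamma>. act V g v)"
    by (rule V.M.finsum_reindex[symmetric]) (use h v act_closed inj_on_cmult in auto)
  finally show ?thesis
    using linear_mapsD(3)[OF act_linear[OF h] \<nu> sum_closed[OF v]] surj_const_mult[OF h] by (simp add: average_def)
qed

lemma average_fixed: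
  assumes fin: "finite (carrier \<Gamma>)" and \<nu>: "\<nu> \<in> carrier K" "\<nu> \<otimes>\<^bsub>K\<^esub> (\<Oplus>\<^bsub>K\<^esub>g\<in>carrier \<Gamma>. \<one>\<^bsub>K\<^esub>) = \<one>\<^bsub>K\<^esub>"
    and v: "v \<in> carrier V" "\<And>g. g \<in> carrier \<Gamma> \<Longrightarrow> act V g v = v"
  shows "average \<nu> v = v"
proof -
  interpret V: module K V by (rule rep_module)
  have "(\<Oplus>\<^bsub>V\<^esub>g\<in>carrier \<Gamma>. act V g v) = (\<Oplus>\<^bsub>V\<^esub>g\<in>carrier \<Gamma>. v)"
    by (rule V.M.finsum_cong') (use v in auto)
  also have "\<dots> = (\<Oplus>\<^bsub>K\<^esub>g\<in>carrier \<Gamma>. \<one>\<^bsub>K\<^esub>) \<odot>\<^bsub>V\<^esub> v" by (rule V.finsum_constant[OF fin v(1)])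
  also have "\<nu> \<odot>\<^bsub>V\<^esub> \<dots> = (\<nu> \<otimes>\<^bsub>K\<^esub> (\<Oplus>\<^bsub>K\<^esub>g\<in>carrier \<Gamma>. \<one>\<^bsub>K\<^esub>)) \<odot>\<^bsub>V\<^esub> v"
    by (rule V.smult_assoc1[symmetric]) (use \<nu>(1) v(1) in \<open>auto intro!: V.R.finsum_closed\<close>)
  finally show ?thesis using \<nu> v(1) by (simp add: average_def)
qed

lemma average_sum:
  assumes fin: "finite (carrier \<Gamma>)" and \<nu>: "\<nu> \<in> carrier K" and v: "v \<in> carrier V" and W: "module K W"
    and f: "f \<in> linear_maps K V W"
  shows "f (average \<nu> v) = \<nu> \<odot>\<^bsub>W\<^esub> (\<Oplus>\<^bsub>W\<^esub>g\<in>carrier \<Gamma>. f (act V g v))"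
  using linear_mapsD(3)[OF f \<nu> sum_closed[OF v]]
    linear_maps_finsum[OF f module.axioms(2)[OF rep_module] module.axioms(2)[OF W] fin act_closed[OF _ v]]
  by (simp add: average_def)

end

text \<open>An equivariant linear map commutes with averaging, and an invariant vector is its own
  average. So a solution of an equivariant linear equation with invariant right-hand side can be
  averaged into an invariant solution.\<close>

lemma average_rep_hom:
  assumes V: "group_representation \<Gamma> K V" and W: "group_representation \<Gamma> K W" and fin: "finite (carrier \<Gamma>)"
    and \<nu>: "\<nu> \<in> carrier K" "\<nu> \<otimes>\<^bsub>K\<^esub> (\<Oplus>\<^bsub>K\<^esub>g\<in>carrier \<Gamma>. \<one>\<^bsub>K\<^esub>) = \<one>\<^bsub>K\<^esub>"
    and f: "f \<in> rep_homs K \<Gamma> V W" and v: "v \<in> carrier V"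
    and inv: "\<And>g. g \<in> carrier \<Gamma> \<Longrightarrow> act W g (f v) = f v"
  shows "f (group_representation.average \<Gamma> V \<nu> v) = f v"
proof -
  interpret V: group_representation \<Gamma> K V by fact
  interpret W: group_representation \<Gamma> K W by fact
  have fl: "f \<in> linear_maps K V W" and fe: "\<And>g v. g \<in> carrier \<Gamma> \<Longrightarrow> v \<in> carrier V \<Longrightarrow> f (act V g v) = act W g (f v)"
    using f by (auto simp: rep_homs_def)
  have "f (V.average \<nu> v) = \<nu> \<odot>\<^bsub>W\<^esub> (\<Oplus>\<^bsub>W\<^esub>g\<in>carrier \<Gamma>. f (act V g v))"
    by (rule V.average_sum[OF fin \<nu>(1) v W.rep_module fl])
  also have "(\<Oplus>\<^bsub>W\<^esub>g\<in>carrier \<Gamma>. f (act V g v)) = (\<Oplus>\<^bsub>W\<^esub>g\<in>carrier \<Gamma>. act W g (f v))"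
  proof -
    interpret WM: module K W by (rule W.rep_module)
    show ?thesis
      by (rule WM.M.finsum_cong') (use v fe W.act_closed linear_mapsD(1)[OF fl] in auto)
  qed
  also have "\<nu> \<odot>\<^bsub>W\<^esub> \<dots> = f v"
    using W.average_fixed[OF fin \<nu> linear_mapsD(1)[OF fl v] inv] by (simp add: W.average_def)
  finally show ?thesis .
qed


section \<open>Hom spaces as representations\<close>

context equivariant
begin

definition hom_rep :: "'o \<times> ('g \<Rightarrow> 'm) \<Rightarrow> 'o \<times> ('g \<Rightarrow> 'm) \<Rightarrow> ('k, 'm, 'g) rep_module" where
  "hom_rep X Y = module.extend (Hom C (fst X) (fst Y))
     (rep_module.fields (\<lambda>g f. snd Y g \<bullet> mo g f \<bullet> mor_inv C (ob g (fst X)) (fst X) (snd X g)))"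

lemma hom_rep_simps [simp]:
  "carrier (hom_rep X Y) = mor C (fst X) (fst Y)"
  "\<zero>\<^bsub>hom_rep X Y\<^esub> = \<zero>\<^bsub>Hom C (fst X) (fst Y)\<^esub>"
  "f \<oplus>\<^bsub>hom_rep X Y\<^esub> f' = f \<oplus>\<^bsub>Hom C (fst X) (fst Y)\<^esub> f'"
  "a \<odot>\<^bsub>hom_rep X Y\<^esub> f = a \<odot>\<^bsub>Hom C (fst X) (fst Y)\<^esub> f"
  by (simp_all add: hom_rep_def module.defs rep_module.defs)

lemma hom_rep_act: "act (hom_rep (X, \<psi>) (Y, \<chi>)) g f = \<chi> g \<bullet> mo g f \<bullet> mor_inv C (ob g X) X (\<psi> g)"
  by (simp add: hom_rep_def module.defs rep_module.defs)

text \<open>The value of the action is pinned down by an equation that does not mention the inverse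
  of \<open>\<psi> g\<close>; the properties of \<open>hom_rep\<close> are proved through
  it.\<close>

lemma hom_rep_act_iff:
  assumes X: "(X, \<psi>) \<in> equiv_objects \<Gamma> C T" and Y: "(Y, \<chi>) \<in> equiv_objects \<Gamma> C T" and g: "g \<in> carrier \<Gamma>"
    and f: "f \<in> arr C X Y"
  shows "act (hom_rep (X, \<psi>) (Y, \<chi>)) g f \<in> arr C X Y"
    "act (hom_rep (X, \<psi>) (Y, \<chi>)) g f \<bullet> \<psi> g = \<chi> g \<bullet> mo g f"
    "\<lbrakk>f' \<in> arr C X Y; f' \<bullet> \<psi> g = \<chi> g \<bullet> mo g f\<rbrakk> \<Longrightarrow> f' = act (hom_rep (X, \<psi>) (Y, \<chi>)) g f"
proof -
  note x = equiv_objectsD(1)[OF X] and d = equiv_objectsD(4)[OF X g] equiv_objectsD(4)[OF Y g]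
  note iso = equiv_objectsD(3)[OF X g]
  note i = mor_inv_iso[OF iso act_ob_closed[OF g x] x]
  note m = comp[OF mo_arr[OF g f] d(2)]
  show a: "act (hom_rep (X, \<psi>) (Y, \<chi>)) g f \<in> arr C X Y"
    unfolding hom_rep_act by (rule comp[OF i(2) m])
  show e: "act (hom_rep (X, \<psi>) (Y, \<chi>)) g f \<bullet> \<psi> g = \<chi> g \<bullet> mo g f"
    unfolding hom_rep_act using assoc[OF i(1,2) m] i(3) idr[OF m] by metis
  show "f' = act (hom_rep (X, \<psi>) (Y, \<chi>)) g f" if "f' \<in> arr C X Y" "f' \<bullet> \<psi> g = \<chi> g \<bullet> mo g f"
    by (rule iso_cancel_right[OF iso act_ob_closed[OF g x] that(1) a]) (use that(2) e in simp)
qed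

lemma hom_rep_invariant_iff:
  assumes X: "(X, \<psi>) \<in> equiv_objects \<Gamma> C T" and Y: "(Y, \<chi>) \<in> equiv_objects \<Gamma> C T" and f: "f \<in> arr C X Y"
  shows "f \<in> arr D (X, \<psi>) (Y, \<chi>) \<longleftrightarrow> (\<forall>g\<in>carrier \<Gamma>. act (hom_rep (X, \<psi>) (Y, \<chi>)) g f = f)"
  using hom_rep_act_iff[OF X Y _ f] X Y f by (auto simp: arr_D)

text \<open>For each axiom the claimed value satisfies the equation that characterises the action.
  Multiplicativity is a computation with graded composition.\<close>

lemma representation_hom_rep:
  assumes X: "(X, \<psi>) \<in> equiv_objects \<Gamma> C T" and Y: "(Y, \<chi>) \<in> equiv_objects \<Gamma> C T"
  shows "representation K \<Gamma> (hom_rep (X, \<psi>) (Y, \<chi>))"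
proof -
  note x = equiv_objectsD(1)[OF X] and y = equiv_objectsD(1)[OF Y]
  let ?V = "hom_rep (X, \<psi>) (Y, \<chi>)"
  note A = hom_rep_act_iff[OF X Y]
  have carr: "f \<in> carrier ?V \<longleftrightarrow> f \<in> arr C X Y" for f using x y by (simp add: arr_def)
  show ?thesis
    unfolding representation_def
  proof (intro conjI ballI)
    show "module K ?V" by (rule module_cong[OF Hom_module[OF x y]]) simp_all
    show "act ?V \<one>\<^bsub>\<Gamma>\<^esub> f = f" if "f \<in> carrier ?V" for f
      using A(3)[OF G.one_closed that[unfolded carr] that[unfolded carr]] unt_natural[OF that[unfolded carr]]
        equiv_objectsD(6)[OF X] equiv_objectsD(6)[OF Y] by simp
    show "act ?V g \<in> linear_maps K ?V ?V" if g: "g \<in> carrier \<Gamma>" for g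
      unfolding linear_maps_def
    proof (intro CollectI conjI funcsetI ballI)
      note d = equiv_objectsD(4)[OF X g] equiv_objectsD(4)[OF Y g]
      show "act ?V g f \<in> carrier ?V" if "f \<in> carrier ?V" for f using A(1)[OF g that[unfolded carr]] by (simp only: carr)
      show "act ?V g (f \<oplus>\<^bsub>?V\<^esub> f') = act ?V g f \<oplus>\<^bsub>?V\<^esub> act ?V g f'" if f: "f \<in> carrier ?V" "f' \<in> carrier ?V" for f f'
      proof -
        note f = f[unfolded carr] and a = A(1)[OF g f(1)[unfolded carr]] A(1)[OF g f(2)[unfolded carr]]
        have "act ?V g f \<oplus>\<^bsub>Hom C X Y\<^esub> act ?V g f' = act ?V g (f \<oplus>\<^bsub>Hom C X Y\<^esub> f')"
          by (rule A(3)[OF g add_arr[OF f] add_arr[OF a]])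
             (simp add: add_comp[OF d(1) a] A(2)[OF g f(1)] A(2)[OF g f(2)] mo_add[OF g f]
               comp_add[OF mo_arr[OF g f(1)] mo_arr[OF g f(2)] d(2)])
        then show ?thesis by simp
      qed
      show "act ?V g (r \<odot>\<^bsub>?V\<^esub> f) = r \<odot>\<^bsub>?V\<^esub> act ?V g f" if r: "r \<in> carrier K" and f: "f \<in> carrier ?V" for r f
      proof -
        note f = f[unfolded carr] and a = A(1)[OF g f[unfolded carr]]
        have "r \<odot>\<^bsub>Hom C X Y\<^esub> act ?V g f = act ?V g (r \<odot>\<^bsub>Hom C X Y\<^esub> f)"
          by (rule A(3)[OF g smult_arr[OF r f] smult_arr[OF r a]])
             (simp add: smult_comp[OF r d(1) a] A(2)[OF g f] mo_smult[OF g r f] comp_smult[OF r mo_arr[OF g f] d(2)])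
        then show ?thesis by simp
      qed
    qed
    show "act ?V (g \<otimes>\<^bsub>\<Gamma>\<^esub> h) f = act ?V g (act ?V h f)"
      if g: "g \<in> carrier \<Gamma>" and h: "h \<in> carrier \<Gamma>" and f: "f \<in> carrier ?V" for g h f
    proof -
      note f = f[unfolded carr]
      have gh: "g \<otimes>\<^bsub>\<Gamma>\<^esub> h \<in> carrier \<Gamma>" using g h by simp
      note d = equiv_objectsD(4)[OF X g] equiv_objectsD(4)[OF X h] equiv_objectsD(4)[OF Y g] equiv_objectsD(4)[OF Y h]
      note a = A(1)[OF h f] and b = A(1)[OF g A(1)[OF h f]]
      have "act ?V g (act ?V h f) \<bullet> \<psi> (g \<otimes>\<^bsub>\<Gamma>\<^esub> h) = gc g h X (\<chi> g \<bullet> mo g (act ?V h f)) (\<psi> h)"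
        using equiv_objectsD(5)[OF X g h] gc_post[OF g h d(2,1) x b] A(2)[OF g a] by simp
      also have "\<dots> = gc g h X (\<chi> g) (\<chi> h \<bullet> mo h f)"
        using gc_mid[OF g h d(2,3) a] A(2)[OF h f] by simp
      also have "\<dots> = \<chi> (g \<otimes>\<^bsub>\<Gamma>\<^esub> h) \<bullet> mo (g \<otimes>\<^bsub>\<Gamma>\<^esub> h) f"
        using gc_pre[OF g h d(4,3) f] equiv_objectsD(5)[OF Y g h] by simp
      finally show ?thesis using A(3)[OF gh f b] by simp
    qed
  qed
qed

lemma hom_rep_post:
  assumes X: "(X, \<psi>) \<in> equiv_objects \<Gamma> C T" and f: "f \<in> arr D (Y, \<chi>) (Z, \<omega>)"
  shows "(\<lambda>u. f \<bullet> u) \<in> rep_homs K \<Gamma> (hom_rep (X, \<psi>) (Y, \<chi>)) (hom_rep (X, \<psi>) (Z, \<omega>))"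
proof -
  have Y: "(Y, \<chi>) \<in> equiv_objects \<Gamma> C T" and Z: "(Z, \<omega>) \<in> equiv_objects \<Gamma> C T" and fC: "f \<in> arr C Y Z"
    and eq: "\<And>g. g \<in> carrier \<Gamma> \<Longrightarrow> f \<bullet> \<chi> g = \<omega> g \<bullet> mo g f" using f by (auto simp: arr_D)
  note x = equiv_objectsD(1)[OF X] and y = equiv_objectsD(1)[OF Y] and z = equiv_objectsD(1)[OF Z]
  have "f \<bullet> act (hom_rep (X, \<psi>) (Y, \<chi>)) g u = act (hom_rep (X, \<psi>) (Z, \<omega>)) g (f \<bullet> u)"
    if g: "g \<in> carrier \<Gamma>" and u: "u \<in> arr C X Y" for g u
  proof -
    note a = hom_rep_act_iff[OF X Y g u]
    note d = equiv_objectsD(4)[OF X g] equiv_objectsD(4)[OF Y g] equiv_objectsD(4)[OF Z g]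
    show ?thesis
      by (rule hom_rep_act_iff(3)[OF X Z g comp[OF u fC] comp[OF a(1) fC]])
         (use assoc[OF d(1) a(1) fC] a(2) assoc[OF mo_arr[OF g u] d(2) fC] eq[OF g]
           assoc[OF mo_arr[OF g u] mo_arr[OF g fC] d(3)] mo_comp[OF g u fC] in metis)
  qed
  moreover have "(\<lambda>u. f \<bullet> u) \<in> linear_maps K (hom_rep (X, \<psi>) (Y, \<chi>)) (hom_rep (X, \<psi>) (Z, \<omega>))"
    using Comp_linear_right[OF x y z arr_mor[OF fC]] by (simp add: linear_maps_def)
  ultimately show ?thesis using x y by (simp add: rep_homs_def arr_def)
qed

lemma hom_rep_pre:
  assumes Z: "(Z, \<omega>) \<in> equiv_objects \<Gamma> C T" and f: "f \<in> arr D (X, \<psi>) (Y, \<chi>)"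
  shows "(\<lambda>u. u \<bullet> f) \<in> rep_homs K \<Gamma> (hom_rep (Y, \<chi>) (Z, \<omega>)) (hom_rep (X, \<psi>) (Z, \<omega>))"
proof -
  have X: "(X, \<psi>) \<in> equiv_objects \<Gamma> C T" and Y: "(Y, \<chi>) \<in> equiv_objects \<Gamma> C T" and fC: "f \<in> arr C X Y"
    and eq: "\<And>g. g \<in> carrier \<Gamma> \<Longrightarrow> f \<bullet> \<psi> g = \<chi> g \<bullet> mo g f" using f by (auto simp: arr_D)
  note x = equiv_objectsD(1)[OF X] and y = equiv_objectsD(1)[OF Y] and z = equiv_objectsD(1)[OF Z]
  have "act (hom_rep (Y, \<chi>) (Z, \<omega>)) g u \<bullet> f = act (hom_rep (X, \<psi>) (Z, \<omega>)) g (u \<bullet> f)"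
    if g: "g \<in> carrier \<Gamma>" and u: "u \<in> arr C Y Z" for g u
  proof -
    note a = hom_rep_act_iff[OF Y Z g u]
    note d = equiv_objectsD(4)[OF X g] equiv_objectsD(4)[OF Y g] equiv_objectsD(4)[OF Z g]
    show ?thesis
      by (rule hom_rep_act_iff(3)[OF X Z g comp[OF fC u] comp[OF fC a(1)]])
         (use assoc[OF d(1) fC a(1)] a(2) assoc[OF mo_arr[OF g fC] d(2) a(1)] eq[OF g]
           assoc[OF mo_arr[OF g fC] mo_arr[OF g u] d(3)] mo_comp[OF g fC u] in metis)
  qed
  moreover have "(\<lambda>u. u \<bullet> f) \<in> linear_maps K (hom_rep (Y, \<chi>) (Z, \<omega>)) (hom_rep (X, \<psi>) (Z, \<omega>))"
    using Comp_linear_left[OF x y z arr_mor[OF fC]] by (simp add: linear_maps_def)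
  ultimately show ?thesis using y z by (simp add: rep_homs_def arr_def)
qed


section \<open>The group action on extension classes\<close>

definition act_ext_triple :: "'g \<Rightarrow> 'o \<times> 'm \<times> 'm \<Rightarrow> 'o \<times> 'm \<times> 'm" where
  "act_ext_triple g = (\<lambda>(E, i, p). (ob g E, mo g i, mo g p))"

lemma act_ext_triple_mor:
  assumes m: "ext_mor C X Y X' Y' a b e e'" and g: "g \<in> carrier \<Gamma>" and a: "a \<in> arr C X X'" and b: "b \<in> arr C Y Y'"
  shows "ext_mor C (ob g X) (ob g Y) (ob g X') (ob g Y') (mo g a) (mo g b) (act_ext_triple g e) (act_ext_triple g e')"
proof -
  obtain E i p E' i' p' where es: "e = (E, i, p)" "e' = (E', i', p')" by (metis prod_cases3)
  from m obtain u where ex: "(E, i, p) \<in> exts C X Y" "(E', i', p') \<in> exts C X' Y'"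
    and u: "u \<in> arr C E E'" "u \<bullet> i = i' \<bullet> b" "p' \<bullet> u = a \<bullet> p" by (auto simp: ext_mor_def es)
  note x = exts_arr[OF ex(1)] and x' = exts_arr[OF ex(2)]
  have "mo g u \<bullet> mo g i = mo g i' \<bullet> mo g b" "mo g p' \<bullet> mo g u = mo g a \<bullet> mo g p"
    using mo_comp[OF g x(2) u(1)] mo_comp[OF g b x'(2)] mo_comp[OF g u(1) x'(3)] mo_comp[OF g x(3) a] u by metis+
  then show ?thesis
    using action_Confl[OF g x(1)] action_Confl[OF g x'(1)] mo_arr[OF g u(1)]
    by (auto simp: ext_mor_def es act_ext_triple_def exts_def)
qed

lemma act_ext_triple_exts:
  assumes "e \<in> exts C X Y" "g \<in> carrier \<Gamma>" shows "act_ext_triple g e \<in> exts C (ob g X) (ob g Y)"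
  by (rule ext_mor_exts(1)[OF act_ext_triple_mor[OF ext_mor_refl[OF assms(1)] assms(2)
        Id_arr[OF exts_Ob(1)[OF assms(1)]] Id_arr[OF exts_Ob(2)[OF assms(1)]]]])

text \<open>\<open>act_ext\<close> is the union of the classes of all translated members;
  translation preserves equivalences, so these classes are one and the same.\<close>

lemma act_ext_cls:
  assumes e: "e \<in> exts C X Y" and g: "g \<in> carrier \<Gamma>"
  shows "act_ext C T g X Y (ext_cls C X Y e) = ext_cls C (ob g X) (ob g Y) (act_ext_triple g e)"
proof -
  note X = exts_Ob[OF e]
  have same: "ext_cls C (ob g X) (ob g Y) (act_ext_triple g e') = ext_cls C (ob g X) (ob g Y) (act_ext_triple g e)"
    if e': "e' \<in> ext_cls C X Y e" for e'
  proof -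
    have "ext_mor C X Y X Y (Id C X) (Id C Y) e e'" using e' by (simp add: ext_equiv_iff)
    from act_ext_triple_mor[OF this g Id_arr[OF X(1)] Id_arr[OF X(2)]]
    have "ext_mor C (ob g X) (ob g Y) (ob g X) (ob g Y) (Id C (ob g X)) (Id C (ob g Y))
        (act_ext_triple g e) (act_ext_triple g e')"
      using act_mor_Id[OF g X(1)] act_mor_Id[OF g X(2)] by simp
    then show ?thesis using ext_cls_eq by blast
  qed
  have "act_ext C T g X Y (ext_cls C X Y e) = (\<Union>e'\<in>ext_cls C X Y e. ext_cls C (ob g X) (ob g Y) (act_ext_triple g e'))"
    by (force simp: act_ext_def act_ext_triple_def)
  also have "\<dots> = ext_cls C (ob g X) (ob g Y) (act_ext_triple g e)"
    using same ext_cls_self[OF e] by blast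
  finally show ?thesis .
qed

lemma act_ext_closed:
  assumes "\<xi> \<in> carrier (Ext C X Y)" and g: "g \<in> carrier \<Gamma>"
  shows "act_ext C T g X Y \<xi> \<in> carrier (Ext C (ob g X) (ob g Y))"
proof -
  from ExtE[OF assms(1)] obtain e where e: "e \<in> exts C X Y" "\<xi> = ext_cls C X Y e" .
  show ?thesis using act_ext_cls[OF e(1) g] ext_cls_carrier[OF act_ext_triple_exts[OF e(1) g]] e(2) by simp
qed

text \<open>Translation is an exact functor, so it carries the morphisms of extensions that compute
  Ext(a, b) to those that compute it for the translated maps.\<close>

lemma act_ext_map:
  assumes \<xi>: "\<xi> \<in> carrier (Ext C X Y)" and g: "g \<in> carrier \<Gamma>" and a: "a \<in> arr C X' X" and b: "b \<in> arr C Y Y'"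
  shows "act_ext C T g X' Y' (ext_map C X X' Y' a b \<xi>)
    = ext_map C (ob g X) (ob g X') (ob g Y') (mo g a) (mo g b) (act_ext C T g X Y \<xi>)"
proof -
  from ExtE[OF \<xi>] obtain e where e: "e \<in> exts C X Y" "\<xi> = ext_cls C X Y e" .
  note X = arr_cod[OF a] and Y' = arr_cod[OF b]
  from ext_map_rep[OF e(1) a b] obtain e1 e2 where
    m: "ext_mor C X Y X Y' (Id C X) b e e1" "ext_mor C X' Y' X Y' a (Id C Y') e2 e1"
    "ext_map C X X' Y' a b (ext_cls C X Y e) = ext_cls C X' Y' e2" .
  have "ext_map C (ob g X) (ob g X') (ob g Y') (mo g a) (mo g b) (ext_cls C (ob g X) (ob g Y) (act_ext_triple g e))
      = ext_cls C (ob g X') (ob g Y') (act_ext_triple g e2)"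
    using ext_map_cls[OF _ _ mo_arr[OF g a] mo_arr[OF g b]] act_ext_triple_mor[OF m(1) g Id_arr[OF X] b]
      act_ext_triple_mor[OF m(2) g a Id_arr[OF Y']] act_mor_Id[OF g X] act_mor_Id[OF g Y'] by simp
  then show ?thesis using e(2) m(3) act_ext_cls[OF e(1) g] act_ext_cls[OF ext_mor_exts(1)[OF m(2)] g] by simp
qed

lemma rep_Ext_simps [simp]:
  "carrier (rep_Ext C T X Y) = carrier (Ext C (fst X) (fst Y))"
  "\<zero>\<^bsub>rep_Ext C T X Y\<^esub> = \<zero>\<^bsub>Ext C (fst X) (fst Y)\<^esub>"
  "\<xi> \<oplus>\<^bsub>rep_Ext C T X Y\<^esub> \<xi>' = \<xi> \<oplus>\<^bsub>Ext C (fst X) (fst Y)\<^esub> \<xi>'"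
  "a \<odot>\<^bsub>rep_Ext C T X Y\<^esub> \<xi> = a \<odot>\<^bsub>Ext C (fst X) (fst Y)\<^esub> \<xi>"
  by (simp_all add: rep_Ext_def module.defs rep_module.defs split: prod.split)

lemma rep_Ext_act: "act (rep_Ext C T (X, \<psi>) (Y, \<chi>)) g \<xi>
    = ext_map C (ob g X) X Y (mor_inv C (ob g X) X (\<psi> g)) (\<chi> g) (act_ext C T g X Y \<xi>)"
  by (simp add: rep_Ext_def module.defs rep_module.defs)

text \<open>After a pushout along \<open>b\<close> the right end is changed by composing the
  deflation with the isomorphism \<open>a\<close>, which keeps the sequence a conflation.\<close>

lemma ext_mor_along_iso:
  assumes e: "e \<in> exts C X Y" and a: "a \<in> isos C X X'" and X': "X' \<in> Ob C" and b: "b \<in> arr C Y Y'"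
  obtains e' where "ext_mor C X Y X' Y' a b e e'"
proof -
  from push_mor_exists[OF e b] obtain e1 where e1: "ext_mor C X Y X Y' (Id C X) b e e1" .
  obtain E i p where ep: "e1 = (E, i, p)" by (metis prod_cases3)
  note x = exts_arr[OF ext_mor_exts(2)[OF e1, unfolded ep]]
  from isosE[OF a x(5) X'] have a': "a \<in> arr C X X'" by blast
  have "Confl C Y' i E (a \<bullet> p) X'"
    by (rule Confl_iso[OF x(1,6,7) X' arr_mor[OF x(2)] arr_mor[OF comp[OF x(3) a']] Id_isos[OF x(6)] Id_isos[OF x(7)] a])
       (simp_all add: idl[OF x(2)] idr[OF x(2)] idr[OF comp[OF x(3) a']])
  then have "ext_mor C X Y' X' Y' a (Id C Y') e1 (E, i, a \<bullet> p)"
    using x Id_arr[OF x(7)] idl[OF x(2)] idr[OF x(2)] idr[OF comp[OF x(3) a']] ext_mor_exts(2)[OF e1]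
    by (auto simp: ext_mor_def ep exts_def)
  from ext_mor_comp[OF e1 this Id_arr[OF x(5)] b a' Id_arr[OF x(6)]]
  have "ext_mor C X Y X' Y' a b e (E, i, a \<bullet> p)" using idr[OF a'] idl[OF b] by simp
  then show ?thesis using that by blast
qed

context
  fixes X \<psi> Y \<chi>
  assumes X: "(X, \<psi>) \<in> equiv_objects \<Gamma> C T" and Y: "(Y, \<chi>) \<in> equiv_objects \<Gamma> C T"
begin

text \<open>Replaces the inverse of the structure map in \<open>rep_Ext\<close> by a morphism of
  extensions with structure maps at both ends, so that the action is computed by exhibiting a middle
  component.\<close>

lemma rep_Ext_act_cls:
  assumes m: "ext_mor C (ob g X) (ob g Y) X Y (\<psi> g) (\<chi> g) (act_ext_triple g e) e'" and g: "g \<in> carrier \<Gamma>"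
    and e: "e \<in> exts C X Y"
  shows "act (rep_Ext C T (X, \<psi>) (Y, \<chi>)) g (ext_cls C X Y e) = ext_cls C X Y e'"
proof -
  note x = equiv_objectsD(1)[OF X] and d = equiv_objectsD(4)[OF X g] equiv_objectsD(4)[OF Y g]
  note i = mor_inv_iso[OF equiv_objectsD(3)[OF X g] act_ob_closed[OF g x] x]
  show ?thesis unfolding rep_Ext_act act_ext_cls[OF e g] by (rule ext_map_iso[OF m d(1) i(2,4) d(2)])
qed

lemma rep_Ext_act_rep:
  assumes e: "e \<in> exts C X Y" and g: "g \<in> carrier \<Gamma>"
  obtains e' where "ext_mor C (ob g X) (ob g Y) X Y (\<psi> g) (\<chi> g) (act_ext_triple g e) e'"
    "act (rep_Ext C T (X, \<psi>) (Y, \<chi>)) g (ext_cls C X Y e) = ext_cls C X Y e'"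
proof -
  from ext_mor_along_iso[OF act_ext_triple_exts[OF e g] equiv_objectsD(3)[OF X g] equiv_objectsD(1)[OF X] equiv_objectsD(4)[OF Y g]]
  obtain e' where m: "ext_mor C (ob g X) (ob g Y) X Y (\<psi> g) (\<chi> g) (act_ext_triple g e) e'" .
  show ?thesis using that[OF m rep_Ext_act_cls[OF m g e]] .
qed

text \<open>The source of the candidate structure maps: when the class is fixed, the acted class is
  again represented by \<open>e\<close>, and the middle component becomes a morphism from the
  translate of \<open>E\<close> to \<open>E\<close> over the structures of the ends.\<close>

lemma rep_Ext_act_fixed:
  assumes e: "e \<in> exts C X Y" and g: "g \<in> carrier \<Gamma>"
    and fix_cls: "act (rep_Ext C T (X, \<psi>) (Y, \<chi>)) g (ext_cls C X Y e) = ext_cls C X Y e"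
  shows "ext_mor C (ob g X) (ob g Y) X Y (\<psi> g) (\<chi> g) (act_ext_triple g e) e"
proof -
  note x = equiv_objectsD(1)[OF X] and y = equiv_objectsD(1)[OF Y]
  note d = equiv_objectsD(4)[OF X g] equiv_objectsD(4)[OF Y g]
  from rep_Ext_act_rep[OF e g] obtain e' where
    m: "ext_mor C (ob g X) (ob g Y) X Y (\<psi> g) (\<chi> g) (act_ext_triple g e) e'"
    and eq: "act (rep_Ext C T (X, \<psi>) (Y, \<chi>)) g (ext_cls C X Y e) = ext_cls C X Y e'" .
  have "e \<in> ext_cls C X Y e'" using fix_cls eq ext_cls_self[OF e] by simp
  then have "ext_mor C X Y X Y (Id C X) (Id C Y) e' e" by (simp add: ext_equiv_iff)
  from ext_mor_comp[OF m this d Id_arr[OF x] Id_arr[OF y]] show ?thesis using idl[OF d(1)] idl[OF d(2)] by simp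
qed

lemma rep_Ext_act_closed:
  assumes \<xi>: "\<xi> \<in> carrier (Ext C X Y)" and g: "g \<in> carrier \<Gamma>"
  shows "act (rep_Ext C T (X, \<psi>) (Y, \<chi>)) g \<xi> \<in> carrier (Ext C X Y)"
proof -
  from ExtE[OF \<xi>] obtain e where e: "e \<in> exts C X Y" "\<xi> = ext_cls C X Y e" .
  from rep_Ext_act_rep[OF e(1) g] obtain e' where
    "ext_mor C (ob g X) (ob g Y) X Y (\<psi> g) (\<chi> g) (act_ext_triple g e) e'"
    "act (rep_Ext C T (X, \<psi>) (Y, \<chi>)) g (ext_cls C X Y e) = ext_cls C X Y e'" .
  then show ?thesis using ext_cls_carrier[OF ext_mor_exts(2)] e(2) by simp
qed

text \<open>The unit map of the middle term is the required middle component, by naturality.\<close>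

lemma rep_Ext_act_one:
  assumes \<xi>: "\<xi> \<in> carrier (Ext C X Y)"
  shows "act (rep_Ext C T (X, \<psi>) (Y, \<chi>)) \<one>\<^bsub>\<Gamma>\<^esub> \<xi> = \<xi>"
proof -
  from ExtE[OF \<xi>] obtain e where e: "e \<in> exts C X Y" "\<xi> = ext_cls C X Y e" .
  obtain E i p where ep: "e = (E, i, p)" by (metis prod_cases3)
  note x = exts_arr[OF e(1)[unfolded ep]]
  have "ext_mor C (ob \<one>\<^bsub>\<Gamma>\<^esub> X) (ob \<one>\<^bsub>\<Gamma>\<^esub> Y) X Y (\<psi> \<one>\<^bsub>\<Gamma>\<^esub>) (\<chi> \<one>\<^bsub>\<Gamma>\<^esub>) (act_ext_triple \<one>\<^bsub>\<Gamma>\<^esub> e) e"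
    using e(1) act_ext_triple_exts[OF e(1) G.one_closed] unt_arr[OF x(7)] unt_natural[OF x(2)] unt_natural[OF x(3)]
      equiv_objectsD(6)[OF X] equiv_objectsD(6)[OF Y] by (auto simp: ext_mor_def ep act_ext_triple_def)
  from rep_Ext_act_cls[OF this G.one_closed e(1)] show ?thesis using e(2) by simp
qed

text \<open>The graded composite of the two middle components is a middle component for the product,
  because the structure maps at the ends are multiplicative.\<close>

lemma rep_Ext_act_mult:
  assumes \<xi>: "\<xi> \<in> carrier (Ext C X Y)" and g: "g \<in> carrier \<Gamma>" and h: "h \<in> carrier \<Gamma>"
  shows "act (rep_Ext C T (X, \<psi>) (Y, \<chi>)) (g \<otimes>\<^bsub>\<Gamma>\<^esub> h) \<xi>
    = act (rep_Ext C T (X, \<psi>) (Y, \<chi>)) g (act (rep_Ext C T (X, \<psi>) (Y, \<chi>)) h \<xi>)"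
proof -
  have gh: "g \<otimes>\<^bsub>\<Gamma>\<^esub> h \<in> carrier \<Gamma>" using g h by simp
  from ExtE[OF \<xi>] obtain e where e: "e \<in> exts C X Y" "\<xi> = ext_cls C X Y e" .
  from rep_Ext_act_rep[OF e(1) h] obtain e' where m: "ext_mor C (ob h X) (ob h Y) X Y (\<psi> h) (\<chi> h) (act_ext_triple h e) e'"
    and act1: "act (rep_Ext C T (X, \<psi>) (Y, \<chi>)) h (ext_cls C X Y e) = ext_cls C X Y e'" .
  have e': "e' \<in> exts C X Y" using ext_mor_exts(2)[OF m] .
  from rep_Ext_act_rep[OF e' g] obtain e'' where m': "ext_mor C (ob g X) (ob g Y) X Y (\<psi> g) (\<chi> g) (act_ext_triple g e') e''"
    and act2: "act (rep_Ext C T (X, \<psi>) (Y, \<chi>)) g (ext_cls C X Y e') = ext_cls C X Y e''" .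
  obtain E i p E' i' p' E'' i'' p'' where es: "e = (E, i, p)" "e' = (E', i', p')" "e'' = (E'', i'', p'')"
    by (metis prod_cases3)
  note x = exts_arr[OF e(1)[unfolded es]] and x' = exts_arr[OF e'[unfolded es]]
    and x'' = exts_arr[OF ext_mor_exts(2)[OF m', unfolded es]]
  from m obtain v where v: "v \<in> arr C (ob h E) E'" "v \<bullet> mo h i = i' \<bullet> \<chi> h" "p' \<bullet> v = \<psi> h \<bullet> mo h p"
    by (auto simp: ext_mor_def es act_ext_triple_def)
  from m' obtain w where w: "w \<in> arr C (ob g E') E''" "w \<bullet> mo g i' = i'' \<bullet> \<chi> g" "p'' \<bullet> w = \<psi> g \<bullet> mo g p'"
    by (auto simp: ext_mor_def es act_ext_triple_def)
  note d = equiv_objectsD(4)[OF X g] equiv_objectsD(4)[OF X h] equiv_objectsD(4)[OF Y g] equiv_objectsD(4)[OF Y h]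
  have "gc g h E w v \<bullet> mo (g \<otimes>\<^bsub>\<Gamma>\<^esub> h) i = i'' \<bullet> \<chi> (g \<otimes>\<^bsub>\<Gamma>\<^esub> h)"
    using gc_pre[OF g h v(1) w(1) x(2)] v(2) gc_mid[OF g h d(4) w(1) x'(2)] w(2) gc_post[OF g h d(4,3) x(6) x''(2)]
      equiv_objectsD(5)[OF Y g h] by simp
  moreover have "p'' \<bullet> gc g h E w v = \<psi> (g \<otimes>\<^bsub>\<Gamma>\<^esub> h) \<bullet> mo (g \<otimes>\<^bsub>\<Gamma>\<^esub> h) p"
    using gc_post[OF g h v(1) w(1) x(7) x''(3)] w(3) gc_mid[OF g h v(1) d(1) x'(3)] v(3) gc_pre[OF g h d(2,1) x(3)]
      equiv_objectsD(5)[OF X g h] by simp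
  ultimately have "ext_mor C (ob (g \<otimes>\<^bsub>\<Gamma>\<^esub> h) X) (ob (g \<otimes>\<^bsub>\<Gamma>\<^esub> h) Y) X Y (\<psi> (g \<otimes>\<^bsub>\<Gamma>\<^esub> h)) (\<chi> (g \<otimes>\<^bsub>\<Gamma>\<^esub> h))
      (act_ext_triple (g \<otimes>\<^bsub>\<Gamma>\<^esub> h) e) e''"
    using act_ext_triple_exts[OF e(1) gh] ext_mor_exts(2)[OF m'] gc_arr[OF g h v(1) w(1) x(7)]
    by (auto simp: ext_mor_def es act_ext_triple_def)
  from rep_Ext_act_cls[OF this gh e(1)] show ?thesis using act1 act2 e(2) by simp
qed

end

text \<open>Equivariance of \<open>a\<close> lets it pass the inverse structure maps, where it turns
  into its translate; \<open>b\<close> does the same with the structure maps themselves, and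
  functoriality of Ext combines the two.\<close>

lemma rep_Ext_act_map:
  assumes \<xi>: "\<xi> \<in> carrier (Ext C X Y)" and g: "g \<in> carrier \<Gamma>"
    and a: "a \<in> arr D (X', \<psi>') (X, \<psi>)" and b: "b \<in> arr D (Y, \<chi>) (Y', \<chi>')"
  shows "ext_map C X X' Y' a b (act (rep_Ext C T (X, \<psi>) (Y, \<chi>)) g \<xi>)
    = act (rep_Ext C T (X', \<psi>') (Y', \<chi>')) g (ext_map C X X' Y' a b \<xi>)"
proof -
  have O: "(X, \<psi>) \<in> equiv_objects \<Gamma> C T" "(X', \<psi>') \<in> equiv_objects \<Gamma> C T"
    "(Y, \<chi>) \<in> equiv_objects \<Gamma> C T" "(Y', \<chi>') \<in> equiv_objects \<Gamma> C T"
    and aC: "a \<in> arr C X' X" and bC: "b \<in> arr C Y Y'"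
    and eq: "a \<bullet> \<psi>' g = \<psi> g \<bullet> mo g a" "b \<bullet> \<chi> g = \<chi>' g \<bullet> mo g b" using a b g by (auto simp: arr_D)
  note x = equiv_objectsD(1)[OF O(1)] equiv_objectsD(1)[OF O(2)]
  note i = mor_inv_iso[OF equiv_objectsD(3)[OF O(1) g] act_ob_closed[OF g x(1)] x(1)]
  note i' = mor_inv_iso[OF equiv_objectsD(3)[OF O(2) g] act_ob_closed[OF g x(2)] x(2)]
  note d = equiv_objectsD(4)[OF O(3) g] equiv_objectsD(4)[OF O(4) g]
  note ga = mo_arr[OF g aC] and gb = mo_arr[OF g bC]
  let ?j = "mor_inv C (ob g X) X (\<psi> g)" and ?j' = "mor_inv C (ob g X') X' (\<psi>' g)"
  have "?j \<bullet> a = mo g a \<bullet> ?j'"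
  proof (rule iso_cancel_left[OF equiv_objectsD(3)[OF O(1) g] x(1) comp[OF aC i(2)] comp[OF i'(2) ga]])
    show "\<psi> g \<bullet> (?j \<bullet> a) = \<psi> g \<bullet> (mo g a \<bullet> ?j')"
      using assoc[OF aC i(2,1)] i(4) idl[OF aC] assoc[OF i'(2) ga i(1)] eq(1) assoc[OF i'(2,1) aC] i'(4) idr[OF aC]
      by metis
  qed
  then show ?thesis
    unfolding rep_Ext_act act_ext_map[OF \<xi> g aC bC]
    using ext_map_comp[OF act_ext_closed[OF \<xi> g] i(2) d(1) aC bC] ext_map_comp[OF act_ext_closed[OF \<xi> g] ga gb i'(2) d(2)]
      eq(2) by simp
qed

end


lemma dual_rep_Ext [simp]:
  "dual K (rep_Ext C T X Y) = dual K (Ext C (fst X) (fst Y))"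
  by (cases X; cases Y) (simp add: dual_def rep_Ext_def module.defs rep_module.defs)

section \<open>The action on extension spaces\<close>

locale cy_equivariant = cy_category K C c + equivariant K \<Gamma> C T
  for K :: "('k, 'r) ring_scheme" and \<Gamma> :: "('g, 's) monoid_scheme"
    and C :: "('k, 'o, 'm) ex_cat" (structure) and T :: "('g, 'o, 'm) action_data"
    and c :: "('k, 'o, 'm) cy_map" +
  assumes cy_action: "cy_action \<Gamma> C T c"
begin

lemma cy_act_ext:
  assumes g: "g \<in> carrier \<Gamma>" and X: "X \<in> Ob C" "Y \<in> Ob C"
    and \<xi>: "\<xi> \<in> carrier (Ext C X Y)" and \<eta>: "\<eta> \<in> carrier (Ext C Y X)"
  shows "c X Y \<xi> \<eta> = c (ob g X) (ob g Y) (act_ext C T g X Y \<xi>) (act_ext C T g Y X \<eta>)"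
proof -
  have "c X Y \<xi> = (\<lambda>\<eta>\<in>carrier (Ext C Y X).
          c (ob g X) (ob g Y) (act_ext C T g X Y \<xi>) (act_ext C T g Y X \<eta>))"
    using cy_action g X \<xi> by (simp add: cy_action_def)
  then have "c X Y \<xi> \<eta> = (\<lambda>\<eta>\<in>carrier (Ext C Y X).
          c (ob g X) (ob g Y) (act_ext C T g X Y \<xi>) (act_ext C T g Y X \<eta>)) \<eta>" by (rule fun_cong)
  then show ?thesis using \<eta> by simp
qed

context
  fixes X \<psi> Y \<chi>
  assumes X: "(X, \<psi>) \<in> equiv_objects \<Gamma> C T" and Y: "(Y, \<chi>) \<in> equiv_objects \<Gamma> C T"
begin

text \<open>Naturality moves the structure maps from the first argument to the second, where they
  undo those in the action on \<eta> and leave its translate. What remains is the Calabi--Yau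
  condition for \<open>g\<close>.\<close>

lemma cy_rep_act:
  assumes g: "g \<in> carrier \<Gamma>" and \<xi>: "\<xi> \<in> carrier (Ext C X Y)" and \<eta>: "\<eta> \<in> carrier (Ext C Y X)"
  shows "c X Y (act (rep_Ext C T (X, \<psi>) (Y, \<chi>)) g \<xi>) (act (rep_Ext C T (Y, \<chi>) (X, \<psi>)) g \<eta>) = c X Y \<xi> \<eta>"
proof -
  note x = equiv_objectsD(1)[OF X] and y = equiv_objectsD(1)[OF Y]
  note d = equiv_objectsD(4)[OF X g] equiv_objectsD(4)[OF Y g]
  note i = mor_inv_iso[OF equiv_objectsD(3)[OF X g] act_ob_closed[OF g x] x]
  note j = mor_inv_iso[OF equiv_objectsD(3)[OF Y g] act_ob_closed[OF g y] y]
  let ?\<eta> = "act (rep_Ext C T (Y, \<chi>) (X, \<psi>)) g \<eta>"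
  have \<eta>': "?\<eta> \<in> carrier (Ext C Y X)" using rep_Ext_act_closed[OF Y X \<eta> g] .
  have "ext_map C Y (ob g Y) (ob g X) (\<chi> g) (mor_inv C (ob g X) X (\<psi> g)) ?\<eta> = act_ext C T g Y X \<eta>"
    unfolding rep_Ext_act
    using ext_map_comp[OF act_ext_closed[OF \<eta> g] j(2) d(1) d(2) i(2)] i(3) j(3) ext_map_Id[OF act_ext_closed[OF \<eta> g]]
    by simp
  then show ?thesis
    unfolding rep_Ext_act[of X \<psi> Y \<chi>]
    using cy_natural[OF act_ext_closed[OF \<xi> g] i(2) d(2) \<eta>'] cy_act_ext[OF g x y \<xi> \<eta>] by simp
qed

lemma rep_Ext_act_inverse:
  assumes g: "g \<in> carrier \<Gamma>" and \<xi>: "\<xi> \<in> carrier (Ext C X Y)"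
  shows "act (rep_Ext C T (X, \<psi>) (Y, \<chi>)) g (act (rep_Ext C T (X, \<psi>) (Y, \<chi>)) (inv\<^bsub>\<Gamma>\<^esub> g) \<xi>) = \<xi>"
  using rep_Ext_act_mult[OF X Y \<xi> g G.inv_closed[OF g]] rep_Ext_act_one[OF X Y \<xi>] g by simp

end

text \<open>Linearity of the action of \<open>g\<close> is tested through the pairing. Every test
  class is \<open>g\<close> applied to another one, and invariance of the pairing then removes
  \<open>g\<close> from both arguments.\<close>

lemma representation_rep_Ext:
  assumes X: "(X, \<psi>) \<in> equiv_objects \<Gamma> C T" and Y: "(Y, \<chi>) \<in> equiv_objects \<Gamma> C T"
  shows "representation K \<Gamma> (rep_Ext C T (X, \<psi>) (Y, \<chi>))"
proof -
  note x = equiv_objectsD(1)[OF X] equiv_objectsD(1)[OF Y]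
  let ?V = "rep_Ext C T (X, \<psi>) (Y, \<chi>)" and ?W = "rep_Ext C T (Y, \<chi>) (X, \<psi>)"
  have eqI: "\<xi> = \<xi>'" if g: "g \<in> carrier \<Gamma>" and \<xi>: "\<xi> \<in> carrier (Ext C X Y)" "\<xi>' \<in> carrier (Ext C X Y)"
    and eq: "\<And>\<eta>. \<eta> \<in> carrier (Ext C Y X) \<Longrightarrow> c X Y \<xi> (act ?W g \<eta>) = c X Y \<xi>' (act ?W g \<eta>)" for g \<xi> \<xi>'
  proof (rule cy_eqI[OF x \<xi>])
    fix \<eta> assume \<eta>: "\<eta> \<in> carrier (Ext C Y X)"
    show "c X Y \<xi> \<eta> = c X Y \<xi>' \<eta>"
      using eq[OF rep_Ext_act_closed[OF Y X \<eta> G.inv_closed[OF g]]] rep_Ext_act_inverse[OF Y X g \<eta>] by simp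
  qed
  have "act ?V g \<in> linear_maps K ?V ?V" if g: "g \<in> carrier \<Gamma>" for g
    unfolding linear_maps_def
  proof (intro CollectI conjI funcsetI ballI)
    note cl = rep_Ext_act_closed[OF X Y _ g] and cl' = rep_Ext_act_closed[OF Y X _ g]
    show "act ?V g \<xi> \<in> carrier ?V" if "\<xi> \<in> carrier ?V" for \<xi> using cl that by simp
    show "act ?V g (\<xi> \<oplus>\<^bsub>?V\<^esub> \<xi>') = act ?V g \<xi> \<oplus>\<^bsub>?V\<^esub> act ?V g \<xi>'"
      if "\<xi> \<in> carrier ?V" "\<xi>' \<in> carrier ?V" for \<xi> \<xi>'
    proof -
      have \<xi>: "\<xi> \<in> carrier (Ext C X Y)" "\<xi>' \<in> carrier (Ext C X Y)" using that by simp_all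
      have "act ?V g (\<xi> \<oplus>\<^bsub>Ext C X Y\<^esub> \<xi>') = act ?V g \<xi> \<oplus>\<^bsub>Ext C X Y\<^esub> act ?V g \<xi>'"
        by (rule eqI[OF g]) (simp_all add: cl cl' \<xi> Ext_add_closed cy_add x cy_rep_act[OF X Y g])
      then show ?thesis by simp
    qed
    show "act ?V g (r \<odot>\<^bsub>?V\<^esub> \<xi>) = r \<odot>\<^bsub>?V\<^esub> act ?V g \<xi>" if r: "r \<in> carrier K" and "\<xi> \<in> carrier ?V" for r \<xi>
    proof -
      have \<xi>: "\<xi> \<in> carrier (Ext C X Y)" using that by simp
      have "act ?V g (r \<odot>\<^bsub>Ext C X Y\<^esub> \<xi>) = r \<odot>\<^bsub>Ext C X Y\<^esub> act ?V g \<xi>"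
        by (rule eqI[OF g]) (simp_all add: cl cl' r \<xi> Ext_smult_closed cy_smult x cy_rep_act[OF X Y g])
      then show ?thesis by simp
    qed
  qed
  moreover have "module K ?V" by (rule module_cong[OF Ext_module[OF x]]) simp_all
  ultimately show ?thesis
    unfolding representation_def using rep_Ext_act_one[OF X Y] rep_Ext_act_mult[OF X Y] by simp
qed

lemma ext_map_rep_hom:
  assumes a: "a \<in> arr D (X', \<psi>') (X, \<psi>)" and b: "b \<in> arr D (Y, \<chi>) (Y', \<chi>')"
  shows "ext_map C X X' Y' a b \<in> rep_homs K \<Gamma> (rep_Ext C T (X, \<psi>) (Y, \<chi>)) (rep_Ext C T (X', \<psi>') (Y', \<chi>'))"
proof -
  have aC: "a \<in> arr C X' X" and bC: "b \<in> arr C Y Y'" using a b by (simp_all add: arr_D)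
  have "ext_map C X X' Y' a b \<in> linear_maps K (rep_Ext C T (X, \<psi>) (Y, \<chi>)) (rep_Ext C T (X', \<psi>') (Y', \<chi>'))"
    using ext_map_linear[OF aC bC] by (simp add: linear_maps_def)
  then show ?thesis using rep_Ext_act_map[OF _ _ a b] by (simp add: rep_homs_def)
qed

text \<open>At a test class \<eta>, write \<eta> as \<open>g\<close> applied to its image under the
  inverse of \<open>g\<close>; invariance of the pairing then produces the contragredient
  action.\<close>

lemma cy_rep_iso:
  assumes X: "(X, \<psi>) \<in> equiv_objects \<Gamma> C T" and Y: "(Y, \<chi>) \<in> equiv_objects \<Gamma> C T"
  shows "c X Y \<in> rep_isos K \<Gamma> (rep_Ext C T (X, \<psi>) (Y, \<chi>)) (contragredient K \<Gamma> (rep_Ext C T (Y, \<chi>) (X, \<psi>)))"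
proof -
  note x = equiv_objectsD(1)[OF X] equiv_objectsD(1)[OF Y]
  let ?V = "rep_Ext C T (X, \<psi>) (Y, \<chi>)" and ?W = "rep_Ext C T (Y, \<chi>) (X, \<psi>)"
  note l = linear_mapsD[OF cy_linear[OF x]]
  have "c X Y \<in> linear_maps K ?V (contragredient K \<Gamma> ?W)" using cy_linear[OF x] by (simp add: linear_maps_def)
  moreover have "c X Y (act ?V g \<xi>) = act (contragredient K \<Gamma> ?W) g (c X Y \<xi>)"
    if g: "g \<in> carrier \<Gamma>" and \<xi>: "\<xi> \<in> carrier (Ext C X Y)" for g \<xi>
  proof (rule extensionalityI[of _ "carrier (Ext C Y X)"])
    show "c X Y (act ?V g \<xi>) \<in> extensional (carrier (Ext C Y X))"
      using l(1)[OF rep_Ext_act_closed[OF X Y \<xi> g]] by (auto simp: dual_def PiE_def)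
    show "act (contragredient K \<Gamma> ?W) g (c X Y \<xi>) \<in> extensional (carrier (Ext C Y X))" by simp
    fix \<eta> assume \<eta>: "\<eta> \<in> carrier (Ext C Y X)"
    note \<eta>' = rep_Ext_act_closed[OF Y X \<eta> G.inv_closed[OF g]]
    show "c X Y (act ?V g \<xi>) \<eta> = act (contragredient K \<Gamma> ?W) g (c X Y \<xi>) \<eta>"
      using cy_rep_act[OF X Y g \<xi> \<eta>'] rep_Ext_act_inverse[OF Y X g \<eta>] \<eta> by simp
  qed
  ultimately show ?thesis using cy_bij[OF x] by (simp add: rep_isos_def rep_homs_def)
qed

theorem rep_cy_iso: "rep_cy_iso K \<Gamma> C T c"
proof -
  have obj: "representation K \<Gamma> (rep_Ext C T X Y) \<and> representation K \<Gamma> (contragredient K \<Gamma> (rep_Ext C T Y X)) \<and>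
      c (fst X) (fst Y) \<in> rep_isos K \<Gamma> (rep_Ext C T X Y) (contragredient K \<Gamma> (rep_Ext C T Y X))"
    if "X \<in> Ob D" "Y \<in> Ob D" for X Y
  proof -
    obtain x \<psi> y \<chi> where XY: "X = (x, \<psi>)" "Y = (y, \<chi>)" by (metis surj_pair)
    have o: "(x, \<psi>) \<in> equiv_objects \<Gamma> C T" "(y, \<chi>) \<in> equiv_objects \<Gamma> C T" using that by (simp_all add: XY)
    interpret R: group_representation \<Gamma> K "rep_Ext C T (y, \<chi>) (x, \<psi>)"
      by unfold_locales (rule representation_rep_Ext[OF o(2,1)])
    show ?thesis using representation_rep_Ext[OF o] R.representation_contragredient cy_rep_iso[OF o] by (simp add: XY)
  qed
  have map: "ext_map C (fst X) (fst X') (fst Y') a b \<in> rep_homs K \<Gamma> (rep_Ext C T X Y) (rep_Ext C T X' Y') \<and>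
      (\<lambda>\<phi>. \<lambda>\<eta>\<in>carrier (rep_Ext C T Y' X'). \<phi> (ext_map C (fst Y') (fst Y) (fst X) b a \<eta>))
        \<in> rep_homs K \<Gamma> (contragredient K \<Gamma> (rep_Ext C T Y X)) (contragredient K \<Gamma> (rep_Ext C T Y' X')) \<and>
      (\<forall>\<xi>\<in>carrier (rep_Ext C T X Y). c (fst X') (fst Y') (ext_map C (fst X) (fst X') (fst Y') a b \<xi>) =
        (\<lambda>\<eta>\<in>carrier (rep_Ext C T Y' X'). c (fst X) (fst Y) \<xi> (ext_map C (fst Y') (fst Y) (fst X) b a \<eta>)))"
    if "X \<in> Ob D" "Y \<in> Ob D" "X' \<in> Ob D" "Y' \<in> Ob D" "a \<in> mor D X' X" "b \<in> mor D Y Y'" for X Y X' Y' a b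
  proof -
    obtain x \<psi> y \<chi> x' \<psi>' y' \<chi>' where XY: "X = (x, \<psi>)" "Y = (y, \<chi>)" "X' = (x', \<psi>')" "Y' = (y', \<chi>')"
      by (metis surj_pair)
    have o: "(x, \<psi>) \<in> equiv_objects \<Gamma> C T" "(y, \<chi>) \<in> equiv_objects \<Gamma> C T"
      "(x', \<psi>') \<in> equiv_objects \<Gamma> C T" "(y', \<chi>') \<in> equiv_objects \<Gamma> C T"
      using that by (simp_all add: XY)
    have a: "a \<in> arr D (x', \<psi>') (x, \<psi>)" and b: "b \<in> arr D (y, \<chi>) (y', \<chi>')"
      using that o by (simp_all add: XY mor_D)
    have aC: "a \<in> arr C x' x" and bC: "b \<in> arr C y y'" using a b by (simp_all add: arr_D)
    have "c x' y' (ext_map C x x' y' a b \<xi>) = (\<lambda>\<eta>\<in>carrier (Ext C y' x'). c x y \<xi> (ext_map C y' y x b a \<eta>))"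
      if "\<xi> \<in> carrier (Ext C x y)" for \<xi>
      using cy that aC bC by (auto simp: cy_iso_def arr_def)
    moreover have "(\<lambda>\<phi>. \<lambda>\<eta>\<in>carrier (rep_Ext C T Y' X'). \<phi> (ext_map C y' y x b a \<eta>))
        \<in> rep_homs K \<Gamma> (contragredient K \<Gamma> (rep_Ext C T Y X)) (contragredient K \<Gamma> (rep_Ext C T Y' X'))"
      unfolding XY
      by (rule transpose_rep_hom[OF G.group_axioms representation_rep_Ext[OF o(4,3)] representation_rep_Ext[OF o(2,1)]
            ext_map_rep_hom[OF b a]])
    ultimately show ?thesis using ext_map_rep_hom[OF a b] by (simp add: XY)
  qed
  show ?thesis unfolding rep_cy_iso_def Let_def using obj map by blast
qed

end


section \<open>Extensions in the equivariant category\<close>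

context equivariant
begin

text \<open>Extensions of equivariant objects are thereby handled by the lemmas already proved for
  \<open>C\<close>, under the prefix \<open>EC\<close>.\<close>

sublocale EC: exact_category K D by (rule exact_category_D)

definition forget_triple :: "('o \<times> ('g \<Rightarrow> 'm)) \<times> 'm \<times> 'm \<Rightarrow> 'o \<times> 'm \<times> 'm" where
  "forget_triple = (\<lambda>(E, i, p). (fst E, i, p))"

text \<open>A conflation of \<open>C\<close> equivalent to one in the image may come with no chosen
  equivariant structure on its middle term, so the image is saturated under equivalence to become a
  class.\<close>

definition forget_ext ::
  "'o \<times> ('g \<Rightarrow> 'm) \<Rightarrow> 'o \<times> ('g \<Rightarrow> 'm) \<Rightarrow> ('o \<times> ('g \<Rightarrow> 'm), 'm) ext_class \<Rightarrow> ('o, 'm) ext_class" where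
  "forget_ext X Y \<xi> = ext_equiv C (fst X) (fst Y) `` (forget_triple ` \<xi>)"

lemma exts_D: "((E, \<theta>), i, p) \<in> exts D (X, \<psi>) (Y, \<chi>) \<longleftrightarrow>
    i \<in> arr D (Y, \<chi>) (E, \<theta>) \<and> p \<in> arr D (E, \<theta>) (X, \<psi>) \<and> (E, i, p) \<in> exts C X Y"
  by (simp add: exts_def Confl_D)

lemma forget_exts: "e \<in> exts D X Y \<Longrightarrow> forget_triple e \<in> exts C (fst X) (fst Y)"
  by (cases X; cases Y; cases e) (auto simp: forget_triple_def exts_D)

lemma forget_ext_mor:
  assumes "ext_mor D X Y X' Y' a b e e'"
  shows "ext_mor C (fst X) (fst Y) (fst X') (fst Y') a b (forget_triple e) (forget_triple e')"
proof -
  obtain E i p E' i' p' where es: "e = (E, i, p)" "e' = (E', i', p')" by (metis prod_cases3)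
  from assms obtain u where "(E, i, p) \<in> exts D X Y" "(E', i', p') \<in> exts D X' Y'"
    and u: "u \<in> arr D E E'" "u \<bullet> i = i' \<bullet> b" "p' \<bullet> u = a \<bullet> p"
    by (auto simp: ext_mor_def es)
  then show ?thesis
    using forget_exts[of "(E, i, p)" X Y] forget_exts[of "(E', i', p')" X' Y'] arr_D_forget[OF u(1)]
    by (auto simp: ext_mor_def es forget_triple_def)
qed

lemma forget_ext_cls:
  assumes e: "e \<in> exts D X Y"
  shows "forget_ext X Y (ext_cls D X Y e) = ext_cls C (fst X) (fst Y) (forget_triple e)"
proof -
  have same: "ext_cls C (fst X) (fst Y) (forget_triple e') = ext_cls C (fst X) (fst Y) (forget_triple e)"
    if "e' \<in> ext_cls D X Y e" for e'
  proof -
    have "ext_mor D X Y X Y (Id D X) (Id D Y) e e'" using that EC.mem_ext_cls by blast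
    from forget_ext_mor[OF this] show ?thesis using ext_cls_eq by simp
  qed
  have "forget_ext X Y (ext_cls D X Y e) = (\<Union>e'\<in>ext_cls D X Y e. ext_cls C (fst X) (fst Y) (forget_triple e'))"
    by (auto simp: forget_ext_def)
  also have "\<dots> = ext_cls C (fst X) (fst Y) (forget_triple e)" using same EC.ext_cls_self[OF e] by blast
  finally show ?thesis .
qed

lemma forget_ext_mem:
  assumes "\<xi> \<in> carrier (Ext D X Y)" "e \<in> \<xi>"
  shows "forget_ext X Y \<xi> = ext_cls C (fst X) (fst Y) (forget_triple e)" "forget_triple e \<in> forget_ext X Y \<xi>"
proof -
  note e = EC.Ext_mem_cls[OF assms]
  show "forget_ext X Y \<xi> = ext_cls C (fst X) (fst Y) (forget_triple e)"
    using forget_ext_cls[OF e(2)] e(1) by simp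
  then show "forget_triple e \<in> forget_ext X Y \<xi>" using ext_cls_self[OF forget_exts[OF e(2)]] by simp
qed

lemma forget_ext_closed: "\<xi> \<in> carrier (Ext D X Y) \<Longrightarrow> forget_ext X Y \<xi> \<in> carrier (Ext C (fst X) (fst Y))"
  using EC.ExtE forget_ext_cls ext_cls_carrier[OF forget_exts] by metis

lemma forget_ext_map:
  assumes \<xi>: "\<xi> \<in> carrier (Ext D X Y)" and a: "a \<in> arr D X' X" and b: "b \<in> arr D Y Y'"
  shows "forget_ext X' Y' (ext_map D X X' Y' a b \<xi>) = ext_map C (fst X) (fst X') (fst Y') a b (forget_ext X Y \<xi>)"
proof -
  from EC.ExtE[OF \<xi>] obtain e where e: "e \<in> exts D X Y" "\<xi> = ext_cls D X Y e" .
  from EC.ext_map_rep[OF e(1) a b] obtain e1 e2 where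
    m: "ext_mor D X Y X Y' (Id D X) b e e1" "ext_mor D X' Y' X Y' a (Id D Y') e2 e1"
    "ext_map D X X' Y' a b (ext_cls D X Y e) = ext_cls D X' Y' e2" .
  have "ext_map C (fst X) (fst X') (fst Y') a b (ext_cls C (fst X) (fst Y) (forget_triple e))
      = ext_cls C (fst X') (fst Y') (forget_triple e2)"
    by (rule ext_map_cls[OF _ _ arr_D_forget[OF a] arr_D_forget[OF b]])
       (use forget_ext_mor[OF m(1)] forget_ext_mor[OF m(2)] in simp_all)
  then show ?thesis using e m(3) forget_ext_cls[OF e(1)] forget_ext_cls[OF ext_mor_exts(1)[OF m(2)]] by simp
qed

lemma forget_ext_smult:
  assumes r: "r \<in> carrier K" and \<xi>: "\<xi> \<in> carrier (Ext D X Y)"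
  shows "forget_ext X Y (r \<odot>\<^bsub>Ext D X Y\<^esub> \<xi>) = r \<odot>\<^bsub>Ext C (fst X) (fst Y)\<^esub> forget_ext X Y \<xi>"
proof -
  obtain e where e: "e \<in> exts D X Y" using EC.ExtE[OF \<xi>] .
  note X = EC.exts_Ob[OF e]
  note I = EC.Id_arr[OF X(1)] EC.smult_arr[OF r EC.Id_arr[OF X(2)]]
  show ?thesis
    using EC.Ext_smult_map[OF r \<xi>] Ext_smult_map[OF r forget_ext_closed[OF \<xi>]] forget_ext_map[OF \<xi> I] by simp
qed

lemma biproduct_D_forget:
  assumes b: "biproduct D X Y S i1 i2 p1 p2" and X: "X \<in> equiv_objects \<Gamma> C T" and Y: "Y \<in> equiv_objects \<Gamma> C T"
  shows "biproduct C (fst X) (fst Y) (fst S) i1 i2 p1 p2"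
proof -
  have S: "S \<in> equiv_objects \<Gamma> C T" using b by (simp add: biproduct_def)
  have "i1 \<in> arr D X S" "i2 \<in> arr D Y S" "p1 \<in> arr D S X" "p2 \<in> arr D S Y"
    using b by (simp_all add: biproduct_def mor_D X Y S)
  from this[THEN arr_D_forget, THEN arr_mor] show ?thesis
    using b fst_equiv_object[OF S] by (simp add: biproduct_def)
qed

text \<open>A biproduct of equivariant objects is a biproduct of the underlying objects, so a triple
  in the equivariant Baer sum yields, with the same choices, a triple in the Baer sum of the images.
  One common member decides the equality of classes.\<close>

lemma forget_ext_add:
  assumes \<xi>: "\<xi> \<in> carrier (Ext D X Y)" and \<xi>': "\<xi>' \<in> carrier (Ext D X Y)"
  shows "forget_ext X Y (\<xi> \<oplus>\<^bsub>Ext D X Y\<^esub> \<xi>') = forget_ext X Y \<xi> \<oplus>\<^bsub>Ext C (fst X) (fst Y)\<^esub> forget_ext X Y \<xi>'"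
proof -
  have s: "baer_sum D X Y \<xi> \<xi>' \<in> carrier (Ext D X Y)" by (rule EC.baer_sum_closed[OF \<xi> \<xi>'])
  from EC.ExtE[OF s] obtain t where "t \<in> exts D X Y" "baer_sum D X Y \<xi> \<xi>' = ext_cls D X Y t" .
  then have t: "t \<in> baer_sum D X Y \<xi> \<xi>'" using EC.ext_cls_self by simp
  from t[unfolded mem_baer_sum] obtain E i p E' i' p' XX j1 j2 q1 q2 YY k1 k2 r1 r2 EE l1 l2 s1 s2
    where e: "(E, i, p) \<in> \<xi>" "(E', i', p') \<in> \<xi>'"
     and b: "biproduct D X X XX j1 j2 q1 q2" "biproduct D Y Y YY k1 k2 r1 r2" "biproduct D E E' EE l1 l2 s1 s2"
     and tm: "t \<in> ext_map D XX X Y (j1 \<oplus>\<^bsub>Hom D X XX\<^esub> j2) (r1 \<oplus>\<^bsub>Hom D YY Y\<^esub> r2)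
        (ext_cls D XX YY (EE, biprod_map D YY r1 r2 EE l1 l2 i i', biprod_map D EE s1 s2 XX j1 j2 p p'))"
    by - (elim exE conjE, rule that)
  let ?d = "(EE, biprod_map D YY r1 r2 EE l1 l2 i i', biprod_map D EE s1 s2 XX j1 j2 p p')"
  note x = EC.Ext_mem_cls(2)[OF \<xi> e(1)] and x' = EC.Ext_mem_cls(2)[OF \<xi>' e(2)]
  note O = EC.exts_Ob[OF x]
  have d: "?d \<in> exts D XX YY" by (rule EC.direct_sum_exts[OF x x' b])
  note D1 = EC.biproduct_diagonal(1)[OF b(1) O(1)] and D2 = EC.biproduct_diagonal(2)[OF b(2) O(2)]
  note dc = EC.ext_cls_carrier[OF d]
  have tC: "forget_triple t \<in> ext_map C (fst XX) (fst X) (fst Y) (j1 \<oplus>\<^bsub>Hom D X XX\<^esub> j2) (r1 \<oplus>\<^bsub>Hom D YY Y\<^esub> r2)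
     (ext_cls C (fst XX) (fst YY) (forget_triple ?d))"
    using forget_ext_mem(2)[OF EC.ext_map_closed[OF dc D1 D2] tm] forget_ext_map[OF dc D1 D2] forget_ext_cls[OF d] by simp
  have fd: "forget_triple ?d = (fst EE, (l1 \<bullet> i \<bullet> r1) \<oplus>\<^bsub>Hom C (fst YY) (fst EE)\<^esub> (l2 \<bullet> i' \<bullet> r2),
      (j1 \<bullet> p \<bullet> s1) \<oplus>\<^bsub>Hom C (fst EE) (fst XX)\<^esub> (j2 \<bullet> p' \<bullet> s2))"
    by (simp add: forget_triple_def biprod_map_def)
  have eC: "(fst E, i, p) \<in> forget_ext X Y \<xi>" "(fst E', i', p') \<in> forget_ext X Y \<xi>'"
    using forget_ext_mem(2)[OF \<xi> e(1)] forget_ext_mem(2)[OF \<xi>' e(2)] by (simp_all add: forget_triple_def)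
  have bC: "biproduct C (fst X) (fst X) (fst XX) j1 j2 q1 q2" "biproduct C (fst Y) (fst Y) (fst YY) k1 k2 r1 r2"
    "biproduct C (fst E) (fst E') (fst EE) l1 l2 s1 s2"
    using b biproduct_D_forget O EC.exts_arr(7)[OF x] EC.exts_arr(7)[OF x'] by simp_all
  have "forget_triple t \<in> baer_sum C (fst X) (fst Y) (forget_ext X Y \<xi>) (forget_ext X Y \<xi>')"
    unfolding mem_baer_sum biprod_map_def
    by ((rule exI)+, intro conjI, rule eC(1), rule eC(2), rule bC(1), rule bC(2), rule bC(3)) (use tC fd in simp)
  from Ext_mem_cls(1)[OF baer_sum_closed[OF forget_ext_closed[OF \<xi>] forget_ext_closed[OF \<xi>']] this]
  show ?thesis using forget_ext_mem(1)[OF s t] by (simp add: Ext_add EC.Ext_add)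
qed

text \<open>The structure map of the middle term is itself a morphism from the translated extension
  to the extension.\<close>

lemma forget_ext_invariant:
  assumes \<xi>: "\<xi> \<in> carrier (Ext D (X, \<psi>) (Y, \<chi>))" and g: "g \<in> carrier \<Gamma>"
  shows "act (rep_Ext C T (X, \<psi>) (Y, \<chi>)) g (forget_ext (X, \<psi>) (Y, \<chi>) \<xi>) = forget_ext (X, \<psi>) (Y, \<chi>) \<xi>"
proof -
  from EC.ExtE[OF \<xi>] obtain e where e: "e \<in> exts D (X, \<psi>) (Y, \<chi>)" "\<xi> = ext_cls D (X, \<psi>) (Y, \<chi>) e" .
  obtain E \<theta> i p where ep: "e = ((E, \<theta>), i, p)" by (metis surj_pair)
  have i: "i \<in> arr D (Y, \<chi>) (E, \<theta>)" and p: "p \<in> arr D (E, \<theta>) (X, \<psi>)" and x: "(E, i, p) \<in> exts C X Y"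
    using e(1) by (simp_all add: ep exts_D)
  then have O: "(X, \<psi>) \<in> equiv_objects \<Gamma> C T" "(Y, \<chi>) \<in> equiv_objects \<Gamma> C T" "(E, \<theta>) \<in> equiv_objects \<Gamma> C T"
    and eq: "i \<bullet> \<chi> g = \<theta> g \<bullet> mo g i" "p \<bullet> \<theta> g = \<psi> g \<bullet> mo g p"
    using g by (auto simp: arr_D)
  have "ext_mor C (ob g X) (ob g Y) X Y (\<psi> g) (\<chi> g) (act_ext_triple g (E, i, p)) (E, i, p)"
    using act_ext_triple_exts[OF x g] x eq equiv_objectsD(4)[OF O(3) g] by (auto simp: ext_mor_def act_ext_triple_def)
  from rep_Ext_act_cls[OF O(1,2) this g x] show ?thesis
    using forget_ext_cls[OF e(1)] by (simp add: e(2) ep forget_triple_def)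
qed

end

section \<open>Injectivity of the forgetful map on classes\<close>

locale equivariant_averaging = equivariant K \<Gamma> C T
  for K :: "('k, 'r) ring_scheme" and \<Gamma> :: "('g, 's) monoid_scheme"
    and C :: "('k, 'o, 'm) ex_cat" (structure) and T :: "('g, 'o, 'm) action_data" +
  fixes \<nu> :: 'k
  assumes fin: "finite (carrier \<Gamma>)"
    and \<nu>: "\<nu> \<in> carrier K" "\<nu> \<otimes>\<^bsub>K\<^esub> (\<Oplus>\<^bsub>K\<^esub>g\<in>carrier \<Gamma>. \<one>\<^bsub>K\<^esub>) = \<one>\<^bsub>K\<^esub>"
begin

text \<open>
  Averaging an isomorphism of the underlying extensions over \<open>\<Gamma>\<close> makes it equivariant without
  changing its composites with the equivariant morphisms \<open>i\<close> and \<open>p'\<close>.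
\<close>

lemma forget_ext_inj:
  assumes \<xi>: "\<xi> \<in> carrier (Ext D X Y)" and \<xi>': "\<xi>' \<in> carrier (Ext D X Y)"
    and eq: "forget_ext X Y \<xi> = forget_ext X Y \<xi>'"
  shows "\<xi> = \<xi>'"
proof -
  from EC.ExtE[OF \<xi>] obtain e where e: "e \<in> exts D X Y" "\<xi> = ext_cls D X Y e" .
  from EC.ExtE[OF \<xi>'] obtain e' where e': "e' \<in> exts D X Y" "\<xi>' = ext_cls D X Y e'" .
  obtain x \<psi> y \<chi> where XY: "X = (x, \<psi>)" "Y = (y, \<chi>)" by (metis surj_pair)
  obtain E \<theta> i p E' \<theta>' i' p' where es: "e = ((E, \<theta>), i, p)" "e' = ((E', \<theta>'), i', p')" by (metis surj_pair)
  have m: "i \<in> arr D (y, \<chi>) (E, \<theta>)" "p \<in> arr D (E, \<theta>) (x, \<psi>)" "(E, i, p) \<in> exts C x y"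
    and m': "i' \<in> arr D (y, \<chi>) (E', \<theta>')" "p' \<in> arr D (E', \<theta>') (x, \<psi>)" "(E', i', p') \<in> exts C x y"
    using e(1) e'(1) by (simp_all add: es XY exts_D)
  then have O: "(x, \<psi>) \<in> equiv_objects \<Gamma> C T" "(y, \<chi>) \<in> equiv_objects \<Gamma> C T"
    "(E, \<theta>) \<in> equiv_objects \<Gamma> C T" "(E', \<theta>') \<in> equiv_objects \<Gamma> C T" by (auto simp: arr_D)
  have "ext_cls C x y (E, i, p) = ext_cls C x y (E', i', p')"
    using eq forget_ext_cls[OF e(1)] forget_ext_cls[OF e'(1)] e(2) e'(2) by (simp add: es XY forget_triple_def)
  then have "(E', i', p') \<in> ext_cls C x y (E, i, p)" using ext_cls_self[OF m'(3)] by simp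
  then have "ext_mor C x y x y (Id C x) (Id C y) (E, i, p) (E', i', p')" using mem_ext_cls by blast
  then obtain u where u: "u \<in> arr C E E'" "u \<bullet> i = i'" "p' \<bullet> u = p" by (auto simp: ext_mor_Id_iff)
  interpret V: group_representation \<Gamma> K "hom_rep (E, \<theta>) (E', \<theta>')"
    by unfold_locales (rule representation_hom_rep[OF O(3,4)])
  have Vr: "group_representation \<Gamma> K (hom_rep (E, \<theta>) (E', \<theta>'))" by unfold_locales
  have Wi: "group_representation \<Gamma> K (hom_rep (y, \<chi>) (E', \<theta>'))"
    by (rule group_representation.intro[OF G.group_axioms]) (unfold_locales, rule representation_hom_rep[OF O(2,4)])
  have Wp: "group_representation \<Gamma> K (hom_rep (E, \<theta>) (x, \<psi>))"
    by (rule group_representation.intro[OF G.group_axioms]) (unfold_locales, rule representation_hom_rep[OF O(3,1)])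
  define v where "v = V.average \<nu> u"
  have uc: "u \<in> carrier (hom_rep (E, \<theta>) (E', \<theta>'))" using arr_mor[OF u(1)] by simp
  have vC: "v \<in> arr C E E'"
    using V.average_closed[OF \<nu>(1) uc] arr_dom[OF u(1)] arr_cod[OF u(1)] by (simp add: v_def arr_def)
  have "v \<in> arr D (E, \<theta>) (E', \<theta>')"
    using hom_rep_invariant_iff[OF O(3,4) vC] V.average_invariant[OF fin \<nu>(1) uc] by (simp add: v_def)
  moreover have "v \<bullet> i = i'"
    using average_rep_hom[OF Vr Wi fin \<nu> hom_rep_pre[OF O(4) m(1)] uc] u(2)
      hom_rep_invariant_iff[OF O(2,4), of i'] m'(1) by (simp add: v_def arr_D)
  moreover have "p' \<bullet> v = p"
    using average_rep_hom[OF Vr Wp fin \<nu> hom_rep_post[OF O(3) m'(2)] uc] u(3)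
      hom_rep_invariant_iff[OF O(3,1), of p] m(2) by (simp add: v_def arr_D)
  ultimately have "ext_mor D X Y X Y (Id D X) (Id D Y) e e'"
    using EC.ext_mor_Id_iff[of X Y "(E, \<theta>)" i p "(E', \<theta>')" i' p'] e(1) e'(1) by (auto simp: es)
  from EC.ext_cls_eq[OF this] show ?thesis using e(2) e'(2) by simp
qed

end


section \<open>Automorphisms of an extension\<close>

context exact_category
begin

text \<open>The map 1 + i z p, an automorphism of the extension that is the identity on both ends.
  Through these maps Hom(X, Y) acts on the lifts of given end components.\<close>

definition ext_shift :: "'o \<Rightarrow> 'm \<Rightarrow> 'm \<Rightarrow> 'm \<Rightarrow> 'm" where
  "ext_shift E i p z = Id C E \<oplus>\<^bsub>Hom C E E\<^esub> (i \<bullet> (z \<bullet> p))"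

context
  fixes E i p X Y
  assumes e: "(E, i, p) \<in> exts C X Y"
begin

private lemmas x = exts_arr[OF e]

lemma ext_shift_arr: "z \<in> arr C X Y \<Longrightarrow> ext_shift E i p z \<in> arr C E E"
  unfolding ext_shift_def by (rule add_arr[OF Id_arr[OF x(7)] comp[OF comp[OF x(3)] x(2)]])

lemma ext_shift_comp:
  assumes z: "z \<in> arr C X Y" and f: "f \<in> arr C W E"
  shows "ext_shift E i p z \<bullet> f = f \<oplus>\<^bsub>Hom C W E\<^esub> (i \<bullet> (z \<bullet> (p \<bullet> f)))"
  unfolding ext_shift_def
  using add_comp[OF f Id_arr[OF x(7)] comp[OF comp[OF x(3) z] x(2)]] idl[OF f]
    assoc[OF f comp[OF x(3) z] x(2)] assoc[OF f x(3) z] by simp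

lemma ext_shift_i: assumes z: "z \<in> arr C X Y" shows "ext_shift E i p z \<bullet> i = i"
  using ext_shift_comp[OF z x(2)] x(4) comp_zero[OF x(6) z] comp_zero[OF x(6) x(2)] add_zero[OF x(2)] by simp

lemma ext_shift_p: assumes z: "z \<in> arr C X Y" shows "p \<bullet> ext_shift E i p z = p"
proof -
  note zp = comp[OF x(3) z]
  have "p \<bullet> (i \<bullet> (z \<bullet> p)) = \<zero>\<^bsub>Hom C E X\<^esub>"
    using assoc[OF zp x(2,3)] x(4) zero_comp[OF x(5) zp] by simp
  then show ?thesis
    unfolding ext_shift_def using comp_add[OF Id_arr[OF x(7)] comp[OF zp x(2)] x(3)] idr[OF x(3)] add_zero[OF x(3)] by simp
qed

text \<open>The product of the two correction terms contains \<open>p \<bullet> i\<close> and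
  vanishes, so composition of shifts is addition.\<close>

lemma ext_shift_add:
  assumes z: "z \<in> arr C X Y" and z': "z' \<in> arr C X Y"
  shows "ext_shift E i p z \<bullet> ext_shift E i p z' = ext_shift E i p (z \<oplus>\<^bsub>Hom C X Y\<^esub> z')"
proof -
  note a = comp[OF comp[OF x(3) z] x(2)] and a' = comp[OF comp[OF x(3) z'] x(2)] and I = Id_arr[OF x(7)]
  have "ext_shift E i p z \<bullet> ext_shift E i p z'
      = (Id C E \<oplus>\<^bsub>Hom C E E\<^esub> (i \<bullet> (z' \<bullet> p))) \<oplus>\<^bsub>Hom C E E\<^esub> (i \<bullet> (z \<bullet> p))"
    using ext_shift_comp[OF z ext_shift_arr[OF z']] ext_shift_p[OF z'] by (simp add: ext_shift_def)
  also have "\<dots> = Id C E \<oplus>\<^bsub>Hom C E E\<^esub> ((i \<bullet> (z \<bullet> p)) \<oplus>\<^bsub>Hom C E E\<^esub> (i \<bullet> (z' \<bullet> p)))"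
    using add_assoc[OF I a' a] add_commute[OF a a'] by simp
  also have "\<dots> = ext_shift E i p (z \<oplus>\<^bsub>Hom C X Y\<^esub> z')"
    unfolding ext_shift_def
    using add_comp[OF x(3) z z'] comp_add[OF comp[OF x(3) z] comp[OF x(3) z'] x(2)] by simp
  finally show ?thesis .
qed

lemma ext_shift_zero: "ext_shift E i p \<zero>\<^bsub>Hom C X Y\<^esub> = Id C E"
  unfolding ext_shift_def
  using zero_comp[OF x(6) x(3)] comp_zero[OF x(7) x(2)] add_zero[OF Id_arr[OF x(7)]] by simp

text \<open>Transitivity: two lifts of the same ends differ by a map that is killed by
  \<open>a\<close> and by \<open>p\<close>, hence factors through \<open>b\<close> on one side and
  \<open>i\<close> on the other. The isomorphism \<open>t\<close> turns the resulting map out of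
  \<open>U\<close> into one out of \<open>X\<close>.\<close>

lemma ext_shift_exists:
  assumes c: "Confl C A a W b U" and f: "f \<in> arr C W E" and f': "f' \<in> arr C W E"
    and fa: "f \<bullet> a = f' \<bullet> a" and pf: "p \<bullet> f = t \<bullet> b" and pf': "p \<bullet> f' = t \<bullet> b" and t: "t \<in> isos C U X"
  shows "\<exists>z\<in>arr C X Y. f = ext_shift E i p z \<bullet> f'"
proof -
  note y = Confl_arr[OF c]
  note t' = mor_inv_iso[OF t arr_cod[OF y(2)] x(5)]
  let ?d = "f \<ominus>\<^bsub>Hom C W E\<^esub> f'"
  have d: "?d \<in> arr C W E" using minus_arr[OF f f'] .
  have "p \<bullet> ?d = \<zero>\<^bsub>Hom C W X\<^esub>" using comp_minus[OF f f' x(3)] pf pf' minus_self[OF comp[OF y(2) t'(1)]] by simp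
  from kernel_lift[OF x(1) d this] obtain d' where d': "d' \<in> arr C W Y" "i \<bullet> d' = ?d" .
  have da: "?d \<bullet> a = \<zero>\<^bsub>Hom C A E\<^esub>" using minus_comp[OF y(1) f f'] fa minus_self[OF comp[OF y(1) f']] by simp
  have "d' \<bullet> a = \<zero>\<^bsub>Hom C A Y\<^esub>"
    by (rule Confl_mono[OF x(1) comp[OF y(1) d'(1)] zero_arr[OF arr_dom[OF y(1)] x(6)]])
       (use assoc[OF y(1) d'(1) x(2)] d'(2) da comp_zero[OF arr_dom[OF y(1)] x(2)] in simp)
  from cokernel_lift[OF c d'(1) this] obtain z' where z': "z' \<in> arr C U Y" "z' \<bullet> b = d'" .
  let ?z = "z' \<bullet> mor_inv C U X t"
  have z: "?z \<in> arr C X Y" using comp[OF t'(2) z'(1)] .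
  have "?z \<bullet> (p \<bullet> f') = d'"
    using assoc[OF y(2) t'(1) z] assoc[OF t'(1,2) z'(1)] t'(3) idr[OF z'(1)] z'(2) pf' by metis
  then have "ext_shift E i p ?z \<bullet> f' = f' \<oplus>\<^bsub>Hom C W E\<^esub> ?d"
    using ext_shift_comp[OF z f'] d'(2) by simp
  also have "\<dots> = f" using add_commute[OF f' d] minus_add_cancel[OF f f'] by simp
  finally show ?thesis using z by blast
qed

text \<open>Freeness: \<open>i\<close> can be cancelled on the left, then \<open>b\<close> and
  \<open>t\<close> on the right.\<close>

lemma ext_shift_inj:
  assumes c: "Confl C A a W b U" and f: "f \<in> arr C W E" and pf: "p \<bullet> f = t \<bullet> b" and t: "t \<in> isos C U X"
    and z: "z \<in> arr C X Y" and z': "z' \<in> arr C X Y" and eq: "ext_shift E i p z \<bullet> f = ext_shift E i p z' \<bullet> f"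
  shows "z = z'"
proof -
  note y = Confl_arr[OF c]
  note t' = mor_inv_iso[OF t arr_cod[OF y(2)] x(5)]
  note pa = comp[OF f x(3)]
  note zp = comp[OF pa z] and zp' = comp[OF pa z']
  have "(i \<bullet> (z \<bullet> (p \<bullet> f))) \<oplus>\<^bsub>Hom C W E\<^esub> f = (i \<bullet> (z' \<bullet> (p \<bullet> f))) \<oplus>\<^bsub>Hom C W E\<^esub> f"
    using eq ext_shift_comp[OF z f] ext_shift_comp[OF z' f] add_commute[OF f comp[OF zp x(2)]]
      add_commute[OF f comp[OF zp' x(2)]] by simp
  then have "i \<bullet> (z \<bullet> (p \<bullet> f)) = i \<bullet> (z' \<bullet> (p \<bullet> f))"
    by (rule add_right_cancel[OF comp[OF zp x(2)] comp[OF zp' x(2)] f])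
  then have "z \<bullet> (p \<bullet> f) = z' \<bullet> (p \<bullet> f)" by (rule Confl_mono[OF x(1) zp zp'])
  then have "(z \<bullet> t) \<bullet> b = (z' \<bullet> t) \<bullet> b"
    using pf assoc[OF y(2) t'(1) z] assoc[OF y(2) t'(1) z'] by metis
  then have "z \<bullet> t = z' \<bullet> t" by (rule Confl_epi[OF c comp[OF t'(1) z] comp[OF t'(1) z']])
  then show ?thesis by (rule iso_cancel_right[OF t arr_cod[OF y(2)] z z'])
qed

end

end

text \<open>The coboundary equation rewritten for the negative of the cochain: \<open>z\<close>
  stands for the cocycle, \<open>a\<close>, \<open>b\<close> and \<open>w\<close> for the three
  terms of the coboundary.\<close>

lemma (in abelian_group) cocycle_rearrange:
  assumes "a \<in> carrier G" "b \<in> carrier G" "w \<in> carrier G" "z \<in> carrier G" and eq: "z \<oplus> w = a \<oplus> b"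
  shows "\<ominus> b \<oplus> (\<ominus> a \<oplus> z) = \<ominus> w"
proof (rule minus_equality[symmetric])
  have "\<ominus> b \<oplus> (\<ominus> a \<oplus> z) \<oplus> w = \<ominus> b \<oplus> (\<ominus> a \<oplus> (a \<oplus> b))"
    using assms by (simp add: a_assoc)
  also have "\<dots> = \<ominus> b \<oplus> ((\<ominus> a \<oplus> a) \<oplus> b)" using assms by (simp only: a_assoc a_inv_closed)
  also have "\<dots> = \<zero>" using assms by (simp add: l_neg)
  finally show "\<ominus> b \<oplus> (\<ominus> a \<oplus> z) \<oplus> w = \<zero>" .
qed (use assms in auto)

section \<open>Lifting invariant classes\<close>

context equivariant_averaging
begin

text \<open>
  A class fixed by \<open>\<Gamma>\<close> yields morphisms \<open>\<theta>\<^sub>g\<close> lifting the structures of \<open>X\<close> and \<open>Y\<close>. They are multiplicative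
  up to a 2-cocycle \<open>z\<close> with values in \<open>Hom(X, Y)\<close>, which is the coboundary of
  \<open>w\<^sub>g = \<nu> \<Sum>\<^sub>k z\<^sub>g\<^sub>k\<close>; correcting \<open>\<theta>\<^sub>g\<close> by \<open>1 - i w\<^sub>g p\<close> makes it multiplicative.
\<close>

lemma invariant_ext_lift:
  assumes X: "(X, \<psi>) \<in> equiv_objects \<Gamma> C T" and Y: "(Y, \<chi>) \<in> equiv_objects \<Gamma> C T"
    and e: "(E, i, p) \<in> exts C X Y"
    and inv: "\<And>g. g \<in> carrier \<Gamma> \<Longrightarrow>
      act (rep_Ext C T (X, \<psi>) (Y, \<chi>)) g (ext_cls C X Y (E, i, p)) = ext_cls C X Y (E, i, p)"
  shows "\<exists>\<theta>. ((E, \<theta>), i, p) \<in> exts D (X, \<psi>) (Y, \<chi>)"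
proof -
  note x = exts_arr[OF e]
  note dX = equiv_objectsD[OF X] and dY = equiv_objectsD[OF Y]
  have conf: "Confl C (ob g Y) (mo g i) (ob g E) (mo g p) (ob g X)" if "g \<in> carrier \<Gamma>" for g
    using action_Confl[OF that x(1)] .
  have "\<exists>t. t \<in> arr C (ob g E) E \<and> t \<bullet> mo g i = i \<bullet> \<chi> g \<and> p \<bullet> t = \<psi> g \<bullet> mo g p" if g: "g \<in> carrier \<Gamma>" for g
    using rep_Ext_act_fixed[OF X Y e g inv[OF g]] by (auto simp: ext_mor_def act_ext_triple_def)
  from equivariant_structure_choice[OF this] obtain \<theta> where
    \<theta>: "\<And>g. g \<in> carrier \<Gamma> \<Longrightarrow> \<theta> g \<in> arr C (ob g E) E"
      "\<And>g. g \<in> carrier \<Gamma> \<Longrightarrow> \<theta> g \<bullet> mo g i = i \<bullet> \<chi> g" "\<And>g. g \<in> carrier \<Gamma> \<Longrightarrow> p \<bullet> \<theta> g = \<psi> g \<bullet> mo g p" by blast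
  let ?s = "ext_shift E i p"
  let ?R = "hom_rep (X, \<psi>) (Y, \<chi>)"
  interpret R: group_representation \<Gamma> K ?R by unfold_locales (rule representation_hom_rep[OF X Y])
  interpret H: module K "Hom C X Y" by (rule Hom_module[OF dX(1) dY(1)])
  have carr: "z \<in> mor C X Y \<longleftrightarrow> z \<in> arr C X Y" for z using arr_iff[OF dX(1) dY(1)] by simp
  have act_arr: "act ?R g z \<in> arr C X Y" if "g \<in> carrier \<Gamma>" "z \<in> arr C X Y" for g z
    using hom_rep_act_iff(1)[OF X Y that] .
  \<comment> \<open>Moving a shift across \<open>\<theta> g\<close> replaces \<open>z\<close> by its
    image under the action of \<open>g\<close> on Hom(X, Y), because \<open>\<theta> g\<close> lies
    over the structure maps of \<open>X\<close> and \<open>Y\<close>.\<close>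
  have shift_act: "\<theta> g \<bullet> mo g (?s z) = ?s (act ?R g z) \<bullet> \<theta> g" if g: "g \<in> carrier \<Gamma>" and z: "z \<in> arr C X Y" for g z
  proof -
    note zp = comp[OF x(3) z]
    note m = mo_arr[OF g x(2)] mo_arr[OF g x(3)] mo_arr[OF g z]
    note a = hom_rep_act_iff[OF X Y g z]
    have "\<theta> g \<bullet> mo g (i \<bullet> (z \<bullet> p)) = i \<bullet> (act ?R g z \<bullet> (p \<bullet> \<theta> g))"
    proof -
      have "\<theta> g \<bullet> mo g (i \<bullet> (z \<bullet> p)) = (\<theta> g \<bullet> mo g i) \<bullet> (mo g z \<bullet> mo g p)"
        using mo_comp[OF g zp x(2)] mo_comp[OF g x(3) z] assoc[OF comp[OF m(2,3)] m(1) \<theta>(1)[OF g]] by simp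
      also have "\<dots> = i \<bullet> ((\<chi> g \<bullet> mo g z) \<bullet> mo g p)"
        using \<theta>(2)[OF g] assoc[OF comp[OF m(2,3)] dY(4)[OF g] x(2)] assoc[OF m(2,3) dY(4)[OF g]] by simp
      also have "\<dots> = i \<bullet> (act ?R g z \<bullet> (p \<bullet> \<theta> g))"
        using a(2) \<theta>(3)[OF g] assoc[OF m(2) dX(4)[OF g] a(1)] by simp
      finally show ?thesis .
    qed
    then show ?thesis
      using ext_shift_comp[OF e a(1) \<theta>(1)[OF g]] mo_add[OF g Id_arr[OF x(7)] comp[OF zp x(2)]]
        comp_add[OF mo_arr[OF g Id_arr[OF x(7)]] mo_arr[OF g comp[OF zp x(2)]] \<theta>(1)[OF g]]
        act_mor_Id[OF g x(7)] idr[OF \<theta>(1)[OF g]] by (simp add: ext_shift_def)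
  qed
  have gc\<theta>: "gc g h E (\<theta> g) (\<theta> h) \<in> arr C (ob (g \<otimes>\<^bsub>\<Gamma>\<^esub> h) E) E" if "g \<in> carrier \<Gamma>" "h \<in> carrier \<Gamma>" for g h
    using gc_arr[OF that \<theta>(1)[OF that(2)] \<theta>(1)[OF that(1)] x(7)] .
  \<comment> \<open>The structure maps of the ends are multiplicative, so the graded product and
    \<theta> at the product lie over the same ends and differ by a shift.\<close>
  have "\<exists>z\<in>arr C X Y. gc g h E (\<theta> g) (\<theta> h) = ?s z \<bullet> \<theta> (g \<otimes>\<^bsub>\<Gamma>\<^esub> h)"
    if g: "g \<in> carrier \<Gamma>" and h: "h \<in> carrier \<Gamma>" for g h
  proof -
    have gh: "g \<otimes>\<^bsub>\<Gamma>\<^esub> h \<in> carrier \<Gamma>" using g h by simp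
    have "gc g h E (\<theta> g) (\<theta> h) \<bullet> mo (g \<otimes>\<^bsub>\<Gamma>\<^esub> h) i = i \<bullet> \<chi> (g \<otimes>\<^bsub>\<Gamma>\<^esub> h)"
      using gc_pre[OF g h \<theta>(1)[OF h] \<theta>(1)[OF g] x(2)] \<theta>(2)[OF h] gc_mid[OF g h dY(4)[OF h] \<theta>(1)[OF g] x(2)] \<theta>(2)[OF g]
        gc_post[OF g h dY(4)[OF h] dY(4)[OF g] x(6) x(2)] dY(5)[OF g h] by simp
    moreover have "p \<bullet> gc g h E (\<theta> g) (\<theta> h) = \<psi> (g \<otimes>\<^bsub>\<Gamma>\<^esub> h) \<bullet> mo (g \<otimes>\<^bsub>\<Gamma>\<^esub> h) p"
      using gc_post[OF g h \<theta>(1)[OF h] \<theta>(1)[OF g] x(7) x(3)] \<theta>(3)[OF g] gc_mid[OF g h \<theta>(1)[OF h] dX(4)[OF g] x(3)] \<theta>(3)[OF h]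
        gc_pre[OF g h dX(4)[OF h] dX(4)[OF g] x(3)] dX(5)[OF g h] by simp
    ultimately show ?thesis
      using ext_shift_exists[OF e conf[OF gh] gc\<theta>[OF g h] \<theta>(1)[OF gh]] \<theta>(2,3)[OF gh] dX(3)[OF gh] by simp
  qed
  then obtain z where z: "\<And>g h. \<lbrakk>g \<in> carrier \<Gamma>; h \<in> carrier \<Gamma>\<rbrakk> \<Longrightarrow> z g h \<in> arr C X Y"
    and gcz: "\<And>g h. \<lbrakk>g \<in> carrier \<Gamma>; h \<in> carrier \<Gamma>\<rbrakk> \<Longrightarrow> gc g h E (\<theta> g) (\<theta> h) = ?s (z g h) \<bullet> \<theta> (g \<otimes>\<^bsub>\<Gamma>\<^esub> h)"
    by metis
  note s = ext_shift_arr[OF e] and sadd = ext_shift_add[OF e]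
  \<comment> \<open>Each bracketing of a triple graded product is a shift of \<theta> at the triple
    product; associativity and freeness of shifts equate the two.\<close>
  have cocycle: "z g h \<oplus>\<^bsub>Hom C X Y\<^esub> z (g \<otimes>\<^bsub>\<Gamma>\<^esub> h) k = act ?R g (z h k) \<oplus>\<^bsub>Hom C X Y\<^esub> z g (h \<otimes>\<^bsub>\<Gamma>\<^esub> k)"
    if g: "g \<in> carrier \<Gamma>" and h: "h \<in> carrier \<Gamma>" and k: "k \<in> carrier \<Gamma>" for g h k
  proof -
    have gh: "g \<otimes>\<^bsub>\<Gamma>\<^esub> h \<in> carrier \<Gamma>" and hk: "h \<otimes>\<^bsub>\<Gamma>\<^esub> k \<in> carrier \<Gamma>" and ghk: "g \<otimes>\<^bsub>\<Gamma>\<^esub> (h \<otimes>\<^bsub>\<Gamma>\<^esub> k) \<in> carrier \<Gamma>"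
      using g h k by simp_all
    have eq: "(g \<otimes>\<^bsub>\<Gamma>\<^esub> h) \<otimes>\<^bsub>\<Gamma>\<^esub> k = g \<otimes>\<^bsub>\<Gamma>\<^esub> (h \<otimes>\<^bsub>\<Gamma>\<^esub> k)" using g h k by (rule G.m_assoc)
    note t = \<theta>(1)[OF ghk] and za = act_arr[OF g z[OF h k]]
    have "gc (g \<otimes>\<^bsub>\<Gamma>\<^esub> h) k E (gc g h E (\<theta> g) (\<theta> h)) (\<theta> k)
        = ?s (z g h \<oplus>\<^bsub>Hom C X Y\<^esub> z (g \<otimes>\<^bsub>\<Gamma>\<^esub> h) k) \<bullet> \<theta> (g \<otimes>\<^bsub>\<Gamma>\<^esub> (h \<otimes>\<^bsub>\<Gamma>\<^esub> k))"
      using gcz[OF g h] gc_post[OF gh k \<theta>(1)[OF k] \<theta>(1)[OF gh] x(7) s[OF z[OF g h]]] gcz[OF gh k] eq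
        assoc[OF t s[OF z[OF gh k]] s[OF z[OF g h]]] sadd[OF z[OF g h] z[OF gh k]] by simp
    moreover have "gc g (h \<otimes>\<^bsub>\<Gamma>\<^esub> k) E (\<theta> g) (gc h k E (\<theta> h) (\<theta> k))
        = ?s (act ?R g (z h k) \<oplus>\<^bsub>Hom C X Y\<^esub> z g (h \<otimes>\<^bsub>\<Gamma>\<^esub> k)) \<bullet> \<theta> (g \<otimes>\<^bsub>\<Gamma>\<^esub> (h \<otimes>\<^bsub>\<Gamma>\<^esub> k))"
      using gcz[OF h k] gc_mid[OF g hk \<theta>(1)[OF hk] \<theta>(1)[OF g] s[OF z[OF h k]]] shift_act[OF g z[OF h k]]
        gc_post[OF g hk \<theta>(1)[OF hk] \<theta>(1)[OF g] x(7) s[OF za]] gcz[OF g hk]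
        assoc[OF t s[OF z[OF g hk]] s[OF za]] sadd[OF za z[OF g hk]] by simp
    ultimately have "?s (z g h \<oplus>\<^bsub>Hom C X Y\<^esub> z (g \<otimes>\<^bsub>\<Gamma>\<^esub> h) k) \<bullet> \<theta> (g \<otimes>\<^bsub>\<Gamma>\<^esub> (h \<otimes>\<^bsub>\<Gamma>\<^esub> k))
        = ?s (act ?R g (z h k) \<oplus>\<^bsub>Hom C X Y\<^esub> z g (h \<otimes>\<^bsub>\<Gamma>\<^esub> k)) \<bullet> \<theta> (g \<otimes>\<^bsub>\<Gamma>\<^esub> (h \<otimes>\<^bsub>\<Gamma>\<^esub> k))"
      using gc_assoc[OF g h k x(7) \<theta>(1)[OF k] \<theta>(1)[OF h] \<theta>(1)[OF g]] by simp
    then show ?thesis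
      by (rule ext_shift_inj[OF e conf[OF ghk] t \<theta>(3)[OF ghk] dX(3)[OF ghk] add_arr[OF z[OF g h] z[OF gh k]]
            add_arr[OF za z[OF g hk]]])
  qed
  define W where "W g = (\<Oplus>\<^bsub>Hom C X Y\<^esub>k\<in>carrier \<Gamma>. z g k)" for g
  define w where "w g = \<nu> \<odot>\<^bsub>Hom C X Y\<^esub> W g" for g
  have W: "W g \<in> mor C X Y" if "g \<in> carrier \<Gamma>" for g
    unfolding W_def by (rule H.M.finsum_closed) (use z[OF that] carr in auto)
  have w: "w g \<in> arr C X Y" if "g \<in> carrier \<Gamma>" for g
    using H.smult_closed[OF \<nu>(1) W[OF that]] carr by (simp add: w_def)
  have act_lin: "act ?R g \<in> linear_maps K (Hom C X Y) (Hom C X Y)" if "g \<in> carrier \<Gamma>" for g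
    using R.act_linear[OF that] by (simp add: linear_maps_def)
  \<comment> \<open>The cocycle identity is summed over \<open>k\<close>. One term does not depend
    on \<open>k\<close> and is multiplied by the order, which \<nu> cancels; in the last term
    \<open>h\<close> times \<open>k\<close> runs over the whole group, which gives
    \<open>W g\<close>.\<close>
  have coboundary: "z g h \<oplus>\<^bsub>Hom C X Y\<^esub> w (g \<otimes>\<^bsub>\<Gamma>\<^esub> h) = act ?R g (w h) \<oplus>\<^bsub>Hom C X Y\<^esub> w g"
    if g: "g \<in> carrier \<Gamma>" and h: "h \<in> carrier \<Gamma>" for g h
  proof -
    have gh: "g \<otimes>\<^bsub>\<Gamma>\<^esub> h \<in> carrier \<Gamma>" using g h by simp
    let ?N = "\<Oplus>\<^bsub>K\<^esub>g\<in>carrier \<Gamma>. \<one>\<^bsub>K\<^esub>"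
    have N: "?N \<in> carrier K" by (rule H.R.finsum_closed) auto
    have zg: "z g h \<in> mor C X Y" using z[OF g h] carr by simp
    have "(\<Oplus>\<^bsub>Hom C X Y\<^esub>k\<in>carrier \<Gamma>. z g h \<oplus>\<^bsub>Hom C X Y\<^esub> z (g \<otimes>\<^bsub>\<Gamma>\<^esub> h) k) = (?N \<odot>\<^bsub>Hom C X Y\<^esub> z g h) \<oplus>\<^bsub>Hom C X Y\<^esub> W (g \<otimes>\<^bsub>\<Gamma>\<^esub> h)"
      using H.M.finsum_addf[of "\<lambda>_. z g h" "carrier \<Gamma>" "\<lambda>k. z (g \<otimes>\<^bsub>\<Gamma>\<^esub> h) k"] zg z[OF gh] carr
        H.finsum_constant[OF fin zg] by (auto simp: W_def)
    moreover have "(\<Oplus>\<^bsub>Hom C X Y\<^esub>k\<in>carrier \<Gamma>. act ?R g (z h k) \<oplus>\<^bsub>Hom C X Y\<^esub> z g (h \<otimes>\<^bsub>\<Gamma>\<^esub> k)) = act ?R g (W h) \<oplus>\<^bsub>Hom C X Y\<^esub> W g"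
    proof -
      have "(\<Oplus>\<^bsub>Hom C X Y\<^esub>k\<in>carrier \<Gamma>. act ?R g (z h k)) = act ?R g (W h)"
        unfolding W_def
        by (rule linear_maps_finsum[OF act_lin[OF g] H.abelian_group_axioms H.abelian_group_axioms fin, symmetric])
           (use z[OF h] carr in auto)
      moreover have "(\<Oplus>\<^bsub>Hom C X Y\<^esub>k\<in>carrier \<Gamma>. z g (h \<otimes>\<^bsub>\<Gamma>\<^esub> k)) = W g"
        using H.M.finsum_reindex[of "z g" "\<lambda>k. h \<otimes>\<^bsub>\<Gamma>\<^esub> k" "carrier \<Gamma>"] G.surj_const_mult[OF h] G.inj_on_cmult[OF h] z[OF g] carr
        by (auto simp: W_def)
      ultimately show ?thesis
        using H.M.finsum_addf[of "\<lambda>k. act ?R g (z h k)" "carrier \<Gamma>" "\<lambda>k. z g (h \<otimes>\<^bsub>\<Gamma>\<^esub> k)"] act_arr[OF g z[OF h]] z[OF g] h carr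
        by auto
    qed
    moreover have "(\<Oplus>\<^bsub>Hom C X Y\<^esub>k\<in>carrier \<Gamma>. z g h \<oplus>\<^bsub>Hom C X Y\<^esub> z (g \<otimes>\<^bsub>\<Gamma>\<^esub> h) k)
        = (\<Oplus>\<^bsub>Hom C X Y\<^esub>k\<in>carrier \<Gamma>. act ?R g (z h k) \<oplus>\<^bsub>Hom C X Y\<^esub> z g (h \<otimes>\<^bsub>\<Gamma>\<^esub> k))"
      by (rule H.M.finsum_cong') (use cocycle[OF g h] add_arr[OF act_arr[OF g z[OF h]] z[OF g]] h carr in auto)
    ultimately have "(?N \<odot>\<^bsub>Hom C X Y\<^esub> z g h) \<oplus>\<^bsub>Hom C X Y\<^esub> W (g \<otimes>\<^bsub>\<Gamma>\<^esub> h) = act ?R g (W h) \<oplus>\<^bsub>Hom C X Y\<^esub> W g" by simp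
    then have "\<nu> \<odot>\<^bsub>Hom C X Y\<^esub> ((?N \<odot>\<^bsub>Hom C X Y\<^esub> z g h) \<oplus>\<^bsub>Hom C X Y\<^esub> W (g \<otimes>\<^bsub>\<Gamma>\<^esub> h))
        = \<nu> \<odot>\<^bsub>Hom C X Y\<^esub> (act ?R g (W h) \<oplus>\<^bsub>Hom C X Y\<^esub> W g)" by simp
    moreover have "\<nu> \<odot>\<^bsub>Hom C X Y\<^esub> (?N \<odot>\<^bsub>Hom C X Y\<^esub> z g h) = z g h"
      using H.smult_assoc1[OF \<nu>(1) N zg] \<nu>(2) H.smult_one[OF zg] by simp
    ultimately show ?thesis
      using H.smult_r_distr[OF \<nu>(1) H.smult_closed[OF N zg] W[OF gh]]
        H.smult_r_distr[OF \<nu>(1) linear_mapsD(1)[OF act_lin[OF g] W[OF h]] W[OF g]]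
        linear_mapsD(3)[OF act_lin[OF g] \<nu>(1) W[OF h]] by (simp add: w_def)
  qed
  \<comment> \<open>The correction uses the negative of the cochain, so that its coboundary cancels
    \<open>z\<close>.\<close>
  define n where "n g = \<ominus>\<^bsub>Hom C X Y\<^esub> w g" for g
  have n: "n g \<in> arr C X Y" if "g \<in> carrier \<Gamma>" for g using neg_arr[OF w[OF that]] by (simp add: n_def)
  have nz: "n g \<oplus>\<^bsub>Hom C X Y\<^esub> (act ?R g (n h) \<oplus>\<^bsub>Hom C X Y\<^esub> z g h) = n (g \<otimes>\<^bsub>\<Gamma>\<^esub> h)"
    if g: "g \<in> carrier \<Gamma>" and h: "h \<in> carrier \<Gamma>" for g h
  proof -
    have wh: "w h \<in> mor C X Y" using w[OF h] carr by simp
    note c = linear_mapsD[OF act_lin[OF g]]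
    have "act ?R g (n h) \<oplus>\<^bsub>Hom C X Y\<^esub> act ?R g (w h) = act ?R g \<zero>\<^bsub>Hom C X Y\<^esub>"
      using c(2)[OF H.M.a_inv_closed[OF wh] wh] H.M.l_neg[OF wh] by (simp add: n_def)
    also have "\<dots> = \<zero>\<^bsub>Hom C X Y\<^esub>"
      using c(3)[OF H.R.zero_closed H.M.zero_closed] H.smult_l_null[OF c(1)[OF H.M.zero_closed]]
        H.smult_l_null[OF H.M.zero_closed] by simp
    finally have "act ?R g (n h) = \<ominus>\<^bsub>Hom C X Y\<^esub> act ?R g (w h)"
      using H.M.minus_equality[OF _ c(1)[OF wh] c(1), of "n h"] n[OF h] carr by simp
    moreover have "g \<otimes>\<^bsub>\<Gamma>\<^esub> h \<in> carrier \<Gamma>" using g h by simp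
    ultimately show ?thesis
      using H.M.cocycle_rearrange[OF c(1)[OF wh] _ _ _ coboundary[OF g h]] w z[OF g h] g carr by (simp add: n_def)
  qed
  define \<theta>' where "\<theta>' = (\<lambda>g\<in>carrier \<Gamma>. ?s (n g) \<bullet> \<theta> g)"
  have \<theta>': "\<theta>' g \<in> arr C (ob g E) E" "\<theta>' g \<bullet> mo g i = i \<bullet> \<chi> g" "p \<bullet> \<theta>' g = \<psi> g \<bullet> mo g p" if g: "g \<in> carrier \<Gamma>" for g
  proof -
    note sn = s[OF n[OF g]] and t = \<theta>(1)[OF g]
    show "\<theta>' g \<in> arr C (ob g E) E" using comp[OF t sn] g by (simp add: \<theta>'_def)
    have "(?s (n g) \<bullet> \<theta> g) \<bullet> mo g i = i \<bullet> \<chi> g"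
      using assoc[OF mo_arr[OF g x(2)] t sn] \<theta>(2)[OF g] assoc[OF dY(4)[OF g] x(2) sn] ext_shift_i[OF e n[OF g]] by simp
    then show "\<theta>' g \<bullet> mo g i = i \<bullet> \<chi> g" using g by (simp add: \<theta>'_def)
    have "p \<bullet> (?s (n g) \<bullet> \<theta> g) = \<psi> g \<bullet> mo g p"
      using assoc[OF t sn x(3)] \<theta>(3)[OF g] ext_shift_p[OF e n[OF g]] by simp
    then show "p \<bullet> \<theta>' g = \<psi> g \<bullet> mo g p" using g by (simp add: \<theta>'_def)
  qed
  have mult: "\<theta>' (g \<otimes>\<^bsub>\<Gamma>\<^esub> h) = gc g h E (\<theta>' g) (\<theta>' h)" if g: "g \<in> carrier \<Gamma>" and h: "h \<in> carrier \<Gamma>" for g h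
  proof -
    have gh: "g \<otimes>\<^bsub>\<Gamma>\<^esub> h \<in> carrier \<Gamma>" using g h by simp
    note tg = \<theta>(1)[OF g] and th = \<theta>(1)[OF h] and t = \<theta>(1)[OF gh]
    note ah = act_arr[OF g n[OF h]]
    note az = add_arr[OF ah z[OF g h]]
    have "gc g h E (?s (n g) \<bullet> \<theta> g) (?s (n h) \<bullet> \<theta> h) = ?s (n g) \<bullet> gc g h E (\<theta> g) (?s (n h) \<bullet> \<theta> h)"
      by (rule gc_post[OF g h comp[OF th s[OF n[OF h]]] tg x(7) s[OF n[OF g]]])
    also have "gc g h E (\<theta> g) (?s (n h) \<bullet> \<theta> h) = gc g h E (?s (act ?R g (n h)) \<bullet> \<theta> g) (\<theta> h)"
      using gc_mid[OF g h th tg s[OF n[OF h]]] shift_act[OF g n[OF h]] by simp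
    also have "\<dots> = ?s (act ?R g (n h)) \<bullet> (?s (z g h) \<bullet> \<theta> (g \<otimes>\<^bsub>\<Gamma>\<^esub> h))"
      using gc_post[OF g h th tg x(7) s[OF ah]] gcz[OF g h] by simp
    also have "\<dots> = ?s (act ?R g (n h) \<oplus>\<^bsub>Hom C X Y\<^esub> z g h) \<bullet> \<theta> (g \<otimes>\<^bsub>\<Gamma>\<^esub> h)"
      using assoc[OF t s[OF z[OF g h]] s[OF ah]] sadd[OF ah z[OF g h]] by simp
    also have "?s (n g) \<bullet> \<dots> = ?s (n (g \<otimes>\<^bsub>\<Gamma>\<^esub> h)) \<bullet> \<theta> (g \<otimes>\<^bsub>\<Gamma>\<^esub> h)"
      using assoc[OF t s[OF az] s[OF n[OF g]]] sadd[OF n[OF g] az] nz[OF g h] by simp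
    finally show ?thesis using g h gh by (simp add: \<theta>'_def)
  qed
  \<comment> \<open>The corrected map at the identity and the unit map of \<open>E\<close> both lie
    over the unit maps of the ends, so they differ by a shift \<kappa>. Multiplicativity at the pair
    of identities gives \<kappa> + \<kappa> = \<kappa>, hence \<kappa> is zero.\<close>
  have one: "\<theta>' \<one>\<^bsub>\<Gamma>\<^esub> = unt E"
  proof -
    let ?o = "\<one>\<^bsub>\<Gamma>\<^esub>"
    note o = G.one_closed
    note u = unt_arr[OF x(7)]
    have ui: "unt E \<bullet> mo ?o i = i \<bullet> \<chi> ?o" and up: "p \<bullet> unt E = \<psi> ?o \<bullet> mo ?o p"
      using unt_natural[OF x(2)] unt_natural[OF x(3)] dX(6) dY(6) by simp_all
    obtain \<kappa> where \<kappa>: "\<kappa> \<in> arr C X Y" "\<theta>' ?o = ?s \<kappa> \<bullet> unt E"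
      using ext_shift_exists[OF e conf[OF o] \<theta>'(1)[OF o] u _ \<theta>'(3)[OF o] up dX(3)[OF o]] \<theta>'(2)[OF o] ui by auto
    note s\<kappa> = s[OF \<kappa>(1)]
    \<comment> \<open>By the triangle axiom the unit map is idempotent for graded
      composition.\<close>
    have uu: "gc ?o ?o E (unt E) (unt E) = unt E"
      unfolding gc_def
      using assoc[OF asc_arr[OF o o x(7)] mo_arr[OF o u] u] act_triangle[OF o x(7)] idr[OF u] by simp
    have "gc ?o ?o E (\<theta>' ?o) (\<theta>' ?o) = ?s \<kappa> \<bullet> gc ?o ?o E (unt E) (?s \<kappa> \<bullet> unt E)"
      unfolding \<kappa>(2) by (rule gc_post[OF o o comp[OF u s\<kappa>] u x(7) s\<kappa>])
    also have "gc ?o ?o E (unt E) (?s \<kappa> \<bullet> unt E) = ?s \<kappa> \<bullet> unt E"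
      using gc_mid[OF o o u u s\<kappa>] unt_natural[OF s\<kappa>] gc_post[OF o o u u x(7) s\<kappa>] uu by simp
    also have "?s \<kappa> \<bullet> \<dots> = ?s (\<kappa> \<oplus>\<^bsub>Hom C X Y\<^esub> \<kappa>) \<bullet> unt E"
      using assoc[OF u s\<kappa> s\<kappa>] sadd[OF \<kappa>(1) \<kappa>(1)] by simp
    finally have "?s (\<kappa> \<oplus>\<^bsub>Hom C X Y\<^esub> \<kappa>) \<bullet> unt E = ?s \<kappa> \<bullet> unt E"
      using mult[OF o o] \<kappa>(2) by simp
    then have "\<kappa> \<oplus>\<^bsub>Hom C X Y\<^esub> \<kappa> = \<kappa>"
      by (rule ext_shift_inj[OF e conf[OF o] u up dX(3)[OF o] add_arr[OF \<kappa>(1) \<kappa>(1)] \<kappa>(1)])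
    then have "\<kappa> = \<zero>\<^bsub>Hom C X Y\<^esub>" using add_eq_self_iff[OF \<kappa>(1) \<kappa>(1)] by simp
    then show ?thesis using \<kappa>(2) ext_shift_zero[OF e] idl[OF u] by simp
  qed
  have "\<theta>' \<in> extensional (carrier \<Gamma>)" unfolding \<theta>'_def by (rule restrict_extensional)
  from equiv_objectsI[OF x(7) this \<theta>'(1) mult one] have "(E, \<theta>') \<in> equiv_objects \<Gamma> C T" .
  then have "((E, \<theta>'), i, p) \<in> exts D (X, \<psi>) (Y, \<chi>)"
    using e X Y x(2,3) \<theta>'(2,3) by (simp add: exts_D arr_D)
  then show ?thesis by blast
qed

lemma forget_ext_surj:
  assumes X: "(X, \<psi>) \<in> equiv_objects \<Gamma> C T" and Y: "(Y, \<chi>) \<in> equiv_objects \<Gamma> C T"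
    and \<xi>: "\<xi> \<in> carrier (Ext C X Y)" and inv: "\<And>g. g \<in> carrier \<Gamma> \<Longrightarrow> act (rep_Ext C T (X, \<psi>) (Y, \<chi>)) g \<xi> = \<xi>"
  obtains \<zeta> where "\<zeta> \<in> carrier (Ext D (X, \<psi>) (Y, \<chi>))" "forget_ext (X, \<psi>) (Y, \<chi>) \<zeta> = \<xi>"
proof -
  from ExtE[OF \<xi>] obtain e where e: "e \<in> exts C X Y" "\<xi> = ext_cls C X Y e" .
  obtain E i p where ep: "e = (E, i, p)" by (metis prod_cases3)
  from invariant_ext_lift[OF X Y e(1)[unfolded ep]] inv e(2) obtain \<theta>
    where d: "((E, \<theta>), i, p) \<in> exts D (X, \<psi>) (Y, \<chi>)" by (auto simp: ep)
  show ?thesis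
    using that[OF EC.ext_cls_carrier[OF d]] forget_ext_cls[OF d] e(2) by (simp add: ep forget_triple_def)
qed

end

section \<open>The pairing on equivariant extensions\<close>

locale cy_equivariant_averaging =
  cy_equivariant K \<Gamma> C T c + equivariant_averaging K \<Gamma> C T \<nu>
  for K :: "('k, 'r) ring_scheme" and \<Gamma> :: "('g, 's) monoid_scheme"
    and C :: "('k, 'o, 'm) ex_cat" (structure) and T :: "('g, 'o, 'm) action_data"
    and c :: "('k, 'o, 'm) cy_map" and \<nu> :: 'k
begin

text \<open>The pairing of \<open>C\<close> evaluated on underlying classes; the bounded abstraction
  makes its values extensional, as elements of the dual have to be.\<close>

definition equivariant_cy :: "('k, 'o \<times> ('g \<Rightarrow> 'm), 'm) cy_map" where
  "equivariant_cy X Y \<xi> = (\<lambda>\<eta>\<in>carrier (Ext D Y X). c (fst X) (fst Y) (forget_ext X Y \<xi>) (forget_ext Y X \<eta>))"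

lemma group_representation_Ext:
  assumes "(X, \<psi>) \<in> equiv_objects \<Gamma> C T" "(Y, \<chi>) \<in> equiv_objects \<Gamma> C T"
  shows "group_representation \<Gamma> K (rep_Ext C T (X, \<psi>) (Y, \<chi>))"
  by (rule group_representation.intro[OF G.group_axioms])
     (unfold_locales, rule representation_rep_Ext[OF assms])

text \<open>An invariant \<open>\<xi>\<close> pairs with \<open>\<eta>\<close> as it does with all translates of \<open>\<eta>\<close>, hence as with the average of \<open>\<eta>\<close>.\<close>

lemma cy_average:
  assumes X: "(X, \<psi>) \<in> equiv_objects \<Gamma> C T" and Y: "(Y, \<chi>) \<in> equiv_objects \<Gamma> C T"
    and \<xi>: "\<xi> \<in> carrier (Ext C X Y)" and inv: "\<And>g. g \<in> carrier \<Gamma> \<Longrightarrow> act (rep_Ext C T (X, \<psi>) (Y, \<chi>)) g \<xi> = \<xi>"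
    and \<eta>: "\<eta> \<in> carrier (Ext C Y X)"
  shows "c X Y \<xi> (group_representation.average \<Gamma> (rep_Ext C T (Y, \<chi>) (X, \<psi>)) \<nu> \<eta>) = c X Y \<xi> \<eta>"
proof -
  note x = equiv_objectsD(1)[OF X] equiv_objectsD(1)[OF Y]
  interpret K: field K by (rule field_K)
  interpret V: group_representation \<Gamma> K "rep_Ext C T (Y, \<chi>) (X, \<psi>)" by (rule group_representation_Ext[OF Y X])
  \<comment> \<open>The field as a module over itself, so that a functional becomes a linear map of
    modules and can be exchanged with the average.\<close>
  let ?K = "\<lparr>carrier = carrier K, monoid.mult = monoid.mult K, one = one K, zero = zero K, add = add K,
     module.smult = monoid.mult K\<rparr>"
  have Km: "module K ?K"
  proof (rule moduleI)
    show "abelian_group ?K" by (rule abelian_groupI) (use K.a_ac K.l_neg K.a_inv_closed in \<open>auto intro: bexI[of _ "\<ominus>\<^bsub>K\<^esub> _"]\<close>)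
  qed (use K.cring_axioms K.l_distr K.r_distr K.m_assoc in auto)
  note \<phi> = linear_mapsD(1)[OF cy_linear[OF x] \<xi>]
  have lin: "c X Y \<xi> \<in> linear_maps K (rep_Ext C T (Y, \<chi>) (X, \<psi>)) ?K"
    using dual_linear[OF \<phi>] dual_apply[OF \<phi>] by (simp add: linear_maps_def)
  have \<eta>': "\<eta> \<in> carrier (rep_Ext C T (Y, \<chi>) (X, \<psi>))" using \<eta> by simp
  interpret M: module K ?K by (rule Km)
  have v: "c X Y \<xi> \<eta> \<in> carrier ?K" using dual_apply[OF \<phi> \<eta>] by simp
  have "(\<Oplus>\<^bsub>?K\<^esub>g\<in>carrier \<Gamma>. c X Y \<xi> (act (rep_Ext C T (Y, \<chi>) (X, \<psi>)) g \<eta>)) = (\<Oplus>\<^bsub>?K\<^esub>g\<in>carrier \<Gamma>. c X Y \<xi> \<eta>)"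
    by (rule M.M.finsum_cong') (use cy_rep_act[OF X Y _ \<xi> \<eta>] inv v in auto)
  also have "\<dots> = (\<Oplus>\<^bsub>K\<^esub>g\<in>carrier \<Gamma>. \<one>\<^bsub>K\<^esub>) \<odot>\<^bsub>?K\<^esub> c X Y \<xi> \<eta>" by (rule M.finsum_constant[OF fin v])
  finally have "c X Y \<xi> (V.average \<nu> \<eta>) = \<nu> \<odot>\<^bsub>?K\<^esub> ((\<Oplus>\<^bsub>K\<^esub>g\<in>carrier \<Gamma>. \<one>\<^bsub>K\<^esub>) \<odot>\<^bsub>?K\<^esub> c X Y \<xi> \<eta>)"
    using V.average_sum[OF fin \<nu>(1) \<eta>' Km lin] by simp
  also have "\<dots> = c X Y \<xi> \<eta>"
    using K.m_assoc[OF \<nu>(1) K.finsum_closed[of "\<lambda>_. \<one>\<^bsub>K\<^esub>" "carrier \<Gamma>"]] v \<nu>(2) by simp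
  finally show ?thesis .
qed

lemma average_linear:
  assumes V: "group_representation \<Gamma> K V"
  shows "group_representation.average \<Gamma> V \<nu> \<in> linear_maps K V V"
proof -
  interpret V: group_representation \<Gamma> K V by fact
  interpret M: module K V by (rule V.rep_module)
  have cl: "V.average \<nu> v \<in> carrier V" if "v \<in> carrier V" for v using V.average_closed[OF \<nu>(1) that] .
  have "V.average \<nu> (u \<oplus>\<^bsub>V\<^esub> v) = V.average \<nu> u \<oplus>\<^bsub>V\<^esub> V.average \<nu> v" if u: "u \<in> carrier V" and v: "v \<in> carrier V" for u v
  proof -
    have "(\<Oplus>\<^bsub>V\<^esub>g\<in>carrier \<Gamma>. act V g (u \<oplus>\<^bsub>V\<^esub> v)) = (\<Oplus>\<^bsub>V\<^esub>g\<in>carrier \<Gamma>. act V g u \<oplus>\<^bsub>V\<^esub> act V g v)"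
      by (rule M.M.finsum_cong') (use u v V.act_closed linear_mapsD(2)[OF V.act_linear] in auto)
    also have "\<dots> = (\<Oplus>\<^bsub>V\<^esub>g\<in>carrier \<Gamma>. act V g u) \<oplus>\<^bsub>V\<^esub> (\<Oplus>\<^bsub>V\<^esub>g\<in>carrier \<Gamma>. act V g v)"
      by (rule M.M.finsum_addf) (use u v V.act_closed in auto)
    finally show ?thesis
      using M.smult_r_distr[OF \<nu>(1) V.sum_closed[OF u] V.sum_closed[OF v]] by (simp add: V.average_def)
  qed
  moreover have "V.average \<nu> (r \<odot>\<^bsub>V\<^esub> v) = r \<odot>\<^bsub>V\<^esub> V.average \<nu> v" if r: "r \<in> carrier K" and v: "v \<in> carrier V" for r v
  proof -
    have sm: "(\<lambda>v. r \<odot>\<^bsub>V\<^esub> v) \<in> linear_maps K V V"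
      unfolding linear_maps_def using r M.smult_r_distr M.smult_assoc1[symmetric] M.R.m_comm by (auto simp: M.smult_assoc1[symmetric] M.R.m_comm)
    have "(\<Oplus>\<^bsub>V\<^esub>g\<in>carrier \<Gamma>. act V g (r \<odot>\<^bsub>V\<^esub> v)) = (\<Oplus>\<^bsub>V\<^esub>g\<in>carrier \<Gamma>. r \<odot>\<^bsub>V\<^esub> act V g v)"
      by (rule M.M.finsum_cong') (use r v V.act_closed linear_mapsD(3)[OF V.act_linear] in auto)
    also have "\<dots> = r \<odot>\<^bsub>V\<^esub> (\<Oplus>\<^bsub>V\<^esub>g\<in>carrier \<Gamma>. act V g v)"
      by (rule linear_maps_finsum[OF sm M.abelian_group_axioms M.abelian_group_axioms fin V.act_closed[OF _ v], symmetric])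
    finally show ?thesis
      using linear_mapsD(3)[OF sm \<nu>(1) V.sum_closed[OF v]] by (simp add: V.average_def)
  qed
  ultimately show ?thesis using cl by (simp add: linear_maps_def)
qed

text \<open>Injectivity: an invariant class pairs with any class as with its average, and averages
  come from equivariant extensions, so the equivariant pairing already determines it. Surjectivity:
  a functional on equivariant extensions, extended along averaging, is represented by
  \<open>c\<close>; being constant on orbits it has an invariant representing class, which
  lifts.\<close>

lemma equivariant_cy_iso: "cy_iso K D equivariant_cy"
proof -
  interpret K: field K by (rule field_K)
  note fc = forget_ext_closed
  have iso: "equivariant_cy X Y \<in> linear_isos K (Ext D X Y) (dual K (Ext D Y X))"
    if "X \<in> equiv_objects \<Gamma> C T" "Y \<in> equiv_objects \<Gamma> C T" for X Y
  proof -
    obtain x \<psi> y \<chi> where XY: "X = (x, \<psi>)" "Y = (y, \<chi>)" by (metis surj_pair)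
    have O: "(x, \<psi>) \<in> equiv_objects \<Gamma> C T" "(y, \<chi>) \<in> equiv_objects \<Gamma> C T" using that by (simp_all add: XY)
    note xy = equiv_objectsD(1)[OF O(1)] equiv_objectsD(1)[OF O(2)]
    let ?V = "rep_Ext C T (x, \<psi>) (y, \<chi>)" and ?W = "rep_Ext C T (y, \<chi>) (x, \<psi>)"
    interpret W: group_representation \<Gamma> K ?W by (rule group_representation_Ext[OF O(2,1)])
    note fX = fc[of _ "(x, \<psi>)" "(y, \<chi>)", unfolded fst_conv] and fY = fc[of _ "(y, \<chi>)" "(x, \<psi>)", unfolded fst_conv]
    have val: "equivariant_cy X Y \<xi> \<eta> = c x y (forget_ext X Y \<xi>) (forget_ext Y X \<eta>)" if "\<eta> \<in> carrier (Ext D Y X)" for \<xi> \<eta>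
      using that by (simp add: equivariant_cy_def XY)
    have mem: "equivariant_cy X Y \<xi> \<in> carrier (dual K (Ext D Y X))" if \<xi>: "\<xi> \<in> carrier (Ext D X Y)" for \<xi>
    proof -
      note \<phi> = linear_mapsD(1)[OF cy_linear[OF xy] fX[OF \<xi>[unfolded XY]]]
      have cl: "u \<oplus>\<^bsub>Ext D Y X\<^esub> v \<in> carrier (Ext D Y X)" if "u \<in> carrier (Ext D Y X)" "v \<in> carrier (Ext D Y X)" for u v
        using EC.baer_sum_closed[OF that] by (simp add: EC.Ext_add)
      have "forget_ext Y X \<in> linear_maps K (Ext D Y X) (Ext C y x)"
        using fY forget_ext_add[of _ Y X] forget_ext_smult[of _ _ Y X] by (simp add: linear_maps_def XY)
      from dual_compose[OF this \<phi> cl EC.Ext_smult_closed] show ?thesis by (simp add: equivariant_cy_def XY)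
    qed
    have lin: "equivariant_cy X Y \<in> linear_maps K (Ext D X Y) (dual K (Ext D Y X))"
      unfolding linear_maps_def
    proof (intro CollectI conjI funcsetI ballI mem)
      fix \<xi> \<xi>' assume \<xi>: "\<xi> \<in> carrier (Ext D X Y)" "\<xi>' \<in> carrier (Ext D X Y)"
      show "equivariant_cy X Y (\<xi> \<oplus>\<^bsub>Ext D X Y\<^esub> \<xi>') = equivariant_cy X Y \<xi> \<oplus>\<^bsub>dual K (Ext D Y X)\<^esub> equivariant_cy X Y \<xi>'"
        using \<xi> fX fY xy forget_ext_add[OF \<xi>]
        by (auto simp: equivariant_cy_def XY cy_add dual_def intro!: restrict_ext)
    next
      fix r \<xi> assume r: "r \<in> carrier K" and \<xi>: "\<xi> \<in> carrier (Ext D X Y)"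
      show "equivariant_cy X Y (r \<odot>\<^bsub>Ext D X Y\<^esub> \<xi>) = r \<odot>\<^bsub>dual K (Ext D Y X)\<^esub> equivariant_cy X Y \<xi>"
        using r \<xi> fX fY xy forget_ext_smult[OF r \<xi>]
        by (auto simp: equivariant_cy_def XY cy_smult dual_def intro!: restrict_ext)
    qed
    \<comment> \<open>Averages are invariant, hence underlie equivariant extensions.\<close>
    have average_lift: "\<exists>\<eta>'\<in>carrier (Ext D Y X). forget_ext Y X \<eta>' = W.average \<nu> \<eta>" if \<eta>: "\<eta> \<in> carrier (Ext C y x)" for \<eta>
    proof -
      have \<eta>': "\<eta> \<in> carrier ?W" using \<eta> by simp
      have "W.average \<nu> \<eta> \<in> carrier (Ext C y x)" using W.average_closed[OF \<nu>(1) \<eta>'] by simp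
      from forget_ext_surj[OF O(2,1) this W.average_invariant[OF fin \<nu>(1) \<eta>']] show ?thesis by (auto simp: XY)
    qed
    have inj: "inj_on (equivariant_cy X Y) (carrier (Ext D X Y))"
    proof (rule inj_onI)
      fix \<xi> \<xi>' assume \<xi>: "\<xi> \<in> carrier (Ext D X Y)" "\<xi>' \<in> carrier (Ext D X Y)" and eq: "equivariant_cy X Y \<xi> = equivariant_cy X Y \<xi>'"
      have "forget_ext X Y \<xi> = forget_ext X Y \<xi>'"
      proof (rule cy_eqI[OF xy])
        show "forget_ext X Y \<xi> \<in> carrier (Ext C x y)" "forget_ext X Y \<xi>' \<in> carrier (Ext C x y)" using \<xi> fX by (simp_all add: XY)
        fix \<eta> assume \<eta>: "\<eta> \<in> carrier (Ext C y x)"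
        from average_lift[OF \<eta>] obtain \<eta>' where \<eta>': "\<eta>' \<in> carrier (Ext D Y X)" "forget_ext Y X \<eta>' = W.average \<nu> \<eta>" by blast
        have av: "c x y (forget_ext X Y \<zeta>) (W.average \<nu> \<eta>) = c x y (forget_ext X Y \<zeta>) \<eta>" if "\<zeta> \<in> carrier (Ext D X Y)" for \<zeta>
          using cy_average[OF O fX forget_ext_invariant \<eta>] that by (simp add: XY)
        show "c x y (forget_ext X Y \<xi>) \<eta> = c x y (forget_ext X Y \<xi>') \<eta>"
          using val[OF \<eta>'(1), of \<xi>] val[OF \<eta>'(1), of \<xi>'] eq \<eta>'(2) av[OF \<xi>(1)] av[OF \<xi>(2)] by simp
      qed
      then show "\<xi> = \<xi>'" using forget_ext_inj[OF \<xi>] by blast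
    qed
    have surj: "\<exists>\<xi>\<in>carrier (Ext D X Y). equivariant_cy X Y \<xi> = \<phi>" if \<phi>: "\<phi> \<in> carrier (dual K (Ext D Y X))" for \<phi>
    proof -
      \<comment> \<open>Averaging followed by the inverse of the forgetful bijection onto
        invariants. The definite description is legitimate because the forgetful map is injective on
        classes; the same uniqueness yields linearity of \<open>lift\<close>.\<close>
      define lift where "lift \<eta> = (THE \<eta>'. \<eta>' \<in> carrier (Ext D Y X) \<and> forget_ext Y X \<eta>' = W.average \<nu> \<eta>)" for \<eta>
      have liftI: "lift \<eta> = \<eta>'" if "\<eta>' \<in> carrier (Ext D Y X)" "forget_ext Y X \<eta>' = W.average \<nu> \<eta>" for \<eta> \<eta>'
        unfolding lift_def
      proof (rule the_equality)
        show "\<eta>' \<in> carrier (Ext D Y X) \<and> forget_ext Y X \<eta>' = W.average \<nu> \<eta>" using that ..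
        fix \<zeta> assume "\<zeta> \<in> carrier (Ext D Y X) \<and> forget_ext Y X \<zeta> = W.average \<nu> \<eta>"
        then show "\<zeta> = \<eta>'" using forget_ext_inj[of \<zeta> Y X \<eta>'] that by metis
      qed
      have lift: "lift \<eta> \<in> carrier (Ext D Y X)" "forget_ext Y X (lift \<eta>) = W.average \<nu> \<eta>" if "\<eta> \<in> carrier (Ext C y x)" for \<eta>
        using average_lift[OF that] liftI by blast+
      note avl = average_linear[OF W.group_representation_axioms]
      have "lift \<in> linear_maps K (Ext C y x) (Ext D Y X)"
        unfolding linear_maps_def
      proof (intro CollectI conjI funcsetI ballI lift(1))
        fix u v assume u: "u \<in> carrier (Ext C y x)" and v: "v \<in> carrier (Ext C y x)"
        show "lift (u \<oplus>\<^bsub>Ext C y x\<^esub> v) = lift u \<oplus>\<^bsub>Ext D Y X\<^esub> lift v"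
        proof (rule liftI)
          show "lift u \<oplus>\<^bsub>Ext D Y X\<^esub> lift v \<in> carrier (Ext D Y X)"
            using EC.baer_sum_closed[OF lift(1)[OF u] lift(1)[OF v]] by (simp add: EC.Ext_add)
          show "forget_ext Y X (lift u \<oplus>\<^bsub>Ext D Y X\<^esub> lift v) = W.average \<nu> (u \<oplus>\<^bsub>Ext C y x\<^esub> v)"
            using forget_ext_add[OF lift(1)[OF u] lift(1)[OF v]] lift(2)[OF u] lift(2)[OF v] linear_mapsD(2)[OF avl, of u v] u v
            by (simp add: XY)
        qed
      next
        fix r v assume r: "r \<in> carrier K" and v: "v \<in> carrier (Ext C y x)"
        show "lift (r \<odot>\<^bsub>Ext C y x\<^esub> v) = r \<odot>\<^bsub>Ext D Y X\<^esub> lift v"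
        proof (rule liftI)
          show "r \<odot>\<^bsub>Ext D Y X\<^esub> lift v \<in> carrier (Ext D Y X)" by (rule EC.Ext_smult_closed[OF r lift(1)[OF v]])
          show "forget_ext Y X (r \<odot>\<^bsub>Ext D Y X\<^esub> lift v) = W.average \<nu> (r \<odot>\<^bsub>Ext C y x\<^esub> v)"
            using forget_ext_smult[OF r lift(1)[OF v]] lift(2)[OF v] linear_mapsD(3)[OF avl r, of v] v by (simp add: XY)
        qed
      qed
      from dual_compose[OF this \<phi> Ext_add_closed Ext_smult_closed]
      have "(\<lambda>\<eta>\<in>carrier (Ext C y x). \<phi> (lift \<eta>)) \<in> carrier (dual K (Ext C y x))" .
      then have "(\<lambda>\<eta>\<in>carrier (Ext C y x). \<phi> (lift \<eta>)) \<in> c x y ` carrier (Ext C x y)"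
        by (simp only: bij_betw_imp_surj_on[OF cy_bij[OF xy]])
      then obtain \<xi> where \<xi>: "(\<lambda>\<eta>\<in>carrier (Ext C y x). \<phi> (lift \<eta>)) = c x y \<xi>" "\<xi> \<in> carrier (Ext C x y)"
        by (rule imageE)
      note \<xi> = \<xi>(2) \<xi>(1)[symmetric]
      \<comment> \<open>Right translation by \<open>g\<close> permutes the summands of the
        average.\<close>
      have lift_act: "lift (act ?W g \<eta>) = lift \<eta>" if g: "g \<in> carrier \<Gamma>" and \<eta>: "\<eta> \<in> carrier (Ext C y x)" for g \<eta>
      proof (rule liftI[OF lift(1)[OF \<eta>]])
        have \<eta>': "\<eta> \<in> carrier ?W" using \<eta> by simp
        show "forget_ext Y X (lift \<eta>) = W.average \<nu> (act ?W g \<eta>)"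
        proof -
          interpret M: module K ?W by (rule W.rep_module)
          have "(\<Oplus>\<^bsub>?W\<^esub>h\<in>carrier \<Gamma>. act ?W h (act ?W g \<eta>)) = (\<Oplus>\<^bsub>?W\<^esub>h\<in>carrier \<Gamma>. act ?W (h \<otimes>\<^bsub>\<Gamma>\<^esub> g) \<eta>)"
            by (rule M.M.finsum_cong') (use W.act_mult W.act_closed g \<eta>' in auto)
          also have "\<dots> = (\<Oplus>\<^bsub>?W\<^esub>h\<in>(\<lambda>h. h \<otimes>\<^bsub>\<Gamma>\<^esub> g) ` carrier \<Gamma>. act ?W h \<eta>)"
            by (rule M.M.finsum_reindex[symmetric]) (use W.act_closed g \<eta>' G.inj_on_multc in auto)
          also have "(\<lambda>h. h \<otimes>\<^bsub>\<Gamma>\<^esub> g) ` carrier \<Gamma> = carrier \<Gamma>"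
            by (rule endo_inj_surj[OF fin _ G.inj_on_multc[OF g]]) (use g in auto)
          finally show ?thesis using lift(2)[OF \<eta>] by (simp add: W.average_def)
        qed
      qed
      \<comment> \<open>Acting on the first argument of the pairing amounts to acting by the inverse
        on the second, where the functional represented by \<xi> is constant on orbits.\<close>
      have "act ?V g \<xi> = \<xi>" if g: "g \<in> carrier \<Gamma>" for g
      proof (rule cy_eqI[OF xy rep_Ext_act_closed[OF O \<xi>(1) g] \<xi>(1)])
        fix \<eta> assume \<eta>: "\<eta> \<in> carrier (Ext C y x)"
        note \<eta>' = rep_Ext_act_closed[OF O(2,1) \<eta> G.inv_closed[OF g]]
        show "c x y (act ?V g \<xi>) \<eta> = c x y \<xi> \<eta>"
          using cy_rep_act[OF O g \<xi>(1) \<eta>'] rep_Ext_act_inverse[OF O(2,1) g \<eta>] lift_act[OF G.inv_closed[OF g] \<eta>] \<eta> \<eta>' \<xi>(2)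
          by simp
      qed
      from forget_ext_surj[OF O \<xi>(1) this] obtain \<zeta> where \<zeta>: "\<zeta> \<in> carrier (Ext D X Y)" "forget_ext X Y \<zeta> = \<xi>"
        by (auto simp: XY)
      have "equivariant_cy X Y \<zeta> = \<phi>"
      proof (rule dual_ext[OF mem[OF \<zeta>(1)] \<phi>])
        fix \<eta> assume \<eta>: "\<eta> \<in> carrier (Ext D Y X)"
        have f: "forget_ext Y X \<eta> \<in> carrier ?W" using fY \<eta> by (simp add: XY)
        \<comment> \<open>Classes of equivariant extensions are invariant and fixed by averaging, so
          \<open>lift\<close> undoes the forgetful map and the represented functional restricts to
          \<phi>.\<close>
        have "W.average \<nu> (forget_ext Y X \<eta>) = forget_ext Y X \<eta>"
          using W.average_fixed[OF fin \<nu> f] forget_ext_invariant[of \<eta> y \<chi> x \<psi>] \<eta> by (simp add: XY)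
        then have "lift (forget_ext Y X \<eta>) = \<eta>" using liftI[OF \<eta>] by simp
        then show "equivariant_cy X Y \<zeta> \<eta> = \<phi> \<eta>" using val[OF \<eta>] \<zeta>(2) \<xi>(2) f by simp
      qed
      then show ?thesis using \<zeta>(1) by blast
    qed
    have "bij_betw (equivariant_cy X Y) (carrier (Ext D X Y)) (carrier (dual K (Ext D Y X)))"
      unfolding bij_betw_def using inj surj mem by blast
    then show ?thesis using lin by (simp add: linear_isos_def)
  qed
  have nat: "equivariant_cy X' Y' (ext_map D X X' Y' a b \<xi>) =
      (\<lambda>\<eta>\<in>carrier (Ext D Y' X'). equivariant_cy X Y \<xi> (ext_map D Y' Y X b a \<eta>))"
    if a: "a \<in> arr D X' X" and b: "b \<in> arr D Y Y'" and \<xi>: "\<xi> \<in> carrier (Ext D X Y)" for X Y X' Y' a b \<xi>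
    unfolding equivariant_cy_def[of X' Y']
  proof (rule restrict_ext)
    fix \<eta> assume \<eta>: "\<eta> \<in> carrier (Ext D Y' X')"
    show "c (fst X') (fst Y') (forget_ext X' Y' (ext_map D X X' Y' a b \<xi>)) (forget_ext Y' X' \<eta>) =
        equivariant_cy X Y \<xi> (ext_map D Y' Y X b a \<eta>)"
      using forget_ext_map[OF \<xi> a b] forget_ext_map[OF \<eta> b a] EC.ext_map_closed[OF \<eta> b a]
        cy_natural[OF fc[OF \<xi>] arr_D_forget[OF a] arr_D_forget[OF b] fc[OF \<eta>]] by (simp add: equivariant_cy_def)
  qed
  show ?thesis
    unfolding cy_iso_def
  proof (intro conjI ballI)
    show "equivariant_cy X Y \<in> linear_isos K (Ext D X Y) (dual K (Ext D Y X))" if "X \<in> Ob D" "Y \<in> Ob D" for X Y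
      using iso that by simp
    show "equivariant_cy X' Y' (ext_map D X X' Y' a b \<xi>) =
      (\<lambda>\<eta>\<in>carrier (Ext D Y' X'). equivariant_cy X Y \<xi> (ext_map D Y' Y X b a \<eta>))"
      if "X \<in> Ob D" "Y \<in> Ob D" "X' \<in> Ob D" "Y' \<in> Ob D" "a \<in> mor D X' X" "b \<in> mor D Y Y'" "\<xi> \<in> carrier (Ext D X Y)"
      for X Y X' Y' a b \<xi>
      using nat[of a X' X b Y Y' \<xi>] that by (simp add: mor_D)
  qed
qed

end

theorem proposition2p47:
  fixes K :: "('k, 'r) ring_scheme"
    and \<Gamma> :: "('g, 's) monoid_scheme"
    and C :: "('k, 'o, 'm) ex_cat"
    and T :: "('g, 'o, 'm) action_data"
    and c :: "('k, 'o, 'm) cy_map"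
  assumes "field K"
    and "group \<Gamma>" and "finite (carrier \<Gamma>)" and "\<not> characteristic K dvd order \<Gamma>"
    and "exact_category K C" and "hom_finite K C" and "krull_schmidt C" and "frobenius C"
    and "cy_iso K C c"
    and "category_action K \<Gamma> C T" and "cy_action \<Gamma> C T c"
  shows "rep_cy_iso K \<Gamma> C T c \<and> stably_2CY K (equivariant_category \<Gamma> C T)"
proof -
  obtain \<nu> where \<nu>: "\<nu> \<in> carrier K" "\<nu> \<otimes>\<^bsub>K\<^esub> (\<Oplus>\<^bsub>K\<^esub>g\<in>carrier \<Gamma>. \<one>\<^bsub>K\<^esub>) = \<one>\<^bsub>K\<^esub>"
    using order_invertible[OF assms(1-4)] by blast
  \<comment> \<open>Exactness of the action, asked for by \<open>equivariant\<close>, is part of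
    \<open>cy_action\<close>.\<close>
  interpret cy_equivariant_averaging K \<Gamma> C T c \<nu>
    by (intro cy_equivariant_averaging.intro cy_equivariant.intro cy_category.intro equivariant.intro
        equivariant_averaging.intro cy_category_axioms.intro cy_equivariant_axioms.intro
        equivariant_axioms.intro equivariant_averaging_axioms.intro)
       (use assms \<nu> in \<open>auto simp: cy_action_def\<close>)
  show ?thesis
    using rep_cy_iso exact_category_D equivariant_cy_iso by (auto simp: stably_2CY_def)
qed

end
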